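(* Let $\mathcal T_h$ be a shape-regular mesh of the bounded Lipschitz domain $\Omega\subset\mathbb R^d$ constituting the triangulation of the finite element partition, and let $\mathcal X_h=\hat{\mathcal V}_h\times\hat{\mathcal V}_{\Gamma,h}$ be equipped with the discrete norm $\|\cdot\|_{\mathcal X_h}$. Then the sesquilinear form $B(\cdot,\cdot):\mathcal X_h\times\mathcal X_h\to\mathbb C$ is continuous: there exists a mesh-independent constant $M>0$ such that $$|B(\mathbf x_h,\mathbf y_h)|\le M\,\|\mathbf x_h\|_{\mathcal X_h}\|\mathbf y_h\|_{\mathcal X_h}\qquad\forall\,\mathbf x_h,\mathbf y_h\in\mathcal X_h .$$
   Context: **Geometry.** $\Omega\subset\mathbb R^d$ ($d=2,3$) is a bounded Lipschitz fluid domain whose boundary consists of the free surface $\Gamma_{\rm fs}$, the bottom $\Gamma_{\rm b}$, the inlet $\Gamma_{\rm in}$ (at $x=-L_f$), the outlet $\Gamma_{\rm out}$ (at $x=L_f$) and, if $d=3$, side walls $\Gamma_{\rm side}$. $\Gamma$ is the (flat) $(d-1)$-dimensional plate inside the fluid, a Lipschitz hypersurface such that $\Omega\setminus\Gamma=\Omega^+\cup\Omega^-$ with $\Omega^\pm$ disjoint bounded Lipschitz domains and $\overline{\Omega^+}\cap\overline{\Omega^-}=\overline\Gamma$. **Meshes.** $\mathcal T_h$ belongs to a shape-regular, quasi-uniform family of triangulations of $\Omega$, $\mathcal T_h=\mathcal T_h^+\cup\mathcal T_h^-$ with $\mathcal T_h^\pm$ a conforming triangulation of $\Omega^\pm$;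 $h_K$ is the diameter of $K\in\mathcal T_h$, $h=\max_K h_K\le 1$, and $h_e\ge c_0h$ for every facet $e$ with fixed $c_0\in(0,1]$ ($h_e$ the facet size). $\Gamma$ is a union of facets; $\mathcal T_h^\Gamma$ is the induced conforming quasi-uniform triangulation of $\Gamma$. $\Lambda$ is the set of interior facets of $\mathcal T_h$ (including those in $\Gamma$), and $\Sigma$ the set of interior $(d-2)$-dimensional facets $p$ of $\mathcal T_h^\Gamma$, with size $h_p$. On a facet shared by two elements, $[\![v]\!]=v_1-v_2$ and $\langle v\rangle=\frac12(v_1+v_2)$; on $\Gamma$, $v_1,v_2$ are the values below and above $\Gamma$. $\boldsymbol n$ is the unit normal (to facets of $\mathcal T_h$), $\partial_{\boldsymbol n}$ the normal derivative, and $\boldsymbol n_\Gamma$ the unit conormal on $\Sigma$ and $\partial\Gamma$ lying in the plane of $\Gamma$. **Spaces.** For fixed polynomial degree $r\ge2$ (complex coefficients), $\hat{\mathcal V}_h=\{v\in L^2(\Omega;\mathbb C): v|_K\in\mathbb P_r(K)\ \forall K\in\mathcal T_h\}$ and $\hat{\mathcal V}_{\Gamma,h}=\{v\in C^0(\Gamma;\mathbb C): v|_E\in\mathbb P_r(E)\ \forall E\in\mathcal T_h^\Gamma\}$. Elements of $\mathcal X_h$ are written $\mathbf x_h=[\phi_h,w_h]$, $\mathbf y_h=[v_h,r_h]$. $(u,v)_S=\int_S u\overline v$. $\nabla$, $\nabla^2$ denote the elementwise (broken) gradient and Hessian (on $\Gamma$: tangential). **Norm.** $\|\mathbf x_h\|_{\mathcal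 X_h}^2=\|\nabla\phi_h\|_{L^2(\Omega)}^2+\|\phi_h\|_{L^2(\Omega)}^2+J_f(\phi_h)^2+\mu_p\big(\|\nabla^2w_h\|_{L^2(\Gamma)}^2+\|w_h\|_{L^2(\Gamma)}^2+J_p(w_h)^2\big)$, where $J_f(v)^2=\sum_{e\in\Lambda\setminus\Gamma}h_e^{-1}\|[\![v]\!]\|_{L^2(e)}^2$ and $J_p(w)^2=\sum_{p\in\Sigma}h_p^{-1}\|[\![\nabla w\otimes\boldsymbol n_\Gamma]\!]\|_{L^2(p)}^2$. **Sesquilinear form.** $$\begin{aligned}B([\phi,w],[v,r])=&\,(\nabla\phi,\nabla v)_\Omega-(\alpha\phi,v)_{\Gamma_{\rm fs}}-K(\phi,v)-(\langle\partial_{\boldsymbol n}\phi\rangle,[\![v]\!])_{\Lambda\setminus\Gamma}-([\![\phi]\!],\langle\partial_{\boldsymbol n}v\rangle)_{\Lambda\setminus\Gamma}+(\mu_1[\![\phi]\!],[\![v]\!])_{\Lambda\setminus\Gamma}+(\mathrm i\omega w,[\![v]\!])_\Gamma\\&+\mu_p\Big[(\mathbf D:\nabla^2w,\nabla^2r)_\Gamma-(I_0\omega^2w,r)_\Gamma-(\mathrm i\omega\rho_w[\![\phi]\!],r)_\Gamma-(\langle\mathbf D:\nabla^2w\rangle,[\![\nabla r\otimes\boldsymbol n_\Gamma]\!])_\Sigma\\&\qquad-([\![\nabla w\otimes\boldsymbol n_\Gamma]\!],\langle\mathbf D:\nabla^2r\rangle)_\Sigma+(\mu_2[\![\nabla w\otimes\boldsymbol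 n_\Gamma]\!],[\![\nabla r\otimes\boldsymbol n_\Gamma]\!])_\Sigma\Big],\end{aligned}$$ $$K(\phi,v)=\sum_{m=0}^M\frac{\mathrm i k_m}{C_m}\Big[(\phi,\psi_m)_{\Gamma_{\rm in}}\overline{(v,\psi_m)_{\Gamma_{\rm in}}}+(\phi,\psi_m)_{\Gamma_{\rm out}}\overline{(v,\psi_m)_{\Gamma_{\rm out}}}\Big]$$ (the upper summation limit is a fixed truncation index, unrelated to the continuity constant). Here $\omega>0$, $\alpha=\omega^2/g>0$, $\rho_w>0$, $I_0\ge 0$, $\mu_p>0$ are fixed constants; $\mu_1|_e=\sigma_1/h_e$, $\mu_2|_p=\sigma_2/h_p$ with fixed $\sigma_1,\sigma_2>0$. **Standing assumptions.** $\mathbf D$ is a symmetric, real, bounded fourth-order rigidity tensor on $\Gamma$ with $\mathbf x\cdot\mathbf D\cdot\mathbf x\ge\gamma_{\min}\|\mathbf x\|^2$ a.e., $\gamma_{\min}>0$. $\Gamma_{\rm in}$ and $\Gamma_{\rm out}$ share a common cross section, on which $\{\psi_m\}_{m=0}^M$ is a fixed finite family of real functions, mutually orthogonal in $L^2$ of the cross section, with $C_m=\|\psi_m\|_{L^2}^2>0$; the $k_m\in\mathbb C$ are fixed with $k_m^2=k^2-\lambda_m$ ($\lambda_m$ the real transverse eigenvalue of $\psi_m$, $k=\omega/c$), $k^2\ne\lambda_m$, $\mathrm{Im}(k_m)\ge0$. "Mesh-independent" means the constant depends only on the domain, the physical, penalty and modal data, $r$, and the shape-regularity/quasi-uniformity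 constants, not on $h$. *)

theory Defs
  imports "HOL-Analysis.Analysis"
begin

section \<open>Lebesgue measure on affine subspaces\<close>

text \<open>
  The k-dimensional Lebesgue measure on the affine hull \<open>A\<close> of \<open>S\<close>, where \<open>k = aff_dim S\<close>,
  as a Borel measure on the ambient space: a Borel set \<open>B \<subseteq> A\<close> is measured by the volume of the
  tube of radius 1 over \<open>B\<close> orthogonal to \<open>A\<close>, divided by the volume of the unit ball of
  dimension \<open>codim A\<close>. If \<open>S\<close> is a point this is the unit mass there; if \<open>S\<close> spans the whole
  space it is \<open>lborel\<close>.
\<close>

definition flat_measure :: "'a::euclidean_space set \<Rightarrow> 'a measure" where
  "flat_measure S =
     scale_measure (ennreal (1 / unit_ball_vol (of_int (int DIM('a) - aff_dim S))))
       (distr (restrict_space lborel {x. infdist x (affine hull S) \<le> 1}) borel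
          (closest_point (affine hull S)))"


section \<open>Polynomials and differential operators\<close>

definition polys :: "nat \<Rightarrow> (real^'n \<Rightarrow> complex) set" where
  "polys r = {p. \<exists>c :: ('n \<Rightarrow> nat) \<Rightarrow> complex.
     p = (\<lambda>x. \<Sum>a | sum a UNIV \<le> r. c a * (\<Prod>i\<in>UNIV. complex_of_real (x $ i) ^ a i))}"

definition grad :: "(real^'n \<Rightarrow> complex) \<Rightarrow> real^'n \<Rightarrow> complex^'n" where
  "grad p x = (\<chi> i. frechet_derivative p (at x) (axis i 1))"

definition hess :: "(real^'n \<Rightarrow> complex) \<Rightarrow> real^'n \<Rightarrow> complex^'n^'n" where
  "hess p x = (\<chi> i. grad (\<lambda>y. grad p y $ i) x)"

definition dnormal :: "real^'n \<Rightarrow> (real^'n \<Rightarrow> complex) \<Rightarrow> real^'n \<Rightarrow> complex" where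
  "dnormal n p x = (\<Sum>i\<in>UNIV. grad p x $ i * complex_of_real (n $ i))"

text \<open>
  Derivatives along a hyperplane with unit normal \<open>\<nu>\<close> are represented by ambient vectors and
  matrices, obtained by the orthogonal projection \<open>I - \<nu> \<otimes> \<nu>\<close>. They only depend on the
  restriction of \<open>p\<close> to that hyperplane.
\<close>

definition tangent_proj :: "real^'n \<Rightarrow> complex^'n^'n" where
  "tangent_proj \<nu> = mat 1 - (\<chi> i j. complex_of_real (\<nu> $ i * \<nu> $ j))"

definition tgrad :: "real^'n \<Rightarrow> (real^'n \<Rightarrow> complex) \<Rightarrow> real^'n \<Rightarrow> complex^'n" where
  "tgrad \<nu> p x = tangent_proj \<nu> *v grad p x"

definition thess :: "real^'n \<Rightarrow> (real^'n \<Rightarrow> complex) \<Rightarrow> real^'n \<Rightarrow> complex^'n^'n" where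
  "thess \<nu> p x = tangent_proj \<nu> ** hess p x ** tangent_proj \<nu>"

definition cdot :: "complex^'n \<Rightarrow> complex^'n \<Rightarrow> complex" where
  "cdot u v = (\<Sum>i\<in>UNIV. u $ i * cnj (v $ i))"

definition cddot :: "complex^'n^'n \<Rightarrow> complex^'n^'n \<Rightarrow> complex" where
  "cddot A B = (\<Sum>i\<in>UNIV. \<Sum>j\<in>UNIV. A $ i $ j * cnj (B $ i $ j))"

definition outer :: "complex^'n \<Rightarrow> real^'n \<Rightarrow> complex^'n^'n" where
  "outer u n = (\<chi> i j. u $ i * complex_of_real (n $ j))"

definition contract :: "real^'n^'n^'n^'n \<Rightarrow> complex^'n^'n \<Rightarrow> complex^'n^'n" where
  "contract D H = (\<chi> i j. \<Sum>k\<in>UNIV. \<Sum>l\<in>UNIV. complex_of_real (D $ i $ j $ k $ l) * H $ k $ l)"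


section \<open>Geometry\<close>

definition lipschitz_domain :: "(real^'n) set \<Rightarrow> bool" where
  "lipschitz_domain U \<longleftrightarrow>
     open U \<and> connected U \<and> U \<noteq> {} \<and>
     (\<forall>x\<in>frontier U. \<exists>u \<rho> L g. norm u = 1 \<and> 0 < \<rho> \<and> L-lipschitz_on UNIV g \<and>
        (\<forall>y\<in>ball x \<rho>. y \<in> U \<longleftrightarrow> g (y - (y \<bullet> u) *\<^sub>R u) < y \<bullet> u))"

text \<open>
  \<open>OmM\<close> and \<open>OmP\<close> are the parts of the fluid \<open>Om\<close> below and above the plate \<open>Gam\<close>;
  \<open>nu\<close> is a unit normal of the plate, \<open>ix\<close> the index of the coordinate \<open>x\<close> in which the inlet and
  the outlet sit at \<open>- Lf\<close> and \<open>Lf\<close>, and \<open>Sec\<close> their common cross section, placed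
  in the coordinate plane \<open>x = 0\<close>.
\<close>

record ('n::finite) geometry =
  Om :: "(real^'n) set"
  OmP :: "(real^'n) set"
  OmM :: "(real^'n) set"
  Gam :: "(real^'n) set"
  nu :: "real^'n"
  Gfs :: "(real^'n) set"
  Gbot :: "(real^'n) set"
  Gin :: "(real^'n) set"
  Gout :: "(real^'n) set"
  Gside :: "(real^'n) set"
  ix :: 'n
  Lf :: real
  Sec :: "(real^'n) set"

definition fluid_geometry :: "'n::finite geometry \<Rightarrow> bool" where
  "fluid_geometry G \<longleftrightarrow>
     bounded (Om G) \<and> lipschitz_domain (Om G) \<and>
     frontier (Om G) = Gfs G \<union> Gbot G \<union> Gin G \<union> Gout G \<union> Gside G \<and>
     (\<forall>S\<in>{Gfs G, Gbot G, Gin G, Gout G, Gside G}. closed S) \<and>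
     sorted_wrt (\<lambda>S S'. (top_of_set (frontier (Om G))) interior_of (S \<inter> S') = {})
       [Gfs G, Gbot G, Gin G, Gout G, Gside G] \<and>
     (CARD('n) = 2 \<longrightarrow> Gside G = {}) \<and>
     0 < Lf G \<and> Sec G \<subseteq> {y. y $ ix G = 0} \<and>
     Gin G = (\<lambda>y. y - Lf G *\<^sub>R axis (ix G) 1) ` Sec G \<and>
     Gout G = (\<lambda>y. y + Lf G *\<^sub>R axis (ix G) 1) ` Sec G \<and>
     norm (nu G) = 1 \<and> Gam G \<noteq> {} \<and> Gam G \<subseteq> Om G \<and>
     (\<exists>b. openin (top_of_set {x. nu G \<bullet> x = b}) (Gam G)) \<and>
     lipschitz_domain (OmP G) \<and> lipschitz_domain (OmM G) \<and>
     OmP G \<inter> OmM G = {} \<and> Om G - Gam G = OmP G \<union> OmM G \<and>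
     closure (OmP G) \<inter> closure (OmM G) = closure (Gam G)"

definition cross_measure :: "'n::finite geometry \<Rightarrow> (real^'n) measure" where
  "cross_measure G = flat_measure {y. y $ ix G = 0}"

definition to_cross :: "'n::finite geometry \<Rightarrow> real^'n \<Rightarrow> real^'n" where
  "to_cross G x = x - (x $ ix G) *\<^sub>R axis (ix G) 1"


section \<open>Coefficients and modes\<close>

record ('n::finite) params =
  omega :: real
  grav :: real
  cspeed :: real
  rhow :: real
  inert :: real
  mup :: real
  sig1 :: real
  sig2 :: real
  rigid :: "real^'n \<Rightarrow> real^'n^'n^'n^'n"
  nmode :: nat
  psi :: "nat \<Rightarrow> real^'n \<Rightarrow> real"
  km :: "nat \<Rightarrow> complex"
  lam :: "nat \<Rightarrow> real"

definition modal_norm2 :: "'n::finite geometry \<Rightarrow> 'n params \<Rightarrow> nat \<Rightarrow> real" where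
  "modal_norm2 G P m = (LINT y:Sec G|cross_measure G. (psi P m y)\<^sup>2)"

text \<open>
  The form evaluates the rigidity tensor on facets of the plate mesh, which are null sets of the
  plate; hence it is a Borel function with a bound valid at every point, not a class of functions
  equal almost everywhere. Only its action on matrices tangential to the plate matters.
\<close>

definition rigidity_tensor ::
    "'n::finite geometry \<Rightarrow> (real^'n \<Rightarrow> real^'n^'n^'n^'n) \<Rightarrow> bool" where
  "rigidity_tensor G D \<longleftrightarrow>
     D \<in> borel_measurable (restrict_space borel (closure (Gam G))) \<and>
     bounded (D ` closure (Gam G)) \<and>
     (\<forall>x\<in>closure (Gam G). \<forall>i j k l. D x $ i $ j $ k $ l = D x $ k $ l $ i $ j) \<and>
     (\<exists>\<gamma>>0. AE x in flat_measure (Gam G). x \<in> Gam G \<longrightarrow>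
        (\<forall>X :: real^'n^'n. transpose X = X \<and> X *v nu G = 0 \<longrightarrow>
           \<gamma> * (norm X)\<^sup>2 \<le>
             (\<Sum>i\<in>UNIV. \<Sum>j\<in>UNIV. \<Sum>k\<in>UNIV. \<Sum>l\<in>UNIV. X $ i $ j * D x $ i $ j $ k $ l * X $ k $ l)))"

definition modal_data :: "'n::finite geometry \<Rightarrow> 'n params \<Rightarrow> bool" where
  "modal_data G P \<longleftrightarrow>
     (\<forall>m\<le>nmode P.
        set_borel_measurable (cross_measure G) (Sec G) (psi P m) \<and>
        set_integrable (cross_measure G) (Sec G) (\<lambda>y. (psi P m y)\<^sup>2) \<and>
        0 < modal_norm2 G P m \<and>
        (km P m)\<^sup>2 = complex_of_real ((omega P / cspeed P)\<^sup>2 - lam P m) \<and>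
        (omega P / cspeed P)\<^sup>2 \<noteq> lam P m \<and> 0 \<le> Im (km P m)) \<and>
     (\<forall>m\<le>nmode P. \<forall>m'\<le>nmode P. m \<noteq> m' \<longrightarrow>
        (LINT y:Sec G|cross_measure G. psi P m y * psi P m' y) = 0)"

definition admissible_params :: "'n::finite geometry \<Rightarrow> 'n params \<Rightarrow> bool" where
  "admissible_params G P \<longleftrightarrow>
     0 < omega P \<and> 0 < grav P \<and> 0 < cspeed P \<and> 0 < rhow P \<and> 0 \<le> inert P \<and> 0 < mup P \<and>
     0 < sig1 P \<and> 0 < sig2 P \<and> rigidity_tensor G (rigid P) \<and> modal_data G P"


section \<open>Meshes\<close>

text \<open>
  Besides its simplices, a mesh carries a choice of the two sides \<open>1\<close>, \<open>2\<close> and of a unit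
  normal for every interior facet, and the analogous choice for the interfaces of the plate mesh.
\<close>

record ('n::finite) mesh =
  elsP :: "(real^'n) set set"
  elsM :: "(real^'n) set set"
  side1 :: "(real^'n) set \<Rightarrow> (real^'n) set"
  side2 :: "(real^'n) set \<Rightarrow> (real^'n) set"
  fnormal :: "(real^'n) set \<Rightarrow> real^'n"
  pside1 :: "(real^'n) set \<Rightarrow> (real^'n) set"
  pside2 :: "(real^'n) set \<Rightarrow> (real^'n) set"
  conormal :: "(real^'n) set \<Rightarrow> real^'n"

definition facets :: "'a::euclidean_space set set \<Rightarrow> 'a set set" where
  "facets T = {e. \<exists>K\<in>T. e facet_of K}"

definition interior_facets :: "'a::euclidean_space set set \<Rightarrow> 'a set set" where
  "interior_facets T = {e. \<exists>K\<in>T. \<exists>K'\<in>T. K \<noteq> K' \<and> e facet_of K \<and> e facet_of K'}"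

definition boundary_facets :: "'a::euclidean_space set set \<Rightarrow> 'a set set" where
  "boundary_facets T = facets T - interior_facets T"

definition els :: "'n::finite mesh \<Rightarrow> (real^'n) set set" where
  "els T = elsP T \<union> elsM T"

definition mesh_size :: "'n::finite mesh \<Rightarrow> real" where
  "mesh_size T = Max (diameter ` els T)"

definition plate_els :: "'n::finite geometry \<Rightarrow> 'n mesh \<Rightarrow> (real^'n) set set" where
  "plate_els G T = {e \<in> interior_facets (els T). e \<subseteq> closure (Gam G)}"

definition fluid_facets :: "'n::finite geometry \<Rightarrow> 'n mesh \<Rightarrow> (real^'n) set set" where
  "fluid_facets G T = interior_facets (els T) - plate_els G T"

definition plate_facets :: "'n::finite geometry \<Rightarrow> 'n mesh \<Rightarrow> (real^'n) set set" where
  "plate_facets G T = interior_facets (plate_els G T)"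

definition inradius :: "'a::euclidean_space set \<Rightarrow> real" where
  "inradius K = Sup {\<rho>. 0 \<le> \<rho> \<and> (\<exists>x. cball x \<rho> \<subseteq> K)}"

text \<open>
  The interfaces of a one-dimensional plate mesh are points, of diameter 0; their size is the mean
  length of the two adjacent plate elements.
\<close>

definition plate_facet_size :: "'n::finite mesh \<Rightarrow> (real^'n) set \<Rightarrow> real" where
  "plate_facet_size T p =
     (if CARD('n) = 2 then (diameter (pside1 T p) + diameter (pside2 T p)) / 2 else diameter p)"

definition conforming_mesh :: "'n::finite geometry \<Rightarrow> 'n mesh \<Rightarrow> bool" where
  "conforming_mesh G T \<longleftrightarrow>
     triangulation (els T) \<and> (\<forall>K\<in>els T. int CARD('n) simplex K) \<and>
     \<Union>(elsP T) = closure (OmP G) \<and> \<Union>(elsM T) = closure (OmM G) \<and>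
     \<Union>(plate_els G T) = closure (Gam G)"

text \<open>
  The orientation of the normals relative to the labelling of the sides is arbitrary.
\<close>

definition oriented_mesh :: "'n::finite geometry \<Rightarrow> 'n mesh \<Rightarrow> bool" where
  "oriented_mesh G T \<longleftrightarrow>
     (\<forall>e\<in>interior_facets (els T).
        side1 T e \<in> els T \<and> side2 T e \<in> els T \<and> side1 T e \<noteq> side2 T e \<and>
        e facet_of side1 T e \<and> e facet_of side2 T e \<and>
        norm (fnormal T e) = 1 \<and> (\<forall>x\<in>e. \<forall>y\<in>e. (x - y) \<bullet> fnormal T e = 0)) \<and>
     (\<forall>e\<in>plate_els G T. side1 T e \<in> elsM T \<and> side2 T e \<in> elsP T) \<and>
     (\<forall>p\<in>plate_facets G T.
        pside1 T p \<in> plate_els G T \<and> pside2 T p \<in> plate_els G T \<and> pside1 T p \<noteq> pside2 T p \<and>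
        p facet_of pside1 T p \<and> p facet_of pside2 T p \<and>
        norm (conormal T p) = 1 \<and> conormal T p \<bullet> nu G = 0 \<and>
        (\<forall>x\<in>p. \<forall>y\<in>p. (x - y) \<bullet> conormal T p = 0))"

text \<open>
  For fixed \<open>\<kappa>\<close>, \<open>q\<close>, \<open>c0\<close> the admissible meshes of a domain are a shape-regular, quasi-uniform
  family; a constant is mesh-independent if it serves all of them.
\<close>

definition admissible_mesh ::
    "'n::finite geometry \<Rightarrow> real \<Rightarrow> real \<Rightarrow> real \<Rightarrow> 'n mesh \<Rightarrow> bool" where
  "admissible_mesh G \<kappa> q c0 T \<longleftrightarrow>
     conforming_mesh G T \<and> oriented_mesh G T \<and>
     mesh_size T \<le> 1 \<and>
     (\<forall>K\<in>els T. diameter K \<le> \<kappa> * inradius K) \<and>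
     (\<forall>K\<in>els T. mesh_size T \<le> q * diameter K) \<and>
     (\<forall>e\<in>facets (els T). c0 * mesh_size T \<le> diameter e)"


section \<open>Discrete spaces\<close>

definition fluid_space :: "'n::finite geometry \<Rightarrow> nat \<Rightarrow> 'n mesh \<Rightarrow> (real^'n \<Rightarrow> complex) set" where
  "fluid_space G r T = {v.
     v \<in> borel_measurable (lebesgue_on (Om G)) \<and>
     integrable (lebesgue_on (Om G)) (\<lambda>x. (cmod (v x))\<^sup>2) \<and>
     (\<forall>K\<in>els T. \<exists>p\<in>polys r. AE x in lebesgue. x \<in> K \<longrightarrow> v x = p x)}"

definition plate_space :: "'n::finite geometry \<Rightarrow> nat \<Rightarrow> 'n mesh \<Rightarrow> (real^'n \<Rightarrow> complex) set" where
  "plate_space G r T = {w.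
     continuous_on (closure (Gam G)) w \<and>
     (\<forall>E\<in>plate_els G T. \<exists>p\<in>polys r. \<forall>x\<in>E. w x = p x)}"

definition discrete_space ::
    "'n::finite geometry \<Rightarrow> nat \<Rightarrow> 'n mesh \<Rightarrow> ((real^'n \<Rightarrow> complex) \<times> (real^'n \<Rightarrow> complex)) set" where
  "discrete_space G r T = fluid_space G r T \<times> plate_space G r T"

text \<open>
  Polynomials representing a discrete function on one element. They provide the elementwise
  derivatives and the one-sided traces on facets. On the plate they are unique only up to
  polynomials vanishing on its hyperplane, which does not affect tangential derivatives.
\<close>

definition loc :: "nat \<Rightarrow> (real^'n \<Rightarrow> complex) \<Rightarrow> (real^'n) set \<Rightarrow> real^'n \<Rightarrow> complex" where
  "loc r v K = (SOME p. p \<in> polys r \<and> (AE x in lebesgue. x \<in> K \<longrightarrow> v x = p x))"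

definition ploc :: "nat \<Rightarrow> (real^'n \<Rightarrow> complex) \<Rightarrow> (real^'n) set \<Rightarrow> real^'n \<Rightarrow> complex" where
  "ploc r w E = (SOME p. p \<in> polys r \<and> (\<forall>x\<in>E. w x = p x))"

definition bd_trace ::
    "nat \<Rightarrow> 'n::finite mesh \<Rightarrow> (real^'n \<Rightarrow> complex) \<Rightarrow> (real^'n) set \<Rightarrow> real^'n \<Rightarrow> complex" where
  "bd_trace r T v e = loc r v (THE K. K \<in> els T \<and> e facet_of K)"

definition jump ::
    "nat \<Rightarrow> 'n::finite mesh \<Rightarrow> (real^'n \<Rightarrow> complex) \<Rightarrow> (real^'n) set \<Rightarrow> real^'n \<Rightarrow> complex" where
  "jump r T v e x = loc r v (side1 T e) x - loc r v (side2 T e) x"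

definition avg_dn ::
    "nat \<Rightarrow> 'n::finite mesh \<Rightarrow> (real^'n \<Rightarrow> complex) \<Rightarrow> (real^'n) set \<Rightarrow> real^'n \<Rightarrow> complex" where
  "avg_dn r T v e x =
     (dnormal (fnormal T e) (loc r v (side1 T e)) x
      + dnormal (fnormal T e) (loc r v (side2 T e)) x) / 2"

definition pjump ::
    "'n::finite geometry \<Rightarrow> nat \<Rightarrow> 'n mesh \<Rightarrow> (real^'n \<Rightarrow> complex) \<Rightarrow> (real^'n) set \<Rightarrow> real^'n
      \<Rightarrow> complex^'n^'n" where
  "pjump G r T w p x =
     outer (tgrad (nu G) (ploc r w (pside1 T p)) x) (conormal T p)
     - outer (tgrad (nu G) (ploc r w (pside2 T p)) x) (conormal T p)"

definition pavg ::
    "'n::finite geometry \<Rightarrow> 'n params \<Rightarrow> nat \<Rightarrow> 'n mesh \<Rightarrow> (real^'n \<Rightarrow> complex) \<Rightarrow> (real^'n) set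
      \<Rightarrow> real^'n \<Rightarrow> complex^'n^'n" where
  "pavg G P r T w p x = (1 / 2) *\<^sub>R
     (contract (rigid P x) (thess (nu G) (ploc r w (pside1 T p)) x)
      + contract (rigid P x) (thess (nu G) (ploc r w (pside2 T p)) x))"


section \<open>The discrete norm\<close>

definition Jf2 :: "'n::finite geometry \<Rightarrow> nat \<Rightarrow> 'n mesh \<Rightarrow> (real^'n \<Rightarrow> complex) \<Rightarrow> real" where
  "Jf2 G r T v = (\<Sum>e\<in>fluid_facets G T.
     (1 / diameter e) * (LINT x:e|flat_measure e. (cmod (jump r T v e x))\<^sup>2))"

definition Jp2 :: "'n::finite geometry \<Rightarrow> nat \<Rightarrow> 'n mesh \<Rightarrow> (real^'n \<Rightarrow> complex) \<Rightarrow> real" where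
  "Jp2 G r T w = (\<Sum>p\<in>plate_facets G T.
     (1 / plate_facet_size T p) * (LINT x:p|flat_measure p. (norm (pjump G r T w p x))\<^sup>2))"

definition Xnorm ::
    "'n::finite geometry \<Rightarrow> 'n params \<Rightarrow> nat \<Rightarrow> 'n mesh
      \<Rightarrow> (real^'n \<Rightarrow> complex) \<times> (real^'n \<Rightarrow> complex) \<Rightarrow> real" where
  "Xnorm G P r T = (\<lambda>(\<phi>, w). sqrt (
     (\<Sum>K\<in>els T. LINT x:K|lebesgue. (norm (grad (loc r \<phi> K) x))\<^sup>2)
     + (LINT x:Om G|lebesgue. (cmod (\<phi> x))\<^sup>2)
     + Jf2 G r T \<phi>
     + mup P *
        ((\<Sum>E\<in>plate_els G T. LINT x:E|flat_measure E. (norm (thess (nu G) (ploc r w E) x))\<^sup>2)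
         + (LINT x:Gam G|flat_measure (Gam G). (cmod (w x))\<^sup>2)
         + Jp2 G r T w)))"


section \<open>The sesquilinear form\<close>

text \<open>
  Integrals over a part \<open>S\<close> of the boundary are assembled from the boundary facets, where the
  trace of a discrete function is a polynomial.
\<close>

definition bd_integral ::
    "'n::finite mesh \<Rightarrow> (real^'n) set \<Rightarrow> ((real^'n) set \<Rightarrow> real^'n \<Rightarrow> complex) \<Rightarrow> complex" where
  "bd_integral T S f = (\<Sum>e\<in>boundary_facets (els T). LINT x:(e \<inter> S)|flat_measure e. f e x)"

definition modal_coeff ::
    "'n::finite geometry \<Rightarrow> 'n params \<Rightarrow> nat \<Rightarrow> 'n mesh \<Rightarrow> (real^'n) set \<Rightarrow> (real^'n \<Rightarrow> complex) \<Rightarrow> nat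
      \<Rightarrow> complex" where
  "modal_coeff G P r T S v m =
     bd_integral T S (\<lambda>e x. bd_trace r T v e x * complex_of_real (psi P m (to_cross G x)))"

definition Kform ::
    "'n::finite geometry \<Rightarrow> 'n params \<Rightarrow> nat \<Rightarrow> 'n mesh
      \<Rightarrow> (real^'n \<Rightarrow> complex) \<Rightarrow> (real^'n \<Rightarrow> complex) \<Rightarrow> complex" where
  "Kform G P r T \<phi> v = (\<Sum>m\<le>nmode P. \<i> * km P m / complex_of_real (modal_norm2 G P m) *
     (modal_coeff G P r T (Gin G) \<phi> m * cnj (modal_coeff G P r T (Gin G) v m)
      + modal_coeff G P r T (Gout G) \<phi> m * cnj (modal_coeff G P r T (Gout G) v m)))"

definition fluid_form ::
    "'n::finite geometry \<Rightarrow> 'n params \<Rightarrow> nat \<Rightarrow> 'n mesh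
      \<Rightarrow> (real^'n \<Rightarrow> complex) \<Rightarrow> (real^'n \<Rightarrow> complex) \<Rightarrow> complex" where
  "fluid_form G P r T \<phi> v =
     (\<Sum>K\<in>els T. LINT x:K|lebesgue. cdot (grad (loc r \<phi> K) x) (grad (loc r v K) x))
     - bd_integral T (Gfs G) (\<lambda>e x. complex_of_real ((omega P)\<^sup>2 / grav P) *
         bd_trace r T \<phi> e x * cnj (bd_trace r T v e x))
     - Kform G P r T \<phi> v
     - (\<Sum>e\<in>fluid_facets G T. LINT x:e|flat_measure e. avg_dn r T \<phi> e x * cnj (jump r T v e x))
     - (\<Sum>e\<in>fluid_facets G T. LINT x:e|flat_measure e. jump r T \<phi> e x * cnj (avg_dn r T v e x))
     + (\<Sum>e\<in>fluid_facets G T. LINT x:e|flat_measure e.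
          complex_of_real (sig1 P / diameter e) * jump r T \<phi> e x * cnj (jump r T v e x))"

definition plate_form ::
    "'n::finite geometry \<Rightarrow> 'n params \<Rightarrow> nat \<Rightarrow> 'n mesh
      \<Rightarrow> (real^'n \<Rightarrow> complex) \<Rightarrow> (real^'n \<Rightarrow> complex) \<Rightarrow> (real^'n \<Rightarrow> complex) \<Rightarrow> complex" where
  "plate_form G P r T \<phi> w s =
     (\<Sum>E\<in>plate_els G T. LINT x:E|flat_measure E.
        cddot (contract (rigid P x) (thess (nu G) (ploc r w E) x)) (thess (nu G) (ploc r s E) x))
     - (LINT x:Gam G|flat_measure (Gam G).
          complex_of_real (inert P * (omega P)\<^sup>2) * w x * cnj (s x))
     - (\<Sum>E\<in>plate_els G T. LINT x:E|flat_measure E.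
          \<i> * complex_of_real (omega P * rhow P) * jump r T \<phi> E x * cnj (s x))
     - (\<Sum>p\<in>plate_facets G T. LINT x:p|flat_measure p.
          cddot (pavg G P r T w p x) (pjump G r T s p x))
     - (\<Sum>p\<in>plate_facets G T. LINT x:p|flat_measure p.
          cddot (pjump G r T w p x) (pavg G P r T s p x))
     + (\<Sum>p\<in>plate_facets G T. LINT x:p|flat_measure p.
          complex_of_real (sig2 P / plate_facet_size T p) *
          cddot (pjump G r T w p x) (pjump G r T s p x))"

definition Bform ::
    "'n::finite geometry \<Rightarrow> 'n params \<Rightarrow> nat \<Rightarrow> 'n mesh
      \<Rightarrow> (real^'n \<Rightarrow> complex) \<times> (real^'n \<Rightarrow> complex)
      \<Rightarrow> (real^'n \<Rightarrow> complex) \<times> (real^'n \<Rightarrow> complex) \<Rightarrow> complex" where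
  "Bform G P r T = (\<lambda>(\<phi>, w) (v, s).
     fluid_form G P r T \<phi> v
     + (\<Sum>E\<in>plate_els G T. LINT x:E|flat_measure E.
          \<i> * complex_of_real (omega P) * w x * cnj (jump r T v E x))
     + complex_of_real (mup P) * plate_form G P r T \<phi> w s)"

end

theory Submission
  imports Defs
begin

text \<open>
  Every term of the form is estimated by Cauchy--Schwarz; what has to be shown is that the traces
  that occur are controlled by the discrete norm, with constants that do not see the mesh.

  For \<open>h\<^sub>e\<close>-weighted traces of derivatives on facets this is an inverse inequality. Extrapolating
  from the points \<open>1 / (j + 1)\<close> to 0 along a ray writes the value of a polynomial at \<open>x\<close> as a fixed
  linear combination of its values at \<open>x + (y - x) / (j + 1)\<close>; integrating over \<open>y\<close> in a convex set \<open>E\<close> that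
  contains \<open>x\<close> bounds the value at \<open>x\<close> by the mean square over \<open>E\<close>, because homotheties
  centred at \<open>x\<close> map \<open>E\<close> into itself. No pull-back to a reference element is needed. It remains to
  compare the measure of a facet with that of its simplex, which the inscribed ball does.

  For the traces on the free surface, the inlet, the outlet and the plate, a broken trace inequality
  is proved for a Lipschitz domain \<open>U\<close>. In a boundary chart there is a direction \<open>u\<close> transversal to
  every boundary facet, so that the sum over the simplices of the divergence theorem for
  \<open>\<chi> \<bar>p\<bar>\<^sup>2 u\<close>, with a cutoff \<open>\<chi>\<close>, bounds the boundary trace by volume terms and by
  interior facet terms \<open>\<bar>p\<^sub>1 - p\<^sub>2\<bar> (\<bar>p\<^sub>1\<bar> + \<bar>p\<^sub>2\<bar>)\<close>; the latter are absorbed into the jump seminorm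
  and, by the inverse inequality, the \<open>L\<^sup>2\<close> norm. Finitely many charts cover the frontier. The
  inequality is applied to \<open>\<Omega>\<^sup>+\<close> and \<open>\<Omega>\<^sup>-\<close> separately, whose interior facets are exactly those where the
  norm penalises the jump.

  The divergence theorem on a simplex follows from its radial case on the cone over a facet \<open>e\<close> with
  apex \<open>a\<close>, where \<open>d f + (x - a) \<bullet> \<nabla>f\<close> is integrated along rays: the fields \<open>x - a\<close> for
  the vertices \<open>a\<close> span the constant fields.
\<close>


section \<open>Integration over affine subspaces\<close>

text \<open>\<open>flat_measure\<close> is built from tubes, so statements about facets are proved
  as statements about Lebesgue measure of the ambient space, where Fubini, translations and
  homotheties act.

  The domains are merely Lipschitz: there is no normal field to extend inwards, and a constant
  direction per chart takes its place. A graph of slope L keeps - (n \<bullet> u) above 1 / (L + 2)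
  on every boundary facet whose relative interior meets the chart, however the mesh is placed.
  Charts and cutoffs are fixed by the geometry; the mesh enters the trace constant only through the
  ratio of its size to the radii of inscribed balls.

  The powers of the mesh size balance because the norm controls jumps with weight 1 / h_e: Young's
  inequality with this weight leaves h_e times squared traces, which is what the inverse inequality
  turns into volume terms. The square roots of the same weights match averaged derivatives against
  jumps in the consistency terms. One set of extrapolation weights serves polynomials, gradients and
  Hessians, since extrapolation along rays commutes with differentiation.\<close>

lemma infdist_eq_dist_closest_point:
  assumes "closed A" "A \<noteq> {}"
  shows "infdist x A = dist x (closest_point A x)"
proof (rule antisym)
  show "infdist x A \<le> dist x (closest_point A x)"
    using assms closest_point_in_set infdist_le by blast
  show "dist x (closest_point A x) \<le> infdist x A"
    using assms closest_point_le[OF assms(1)] by (auto simp: infdist_notempty intro!: cINF_greatest)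
qed

lemma closest_point_affine_orthogonal:
  fixes A :: "'a::euclidean_space set"
  assumes "affine A" "A \<noteq> {}" "z \<in> A" "z' \<in> A"
  shows "(x - closest_point A x) \<bullet> (z - z') = 0"
proof -
  have cl: "closed A" "convex A" using assms by (auto simp: affine_closed affine_imp_convex)
  let ?p = "closest_point A x"
  have p: "?p \<in> A" using cl assms closest_point_in_set by blast
  have 1: "(x - ?p) \<bullet> (z - ?p) = 0" if "z \<in> A" for z
  proof -
    \<comment> \<open>The reflection of \<open>z\<close> in \<open>?p\<close> also lies in
      \<open>A\<close>, so the variational inequality for the projection holds with both
      signs.\<close>
    have "2 *\<^sub>R ?p + (-1) *\<^sub>R z \<in> A"
      using mem_affine[OF assms(1) p that, of 2 "-1"] by simp
    then have "(x - ?p) \<bullet> (2 *\<^sub>R ?p + (-1) *\<^sub>R z - ?p) \<le> 0" "(x - ?p) \<bullet> (z - ?p) \<le> 0"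
      using closest_point_dot[OF cl(2,1)] that by blast+
    then show ?thesis by (simp add: scaleR_2 inner_simps)
  qed
  show ?thesis using 1[OF assms(3)] 1[OF assms(4)] by (simp add: inner_simps)
qed

lemma closest_point_affine_eqI:
  fixes A :: "'a::euclidean_space set"
  assumes "affine A" "y \<in> A" "\<And>z. z \<in> A \<Longrightarrow> (x - y) \<bullet> (z - y) = 0"
  shows "closest_point A x = y"
proof -
  have "A \<noteq> {}" using assms by auto
  let ?p = "closest_point A x"
  have p: "?p \<in> A" using assms \<open>A \<noteq> {}\<close> closest_point_in_set affine_closed by blast
  have "(x - ?p) \<bullet> (?p - y) = 0" "(x - y) \<bullet> (?p - y) = 0"
    using closest_point_affine_orthogonal[OF assms(1) \<open>A \<noteq> {}\<close> p assms(2)] assms(3)[OF p] by auto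
  then have "(?p - y) \<bullet> (?p - y) = 0" by (simp add: inner_simps)
  then show ?thesis by simp
qed

lemma closest_point_affine_homothety:
  fixes A :: "'a::euclidean_space set"
  assumes A: "affine A" and c: "c \<in> A"
  shows "closest_point A (c + t *\<^sub>R (x - c)) = c + t *\<^sub>R (closest_point A x - c)"
proof (rule closest_point_affine_eqI[OF A])
  have "A \<noteq> {}" using c by auto
  let ?p = "closest_point A x"
  have p: "?p \<in> A" using A \<open>A \<noteq> {}\<close> closest_point_in_set affine_closed by blast
  have "(1 - t) *\<^sub>R c + t *\<^sub>R ?p \<in> A" using A c p by (simp add: mem_affine)
  then show q: "c + t *\<^sub>R (?p - c) \<in> A" by (simp add: algebra_simps)
  fix z assume z: "z \<in> A"
  have "c + t *\<^sub>R (x - c) - (c + t *\<^sub>R (?p - c)) = t *\<^sub>R (x - ?p)" by (simp add: algebra_simps)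
  then show "(c + t *\<^sub>R (x - c) - (c + t *\<^sub>R (?p - c))) \<bullet> (z - (c + t *\<^sub>R (?p - c))) = 0"
    using closest_point_affine_orthogonal[OF A \<open>A \<noteq> {}\<close> z q] by simp
qed

lemma closest_point_hyperplane:
  fixes n :: "'a::euclidean_space"
  assumes "norm n = 1"
  shows "closest_point {x. n \<bullet> x = b} x = x - (n \<bullet> x - b) *\<^sub>R n"
proof (rule closest_point_affine_eqI[OF affine_hyperplane])
  have nn: "n \<bullet> n = 1" using assms by (simp add: norm_eq_1)
  show "x - (n \<bullet> x - b) *\<^sub>R n \<in> {x. n \<bullet> x = b}" by (simp add: inner_simps nn)
  show "(x - (x - (n \<bullet> x - b) *\<^sub>R n)) \<bullet> (z - (x - (n \<bullet> x - b) *\<^sub>R n)) = 0"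
    if "z \<in> {x. n \<bullet> x = b}" for z
    using that by (simp add: inner_simps nn) (simp add: algebra_simps)
qed

section \<open>The surface measure as a tube integral\<close>

definition tube :: "'a::euclidean_space set \<Rightarrow> 'a set" where
  "tube A = {x. infdist x A \<le> 1}"

definition tube_factor :: "'a::euclidean_space set \<Rightarrow> real" where
  "tube_factor S = 1 / unit_ball_vol (of_int (int DIM('a) - aff_dim S))"

lemma tube_factor_pos: "0 < tube_factor (S :: 'a::euclidean_space set)"
  using aff_dim_le_DIM[of S] by (auto simp: tube_factor_def)

lemma closed_tube: "closed (tube A)"
  unfolding tube_def by (intro closed_Collect_le continuous_intros)

lemma mem_tube_iff:
  "closed A \<Longrightarrow> A \<noteq> {} \<Longrightarrow> x \<in> tube A \<longleftrightarrow> norm (x - closest_point A x) \<le> 1"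
  by (simp add: tube_def infdist_eq_dist_closest_point dist_norm)

lemma borel_measurable_closest_point:
  fixes A :: "'a::euclidean_space set"
  shows "affine A \<Longrightarrow> A \<noteq> {} \<Longrightarrow> closest_point A \<in> borel_measurable borel"
  by (intro borel_measurable_continuous_onI continuous_on_closest_point)
    (auto intro: affine_closed affine_imp_convex)

lemma sets_flat_measure [simp, measurable_cong]: "sets (flat_measure S) = sets borel"
  by (simp add: flat_measure_def)

lemma space_flat_measure [simp]: "space (flat_measure S) = UNIV"
  by (simp add: flat_measure_def space_scale_measure)

lemma flat_measure_cong: "affine hull S = affine hull S' \<Longrightarrow> flat_measure S = flat_measure S'"
  unfolding flat_measure_def by (metis aff_dim_affine_hull)

text \<open>Unfolding the image measure turns a surface integral into a Lebesgue integral of a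
  function that is constant along the normal directions. The computations with
  \<open>flat_measure\<close> start from this form.\<close>

lemma nn_integral_flat_measure:
  fixes S :: "'a::euclidean_space set"
  assumes "S \<noteq> {}" and g [measurable]: "g \<in> borel_measurable borel"
  shows "(\<integral>\<^sup>+x. g x \<partial>flat_measure S) = ennreal (tube_factor S) *
    (\<integral>\<^sup>+x. g (closest_point (affine hull S) x) * indicator (tube (affine hull S)) x \<partial>lborel)"
proof -
  let ?A = "affine hull S"
  have [measurable]: "closest_point ?A \<in> borel_measurable borel"
    using assms by (intro borel_measurable_closest_point) auto
  have [measurable]: "tube ?A \<in> sets borel"
    using closed_tube by (rule borel_closed)
  have m: "closest_point ?A \<in> measurable (restrict_space lborel (tube ?A)) borel"
    by (intro measurable_restrict_space1) simp
  have "(\<integral>\<^sup>+x. g x \<partial>flat_measure S) = ennreal (tube_factor S) *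
     (\<integral>\<^sup>+x. g (closest_point ?A x) \<partial>restrict_space lborel (tube ?A))"
    unfolding flat_measure_def tube_factor_def tube_def[symmetric]
    by (subst nn_integral_scale_measure, simp) (subst nn_integral_distr[OF m], auto)
  also have "(\<integral>\<^sup>+x. g (closest_point ?A x) \<partial>restrict_space lborel (tube ?A)) =
     (\<integral>\<^sup>+x. g (closest_point ?A x) * indicator (tube ?A) x \<partial>lborel)"
    by (subst nn_integral_restrict_space) auto
  finally show ?thesis .
qed

lemma emeasure_flat_measure_finite:
  fixes S :: "'a::euclidean_space set"
  assumes "S \<noteq> {}" "bounded B" and [measurable]: "B \<in> sets borel"
  shows "emeasure (flat_measure S) B < \<infinity>"
proof -
  let ?A = "affine hull S"
  have A: "closed ?A" "?A \<noteq> {}" using assms by (auto simp: affine_closed)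
  obtain R where R: "\<And>x. x \<in> B \<Longrightarrow> norm x \<le> R" using assms(2) by (auto simp: bounded_iff)
  have "emeasure (flat_measure S) B = (\<integral>\<^sup>+x. indicator B x \<partial>flat_measure S)"
    by simp
  also have "\<dots> = ennreal (tube_factor S) *
    (\<integral>\<^sup>+x. indicator B (closest_point ?A x) * indicator (tube ?A) x \<partial>lborel)"
    by (rule nn_integral_flat_measure) (use assms in auto)
  also have "\<dots> \<le> ennreal (tube_factor S) * (\<integral>\<^sup>+x. indicator (cball (0::'a) (R + 1)) x \<partial>lborel)"
  proof (rule mult_left_mono, rule nn_integral_mono)
    fix x
    have "norm x \<le> R + 1" if "closest_point ?A x \<in> B" "x \<in> tube ?A"
      using R[OF that(1)] that(2) A mem_tube_iff[OF A] norm_triangle_sub[of x "closest_point ?A x"]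
      by (auto simp: )
    then show "indicator B (closest_point ?A x) * indicator (tube ?A) x \<le> (indicator (cball (0::'a) (R + 1)) x :: ennreal)"
      by (auto simp: indicator_def)
  qed auto
  also have "\<dots> < \<infinity>"
    using emeasure_lborel_cball_finite[of "0::'a" "R+1"] by (auto simp: ennreal_mult_less_top)
  finally show ?thesis .
qed

lemma sigma_finite_flat_measure:
  assumes "S \<noteq> {}"
  shows "sigma_finite_measure (flat_measure S)"
proof
  show "\<exists>A. countable A \<and> A \<subseteq> sets (flat_measure S) \<and> \<Union>A = space (flat_measure S) \<and>
    (\<forall>a\<in>A. emeasure (flat_measure S) a \<noteq> \<infinity>)"
  proof (intro exI[of _ "range (\<lambda>n::nat. cball 0 (real n))"] conjI ballI)
    show "\<Union> (range (\<lambda>n::nat. cball 0 (real n))) = space (flat_measure S)"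
      using real_arch_simple by fastforce
    fix a assume "a \<in> range (\<lambda>n::nat. cball (0::'a) (real n))"
    then show "emeasure (flat_measure S) a \<noteq> \<infinity>"
      using emeasure_flat_measure_finite[OF assms, of a] by auto
  qed auto
qed

lemma set_integrable_flat_measure:
  fixes f :: "'a::euclidean_space \<Rightarrow> 'b::euclidean_space"
  assumes "S \<noteq> {}" "compact B" "continuous_on B f"
  shows "set_integrable (flat_measure S) B f"
proof -
  have [measurable]: "B \<in> sets borel" using assms by (simp add: borel_compact)
  obtain C where C: "\<And>x. x \<in> B \<Longrightarrow> norm (f x) \<le> C"
    using compact_imp_bounded[OF compact_continuous_image[OF assms(3,2)]] by (auto simp: bounded_iff)
  have m: "(\<lambda>x. indicat_real B x *\<^sub>R f x) \<in> borel_measurable borel"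
    using borel_measurable_continuous_on_indicator[of B f] assms by simp
  show ?thesis unfolding set_integrable_def
  proof (rule Bochner_Integration.integrable_bound)
    show "integrable (flat_measure S) (\<lambda>x. C * indicat_real B x)"
      using emeasure_flat_measure_finite[OF assms(1) compact_imp_bounded[OF assms(2)]]
      by (intro integrable_mult_right integrable_real_indicator) auto
    show "(\<lambda>x. indicat_real B x *\<^sub>R f x) \<in> borel_measurable (flat_measure S)"
      using m by (simp add: measurable_cong_sets[of "flat_measure S" borel])
    show "AE x in flat_measure S. norm (indicat_real B x *\<^sub>R f x) \<le> norm (C * indicat_real B x)"
      using C by (intro AE_I2) (force simp: indicator_def)
  qed
qed

text \<open>In codimension 0 the projection is the identity, the tube is the whole space and the
  unit ball has volume 1. Lemmas stated for \<open>flat_measure E\<close> thus cover fluid elements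
  as well as plate elements.\<close>

lemma flat_measure_full:
  assumes "affine hull S = (UNIV :: 'a::euclidean_space set)"
  shows "flat_measure S = lborel"
proof (rule measure_eqI)
  have d: "aff_dim S = int DIM('a)"
    using assms by (metis aff_dim_UNIV aff_dim_affine_hull)
  have ne: "S \<noteq> {}" using assms by auto
  have c: "closest_point UNIV = (\<lambda>x::'a. x)" by (auto simp: closest_point_self)
  have t: "tube UNIV = (UNIV :: 'a set)" by (auto simp: tube_def)
  fix X assume "X \<in> sets (flat_measure S)"
  then have X: "X \<in> sets borel" by simp
  have "emeasure (flat_measure S) X = (\<integral>\<^sup>+x. indicator X x \<partial>flat_measure S)"
    using X by simp
  also have "\<dots> = emeasure lborel X"
    using X ne by (subst nn_integral_flat_measure) (auto simp: assms c t tube_factor_def d)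
  finally show "emeasure (flat_measure S) X = emeasure lborel X" .
qed simp

section \<open>Homotheties of convex sets\<close>

lemma nn_integral_lborel_affine:
  fixes t :: "'a::euclidean_space"
  assumes "g \<in> borel_measurable borel" "c \<noteq> 0"
  shows "(\<integral>\<^sup>+x. g x \<partial>lborel) = ennreal (\<bar>c\<bar> ^ DIM('a)) * (\<integral>\<^sup>+x. g (t + c *\<^sub>R x) \<partial>lborel)"
proof -
  have [measurable]: "g \<in> borel_measurable borel" by fact
  show ?thesis
    by (subst lborel_affine[OF assms(2), of t], subst nn_integral_density)
      (auto simp: nn_integral_distr nn_integral_cmult)
qed

lemma nn_integral_lborel_translate:
  fixes t :: "'a::euclidean_space"
  assumes "g \<in> borel_measurable borel"
  shows "(\<integral>\<^sup>+x. g (x + t) \<partial>lborel) = (\<integral>\<^sup>+x. g x \<partial>lborel)"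
  using nn_integral_lborel_affine[OF assms, of 1 t] by (simp add: add.commute)

text \<open>The homothety is carried out in the ambient space, which also shrinks the tube; for t
  \<le> 1 the shrunk tube stays in the tube. Hence an inequality, with the ambient exponent whatever
  the dimension of \<open>E\<close>. The loss is a power of 1 / t, harmless because t will range
  over fixed nodes.\<close>

lemma nn_integral_flat_measure_homothety:
  fixes E :: "'a::euclidean_space set"
  assumes E: "closed E" "convex E" and c: "c \<in> E" and t: "0 < t" "t \<le> 1"
    and g [measurable]: "g \<in> borel_measurable borel"
  shows "(\<integral>\<^sup>+y. g (c + t *\<^sub>R (y - c)) * indicator E y \<partial>flat_measure E)
    \<le> ennreal ((1 / t) ^ DIM('a)) * (\<integral>\<^sup>+y. g y * indicator E y \<partial>flat_measure E)"
proof -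
  let ?A = "affine hull E"
  let ?P = "closest_point ?A"
  have ne: "E \<noteq> {}" using c by auto
  have A: "affine ?A" "closed ?A" "?A \<noteq> {}" "c \<in> ?A" using c ne by (auto simp: affine_closed hull_inc)
  have [measurable]: "?P \<in> borel_measurable borel" "tube ?A \<in> sets borel" "E \<in> sets borel"
    using A E by (auto intro!: borel_measurable_closest_point borel_closed closed_tube)
  define h where "h z = g (?P z) * indicator E (?P z) * indicator (tube ?A) z" for z
  have [measurable]: "h \<in> borel_measurable borel" unfolding h_def by measurable
  have le: "g (c + t *\<^sub>R (?P x - c)) * indicator E (?P x) * indicator (tube ?A) x
      \<le> h ((1 - t) *\<^sub>R c + t *\<^sub>R x)" for x
  proof -
    have e: "(1 - t) *\<^sub>R c + t *\<^sub>R x = c + t *\<^sub>R (x - c)" for x by (simp add: algebra_simps)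
    have P: "?P (c + t *\<^sub>R (x - c)) = c + t *\<^sub>R (?P x - c)"
      by (rule closest_point_affine_homothety) (use A in auto)
    have 1: "c + t *\<^sub>R (?P x - c) \<in> E" if "?P x \<in> E"
      unfolding e[symmetric] using convexD[OF E(2) c that, of "1 - t" t] t by simp
    have 2: "c + t *\<^sub>R (x - c) \<in> tube ?A" if "x \<in> tube ?A"
    proof -
      have "c + t *\<^sub>R (x - c) - ?P (c + t *\<^sub>R (x - c)) = t *\<^sub>R (x - ?P x)"
        unfolding P by (simp add: algebra_simps)
      then have "norm (c + t *\<^sub>R (x - c) - ?P (c + t *\<^sub>R (x - c))) = t * norm (x - ?P x)"
        using t by simp
      also have "\<dots> \<le> 1" using that t using A by (simp add: mem_tube_iff mult_le_one)
      finally show ?thesis using A by (simp add: mem_tube_iff)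
    qed
    show ?thesis using 1 2 unfolding h_def e P by (auto simp: indicator_def)
  qed
  have "(\<integral>\<^sup>+y. g (c + t *\<^sub>R (y - c)) * indicator E y \<partial>flat_measure E) = ennreal (tube_factor E) *
     (\<integral>\<^sup>+x. g (c + t *\<^sub>R (?P x - c)) * indicator E (?P x) * indicator (tube ?A) x \<partial>lborel)"
    by (rule nn_integral_flat_measure[OF ne]) measurable
  also have "\<dots> \<le> ennreal (tube_factor E) * (\<integral>\<^sup>+x. h ((1 - t) *\<^sub>R c + t *\<^sub>R x) \<partial>lborel)"
    by (intro mult_left_mono nn_integral_mono le) auto
  also have "(\<integral>\<^sup>+x. h ((1 - t) *\<^sub>R c + t *\<^sub>R x) \<partial>lborel) = ennreal ((1 / t) ^ DIM('a)) * (\<integral>\<^sup>+x. h x \<partial>lborel)"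
    using t by (subst nn_integral_lborel_affine[of h t "(1 - t) *\<^sub>R c"])
      (auto simp: mult.assoc[symmetric] ennreal_mult[symmetric] power_mult_distrib[symmetric])
  also have "ennreal (tube_factor E) * (ennreal ((1 / t) ^ DIM('a)) * (\<integral>\<^sup>+x. h x \<partial>lborel))
     = ennreal ((1 / t) ^ DIM('a)) * (\<integral>\<^sup>+y. g y * indicator E y \<partial>flat_measure E)"
    unfolding h_def by (subst nn_integral_flat_measure[OF ne]) (auto simp: ac_simps)
  finally show ?thesis .
qed

lemma nn_integral_eq_set_lebesgue_integral:
  assumes "set_integrable M A f" "\<And>x. x \<in> A \<Longrightarrow> 0 \<le> f x"
  shows "(\<integral>\<^sup>+x. ennreal (f x) * indicator A x \<partial>M) = ennreal (LINT x:A|M. f x)"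
proof -
  have "(\<integral>\<^sup>+x. ennreal (f x) * indicator A x \<partial>M) = (\<integral>\<^sup>+x. ennreal (indicat_real A x * f x) \<partial>M)"
    by (intro nn_integral_cong) (auto simp: indicator_def)
  also have "\<dots> = ennreal (LINT x:A|M. f x)"
    using assms unfolding set_lebesgue_integral_def set_integrable_def
    by (subst nn_integral_eq_integral) (auto simp: indicator_def)
  finally show ?thesis .
qed


section \<open>Inverse inequality\<close>

text \<open>Extrapolation to the parameter 0 along every line, with the same nodes \<open>t\<close>
  and weights \<open>L\<close> for all lines. Being linear in \<open>f\<close> and invariant under
  translations, the property passes to derivatives and to linear images.\<close>

definition reproducing :: "'j set \<Rightarrow> ('j \<Rightarrow> real) \<Rightarrow> ('j \<Rightarrow> real) \<Rightarrow>
    ('a::real_vector \<Rightarrow> 'b::real_vector) \<Rightarrow> bool" where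
  "reproducing J t L f \<longleftrightarrow> (\<forall>x v. f x = (\<Sum>j\<in>J. L j *\<^sub>R f (x + t j *\<^sub>R v)))"

text \<open>Cauchy-Schwarz over the nodes bounds the value at \<open>x\<close> by values at the
  points x + t j (y - x); integration over y in \<open>E\<close> makes each of them a homothety
  centred at \<open>x\<close>. The measure of \<open>E\<close> stays on the left as a factor, so
  that the case of measure 0 is included.\<close>

lemma inverse_inequality_flat_measure:
  fixes f :: "'a::euclidean_space \<Rightarrow> 'b::euclidean_space"
  assumes E: "compact E" "convex E" and x: "x \<in> E" and f: "continuous_on UNIV f"
    and J: "finite J" "\<And>j. j \<in> J \<Longrightarrow> 0 < t j \<and> t j \<le> 1" and rep: "reproducing J t L f"
  shows "measure (flat_measure E) E * (norm (f x))\<^sup>2 \<le>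
     ((\<Sum>j\<in>J. (L j)\<^sup>2) * (\<Sum>j\<in>J. (1 / t j) ^ DIM('a))) * (LINT y:E|flat_measure E. (norm (f y))\<^sup>2)"
proof -
  let ?S = "\<Sum>j\<in>J. (L j)\<^sup>2"
  have ne: "E \<noteq> {}" using x by auto
  have [measurable]: "f \<in> borel_measurable borel" using f by (rule borel_measurable_continuous_onI)
  have [measurable]: "E \<in> sets borel" using E by (simp add: borel_compact)
  have cs: "(norm (f x))\<^sup>2 \<le> ?S * (\<Sum>j\<in>J. (norm (f (x + t j *\<^sub>R v)))\<^sup>2)" for v
  proof -
    have "norm (f x) \<le> (\<Sum>j\<in>J. \<bar>L j\<bar> * norm (f (x + t j *\<^sub>R v)))"
      using rep unfolding reproducing_def
      by (metis (no_types, lifting) norm_scaleR norm_sum sum.cong)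
    then have "(norm (f x))\<^sup>2 \<le> (\<Sum>j\<in>J. \<bar>L j\<bar> * norm (f (x + t j *\<^sub>R v)))\<^sup>2"
      by (intro power_mono) auto
    also have "\<dots> \<le> (\<Sum>j\<in>J. \<bar>L j\<bar>\<^sup>2) * (\<Sum>j\<in>J. (norm (f (x + t j *\<^sub>R v)))\<^sup>2)"
      by (rule Cauchy_Schwarz_ineq_sum)
    finally show ?thesis by simp
  qed
  define I where "I = (LINT y:E|flat_measure E. (norm (f y))\<^sup>2)"
  have int: "set_integrable (flat_measure E) E (\<lambda>y. (norm (f y))\<^sup>2)"
    by (intro set_integrable_flat_measure ne E continuous_intros continuous_on_subset[OF f]) auto
  have I: "(\<integral>\<^sup>+y. ennreal ((norm (f y))\<^sup>2) * indicator E y \<partial>flat_measure E) = ennreal I"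
    unfolding I_def by (rule nn_integral_eq_set_lebesgue_integral[OF int]) auto
  have I0: "0 \<le> I" unfolding I_def set_lebesgue_integral_def by (intro integral_nonneg_AE) auto
  have "ennreal (measure (flat_measure E) E * (norm (f x))\<^sup>2) =
     (\<integral>\<^sup>+y. ennreal ((norm (f x))\<^sup>2) * indicator E y \<partial>flat_measure E)"
    using emeasure_flat_measure_finite[OF ne compact_imp_bounded[OF E(1)]]
    by (subst nn_integral_cmult_indicator) (auto simp: ennreal_mult emeasure_eq_ennreal_measure mult.commute)
  also have "\<dots> \<le> (\<integral>\<^sup>+y. ennreal ?S * (\<Sum>j\<in>J. ennreal ((norm (f (x + t j *\<^sub>R (y - x))))\<^sup>2) * indicator E y) \<partial>flat_measure E)"
  proof (rule nn_integral_mono)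
    fix y
    have "ennreal ((norm (f x))\<^sup>2) \<le> ennreal ?S * (\<Sum>j\<in>J. ennreal ((norm (f (x + t j *\<^sub>R (y - x))))\<^sup>2))"
      using cs[of "y - x"] by (simp add: ennreal_mult'[symmetric] sum_nonneg ennreal_leI)
    then show "ennreal ((norm (f x))\<^sup>2) * indicator E y
      \<le> ennreal ?S * (\<Sum>j\<in>J. ennreal ((norm (f (x + t j *\<^sub>R (y - x))))\<^sup>2) * indicator E y)"
      by (auto simp: indicator_def)
  qed
  also have "\<dots> = ennreal ?S * (\<Sum>j\<in>J. \<integral>\<^sup>+y. ennreal ((norm (f (x + t j *\<^sub>R (y - x))))\<^sup>2) * indicator E y \<partial>flat_measure E)"
    by (subst nn_integral_cmult) (auto simp: nn_integral_sum)
  also have "\<dots> \<le> ennreal ?S * (\<Sum>j\<in>J. ennreal ((1 / t j) ^ DIM('a)) * ennreal I)"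
  proof (intro mult_left_mono sum_mono)
    fix j assume "j \<in> J"
    then show "(\<integral>\<^sup>+y. ennreal ((norm (f (x + t j *\<^sub>R (y - x))))\<^sup>2) * indicator E y \<partial>flat_measure E)
       \<le> ennreal ((1 / t j) ^ DIM('a)) * ennreal I"
      unfolding I[symmetric]
      using nn_integral_flat_measure_homothety[OF compact_imp_closed[OF E(1)] E(2) x, of "t j" "\<lambda>y. ennreal ((norm (f y))\<^sup>2)"] J(2)[of j]
      by auto
  qed auto
  also have "\<dots> = ennreal ((?S * (\<Sum>j\<in>J. (1 / t j) ^ DIM('a))) * I)"
  proof -
    have "(\<Sum>j\<in>J. ennreal ((1 / t j) ^ DIM('a)) * ennreal I) = ennreal ((\<Sum>j\<in>J. (1 / t j) ^ DIM('a)) * I)"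
      unfolding sum_distrib_right using J(2) I0
      by (subst sum_ennreal[symmetric]) (auto intro!: sum.cong simp: ennreal_mult' less_imp_le)
    then show ?thesis
      using I0 J(2) by (simp add: ennreal_mult'[symmetric] sum_nonneg less_imp_le mult.assoc)
  qed
  finally show ?thesis unfolding I_def[symmetric]
    using I0 J(2) by (subst (asm) ennreal_le_iff) (auto intro!: mult_nonneg_nonneg sum_nonneg simp: less_imp_le)
qed


section \<open>Slices and cones\<close>

text \<open>Fubini in the direction \<open>n\<close> without adapted coordinates. The inner integral
  averages over a slab with the weight \<open>w\<close>; after two translations the outer variable
  occurs in \<open>w\<close> alone, whose integral is 1.\<close>

lemma nn_integral_hyperplane_slices:
  fixes n :: "'a::euclidean_space"
  assumes n: "norm n = 1" and [measurable]: "h \<in> borel_measurable borel"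
  shows "(\<integral>\<^sup>+x. h x \<partial>lborel) = (\<integral>\<^sup>+s. (\<integral>\<^sup>+y. h (y + s *\<^sub>R n) \<partial>flat_measure {x. n \<bullet> x = b}) \<partial>lborel)"
proof -
  let ?A = "{x. n \<bullet> x = b}"
  let ?\<tau> = "\<lambda>x. n \<bullet> x - b"
  have n0: "n \<noteq> 0" using n by auto
  have nn: "n \<bullet> n = 1" using n by (simp add: norm_eq_1)
  have hull: "affine hull ?A = ?A" by (simp add: affine_hyperplane hull_same)
  have ne: "?A \<noteq> {}" using n0 hyperplane_eq_empty by blast
  have tf: "tube_factor ?A = 1 / 2"
    using n0 by (simp add: tube_factor_def aff_dim_hyperplane unit_ball_vol_1)
  have tb: "tube ?A = {x. \<bar>?\<tau> x\<bar> \<le> 1}"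
    using mem_tube_iff[of ?A] ne n by (auto simp: closest_point_hyperplane closed_hyperplane)
  define w :: "real \<Rightarrow> ennreal" where "w r = ennreal (1/2) * indicator {r. \<bar>r\<bar> \<le> 1} r" for r
  have [measurable]: "w \<in> borel_measurable borel" unfolding w_def by measurable
  have m1: "{r::real. \<bar>r\<bar> \<le> 1} = {-1..1}" by auto
  have w1: "(\<integral>\<^sup>+s. w (c + (-1) * s) \<partial>lborel) = 1" for c
  proof -
    have "(\<integral>\<^sup>+s. w (c + (-1) * s) \<partial>lborel) = (\<integral>\<^sup>+s. w s \<partial>lborel)"
      using nn_integral_real_affine[of w "-1" c] by simp
    also have "\<dots> = ennreal (1/2) * emeasure lborel {-1..1::real}"
      unfolding w_def
      by (subst nn_integral_cmult_indicator) (auto simp: m1)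
    also have "\<dots> = ennreal (1/2) * ennreal 2" by (simp add: m1 ennreal_numeral)
    also have "\<dots> = 1" by (subst ennreal_mult[symmetric]) auto
    finally show ?thesis .
  qed
  have "(\<integral>\<^sup>+s. (\<integral>\<^sup>+y. h (y + s *\<^sub>R n) \<partial>flat_measure ?A) \<partial>lborel) =
    (\<integral>\<^sup>+s. (\<integral>\<^sup>+x. w (?\<tau> x) * h (x + (s - ?\<tau> x) *\<^sub>R n) \<partial>lborel) \<partial>lborel)"
  proof (rule nn_integral_cong)
    fix s :: real
    have "(\<integral>\<^sup>+y. h (y + s *\<^sub>R n) \<partial>flat_measure ?A) =
      ennreal (1/2) * (\<integral>\<^sup>+x. h (x - ?\<tau> x *\<^sub>R n + s *\<^sub>R n) * indicator {x. \<bar>?\<tau> x\<bar> \<le> 1} x \<partial>lborel)"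
      by (subst nn_integral_flat_measure[OF ne]) (auto simp: hull tf tb closest_point_hyperplane[OF n])
    also have "\<dots> = (\<integral>\<^sup>+x. w (?\<tau> x) * h (x + (s - ?\<tau> x) *\<^sub>R n) \<partial>lborel)"
      by (subst nn_integral_cmult[symmetric])
        (auto simp: w_def algebra_simps indicator_def intro!: nn_integral_cong)
    finally show "(\<integral>\<^sup>+y. h (y + s *\<^sub>R n) \<partial>flat_measure ?A) =
       (\<integral>\<^sup>+x. w (?\<tau> x) * h (x + (s - ?\<tau> x) *\<^sub>R n) \<partial>lborel)" .
  qed
  also have "\<dots> = (\<integral>\<^sup>+x. (\<integral>\<^sup>+s. w (?\<tau> x) * h (x + (s - ?\<tau> x) *\<^sub>R n) \<partial>lborel) \<partial>lborel)"
    by (rule lborel_pair.Fubini') measurable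
  also have "\<dots> = (\<integral>\<^sup>+x. (\<integral>\<^sup>+s. w (?\<tau> x) * h (x + s *\<^sub>R n) \<partial>lborel) \<partial>lborel)"
  proof (rule nn_integral_cong)
    fix x
    show "(\<integral>\<^sup>+s. w (?\<tau> x) * h (x + (s - ?\<tau> x) *\<^sub>R n) \<partial>lborel) = (\<integral>\<^sup>+s. w (?\<tau> x) * h (x + s *\<^sub>R n) \<partial>lborel)"
      using nn_integral_lborel_translate[of "\<lambda>s. w (?\<tau> x) * h (x + s *\<^sub>R n)" "- ?\<tau> x"] by (simp add: algebra_simps)
  qed
  also have "\<dots> = (\<integral>\<^sup>+s. (\<integral>\<^sup>+x. w (?\<tau> x) * h (x + s *\<^sub>R n) \<partial>lborel) \<partial>lborel)"
    by (rule lborel_pair.Fubini') measurable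
  also have "\<dots> = (\<integral>\<^sup>+s. (\<integral>\<^sup>+x. w (?\<tau> x - s) * h x \<partial>lborel) \<partial>lborel)"
  proof (rule nn_integral_cong)
    fix s
    show "(\<integral>\<^sup>+x. w (?\<tau> x) * h (x + s *\<^sub>R n) \<partial>lborel) = (\<integral>\<^sup>+x. w (?\<tau> x - s) * h x \<partial>lborel)"
      using nn_integral_lborel_translate[of "\<lambda>x. w (?\<tau> x - s) * h x" "s *\<^sub>R n"]
      by (simp add: inner_simps nn algebra_simps)
  qed
  also have "\<dots> = (\<integral>\<^sup>+x. (\<integral>\<^sup>+s. w (?\<tau> x - s) * h x \<partial>lborel) \<partial>lborel)"
    by (rule lborel_pair.Fubini') measurable
  also have "\<dots> = (\<integral>\<^sup>+x. h x \<partial>lborel)"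
    using w1 by (intro nn_integral_cong, subst nn_integral_multc) auto
  finally show ?thesis by simp
qed


section \<open>Dilation normal to a hyperplane and the measure of a facet\<close>

lemma ennreal_mult_assoc: "0 \<le> a \<Longrightarrow> ennreal a * (ennreal b * X) = ennreal (a * b) * X"
  by (simp add: ennreal_mult' mult.assoc)

lemma nn_integral_flat_measure_cong:
  fixes S :: "'a::euclidean_space set"
  assumes "S \<noteq> {}" "f \<in> borel_measurable borel" "g \<in> borel_measurable borel"
    and "\<And>y. y \<in> affine hull S \<Longrightarrow> f y = g y"
  shows "(\<integral>\<^sup>+y. f y \<partial>flat_measure S) = (\<integral>\<^sup>+y. g y \<partial>flat_measure S)"
proof -
  have "closest_point (affine hull S) x \<in> affine hull S" for x
    using assms(1) by (intro closest_point_in_set) (auto intro: affine_closed)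
  then show ?thesis
    using assms by (simp add: nn_integral_flat_measure)
qed

text \<open>The argument of \<open>h\<close> is the dilation by \<rho> in the direction
  \<open>n\<close> that fixes the hyperplane. On slices it is a scaling of the one-dimensional
  variable.\<close>

lemma nn_integral_hyperplane_stretch:
  fixes n :: "'a::euclidean_space"
  assumes n: "norm n = 1" and "0 < \<rho>" and [measurable]: "h \<in> borel_measurable borel"
  shows "(\<integral>\<^sup>+x. h (x + ((\<rho> - 1) * (n \<bullet> x - b)) *\<^sub>R n) \<partial>lborel) = ennreal (1 / \<rho>) * (\<integral>\<^sup>+x. h x \<partial>lborel)"
proof -
  let ?A = "{x. n \<bullet> x = b}"
  have n0: "n \<noteq> 0" using n by auto
  have nn: "n \<bullet> n = 1" using n by (simp add: norm_eq_1)
  have ne: "?A \<noteq> {}" using n0 hyperplane_eq_empty by blast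
  have hull: "affine hull ?A = ?A" by (simp add: affine_hyperplane hull_same)
  interpret pair_sigma_finite lborel "flat_measure ?A"
    unfolding pair_sigma_finite_def using sigma_finite_flat_measure[OF ne] sigma_finite_lborel by auto
  define F where "F s = (\<integral>\<^sup>+y. h (y + s *\<^sub>R n) \<partial>flat_measure ?A)" for s
  have [measurable]: "F \<in> borel_measurable borel" unfolding F_def by measurable
  have "(\<integral>\<^sup>+x. h (x + ((\<rho> - 1) * (n \<bullet> x - b)) *\<^sub>R n) \<partial>lborel) =
     (\<integral>\<^sup>+s. (\<integral>\<^sup>+y. h (y + s *\<^sub>R n + ((\<rho> - 1) * (n \<bullet> (y + s *\<^sub>R n) - b)) *\<^sub>R n) \<partial>flat_measure ?A) \<partial>lborel)"
    by (rule nn_integral_hyperplane_slices[OF n, of "\<lambda>x. h (x + ((\<rho> - 1) * (n \<bullet> x - b)) *\<^sub>R n)" b]) measurable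
  also have "\<dots> = (\<integral>\<^sup>+s. F (0 + \<rho> * s) \<partial>lborel)"
    unfolding F_def
  proof (rule nn_integral_cong, rule nn_integral_flat_measure_cong[OF ne])
    fix s y assume "y \<in> affine hull ?A"
    then show "h (y + s *\<^sub>R n + ((\<rho> - 1) * (n \<bullet> (y + s *\<^sub>R n) - b)) *\<^sub>R n) = h (y + (0 + \<rho> * s) *\<^sub>R n)"
      unfolding hull by (simp add: inner_simps nn algebra_simps)
  qed measurable
  also have "\<dots> = ennreal (1 / \<rho>) * (\<integral>\<^sup>+s. F s \<partial>lborel)"
    using \<open>0 < \<rho>\<close> nn_integral_real_affine[of F \<rho> 0]
    by (simp add: ennreal_mult_assoc)
  also have "(\<integral>\<^sup>+s. F s \<partial>lborel) = (\<integral>\<^sup>+x. h x \<partial>lborel)"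
    unfolding F_def by (rule nn_integral_hyperplane_slices[OF n, symmetric]) measurable
  finally show ?thesis .
qed

text \<open>
  The half-sum of \<open>p\<close> and the segment of length \<open>2 \<rho>\<close> normal to \<open>p\<close> lies in \<open>E\<close>, which gives
  the bound on the measure of \<open>p\<close>.
\<close>
lemma emeasure_flat_measure_facet_le:
  fixes E p :: "'a::euclidean_space set"
  assumes E: "closed E" "convex E" and p: "closed p" "p \<subseteq> E" "p \<noteq> {}"
    and n: "norm n = 1" and hull: "affine hull p = affine hull E \<inter> {x. n \<bullet> x = b}"
    and \<rho>: "0 < \<rho>" and seg: "\<And>\<tau>. \<bar>\<tau>\<bar> \<le> \<rho> \<Longrightarrow> a + \<tau> *\<^sub>R n \<in> E"
  shows "emeasure (flat_measure p) p \<le>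
    ennreal (2 ^ DIM('a) * tube_factor p / tube_factor E / \<rho>) * emeasure (flat_measure E) E"
proof -
  let ?A = "affine hull E" and ?B = "affine hull p"
  let ?P = "closest_point ?A" and ?Q = "closest_point ?B"
  have ne: "E \<noteq> {}" using p by auto
  have A: "affine ?A" "closed ?A" "?A \<noteq> {}" and B: "affine ?B" "closed ?B" "?B \<noteq> {}"
    using ne p by (auto intro: affine_closed)
  have [measurable]: "?P \<in> borel_measurable borel" "?Q \<in> borel_measurable borel"
     "tube ?A \<in> sets borel" "tube ?B \<in> sets borel" "E \<in> sets borel" "p \<in> sets borel"
    using A B E p by (auto intro!: borel_measurable_closest_point borel_closed closed_tube)
  have nn: "n \<bullet> n = 1" using n by (simp add: norm_eq_1)
  define h :: "'a \<Rightarrow> ennreal" where "h z = indicator E (?P z) * indicator (tube ?A) z" for z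
  have [measurable]: "h \<in> borel_measurable borel" unfolding h_def by measurable
  define h2 where "h2 z = h ((1/2) *\<^sub>R a + (1/2) *\<^sub>R z)" for z
  have [measurable]: "h2 \<in> borel_measurable borel" unfolding h2_def by measurable
  \<comment> \<open>The tube over \<open>p\<close> has one transversal direction more than the tube
    over \<open>E\<close>, namely \<open>n\<close>. Stretching it by \<rho> and taking the midpoint
    with \<open>a\<close> makes it a direction within \<open>E\<close>; the remaining transversal
    part \<open>w\<close> is only halved.\<close>
  have le: "indicator p (?Q x) * indicator (tube ?B) x \<le> h2 (x + ((\<rho> - 1) * (n \<bullet> x - b)) *\<^sub>R n)" for x
  proof (cases "?Q x \<in> p \<and> x \<in> tube ?B")
    case True
    define \<tau> where "\<tau> = n \<bullet> x - b"
    define y where "y = ?Q x"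
    define w where "w = x - y - \<tau> *\<^sub>R n"
    have yp: "y \<in> p" using True by (simp add: y_def)
    have yB: "y \<in> ?B" using yp by (simp add: hull_inc)
    then have yA: "y \<in> ?A" "n \<bullet> y = b" by (auto simp: hull)
    have nw: "n \<bullet> w = 0" by (simp add: w_def \<tau>_def inner_simps nn yA)
    have xw: "x - y = \<tau> *\<^sub>R n + w" by (simp add: w_def)
    have "(norm (x - y))\<^sup>2 = \<tau>\<^sup>2 + (norm w)\<^sup>2"
      unfolding xw using nw n by (subst norm_add_Pythagorean) (auto simp: orthogonal_def power_mult_distrib)
    moreover have "norm (x - y) \<le> 1" using True B by (auto simp: mem_tube_iff y_def)
    then have "(norm (x - y))\<^sup>2 \<le> 1" by (simp add: power_le_one)
    ultimately have "\<tau>\<^sup>2 \<le> 1" "(norm w)\<^sup>2 \<le> 1"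
      using zero_le_power2[of \<tau>] zero_le_power2[of "norm w"] by linarith+
    then have \<tau>1: "\<bar>\<tau>\<bar> \<le> 1" and w1: "norm w \<le> 1"
      by (auto simp: abs_le_square_iff[of _ 1, simplified] power2_le_imp_le[of "norm w" 1, simplified])
    have dirn: "a + s *\<^sub>R n \<in> ?A" for s
    proof -
      have "a \<in> ?A" "a + \<rho> *\<^sub>R n \<in> ?A" using seg[of 0] seg[of \<rho>] \<rho> by (auto simp: hull_inc)
      then have "(1 - s/\<rho>) *\<^sub>R a + (s/\<rho>) *\<^sub>R (a + \<rho> *\<^sub>R n) \<in> ?A"
        using A(1) by (simp add: mem_affine)
      also have "(1 - s/\<rho>) *\<^sub>R a + (s/\<rho>) *\<^sub>R (a + \<rho> *\<^sub>R n) = a + s *\<^sub>R n"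
        using \<rho> by (simp add: algebra_simps)
      finally show ?thesis .
    qed
    have wA: "w \<bullet> (z - z') = 0" if z: "z \<in> ?A" "z' \<in> ?A" for z z'
    proof -
      \<comment> \<open>Removing the component along \<open>n\<close> from z - z' leaves a direction
        of the affine hull of \<open>p\<close>, to which x - y is orthogonal.\<close>
      define c where "c = n \<bullet> (z - z')"
      have "1 *\<^sub>R y + 1 *\<^sub>R z + (-1) *\<^sub>R z' \<in> ?A"
        using mem_affine_3[OF A(1) yA(1) z, of 1 1 "-1"] by simp
      then have "1 *\<^sub>R (y + z - z') + 1 *\<^sub>R (a + (-c) *\<^sub>R n) + (-1) *\<^sub>R (a + 0 *\<^sub>R n) \<in> ?A"
        by (intro mem_affine_3[OF A(1) _ dirn dirn]) auto
      then have q: "y + z - z' - c *\<^sub>R n \<in> ?B"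
        by (simp add: hull inner_simps nn c_def yA algebra_simps)
      have "(x - y) \<bullet> ((y + z - z' - c *\<^sub>R n) - y) = 0"
        unfolding y_def by (rule closest_point_affine_orthogonal[OF B(1,3)]) (use q yB in \<open>auto simp: y_def\<close>)
      then have "\<tau> * (n \<bullet> (z - z') - c) + w \<bullet> (z - z') = 0"
        unfolding xw using nw by (simp add: inner_simps nn algebra_simps inner_commute)
      then show ?thesis by (simp add: c_def)
    qed
    define q where "q = (1/2) *\<^sub>R y + (1/2) *\<^sub>R (a + (\<rho> * \<tau>) *\<^sub>R n)"
    have qE: "q \<in> E"
      unfolding q_def
    proof (rule convexD[OF E(2)])
      show "y \<in> E" using yp p by auto
      have "\<rho> * \<bar>\<tau>\<bar> \<le> \<rho> * 1" using \<tau>1 \<rho> by (intro mult_left_mono) auto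
      then show "a + (\<rho> * \<tau>) *\<^sub>R n \<in> E" by (intro seg) (use \<rho> in \<open>simp add: abs_mult\<close>)
    qed auto
    have z: "(1/2) *\<^sub>R a + (1/2) *\<^sub>R (x + ((\<rho> - 1) * (n \<bullet> x - b)) *\<^sub>R n) = q + (1/2) *\<^sub>R w"
      unfolding q_def w_def \<tau>_def[symmetric] by (simp add: algebra_simps scaleR_add_left[symmetric])
    have "?P (q + (1/2) *\<^sub>R w) = q"
    proof (rule closest_point_affine_eqI[OF A(1)])
      show qA: "q \<in> ?A" using qE by (simp add: hull_inc)
      fix z assume "z \<in> ?A"
      then show "(q + (1/2) *\<^sub>R w - q) \<bullet> (z - q) = 0" using wA qA by simp
    qed
    then have "h2 (x + ((\<rho> - 1) * (n \<bullet> x - b)) *\<^sub>R n) = 1"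
      unfolding h2_def z h_def using qE A w1 by (simp add: mem_tube_iff)
    then show ?thesis using True by (simp add: indicator_def)
  qed (auto simp: indicator_def)
  have "emeasure (flat_measure p) p = (\<integral>\<^sup>+x. indicator p x \<partial>flat_measure p)" by simp
  also have "\<dots> = ennreal (tube_factor p) * (\<integral>\<^sup>+x. indicator p (?Q x) * indicator (tube ?B) x \<partial>lborel)"
    by (rule nn_integral_flat_measure[OF p(3)]) measurable
  also have "\<dots> \<le> ennreal (tube_factor p) * (\<integral>\<^sup>+x. h2 (x + ((\<rho> - 1) * (n \<bullet> x - b)) *\<^sub>R n) \<partial>lborel)"
    by (intro mult_left_mono nn_integral_mono le) auto
  also have "(\<integral>\<^sup>+x. h2 (x + ((\<rho> - 1) * (n \<bullet> x - b)) *\<^sub>R n) \<partial>lborel) = ennreal (1 / \<rho>) * (\<integral>\<^sup>+x. h2 x \<partial>lborel)"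
    by (rule nn_integral_hyperplane_stretch[OF n \<rho>]) measurable
  also have "(\<integral>\<^sup>+x. h2 x \<partial>lborel) = ennreal (2 ^ DIM('a)) * (\<integral>\<^sup>+x. h x \<partial>lborel)"
    unfolding h2_def
    by (subst nn_integral_lborel_affine[of h "1/2" "(1/2) *\<^sub>R a"])
      (auto simp: ennreal_mult_assoc power_mult_distrib[symmetric])
  also have "(\<integral>\<^sup>+x. h x \<partial>lborel) = ennreal (1 / tube_factor E) * emeasure (flat_measure E) E"
  proof -
    have "emeasure (flat_measure E) E = (\<integral>\<^sup>+x. indicator E x \<partial>flat_measure E)" by simp
    also have "\<dots> = ennreal (tube_factor E) * (\<integral>\<^sup>+x. h x \<partial>lborel)"
      unfolding h_def by (rule nn_integral_flat_measure[OF ne]) measurable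
    finally show ?thesis
      using tube_factor_pos[of E] by (simp add: ennreal_mult_assoc)
  qed
  also have "ennreal (tube_factor p) * (ennreal (1 / \<rho>) * (ennreal (2 ^ DIM('a)) *
       (ennreal (1 / tube_factor E) * emeasure (flat_measure E) E))) =
     ennreal (2 ^ DIM('a) * tube_factor p / tube_factor E / \<rho>) * emeasure (flat_measure E) E"
  proof -
    have 1: "0 \<le> tube_factor p" using tube_factor_pos[of p] by simp
    then have 2: "0 \<le> tube_factor p * (1 / \<rho>)" using \<rho> by simp
    then have 3: "0 \<le> tube_factor p * (1 / \<rho>) * 2 ^ DIM('a)" by (rule mult_nonneg_nonneg) simp
    show ?thesis
      unfolding ennreal_mult_assoc[OF 1] ennreal_mult_assoc[OF 2] ennreal_mult_assoc[OF 3]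
      by (simp add: mult.commute)
  qed
  finally show ?thesis .
qed

text \<open>Here the scaling is exact and has the exponent of the hyperplane. The integral over the
  slab of half-width \<theta> is computed twice: by slices, which gives 2 \<theta> times the surface
  integral, and as an ambient homothety of the slab of half-width 1.\<close>

lemma nn_integral_hyperplane_homothety:
  fixes n :: "'a::euclidean_space"
  assumes n: "norm n = 1" and a: "n \<bullet> a = b" and \<theta>: "0 < \<theta>" and [measurable]: "g \<in> borel_measurable borel"
  shows "(\<integral>\<^sup>+y. g y \<partial>flat_measure {x. n \<bullet> x = b}) =
    ennreal (\<theta> ^ (DIM('a) - 1)) * (\<integral>\<^sup>+y. g (a + \<theta> *\<^sub>R (y - a)) \<partial>flat_measure {x. n \<bullet> x = b})"
proof -
  let ?A = "{x. n \<bullet> x = b}"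
  let ?\<tau> = "\<lambda>x. n \<bullet> x - b"
  let ?P = "\<lambda>x. x - ?\<tau> x *\<^sub>R n"
  have n0: "n \<noteq> 0" using n by auto
  have nn: "n \<bullet> n = 1" using n by (simp add: norm_eq_1)
  have ne: "?A \<noteq> {}" using n0 hyperplane_eq_empty by blast
  have hull: "affine hull ?A = ?A" by (simp add: affine_hyperplane hull_same)
  have tf: "tube_factor ?A = 1 / 2"
    using n0 by (simp add: tube_factor_def aff_dim_hyperplane unit_ball_vol_1)
  have tb: "tube ?A = {x. \<bar>?\<tau> x\<bar> \<le> 1}"
    using mem_tube_iff[of ?A] ne n by (auto simp: closest_point_hyperplane closed_hyperplane)
  define I where "I = (\<integral>\<^sup>+y. g y \<partial>flat_measure ?A)"
  define h where "h z = indicator {z. \<bar>?\<tau> z\<bar> \<le> \<theta>} z * g (?P z)" for z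
  have [measurable]: "h \<in> borel_measurable borel" unfolding h_def by measurable
  have "(\<integral>\<^sup>+x. h x \<partial>lborel) = (\<integral>\<^sup>+s. (\<integral>\<^sup>+y. h (y + s *\<^sub>R n) \<partial>flat_measure ?A) \<partial>lborel)"
    by (rule nn_integral_hyperplane_slices[OF n]) measurable
  also have "\<dots> = (\<integral>\<^sup>+s. indicator {-\<theta>..\<theta>} s * I \<partial>lborel)"
  proof (rule nn_integral_cong)
    fix s
    have "(\<integral>\<^sup>+y. h (y + s *\<^sub>R n) \<partial>flat_measure ?A) = (\<integral>\<^sup>+y. indicator {-\<theta>..\<theta>} s * g y \<partial>flat_measure ?A)"
    proof (rule nn_integral_flat_measure_cong[OF ne])
      fix y assume "y \<in> affine hull ?A"
      then show "h (y + s *\<^sub>R n) = indicator {- \<theta>..\<theta>} s * g y"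
        unfolding hull h_def by (auto simp: inner_simps nn indicator_def)
    qed measurable
    then show "(\<integral>\<^sup>+y. h (y + s *\<^sub>R n) \<partial>flat_measure ?A) = indicator {-\<theta>..\<theta>} s * I"
      by (simp add: nn_integral_cmult I_def)
  qed
  also have "\<dots> = ennreal (2 * \<theta>) * I" using \<theta> by (simp add: nn_integral_multc)
  finally have h: "(\<integral>\<^sup>+x. h x \<partial>lborel) = ennreal (2 * \<theta>) * I" .
  have "(\<integral>\<^sup>+y. g (a + \<theta> *\<^sub>R (y - a)) \<partial>flat_measure ?A) =
     ennreal (1/2) * (\<integral>\<^sup>+x. g (a + \<theta> *\<^sub>R (?P x - a)) * indicator {x. \<bar>?\<tau> x\<bar> \<le> 1} x \<partial>lborel)"
    by (subst nn_integral_flat_measure[OF ne]) (auto simp: hull tf tb closest_point_hyperplane[OF n])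
  also have "(\<integral>\<^sup>+x. g (a + \<theta> *\<^sub>R (?P x - a)) * indicator {x. \<bar>?\<tau> x\<bar> \<le> 1} x \<partial>lborel) =
     (\<integral>\<^sup>+x. h ((1 - \<theta>) *\<^sub>R a + \<theta> *\<^sub>R x) \<partial>lborel)"
  proof (rule nn_integral_cong)
    fix x
    have \<tau>: "?\<tau> ((1 - \<theta>) *\<^sub>R a + \<theta> *\<^sub>R x) = \<theta> * ?\<tau> x" by (simp add: inner_simps a algebra_simps)
    have "?P ((1 - \<theta>) *\<^sub>R a + \<theta> *\<^sub>R x) = a + \<theta> *\<^sub>R (?P x - a)" unfolding \<tau> by (simp add: algebra_simps)
    then show "g (a + \<theta> *\<^sub>R (?P x - a)) * indicator {x. \<bar>?\<tau> x\<bar> \<le> 1} x = h ((1 - \<theta>) *\<^sub>R a + \<theta> *\<^sub>R x)"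
      unfolding h_def using \<tau> \<theta> by (simp add: indicator_def abs_mult)
  qed
  finally have e: "(\<integral>\<^sup>+y. g (a + \<theta> *\<^sub>R (y - a)) \<partial>flat_measure ?A) =
    ennreal (1/2) * (\<integral>\<^sup>+x. h ((1 - \<theta>) *\<^sub>R a + \<theta> *\<^sub>R x) \<partial>lborel)" .
  have "ennreal (\<theta> ^ (DIM('a) - 1)) * (\<integral>\<^sup>+y. g (a + \<theta> *\<^sub>R (y - a)) \<partial>flat_measure ?A) =
     ennreal (1 / (2 * \<theta>)) * (ennreal (\<theta> ^ DIM('a)) * (\<integral>\<^sup>+x. h ((1 - \<theta>) *\<^sub>R a + \<theta> *\<^sub>R x) \<partial>lborel))"
  proof -
    have "\<theta> ^ DIM('a) = \<theta> * \<theta> ^ (DIM('a) - 1)"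
      using DIM_positive[where 'a='a] by (simp add: power_eq_if)
    then have "\<theta> ^ (DIM('a) - 1) * (1 / 2) = 1 / (2 * \<theta>) * \<theta> ^ DIM('a)" using \<theta> by simp
    then show ?thesis using \<theta> unfolding e by (subst (1 2) ennreal_mult_assoc) (auto simp: mult.commute)
  qed
  also have "\<dots> = ennreal (1 / (2 * \<theta>)) * (ennreal (2 * \<theta>) * I)"
    using nn_integral_lborel_affine[of h \<theta> "(1 - \<theta>) *\<^sub>R a"] \<theta> by (simp add: h)
  also have "\<dots> = I" using \<theta> by (simp add: ennreal_mult_assoc)
  finally show ?thesis unfolding I_def by simp
qed


text \<open>The slice parallel to the base at distance d \<theta> from the apex is the base scaled
  by \<theta>, which contributes \<open>\<theta> ^ (DIM('a) - 1)\<close>; the factor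
  \<open>d\<close> comes from the substitution s = - d + d \<theta>.\<close>

lemma nn_integral_cone:
  fixes n :: "'a::euclidean_space"
  assumes n: "norm n = 1" and a: "n \<bullet> a = b - d" and d: "0 < d"
    and e: "compact e" "e \<subseteq> {x. n \<bullet> x = b}" and K: "K = (\<lambda>(\<theta>, y). a + \<theta> *\<^sub>R (y - a)) ` ({0..1} \<times> e)"
    and h [measurable]: "h \<in> borel_measurable borel"
  shows "(\<integral>\<^sup>+x. h x * indicator K x \<partial>lborel) = (\<integral>\<^sup>+\<theta>. indicator {0..1} \<theta> * ennreal (d * \<theta> ^ (DIM('a) - 1)) *
     (\<integral>\<^sup>+y. h (a + \<theta> *\<^sub>R (y - a)) * indicator e y \<partial>flat_measure {x. n \<bullet> x = b}) \<partial>lborel)"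
proof -
  let ?A = "{x. n \<bullet> x = b}"
  have n0: "n \<noteq> 0" using n by auto
  have nn: "n \<bullet> n = 1" using n by (simp add: norm_eq_1)
  have ne: "?A \<noteq> {}" using n0 hyperplane_eq_empty by blast
  have hull: "affine hull ?A = ?A" by (simp add: affine_hyperplane hull_same)
  interpret pair_sigma_finite lborel "flat_measure ?A"
    unfolding pair_sigma_finite_def using sigma_finite_flat_measure[OF ne] sigma_finite_lborel by auto
  have "compact K"
    unfolding K case_prod_beta
    by (intro compact_continuous_image continuous_intros compact_Times e compact_Icc)
  then have [measurable]: "K \<in> sets borel" "e \<in> sets borel" using e by (auto simp: borel_compact)
  have memK: "a + \<theta> *\<^sub>R (y - a) \<in> K \<longleftrightarrow> y \<in> e" if "y \<in> ?A" "0 < \<theta>" "\<theta> \<le> 1" for \<theta> y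
  proof
    assume "a + \<theta> *\<^sub>R (y - a) \<in> K"
    then obtain \<theta>' y' where e': "a + \<theta> *\<^sub>R (y - a) = a + \<theta>' *\<^sub>R (y' - a)" "y' \<in> e"
      unfolding K by auto
    then have "n \<bullet> (\<theta> *\<^sub>R (y - a)) = n \<bullet> (\<theta>' *\<^sub>R (y' - a))" by simp
    then have "\<theta> * d = \<theta>' * d" using that e' e a by (auto simp: inner_simps)
    then have "\<theta> = \<theta>'" using d by simp
    then have "y = y'" using e' that by simp
    then show "y \<in> e" using e' by simp
  qed (use that in \<open>auto simp: K\<close>)
  have outside: "y + (- d + d * \<theta>) *\<^sub>R n \<notin> K" if "y \<in> ?A" "\<theta> \<notin> {0..1}" for y \<theta>
  proof
    assume "y + (- d + d * \<theta>) *\<^sub>R n \<in> K"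
    then obtain \<theta>' y' where e': "y + (- d + d * \<theta>) *\<^sub>R n = a + \<theta>' *\<^sub>R (y' - a)" "y' \<in> e" "0 \<le> \<theta>'" "\<theta>' \<le> 1"
      unfolding K by auto
    then have "n \<bullet> (y + (- d + d * \<theta>) *\<^sub>R n) = n \<bullet> (a + \<theta>' *\<^sub>R (y' - a))" by simp
    then have "d * \<theta> = d * \<theta>'" using that e' e a by (auto simp: inner_simps nn algebra_simps)
    then show False using d e' that by simp
  qed
  define F where "F s = (\<integral>\<^sup>+y. h (y + s *\<^sub>R n) * indicator K (y + s *\<^sub>R n) \<partial>flat_measure ?A)" for s
  have [measurable]: "F \<in> borel_measurable borel" unfolding F_def by measurable
  have "(\<integral>\<^sup>+x. h x * indicator K x \<partial>lborel) = (\<integral>\<^sup>+s. F s \<partial>lborel)"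
    unfolding F_def by (rule nn_integral_hyperplane_slices[OF n]) measurable
  also have "\<dots> = ennreal d * (\<integral>\<^sup>+\<theta>. F (-d + d * \<theta>) \<partial>lborel)"
    using nn_integral_real_affine[of F d "-d"] d by simp
  also have "\<dots> = (\<integral>\<^sup>+\<theta>. ennreal d * F (-d + d * \<theta>) \<partial>lborel)"
    by (rule nn_integral_cmult[symmetric]) measurable
  also have "\<dots> = (\<integral>\<^sup>+\<theta>. indicator {0..1} \<theta> * ennreal (d * \<theta> ^ (DIM('a) - 1)) *
     (\<integral>\<^sup>+y. h (a + \<theta> *\<^sub>R (y - a)) * indicator e y \<partial>flat_measure ?A) \<partial>lborel)"
  proof (rule nn_integral_cong_AE)
    \<comment> \<open>The slice through the apex is degenerate and is left out as a null set of
      parameters.\<close>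
    have "AE \<theta> in lborel. \<theta> \<noteq> (0::real)" by (rule AE_lborel_singleton)
    then show "AE \<theta> in lborel. ennreal d * F (-d + d * \<theta>) = indicator {0..1} \<theta> * ennreal (d * \<theta> ^ (DIM('a) - 1)) *
     (\<integral>\<^sup>+y. h (a + \<theta> *\<^sub>R (y - a)) * indicator e y \<partial>flat_measure ?A)"
    proof (eventually_elim)
      fix \<theta> :: real assume \<theta>0: "\<theta> \<noteq> 0"
      show "ennreal d * F (-d + d * \<theta>) = indicator {0..1} \<theta> * ennreal (d * \<theta> ^ (DIM('a) - 1)) *
         (\<integral>\<^sup>+y. h (a + \<theta> *\<^sub>R (y - a)) * indicator e y \<partial>flat_measure ?A)"
      proof (cases "\<theta> \<in> {0..1}")
        case False
        have "F (-d + d * \<theta>) = (\<integral>\<^sup>+y. 0 \<partial>flat_measure ?A)"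
          unfolding F_def
          by (rule nn_integral_flat_measure_cong[OF ne]) (use outside[OF _ False] in \<open>auto simp: hull\<close>)
        then show ?thesis using False by simp
      next
        case True
        then have \<theta>: "0 < \<theta>" "\<theta> \<le> 1" using \<theta>0 by auto
        have a0: "n \<bullet> (a + d *\<^sub>R n) = b" by (simp add: inner_simps nn a)
        have "F (-d + d * \<theta>) = ennreal (\<theta> ^ (DIM('a) - 1)) * (\<integral>\<^sup>+y.
            h ((a + d *\<^sub>R n) + \<theta> *\<^sub>R (y - (a + d *\<^sub>R n)) + (-d + d * \<theta>) *\<^sub>R n) *
            indicator K ((a + d *\<^sub>R n) + \<theta> *\<^sub>R (y - (a + d *\<^sub>R n)) + (-d + d * \<theta>) *\<^sub>R n) \<partial>flat_measure ?A)"
          unfolding F_def by (rule nn_integral_hyperplane_homothety[OF n a0 \<theta>(1)]) measurable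
        also have "(\<integral>\<^sup>+y.
            h ((a + d *\<^sub>R n) + \<theta> *\<^sub>R (y - (a + d *\<^sub>R n)) + (-d + d * \<theta>) *\<^sub>R n) *
            indicator K ((a + d *\<^sub>R n) + \<theta> *\<^sub>R (y - (a + d *\<^sub>R n)) + (-d + d * \<theta>) *\<^sub>R n) \<partial>flat_measure ?A)
          = (\<integral>\<^sup>+y. h (a + \<theta> *\<^sub>R (y - a)) * indicator e y \<partial>flat_measure ?A)"
        proof (rule nn_integral_flat_measure_cong[OF ne])
          fix y assume y: "y \<in> affine hull ?A"
          have "(a + d *\<^sub>R n) + \<theta> *\<^sub>R (y - (a + d *\<^sub>R n)) + (-d + d * \<theta>) *\<^sub>R n = a + \<theta> *\<^sub>R (y - a)"
            by (simp add: algebra_simps)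
          then show "h ((a + d *\<^sub>R n) + \<theta> *\<^sub>R (y - (a + d *\<^sub>R n)) + (-d + d * \<theta>) *\<^sub>R n) *
            indicator K ((a + d *\<^sub>R n) + \<theta> *\<^sub>R (y - (a + d *\<^sub>R n)) + (-d + d * \<theta>) *\<^sub>R n)
            = h (a + \<theta> *\<^sub>R (y - a)) * indicator e y"
            using memK[OF _ \<theta>] y unfolding hull by (auto simp only: indicator_def mem_Collect_eq)
        qed measurable
        finally show ?thesis using True d by (simp add: ennreal_mult_assoc)
      qed
    qed
  qed
  finally show ?thesis .
qed

section \<open>Radial fields on a cone\<close>

lemma set_lebesgue_integral_nonneg:
  fixes f :: "'a \<Rightarrow> real"
  shows "(\<And>x. x \<in> A \<Longrightarrow> 0 \<le> f x) \<Longrightarrow> 0 \<le> (LINT x:A|M. f x)"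
  unfolding set_lebesgue_integral_def by (intro integral_nonneg_AE) (auto simp: indicator_def)

text \<open>\<open>g\<close> stands for the radial derivative (x - a) \<bullet> grad f. On the ray
  to y the integrand times the Jacobian is the derivative of
  \<open>d * \<theta> ^ DIM('a) * f (a + \<theta> *\<^sub>R (y - a))\<close>, so the integral over
  \<theta> reduces to the value on the base. Nonnegativity lets the order of integration be
  exchanged.\<close>

lemma nn_integral_cone_radial:
  fixes n :: "'a::euclidean_space" and f g :: "'a \<Rightarrow> real"
  assumes n: "norm n = 1" and a: "n \<bullet> a = b - d" and d: "0 < d"
    and e: "compact e" "e \<subseteq> {x. n \<bullet> x = b}" and K: "K = (\<lambda>(\<theta>, y). a + \<theta> *\<^sub>R (y - a)) ` ({0..1} \<times> e)"
    and f: "continuous_on UNIV f" "continuous_on UNIV g"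
    and der: "\<And>x \<theta>. ((\<lambda>\<theta>. f (a + \<theta> *\<^sub>R x)) has_real_derivative D \<theta> x) (at \<theta>)"
    and D: "\<And>x \<theta>. \<theta> * D \<theta> x = g (a + \<theta> *\<^sub>R x)"
    and nonneg: "\<And>x. x \<in> K \<Longrightarrow> 0 \<le> DIM('a) * f x + g x"
  shows "(\<integral>\<^sup>+x. ennreal (DIM('a) * f x + g x) * indicator K x \<partial>lborel) =
     (\<integral>\<^sup>+y. ennreal (d * f y) * indicator e y \<partial>flat_measure {x. n \<bullet> x = b})"
proof -
  let ?A = "{x. n \<bullet> x = b}"
  let ?N = "DIM('a)"
  let ?G = "\<lambda>x. ?N * f x + g x"
  have n0: "n \<noteq> 0" using n by auto
  have ne: "?A \<noteq> {}" using n0 hyperplane_eq_empty by blast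
  interpret pair_sigma_finite lborel "flat_measure ?A"
    unfolding pair_sigma_finite_def using sigma_finite_flat_measure[OF ne] sigma_finite_lborel by auto
  have [measurable]: "e \<in> sets borel" using e by (auto simp: borel_compact)
  have [measurable]: "f \<in> borel_measurable borel" "g \<in> borel_measurable borel"
    using f by (auto intro: borel_measurable_continuous_onI)
  have "(\<integral>\<^sup>+x. ennreal (?G x) * indicator K x \<partial>lborel) = (\<integral>\<^sup>+\<theta>. indicator {0..1} \<theta> * ennreal (d * \<theta> ^ (?N - 1)) *
     (\<integral>\<^sup>+y. ennreal (?G (a + \<theta> *\<^sub>R (y - a))) * indicator e y \<partial>flat_measure ?A) \<partial>lborel)"
    by (rule nn_integral_cone[OF n a d e K]) measurable
  also have "\<dots> = (\<integral>\<^sup>+\<theta>. (\<integral>\<^sup>+y. indicator {0..1} \<theta> * ennreal (d * \<theta> ^ (?N - 1)) *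
     (ennreal (?G (a + \<theta> *\<^sub>R (y - a))) * indicator e y) \<partial>flat_measure ?A) \<partial>lborel)"
    by (rule nn_integral_cong, rule nn_integral_cmult[symmetric]) measurable
  also have "\<dots> = (\<integral>\<^sup>+y. (\<integral>\<^sup>+\<theta>. indicator {0..1} \<theta> * ennreal (d * \<theta> ^ (?N - 1)) *
     (ennreal (?G (a + \<theta> *\<^sub>R (y - a))) * indicator e y) \<partial>lborel) \<partial>flat_measure ?A)"
    by (rule Fubini'[symmetric]) measurable
  also have "\<dots> = (\<integral>\<^sup>+y. ennreal (d * f y) * indicator e y \<partial>flat_measure ?A)"
  proof (rule nn_integral_cong)
    fix y
    show "(\<integral>\<^sup>+\<theta>. indicator {0..1} \<theta> * ennreal (d * \<theta> ^ (?N - 1)) *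
     (ennreal (?G (a + \<theta> *\<^sub>R (y - a))) * indicator e y) \<partial>lborel) = ennreal (d * f y) * indicator e y"
    proof (cases "y \<in> e")
      case True
      have K': "a + \<theta> *\<^sub>R (y - a) \<in> K" if "0 \<le> \<theta>" "\<theta> \<le> 1" for \<theta>
        using True that unfolding K by (auto intro!: image_eqI[of _ _ "(\<theta>, y)"])
      have N: "?N = Suc (?N - 1)" using DIM_positive[where 'a='a] by simp
      let ?H = "\<lambda>\<theta>. d * \<theta> ^ (?N - 1) * ?G (a + \<theta> *\<^sub>R (y - a))"
      have "(\<integral>\<^sup>+\<theta>. indicator {0..1} \<theta> * ennreal (d * \<theta> ^ (?N - 1)) *
         (ennreal (?G (a + \<theta> *\<^sub>R (y - a))) * indicator e y) \<partial>lborel) = (\<integral>\<^sup>+\<theta>. ennreal (?H \<theta>) * indicator {0..1} \<theta> \<partial>lborel)"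
        using True d by (intro nn_integral_cong) (auto simp: indicator_def ennreal_mult')
      also have "\<dots> = ennreal (d * 1 ^ ?N * f (a + 1 *\<^sub>R (y - a)) - d * 0 ^ ?N * f (a + 0 *\<^sub>R (y - a)))"
      proof (rule nn_integral_FTC_Icc[where F = "\<lambda>\<theta>. d * \<theta> ^ ?N * f (a + \<theta> *\<^sub>R (y - a))"])
        show "?H \<in> borel_measurable borel" by measurable
        fix \<theta> :: real assume "\<theta> \<in> {0..1}"
        then have \<theta>: "0 \<le> \<theta>" "\<theta> \<le> 1" by auto
        show "0 \<le> ?H \<theta>" using nonneg[OF K'[OF \<theta>]] d \<theta> by simp
        have "((\<lambda>\<theta>. d * \<theta> ^ ?N * f (a + \<theta> *\<^sub>R (y - a))) has_real_derivative
           d * (?N * \<theta> ^ (?N - 1)) * f (a + \<theta> *\<^sub>R (y - a)) + d * \<theta> ^ ?N * D \<theta> (y - a)) (at \<theta>)"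
          by (auto intro!: derivative_eq_intros der)
        also have "d * (?N * \<theta> ^ (?N - 1)) * f (a + \<theta> *\<^sub>R (y - a)) + d * \<theta> ^ ?N * D \<theta> (y - a) = ?H \<theta>"
        proof -
          have "\<theta> ^ ?N = \<theta> ^ (?N - 1) * \<theta>" by (metis N power_Suc2)
          then have "d * \<theta> ^ ?N * D \<theta> (y - a) = d * \<theta> ^ (?N - 1) * (\<theta> * D \<theta> (y - a))" by simp
          then show ?thesis unfolding D by (simp add: algebra_simps)
        qed
        finally show "((\<lambda>\<theta>. d * \<theta> ^ ?N * f (a + \<theta> *\<^sub>R (y - a))) has_real_derivative ?H \<theta>) (at \<theta>)" .
      qed simp
      finally show ?thesis using True by (simp add: zero_power)
    qed simp
  qed
  finally show ?thesis .
qed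

text \<open>The sign condition is removed by a shift: with \<open>c\<close> bounding the data on
  \<open>K\<close>, the nonnegative case is applied to \<open>f + \<bar>c\<bar>\<close> and to the
  constant \<open>\<bar>c\<bar>\<close>, and the two identities are subtracted.\<close>

lemma integral_cone_radial:
  fixes n :: "'a::euclidean_space" and f :: "'a \<Rightarrow> real"
  assumes n: "norm n = 1" and a: "n \<bullet> a = b - d" and d: "0 < d"
    and e: "compact e" "e \<subseteq> {x. n \<bullet> x = b}" and K: "K = (\<lambda>(\<theta>, y). a + \<theta> *\<^sub>R (y - a)) ` ({0..1} \<times> e)"
    and f: "\<And>x. (f has_derivative Df x) (at x)" "continuous_on UNIV (\<lambda>x. Df x (x - a))"
  shows "(LINT x:K|lborel. DIM('a) * f x + Df x (x - a)) = d * (LINT y:e|flat_measure {x. n \<bullet> x = b}. f y)"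
proof -
  let ?A = "{x. n \<bullet> x = b}"
  let ?N = "DIM('a)"
  let ?g = "\<lambda>x. Df x (x - a)"
  let ?G = "\<lambda>x. ?N * f x + ?g x"
  have n0: "n \<noteq> 0" using n by auto
  have ne: "?A \<noteq> {}" using n0 hyperplane_eq_empty by blast
  have fc: "continuous_on UNIV f"
    using f(1) by (meson continuous_at_imp_continuous_on has_derivative_continuous)
  have cK: "compact K"
    unfolding K case_prod_beta
    by (intro compact_continuous_image continuous_intros compact_Times e compact_Icc)
  have eK: "e \<subseteq> K" unfolding K by (auto intro!: image_eqI[of _ _ "(1, _)"])
  have "bounded ((\<lambda>x. \<bar>f x\<bar> + \<bar>?G x\<bar>) ` K)"
    by (intro compact_imp_bounded compact_continuous_image cK continuous_intros)
       (auto intro: continuous_on_subset[OF fc] continuous_on_subset[OF f(2)])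
  then obtain c where c: "\<And>x. x \<in> K \<Longrightarrow> \<bar>f x\<bar> + \<bar>?G x\<bar> \<le> c" by (auto simp: bounded_iff)
  \<comment> \<open>The contribution of the constant \<open>\<bar>c\<bar>\<close> to
    \<open>?N * f + ?g\<close>.\<close>
  define C where "C = ?N * \<bar>c\<bar>"
  have N1: "1 \<le> real ?N" using DIM_positive[where 'a='a] by (simp add: Suc_le_eq)
  have C: "0 \<le> ?G x + C" "0 \<le> f x + \<bar>c\<bar>" if "x \<in> K" for x
  proof -
    have "1 * \<bar>c\<bar> \<le> ?N * \<bar>c\<bar>" using N1 by (intro mult_right_mono) auto
    then show "0 \<le> ?G x + C" "0 \<le> f x + \<bar>c\<bar>" using c[OF that] unfolding C_def by linarith+
  qed
  have der: "((\<lambda>\<theta>. f (a + \<theta> *\<^sub>R x)) has_real_derivative Df (a + \<theta> *\<^sub>R x) x) (at \<theta>)" for x \<theta>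
  proof -
    have "((\<lambda>\<theta>. f (a + \<theta> *\<^sub>R x)) has_derivative (\<lambda>h. Df (a + \<theta> *\<^sub>R x) (h *\<^sub>R x))) (at \<theta>)"
      by (rule has_derivative_compose[of "\<lambda>\<theta>. a + \<theta> *\<^sub>R x" _ _ _ f, OF _ f(1)]) (auto intro!: derivative_eq_intros)
    moreover have "Df (a + \<theta> *\<^sub>R x) (h *\<^sub>R x) = h * Df (a + \<theta> *\<^sub>R x) x" for h
      using has_derivative_linear[OF f(1)] by (simp add: linear_scale)
    ultimately show ?thesis by (simp add: has_field_derivative_def mult_commute_abs)
  qed
  have lin: "\<theta> * Df y x = Df y (\<theta> *\<^sub>R x)" for \<theta> y x
    using has_derivative_linear[OF f(1), of y] by (simp add: linear_scale)
  have 1: "(\<integral>\<^sup>+x. ennreal (?N * (f x + \<bar>c\<bar>) + ?g x) * indicator K x \<partial>lborel) =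
     (\<integral>\<^sup>+y. ennreal (d * (f y + \<bar>c\<bar>)) * indicator e y \<partial>flat_measure ?A)"
  proof (rule nn_integral_cone_radial[OF n a d e K])
    show "continuous_on UNIV (\<lambda>x. f x + \<bar>c\<bar>)" by (intro continuous_intros fc)
    show "continuous_on UNIV ?g" by fact
    show "((\<lambda>\<theta>. f (a + \<theta> *\<^sub>R x) + \<bar>c\<bar>) has_real_derivative Df (a + \<theta> *\<^sub>R x) x) (at \<theta>)" for x \<theta>
      by (auto intro!: derivative_eq_intros der)
    show "\<theta> * Df (a + \<theta> *\<^sub>R x) x = Df (a + \<theta> *\<^sub>R x) (a + \<theta> *\<^sub>R x - a)" for x \<theta> by (simp add: lin)
    show "0 \<le> ?N * (f x + \<bar>c\<bar>) + ?g x" if "x \<in> K" for x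
      using C(1)[OF that] by (simp add: C_def algebra_simps)
  qed
  have 2: "(\<integral>\<^sup>+x. ennreal (?N * \<bar>c\<bar> + 0) * indicator K x \<partial>lborel) =
     (\<integral>\<^sup>+y. ennreal (d * \<bar>c\<bar>) * indicator e y \<partial>flat_measure ?A)"
    by (rule nn_integral_cone_radial[OF n a d e K, of _ _ "\<lambda>_ _. 0"]) auto
  have iK: "set_integrable lborel K h" if "continuous_on UNIV h" for h :: "'a \<Rightarrow> real"
    using set_integrable_flat_measure[of UNIV K h] cK that continuous_on_subset[OF that]
    by (simp add: flat_measure_full)
  have ie: "set_integrable (flat_measure ?A) e h" if "continuous_on UNIV h" for h :: "'a \<Rightarrow> real"
    using set_integrable_flat_measure[OF ne e(1), of h] continuous_on_subset[OF that] by simp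
  have dn: "0 \<le> d * (f y + \<bar>c\<bar>)" if "y \<in> e" for y
    using C(2)[of y] eK that d by auto
  have kn: "0 \<le> ?N * (f x + \<bar>c\<bar>) + ?g x" if "x \<in> K" for x
    using C(1)[OF that] by (simp add: C_def algebra_simps)
  have "ennreal (LINT x:K|lborel. ?N * (f x + \<bar>c\<bar>) + ?g x) = ennreal (LINT y:e|flat_measure ?A. d * (f y + \<bar>c\<bar>))"
    using 1 dn kn
    by (subst (1 2) nn_integral_eq_set_lebesgue_integral[symmetric])
      (auto intro!: iK ie continuous_intros fc f)
  then have e1: "(LINT x:K|lborel. ?N * (f x + \<bar>c\<bar>) + ?g x) = (LINT y:e|flat_measure ?A. d * (f y + \<bar>c\<bar>))"
    using set_lebesgue_integral_nonneg[of K, OF kn] set_lebesgue_integral_nonneg[of e, OF dn]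
    by (subst (asm) ennreal_inj) assumption+
  have "ennreal (LINT x:K|lborel. C) = ennreal (LINT y:e|flat_measure ?A. d * \<bar>c\<bar>)"
    using 2 d
    by (subst (1 2) nn_integral_eq_set_lebesgue_integral[symmetric])
      (auto intro!: iK ie continuous_intros simp: C_def algebra_simps)
  then have e2: "(LINT x:K|lborel. C) = (LINT y:e|flat_measure ?A. d * \<bar>c\<bar>)"
    using set_lebesgue_integral_nonneg[of K "\<lambda>_. C"] set_lebesgue_integral_nonneg[of e "\<lambda>_. d * \<bar>c\<bar>"] d
    by (subst (asm) ennreal_inj) (auto simp: C_def)
  have "(LINT x:K|lborel. ?G x) = (LINT x:K|lborel. (?N * (f x + \<bar>c\<bar>) + ?g x) - C)"
    by (simp add: C_def algebra_simps)
  also have "\<dots> = (LINT x:K|lborel. ?N * (f x + \<bar>c\<bar>) + ?g x) - (LINT x:K|lborel. C)"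
    by (intro set_integral_diff(2) iK continuous_intros fc f)
  also have "\<dots> = (LINT y:e|flat_measure ?A. d * (f y + \<bar>c\<bar>)) - (LINT y:e|flat_measure ?A. d * \<bar>c\<bar>)"
    unfolding e1 e2 ..
  also have "\<dots> = (LINT y:e|flat_measure ?A. d * (f y + \<bar>c\<bar>) - d * \<bar>c\<bar>)"
    by (intro set_integral_diff(2)[symmetric] ie continuous_intros fc)
  also have "\<dots> = d * (LINT y:e|flat_measure ?A. f y)"
    by (simp add: algebra_simps)
  finally show ?thesis .
qed


section \<open>Simplices and boundary facets\<close>

text \<open>The outward unit normal, described by a supporting half-space so that no orientation and
  no vertex has to be chosen.\<close>

definition outward :: "'a::euclidean_space set \<Rightarrow> 'a set \<Rightarrow> 'a \<Rightarrow> bool" where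
  "outward K e n \<longleftrightarrow> norm n = 1 \<and> (\<exists>b. e \<subseteq> {x. n \<bullet> x = b} \<and> K \<subseteq> {x. n \<bullet> x \<le> b})"

lemma simplex_facetE:
  fixes K :: "'a::euclidean_space set"
  assumes "m simplex K" "e facet_of K"
  obtains a where "K = convex hull (insert a e)" "a \<in> K" "a \<notin> affine hull e" "e \<noteq> {}"
    "compact e" "convex e" "(m - 1) simplex e"
proof -
  obtain C where C: "finite C" "\<not> affine_dependent C" "int (card C) = m + 1" "K = convex hull C"
    using assms(1) unfolding simplex by blast
  obtain u where u: "2 \<le> card C" "u \<in> C" "e = convex hull (C - {u})"
    using assms(2) facet_of_convex_hull_affine_independent_alt[OF C(2)] C(4) by blast
  have ce: "card (C - {u}) = card C - 1" using C u by simp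
  show thesis
  proof
    show "K = convex hull (insert u e)"
      using u C hull_insert[of convex u "C - {u}"] by (simp add: insert_absorb)
    show "u \<in> K" using u C by (simp add: hull_inc)
    show "u \<notin> affine hull e"
      using u C(2) by (auto simp: affine_hull_convex_hull affine_dependent_def)
    show "e \<noteq> {}" using assms by (auto simp: facet_of_def)
    show "compact e" "convex e" using u C by (auto simp: finite_imp_compact_convex_hull)
    show "(m - 1) simplex e"
      unfolding simplex_def using ce u C
      by (intro exI[of _ "C - {u}"]) (auto dest: affine_dependent_subset[OF _ Diff_subset])
  qed
qed

lemma convex_hull_insert_cone:
  assumes "convex e" "e \<noteq> {}"
  shows "convex hull (insert a e) = (\<lambda>(\<theta>, y). a + \<theta> *\<^sub>R (y - a)) ` ({0..1} \<times> e)"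
proof -
  have h: "convex hull e = e" using assms by (simp add: hull_same)
  have eq: "u *\<^sub>R a + v *\<^sub>R y = a + v *\<^sub>R (y - a)" if "u + v = 1" for u v y
  proof -
    have "u = 1 - v" using that by simp
    then show ?thesis unfolding \<open>u = 1 - v\<close> by (simp add: algebra_simps)
  qed
  show ?thesis
    unfolding convex_hull_insert[OF assms(2)] h
  proof (intro equalityI subsetI)
    fix x assume "x \<in> {z. \<exists>u\<ge>0. \<exists>v\<ge>0. \<exists>b. u + v = 1 \<and> b \<in> e \<and> z = u *\<^sub>R a + v *\<^sub>R b}"
    then obtain u v y where *: "0 \<le> u" "0 \<le> v" "u + v = 1" "y \<in> e" "x = u *\<^sub>R a + v *\<^sub>R y" by blast
    then show "x \<in> (\<lambda>(\<theta>, y). a + \<theta> *\<^sub>R (y - a)) ` ({0..1} \<times> e)"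
      using eq[OF *(3)] by (intro image_eqI[of _ _ "(v, y)"]) auto
  next
    fix x assume "x \<in> (\<lambda>(\<theta>, y). a + \<theta> *\<^sub>R (y - a)) ` ({0..1} \<times> e)"
    then obtain v y where *: "0 \<le> v" "v \<le> 1" "y \<in> e" "x = a + v *\<^sub>R (y - a)" by auto
    then show "x \<in> {z. \<exists>u\<ge>0. \<exists>v\<ge>0. \<exists>b. u + v = 1 \<and> b \<in> e \<and> z = u *\<^sub>R a + v *\<^sub>R b}"
      using eq[of "1 - v" v y] by (intro CollectI exI[of _ "1 - v"] exI[of _ v] exI[of _ y] conjI) auto
  qed
qed

lemma outward_hyperplane:
  fixes K :: "'a::euclidean_space set"
  assumes "int DIM('a) simplex K" "e facet_of K" "norm n = 1" "e \<subseteq> {x. n \<bullet> x = b}"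
  shows "affine hull e = {x. n \<bullet> x = b}"
proof (rule affine_dim_equal)
  have "n \<noteq> 0" using assms by auto
  have "aff_dim e = int DIM('a) - 1"
    using assms(1,2) aff_dim_simplex[OF assms(1)] by (simp add: facet_of_def)
  then show "aff_dim (affine hull e) = aff_dim {x. n \<bullet> x = b}"
    using \<open>n \<noteq> 0\<close> by (simp add: aff_dim_hyperplane)
  show "affine {x. n \<bullet> x = b}" by (rule affine_hyperplane)
  then show "affine hull e \<subseteq> {x. n \<bullet> x = b}" using assms(4) by (simp add: hull_minimal)
  show "affine hull e \<noteq> {}" using assms(2) by (auto simp: facet_of_def)
qed simp

lemma outwardE:
  fixes K :: "'a::euclidean_space set"
  assumes "int DIM('a) simplex K" "e facet_of K" "outward K e n"
  obtains a b where "K = convex hull (insert a e)" "a \<in> K" "n \<bullet> a < b" "affine hull e = {x. n \<bullet> x = b}"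
    "e \<subseteq> {x. n \<bullet> x = b}" "K \<subseteq> {x. n \<bullet> x \<le> b}" "norm n = 1" "e \<noteq> {}" "compact e" "convex e"
proof -
  obtain b where b: "norm n = 1" "e \<subseteq> {x. n \<bullet> x = b}" "K \<subseteq> {x. n \<bullet> x \<le> b}"
    using assms(3) by (auto simp: outward_def)
  obtain a where a: "K = convex hull (insert a e)" "a \<in> K" "a \<notin> affine hull e" "e \<noteq> {}"
    "compact e" "convex e"
    using simplex_facetE[OF assms(1,2)] by metis
  have h: "affine hull e = {x. n \<bullet> x = b}"
    by (rule outward_hyperplane[OF assms(1,2) b(1,2)])
  have "n \<bullet> a < b" using a b h by (force simp: less_le)
  then show thesis using that a b h by blast
qed

lemma outward_exists:
  fixes K :: "'a::euclidean_space set"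
  assumes "int DIM('a) simplex K" "e facet_of K"
  obtains n where "outward K e n"
proof -
  obtain a where a: "K = convex hull (insert a e)" "a \<in> K" "a \<notin> affine hull e" "e \<noteq> {}"
    "compact e" "convex e"
    using simplex_facetE[OF assms] by metis
  have "aff_dim e = int DIM('a) - 1"
    using assms(1,2) aff_dim_simplex[OF assms(1)] by (simp add: facet_of_def)
  then have "aff_dim e = int (DIM('a) - 1)" using DIM_positive[where 'a='a] by linarith
  then obtain c \<beta> where c: "c \<noteq> 0" "affine hull e = {x. c \<bullet> x = \<beta>}"
    using aff_dim_eq_hyperplane[of e] by auto
  \<comment> \<open>The sign puts the apex on the side where n \<bullet> x is smaller.\<close>
  define s where "s = (if c \<bullet> a < \<beta> then 1 else -1) / norm c"
  define n where "n = s *\<^sub>R c"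
  have nn: "norm n = 1" using c by (simp add: n_def s_def)
  have ac: "c \<bullet> a \<noteq> \<beta>" using a c by auto
  have lt: "n \<bullet> a < s * \<beta>" using ac c by (auto simp: n_def s_def divide_simps)
  have e: "e \<subseteq> {x. n \<bullet> x = s * \<beta>}"
    using c hull_subset[of e affine] by (auto simp: n_def)
  have "K \<subseteq> {x. n \<bullet> x \<le> s * \<beta>}"
    unfolding a(1) using lt e by (intro hull_minimal) (auto simp: convex_halfspace_le)
  then have "outward K e n" using nn e by (auto simp: outward_def)
  then show thesis by (rule that)
qed

text \<open>Both normals are orthogonal to the same hyperplane, hence equal up to sign; the vertex
  off the facet decides the sign.\<close>

lemma outward_unique:
  fixes K :: "'a::euclidean_space set"
  assumes K: "int DIM('a) simplex K" "e facet_of K" and n: "outward K e n" "outward K e m"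
  shows "n = m"
proof -
  obtain a b where 1: "K = convex hull (insert a e)" "a \<in> K" "n \<bullet> a < b" "affine hull e = {x. n \<bullet> x = b}"
    "norm n = 1" "e \<noteq> {}" "e \<subseteq> {x. n \<bullet> x = b}"
    using outwardE[OF K n(1)] by metis
  obtain b' where 2: "e \<subseteq> {x. m \<bullet> x = b'}" "K \<subseteq> {x. m \<bullet> x \<le> b'}" "norm m = 1"
    using n(2) by (auto simp: outward_def)
  have h: "affine hull e = {x. m \<bullet> x = b'}" by (rule outward_hyperplane[OF K 2(3,1)])
  obtain y where y: "y \<in> e" using 1 by auto
  have nn: "n \<bullet> n = 1" "m \<bullet> m = 1" using 1 2 by (simp_all add: norm_eq_1)
  define v where "v = m - (n \<bullet> m) *\<^sub>R n"
  have nv: "n \<bullet> v = 0" by (simp add: v_def inner_simps nn)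
  then have "y + v \<in> affine hull e" using y 1 by (auto simp: inner_simps)
  then have "m \<bullet> v = 0" using h y 2 by (auto simp: inner_simps)
  then have "v \<bullet> v = 0" using nv by (simp add: v_def inner_simps inner_commute)
  then have m: "m = (n \<bullet> m) *\<^sub>R n" by (simp add: v_def)
  then have "norm m = \<bar>n \<bullet> m\<bar> * norm n" by (metis norm_scaleR)
  then have "n \<bullet> m = 1 \<or> n \<bullet> m = -1" using 1 2 by auto
  moreover have "n \<bullet> m \<noteq> -1"
  proof
    assume "n \<bullet> m = -1"
    then have mn: "m = - n" using m by simp
    have "m \<bullet> a \<le> m \<bullet> y" using 1 2 y by auto
    then have "n \<bullet> y \<le> n \<bullet> a" by (simp add: mn)
    then show False using 1 y by auto
  qed
  ultimately show ?thesis using m by simp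
qed

text \<open>It serves to show that simplices on the same side of a common facet overlap, and that
  two simplices on opposite sides fill a neighbourhood.\<close>

lemma half_ball_subset_simplex:
  fixes K :: "'a::euclidean_space set"
  assumes K: "int DIM('a) simplex K" "e facet_of K" "outward K e n" and b: "e \<subseteq> {x. n \<bullet> x = b}"
    and y: "y \<in> rel_interior e"
  obtains \<delta> where "0 < \<delta>" "ball y \<delta> \<inter> {x. n \<bullet> x \<le> b} \<subseteq> K"
proof -
  obtain a b' where 1: "K = convex hull (insert a e)" "a \<in> K" "n \<bullet> a < b'" "affine hull e = {x. n \<bullet> x = b'}"
    "norm n = 1" "e \<noteq> {}" "convex e" "e \<subseteq> {x. n \<bullet> x = b'}"
    using outwardE[OF K] by metis
  have b': "b' = b" using 1 b by auto
  have ye: "y \<in> e" using y rel_interior_subset by blast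
  obtain \<epsilon> where \<epsilon>: "0 < \<epsilon>" "ball y \<epsilon> \<inter> affine hull e \<subseteq> e"
    using y by (auto simp: mem_rel_interior_ball)
  define d where "d = b - n \<bullet> a"
  have d: "0 < d" using 1 by (simp add: d_def b')
  \<comment> \<open>\<open>s x\<close> is the barycentric coordinate of x at the vertex
    \<open>a\<close>, and \<open>z x\<close> is the projection of x from \<open>a\<close> onto the
    hyperplane of \<open>e\<close>. Both are continuous at \<open>y\<close>, with values 0 and
    \<open>y\<close>.\<close>
  define s where "s x = (b - n \<bullet> x) / d" for x
  define z where "z x = (1 / (1 - s x)) *\<^sub>R (x - s x *\<^sub>R a)" for x
  have sy: "s y = 0" using ye b by (auto simp: s_def)
  have zy: "z y = y" by (simp add: z_def sy)
  have "isCont s y" unfolding s_def using d by (intro continuous_intros) auto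
  moreover from this have "isCont z y" unfolding z_def using sy by (intro continuous_intros) auto
  ultimately have "(s \<longlongrightarrow> s y) (nhds y)" "(z \<longlongrightarrow> z y) (nhds y)"
    by (simp_all only: isCont_def tendsto_at_iff_tendsto_nhds)
  then have "(s \<longlongrightarrow> 0) (nhds y)" "(z \<longlongrightarrow> y) (nhds y)" by (simp_all only: sy zy)
  then have "\<forall>\<^sub>F x in nhds y. s x < 1 \<and> dist (z x) y < \<epsilon>"
    using \<epsilon> by (intro eventually_conj order_tendstoD tendstoD) auto
  then obtain \<delta> where \<delta>: "0 < \<delta>" "\<And>x. dist x y < \<delta> \<Longrightarrow> s x < 1 \<and> dist (z x) y < \<epsilon>"
    by (auto simp: eventually_nhds_metric)
  have "x \<in> K" if "dist x y < \<delta>" "n \<bullet> x \<le> b" for x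
  proof -
    have s: "0 \<le> s x" "s x < 1" and zx: "dist (z x) y < \<epsilon>" using \<delta>(2)[OF that(1)] that(2) d by (auto simp: s_def)
    have nx: "n \<bullet> x = b - s x * d" using d by (simp add: s_def)
    have "n \<bullet> z x = (n \<bullet> x - s x * (n \<bullet> a)) / (1 - s x)" by (simp add: z_def inner_simps)
    also have "n \<bullet> x - s x * (n \<bullet> a) = b * (1 - s x)" by (simp add: nx d_def algebra_simps)
    finally have "n \<bullet> z x = b" using s by simp
    then have "z x \<in> e" using \<epsilon>(2) zx 1 b' by (auto simp: dist_commute)
    have "x = s x *\<^sub>R a + (1 - s x) *\<^sub>R z x" using s by (simp add: z_def)
    also have "\<dots> \<in> convex hull (insert a e)"
      using s \<open>z x \<in> e\<close> by (intro convexD[OF convex_convex_hull]) (auto intro: hull_inc)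
    finally show ?thesis using 1 by simp
  qed
  then have "ball y \<delta> \<inter> {x. n \<bullet> x \<le> b} \<subseteq> K" by (auto simp: dist_commute)
  then show thesis using that \<delta> by blast
qed

section \<open>Adjacency of simplices in a triangulation\<close>

lemma interior_simplex_nonempty:
  fixes K :: "'a::euclidean_space set"
  assumes "int DIM('a) simplex K"
  shows "interior K \<noteq> {}" "rel_interior K = interior K" "affine hull K = UNIV"
proof -
  have c: "convex K" and d: "aff_dim K = int DIM('a)"
    using assms convex_simplex aff_dim_simplex by blast+
  show h: "affine hull K = UNIV" using d aff_dim_eq_full by blast
  show i: "rel_interior K = interior K" using h by (rule rel_interior_interior)
  have "K \<noteq> {}" using d by auto
  then show "interior K \<noteq> {}" using c i rel_interior_eq_empty by metis
qed

text \<open>The intersection is a face of \<open>K1\<close>, and a face that meets the interior is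
  the whole simplex.\<close>

lemma triangulation_interiors_disjoint:
  fixes S :: "'a::euclidean_space set set"
  assumes "triangulation S" "K1 \<in> S" "K2 \<in> S" "int DIM('a) simplex K1" "int DIM('a) simplex K2"
    and "interior K1 \<inter> K2 \<noteq> {}"
  shows "K1 \<subseteq> K2"
proof -
  have f: "(K1 \<inter> K2) face_of K1" using assms unfolding triangulation_def by blast
  have "K1 \<subseteq> K1 \<inter> K2"
    by (rule subset_of_face_of[OF f order_refl])
       (use assms interior_simplex_nonempty(2)[OF assms(4)] interior_subset in fastforce)
  then show ?thesis by simp
qed

lemma triangulation_interiors_disjoint2:
  fixes S :: "'a::euclidean_space set set"
  assumes "triangulation S" "K1 \<in> S" "K2 \<in> S" "int DIM('a) simplex K1" "int DIM('a) simplex K2"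
    and "interior K1 \<inter> interior K2 \<noteq> {}"
  shows "K1 = K2"
proof (rule antisym)
  show "K1 \<subseteq> K2"
    using assms(6) interior_subset[of K2] by (intro triangulation_interiors_disjoint[OF assms(1-5)]) blast
  show "K2 \<subseteq> K1"
    using assms(6) interior_subset[of K1]
    by (intro triangulation_interiors_disjoint[OF assms(1,3,2,5,4)]) blast
qed

text \<open>Otherwise both simplices lie on the same side and contain a common half ball around a
  relative interior point of \<open>e\<close>, so that their interiors meet.\<close>

lemma outward_opposite:
  fixes S :: "'a::euclidean_space set set"
  assumes S: "triangulation S" "\<And>K. K \<in> S \<Longrightarrow> int DIM('a) simplex K"
    and K: "K1 \<in> S" "K2 \<in> S" "K1 \<noteq> K2" "e facet_of K1" "e facet_of K2" and n: "outward K1 e n"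
  shows "outward K2 e (- n)"
proof -
  obtain m where m: "outward K2 e m" using outward_exists[OF S(2)[OF K(2)] K(5)] by blast
  obtain a b where 1: "K1 = convex hull (insert a e)" "n \<bullet> a < b" "affine hull e = {x. n \<bullet> x = b}"
    "norm n = 1" "e \<noteq> {}" "convex e" "e \<subseteq> {x. n \<bullet> x = b}"
    using outwardE[OF S(2)[OF K(1)] K(4) n] by metis
  obtain a2 b2 where 2: "K2 = convex hull (insert a2 e)" "a2 \<in> K2" "m \<bullet> a2 < b2" "affine hull e = {x. m \<bullet> x = b2}"
    "e \<subseteq> {x. m \<bullet> x = b2}"
    using outwardE[OF S(2)[OF K(2)] K(5) m] by metis
  have a2: "n \<bullet> a2 \<noteq> b" using 1 2 by auto
  have "b < n \<bullet> a2"
  proof (rule ccontr)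
    assume "\<not> b < n \<bullet> a2"
    then have lt: "n \<bullet> a2 < b" using a2 by simp
    have "K2 \<subseteq> {x. n \<bullet> x \<le> b}"
      unfolding 2(1) using lt 1 by (intro hull_minimal) (auto simp: convex_halfspace_le)
    then have o2: "outward K2 e n" using 1 by (auto simp: outward_def)
    obtain y where y: "y \<in> rel_interior e" using 1 rel_interior_eq_empty by blast
    obtain d1 where d1: "0 < d1" "ball y d1 \<inter> {x. n \<bullet> x \<le> b} \<subseteq> K1"
      using half_ball_subset_simplex[OF S(2)[OF K(1)] K(4) n 1(7) y] by metis
    obtain d2 where d2: "0 < d2" "ball y d2 \<inter> {x. n \<bullet> x \<le> b} \<subseteq> K2"
      using half_ball_subset_simplex[OF S(2)[OF K(2)] K(5) o2 1(7) y] by metis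
    have yb: "n \<bullet> y = b" using y 1 rel_interior_subset by blast
    define d where "d = min d1 d2 / 2"
    define x where "x = y - d *\<^sub>R n"
    have nn: "n \<bullet> n = 1" using 1 by (simp add: norm_eq_1)
    have d: "0 < d" "d < d1" "d < d2" using d1 d2 by (auto simp: d_def)
    have o: "open (ball y (min d1 d2) \<inter> {x. n \<bullet> x < b})" by (intro open_Int open_ball open_halfspace_lt)
    have xin: "x \<in> ball y (min d1 d2) \<inter> {x. n \<bullet> x < b}"
      using d 1 by (auto simp: x_def dist_norm inner_simps nn yb)
    have "ball y (min d1 d2) \<inter> {x. n \<bullet> x < b} \<subseteq> K1" "ball y (min d1 d2) \<inter> {x. n \<bullet> x < b} \<subseteq> K2"
      using d1 d2 by force+
    then have "x \<in> interior K1" "x \<in> interior K2" using o xin by (meson interiorI)+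
    then show False
      using triangulation_interiors_disjoint2[OF S(1) K(1,2) S(2)[OF K(1)] S(2)[OF K(2)]] K(3) by blast
  qed
  then have "K2 \<subseteq> {x. (- n) \<bullet> x \<le> - b}"
    unfolding 2(1) using 1 by (intro hull_minimal) (auto simp: convex_halfspace_ge)
  then show ?thesis using 1 by (auto simp: outward_def intro!: exI[of _ "- b"])
qed

text \<open>Being opposite to both, a third simplex would have n and - n as outward normals on
  \<open>e\<close>.\<close>

lemma facet_at_most_two:
  fixes S :: "'a::euclidean_space set set"
  assumes S: "triangulation S" "\<And>K. K \<in> S \<Longrightarrow> int DIM('a) simplex K"
    and K: "K1 \<in> S" "K2 \<in> S" "K1 \<noteq> K2" "e facet_of K1" "e facet_of K2" "K3 \<in> S" "e facet_of K3"
  shows "K3 = K1 \<or> K3 = K2"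
proof (rule ccontr)
  assume "\<not> (K3 = K1 \<or> K3 = K2)"
  then have d: "K1 \<noteq> K3" "K2 \<noteq> K3" by auto
  obtain n where n: "outward K1 e n" using outward_exists[OF S(2)[OF K(1)] K(4)] by blast
  have "outward K2 e (- n)" by (rule outward_opposite[OF S K(1,2,3,4,5) n])
  then have 1: "outward K3 e n" using outward_opposite[OF S K(2,6) d(2) K(5,7)] by force
  have 2: "outward K3 e (- n)" by (rule outward_opposite[OF S K(1,6) d(1) K(4,7) n])
  have "n = - n" by (rule outward_unique[OF S(2)[OF K(6)] K(7) 1 2])
  moreover have "norm n = 1" using n by (simp add: outward_def)
  ultimately show False by (metis eq_neg_iff_add_eq_0 norm_zero scaleR_2 scaleR_eq_0_iff zero_neq_numeral zero_neq_one)
qed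


text \<open>Projection from the opposite vertex maps the disc parallel to \<open>e\<close> through
  the centre of the ball into \<open>e\<close> and enlarges it by 1 / \<theta> \<ge> 1. Shape
  regularity is assumed for the fluid elements; in this way the plate elements inherit it.\<close>

lemma facet_contains_ball:
  fixes K :: "'a::euclidean_space set"
  assumes K: "int DIM('a) simplex K" "e facet_of K" and dim: "2 \<le> DIM('a)"
    and n: "norm n = 1" "e \<subseteq> {x. n \<bullet> x = b}" and ball: "cball c \<rho> \<subseteq> K" "0 < \<rho>"
  obtains a where "\<And>w. n \<bullet> w = 0 \<Longrightarrow> norm w \<le> \<rho> \<Longrightarrow> a + w \<in> e"
proof -
  have h: "affine hull e = {x. n \<bullet> x = b}" by (rule outward_hyperplane[OF K n])
  obtain v where v: "K = convex hull (insert v e)" "v \<notin> affine hull e" "e \<noteq> {}" "convex e"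
    using simplex_facetE[OF K] by metis
  have nv: "n \<bullet> v \<noteq> b" using v h by auto
  have "aff_dim e = int DIM('a) - 1"
    using K aff_dim_simplex[OF K(1)] by (simp add: facet_of_def)
  then have "\<not> (\<exists>x. e = {x})" using dim aff_dim_eq_0[of e] by simp
  then obtain y1 y2 where y: "y1 \<in> e" "y2 \<in> e" "y1 \<noteq> y2" using v(3) by (metis ex_in_conv insertI1 subsetI subset_antisym singletonD)
  \<comment> \<open>If \<theta> were 0, the whole disc would collapse to the vertex. The nonzero
    tangent vector \<open>z0\<close>, which exists in dimension at least 2, excludes this.\<close>
  define z0 where "z0 = (\<rho> / norm (y1 - y2)) *\<^sub>R (y1 - y2)"
  have ny: "n \<bullet> y1 = b" "n \<bullet> y2 = b" using y n by auto
  have z0: "n \<bullet> z0 = 0" "norm z0 = \<rho>" "z0 \<noteq> 0" using y ny ball by (auto simp: z0_def inner_simps)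
  define \<theta> where "\<theta> = (n \<bullet> c - n \<bullet> v) / (b - n \<bullet> v)"
  have dec: "0 \<le> \<theta> \<and> \<theta> \<le> 1 \<and> (\<exists>y\<in>e. c + z = v + \<theta> *\<^sub>R (y - v))" if "n \<bullet> z = 0" "norm z \<le> \<rho>" for z
  proof -
    have "c + z \<in> K" using ball that by (auto simp: dist_norm)
    then obtain t y where ty: "0 \<le> t" "t \<le> 1" "y \<in> e" "c + z = v + t *\<^sub>R (y - v)"
      unfolding v(1) convex_hull_insert_cone[OF v(4,3)] by auto
    have "n \<bullet> (c + z) = n \<bullet> (v + t *\<^sub>R (y - v))" using ty by simp
    moreover have "n \<bullet> y = b" using ty n by auto
    ultimately have "t = \<theta>" using that nv by (simp add: \<theta>_def inner_simps field_simps)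
    then show ?thesis using ty by blast
  qed
  have \<theta>: "0 \<le> \<theta>" "\<theta> \<le> 1" using dec[of 0] ball by auto
  have "\<theta> \<noteq> 0" using dec[of 0] dec[of z0] z0 ball by auto
  then have \<theta>0: "0 < \<theta>" using \<theta> by simp
  show thesis
  proof
    fix w assume w: "n \<bullet> w = 0" "norm w \<le> \<rho>"
    have "norm (\<theta> *\<^sub>R w) \<le> 1 * \<rho>" unfolding norm_scaleR using \<theta> w by (intro mult_mono) auto
    then obtain y where y: "y \<in> e" "c + \<theta> *\<^sub>R w = v + \<theta> *\<^sub>R (y - v)"
      using dec[of "\<theta> *\<^sub>R w"] w by auto
    have "(1/\<theta>) *\<^sub>R (c + \<theta> *\<^sub>R w - v) = (1/\<theta>) *\<^sub>R (\<theta> *\<^sub>R (y - v))" using y by simp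
    then have "v + (1/\<theta>) *\<^sub>R (c - v) + w = y" using \<theta>0 by (simp add: algebra_simps)
    then show "(v + (1/\<theta>) *\<^sub>R (c - v)) + w \<in> e" using y by simp
  qed
qed

lemma inradius_ball:
  fixes K :: "'a::euclidean_space set"
  assumes "bounded K" "K \<noteq> {}" "0 < t" "t < inradius K"
  obtains c where "cball c t \<subseteq> K"
proof -
  let ?R = "{\<rho>. 0 \<le> \<rho> \<and> (\<exists>x. cball x \<rho> \<subseteq> K)}"
  have "0 \<in> ?R" using assms(2) by auto
  then have "?R \<noteq> {}" by blast
  then obtain \<rho> x where "t < \<rho>" "cball x \<rho> \<subseteq> K"
    using less_cSupD[of ?R t] assms(4) unfolding inradius_def by blast
  then have "cball x t \<subseteq> K" by (meson less_imp_le subset_cball subset_trans)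
  then show thesis by (rule that)
qed

section \<open>Boundary facets of a triangulated Lipschitz domain\<close>

lemma lipschitz_chart_eq:
  fixes U :: "(real^'n) set"
  assumes "x \<in> frontier U" "x \<in> ball x0 \<rho>" "L-lipschitz_on UNIV g"
    and chart: "\<And>y. y \<in> ball x0 \<rho> \<Longrightarrow> y \<in> U \<longleftrightarrow> g (y - (y \<bullet> u) *\<^sub>R u) < y \<bullet> u"
  shows "g (x - (x \<bullet> u) *\<^sub>R u) = x \<bullet> u"
proof (rule antisym)
  have gc: "continuous_on UNIV g" using assms(3) by (rule lipschitz_on_continuous_on)
  \<comment> \<open>Near \<open>x0\<close> the sign of \<open>?F\<close> decides membership in
    \<open>U\<close>, so a frontier point can lie in neither of the open sets where
    \<open>?F\<close> has a strict sign.\<close>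
  let ?F = "\<lambda>y. y \<bullet> u - g (y - (y \<bullet> u) *\<^sub>R u)"
  have Fc: "continuous_on UNIV ?F"
    by (intro continuous_intros continuous_on_compose2[OF gc]) auto
  have 1: "open (?F -` {0<..} \<inter> ball x0 \<rho>)" "open (?F -` {..<0} \<inter> ball x0 \<rho>)"
    by (intro open_Int open_ball open_vimage Fc; auto)+
  show "g (x - (x \<bullet> u) *\<^sub>R u) \<le> x \<bullet> u"
  proof (rule ccontr)
    assume "\<not> ?thesis"
    then have "x \<in> ?F -` {..<0} \<inter> ball x0 \<rho>" using assms by auto
    moreover have "(?F -` {..<0} \<inter> ball x0 \<rho>) \<inter> U = {}" using chart by force
    ultimately have "x \<notin> closure U" using 1(2) open_Int_closure_eq_empty by blast
    then show False using assms by (simp add: frontier_def)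
  qed
  show "x \<bullet> u \<le> g (x - (x \<bullet> u) *\<^sub>R u)"
  proof (rule ccontr)
    assume "\<not> ?thesis"
    then have "x \<in> ?F -` {0<..} \<inter> ball x0 \<rho>" using assms by auto
    moreover have "?F -` {0<..} \<inter> ball x0 \<rho> \<subseteq> U" using chart by force
    ultimately have "x \<in> interior U" using 1(1) interiorI by blast
    then show False using assms by (simp add: frontier_def)
  qed
qed

text \<open>The domain lies on one side of its frontier: from a frontier point a small step in the
  direction - u leads out of the closure. Meshes are described by closures, and this recovers the
  open domains from them.\<close>

lemma lipschitz_domain_interior_closure:
  fixes U :: "(real^'n) set"
  assumes "lipschitz_domain U"
  shows "interior (closure U) = U"
proof (rule antisym)
  have "open U" using assms by (simp add: lipschitz_domain_def)
  then show "U \<subseteq> interior (closure U)" by (simp add: closure_subset interior_maximal)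
  show "interior (closure U) \<subseteq> U"
  proof (rule subsetI, rule ccontr)
    fix x assume x: "x \<in> interior (closure U)" "x \<notin> U"
    then have fr: "x \<in> frontier U"
      using \<open>open U\<close> interior_subset[of "closure U"] by (auto simp: frontier_def interior_open)
    then obtain u \<rho> L g where c: "norm u = 1" "0 < \<rho>" "L-lipschitz_on UNIV g"
      "\<And>y. y \<in> ball x \<rho> \<Longrightarrow> y \<in> U \<longleftrightarrow> g (y - (y \<bullet> u) *\<^sub>R u) < y \<bullet> u"
      using assms unfolding lipschitz_domain_def by meson
    have uu: "u \<bullet> u = 1" using c by (simp add: norm_eq_1)
    have gx: "g (x - (x \<bullet> u) *\<^sub>R u) = x \<bullet> u"
      by (rule lipschitz_chart_eq[OF fr _ c(3,4)]) (use c in auto)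
    obtain \<delta> where d: "0 < \<delta>" "ball x \<delta> \<subseteq> closure U" using x by (auto simp: mem_interior)
    define t where "t = min \<delta> \<rho> / 2"
    define y where "y = x - t *\<^sub>R u"
    have t: "0 < t" "t < \<delta>" "t < \<rho>" using d c by (auto simp: t_def)
    have yb: "y \<in> ball x \<delta>" "y \<in> ball x \<rho>" using t c by (auto simp: y_def dist_norm)
    have pr: "y - (y \<bullet> u) *\<^sub>R u = x - (x \<bullet> u) *\<^sub>R u" by (simp add: y_def inner_simps uu algebra_simps)
    have lt: "y \<bullet> u < g (y - (y \<bullet> u) *\<^sub>R u)" unfolding pr gx using t by (simp add: y_def inner_simps uu)
    then have "y \<notin> U" using c(4)[OF yb(2)] by simp
    moreover have "y \<in> closure U" using yb d by auto
    ultimately have "y \<in> frontier U" using \<open>open U\<close> by (auto simp: frontier_def interior_open)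
    then have "g (y - (y \<bullet> u) *\<^sub>R u) = y \<bullet> u" by (rule lipschitz_chart_eq[OF _ yb(2) c(3,4)])
    then show False using lt by simp
  qed
qed

text \<open>If another simplex \<open>K'\<close> contained \<open>x\<close>, the intersection of
  \<open>K\<close> and \<open>K'\<close> would be a proper face containing \<open>e\<close>, hence
  equal to \<open>e\<close> by dimension, and \<open>e\<close> would be a facet of
  \<open>K'\<close>. The other simplices thus form a closed set that misses
  \<open>x\<close>.\<close>

lemma boundary_facet_neighbourhood:
  fixes S :: "'a::euclidean_space set set"
  assumes S: "triangulation S" "\<And>K. K \<in> S \<Longrightarrow> int DIM('a) simplex K"
    and K: "K \<in> S" "e facet_of K" and only: "\<And>K'. K' \<in> S \<Longrightarrow> e facet_of K' \<Longrightarrow> K' = K"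
    and x: "x \<in> rel_interior e"
  obtains \<delta> where "0 < \<delta>" "ball x \<delta> \<inter> \<Union>S \<subseteq> K"
proof -
  note S2 = S(2)
  have xe: "x \<in> e" "x \<in> K" using x K rel_interior_subset facet_of_imp_subset by blast+
  have notin: "x \<notin> K'" if "K' \<in> S" "K' \<noteq> K" for K'
  proof
    assume xK: "x \<in> K'"
    have f1: "(K \<inter> K') face_of K" and f2: "(K' \<inter> K) face_of K'"
      using S(1) K that unfolding triangulation_def by blast+
    have sub: "e \<subseteq> K \<inter> K'"
      by (rule subset_of_face_of[OF f1 facet_of_imp_subset[OF K(2)]]) (use x xe xK in auto)
    have conv: "convex K" "convex K'" using S2 K that convex_simplex by blast+
    have ne: "K \<inter> K' \<noteq> K" "K' \<inter> K \<noteq> K'"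
    proof -
      have "interior K \<inter> K' \<noteq> {}" if "K \<inter> K' = K"
        using that interior_simplex_nonempty(1)[OF S2[OF K(1)]] interior_subset by blast
      moreover have "K' = K" if "K \<subseteq> K'"
      proof -
        have "K face_of K'" using f2 that by (simp add: inf.absorb2)
        moreover have "aff_dim K = aff_dim K'"
          using aff_dim_simplex[OF S2[OF K(1)]] aff_dim_simplex[OF S2[OF \<open>K' \<in> S\<close>]] by simp
        ultimately show ?thesis using face_of_aff_dim_lt[OF conv(2)] by fastforce
      qed
      moreover have "K' = K" if "K' \<subseteq> K"
      proof -
        have "K' face_of K" using f1 that by (simp add: inf.absorb2)
        moreover have "aff_dim K = aff_dim K'"
          using aff_dim_simplex[OF S2[OF K(1)]] aff_dim_simplex[OF S2[OF \<open>K' \<in> S\<close>]] by simp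
        ultimately show ?thesis using face_of_aff_dim_lt[OF conv(1)] by fastforce
      qed
      ultimately show "K \<inter> K' \<noteq> K" "K' \<inter> K \<noteq> K'" using \<open>K' \<noteq> K\<close> by blast+
    qed
    have d1: "aff_dim (K \<inter> K') < aff_dim K" by (rule face_of_aff_dim_lt[OF conv(1) f1 ne(1)])
    have de: "aff_dim e = aff_dim K - 1" using K by (simp add: facet_of_def)
    have "aff_dim e \<le> aff_dim (K \<inter> K')" using sub by (rule aff_dim_subset)
    then have eq: "aff_dim e = aff_dim (K \<inter> K')" using d1 de by simp
    have "e face_of (K \<inter> K')"
      by (rule face_of_subset[OF facet_of_imp_face_of[OF K(2)] sub]) auto
    then have "e = K \<inter> K'"
      using face_of_aff_dim_lt[of "K \<inter> K'" e] convex_Int[OF conv] eq by auto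
    then have "e face_of K'" using f2 by (simp add: Int_commute)
    moreover have "aff_dim K = aff_dim K'"
      using aff_dim_simplex[OF S2[OF K(1)]] aff_dim_simplex[OF S2[OF \<open>K' \<in> S\<close>]] by simp
    ultimately have "e facet_of K'" using de K by (simp add: facet_of_def)
    then show False using only that by blast
  qed
  have "closed (\<Union>(S - {K}))"
    using S(1) S2 closed_simplex unfolding triangulation_def by (intro closed_Union) auto
  moreover have "x \<notin> \<Union>(S - {K})" using notin by auto
  ultimately obtain \<delta> where "0 < \<delta>" "ball x \<delta> \<subseteq> - \<Union>(S - {K})"
    unfolding closed_def open_contains_ball by blast
  then have \<delta>: "0 < \<delta>" "ball x \<delta> \<inter> \<Union>(S - {K}) = {}" by blast+
  have "ball x \<delta> \<inter> \<Union>S \<subseteq> K" using \<delta>(2) by blast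
  then show thesis using that \<delta>(1) by blast
qed

lemma boundary_facet_frontier:
  fixes U :: "'a::euclidean_space set"
  assumes U: "open U" and S: "triangulation S" "\<And>K. K \<in> S \<Longrightarrow> int DIM('a) simplex K" "\<Union>S = closure U"
    and K: "K \<in> S" "e facet_of K" and only: "\<And>K'. K' \<in> S \<Longrightarrow> e facet_of K' \<Longrightarrow> K' = K"
    and x: "x \<in> rel_interior e"
  shows "x \<in> frontier U"
proof -
  obtain n where n: "outward K e n" using outward_exists[OF S(2)[OF K(1)] K(2)] by blast
  obtain b where 1: "affine hull e = {x. n \<bullet> x = b}" "norm n = 1" "e \<subseteq> {x. n \<bullet> x = b}" "K \<subseteq> {x. n \<bullet> x \<le> b}"
    by (rule outwardE[OF S(2)[OF K(1)] K(2) n])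
  have xe: "x \<in> e" "x \<in> K" using x K rel_interior_subset facet_of_imp_subset by blast+
  then have nx: "n \<bullet> x = b" using 1 by auto
  have nn: "n \<bullet> n = 1" using 1 by (simp_all add: norm_eq_1)
  obtain \<delta> where \<delta>: "0 < \<delta>" "ball x \<delta> \<inter> \<Union>S \<subseteq> K"
    by (rule boundary_facet_neighbourhood[OF S(1,2) K only x])
  have near2: "n \<bullet> y \<le> b" if "y \<in> closure U" "dist x y < \<delta>" for y
    using that 1 \<delta> unfolding S(3) by auto
  have "x \<notin> U"
  proof
    assume "x \<in> U"
    then obtain r where r: "0 < r" "ball x r \<subseteq> U" using U open_contains_ball by blast
    define t where "t = min r \<delta> / 2"
    have t: "0 < t" "t < r" "t < \<delta>" using r \<delta> by (auto simp: t_def)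
    have "x + t *\<^sub>R n \<in> ball x r" "dist x (x + t *\<^sub>R n) < \<delta>" using t 1 by (auto simp: dist_norm)
    then have "n \<bullet> (x + t *\<^sub>R n) \<le> b" using near2 r closure_subset by blast
    then show False using t by (simp add: inner_simps nn nx)
  qed
  moreover have "x \<in> closure U" using S(3) K xe by blast
  ultimately show ?thesis using U by (auto simp: frontier_def interior_open)
qed

text \<open>The vector w = u + \<mu> m, with \<open>m\<close> the part of \<open>n\<close>
  orthogonal to \<open>u\<close> and \<mu> = 1 / (L + 1), rises by 1 and moves sideways by at most
  \<mu>, so x + t w stays above a graph of slope L and lies in \<open>U\<close> for small t. Hence n
  \<bullet> w \<le> 0. With c = - (n \<bullet> u) this reads
  \<open>\<mu> * (1 - c\<^sup>2) \<le> c\<close>, and c \<ge> \<mu> / (1 + \<mu>) = 1 / (L + 2)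
  follows.\<close>

lemma boundary_facet_normal:
  fixes U :: "(real^'n) set"
  assumes U: "open U" and S: "triangulation S" "\<And>K. K \<in> S \<Longrightarrow> int CARD('n) simplex K" "\<Union>S = closure U"
    and K: "K \<in> S" "e facet_of K" and only: "\<And>K'. K' \<in> S \<Longrightarrow> e facet_of K' \<Longrightarrow> K' = K"
    and n: "outward K e n"
    and u: "norm u = 1" and g: "L-lipschitz_on UNIV g"
    and chart: "\<And>y. y \<in> ball x0 \<rho> \<Longrightarrow> y \<in> U \<longleftrightarrow> g (y - (y \<bullet> u) *\<^sub>R u) < y \<bullet> u"
    and x: "x \<in> rel_interior e" "x \<in> ball x0 \<rho>"
  shows "1 / (L + 2) \<le> - (n \<bullet> u)"
proof -
  have S2: "int DIM(real^'n) simplex K'" if "K' \<in> S" for K' using S(2)[OF that] by simp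
  obtain b where 1: "affine hull e = {x. n \<bullet> x = b}" "norm n = 1" "e \<subseteq> {x. n \<bullet> x = b}" "K \<subseteq> {x. n \<bullet> x \<le> b}"
    by (rule outwardE[OF S2[OF K(1)] K(2) n])
  have xe: "x \<in> e" "x \<in> K" using x K rel_interior_subset facet_of_imp_subset by blast+
  then have nx: "n \<bullet> x = b" using 1 by auto
  have nn: "n \<bullet> n = 1" "u \<bullet> u = 1" using 1 u by (simp_all add: norm_eq_1)
  obtain \<delta> where \<delta>: "0 < \<delta>" "ball x \<delta> \<inter> \<Union>S \<subseteq> K"
    by (rule boundary_facet_neighbourhood[OF S(1) S2 K only x(1)])
  have near2: "n \<bullet> y \<le> b" if "y \<in> closure U" "dist x y < \<delta>" for y
    using that 1 \<delta> unfolding S(3) by auto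
  have fr: "x \<in> frontier U" by (rule boundary_facet_frontier[OF U S(1) S2 S(3) K only x(1)])
  have gx: "g (x - (x \<bullet> u) *\<^sub>R u) = x \<bullet> u" by (rule lipschitz_chart_eq[OF fr x(2) g chart])
  have L: "0 \<le> L" using g by (rule lipschitz_on_nonneg)
  define m where "m = n - (n \<bullet> u) *\<^sub>R u"
  define \<mu> where "\<mu> = 1 / (L + 1)"
  have \<mu>: "0 < \<mu>" using L by (simp add: \<mu>_def)
  have um: "u \<bullet> m = 0" by (simp add: m_def inner_simps nn inner_commute)
  have mm: "m \<bullet> m = 1 - (n \<bullet> u)\<^sup>2" by (simp add: m_def inner_simps nn inner_commute power2_eq_square)
  have nm: "n \<bullet> m = m \<bullet> m" unfolding mm by (simp add: m_def inner_simps nn inner_commute power2_eq_square)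
  have "(norm m)\<^sup>2 \<le> 1" using mm by (simp add: power2_norm_eq_inner)
  then have m1: "norm m \<le> 1" using power2_le_imp_le[of "norm m" 1] by simp
  define w where "w = u + \<mu> *\<^sub>R m"
  obtain r where r: "0 < r" "ball x r \<subseteq> ball x0 \<rho>" using x(2) open_ball open_contains_ball by blast
  define t where "t = min r \<delta> / (norm w + 1) / 2"
  have rp: "0 < min r \<delta>" using r \<delta> by simp
  have tw: "0 < t" "t * norm w < min r \<delta>"
  proof -
    have p: "0 < norm w + 1" by (smt (verit) norm_ge_zero)
    show "0 < t" using rp p by (simp add: t_def)
    have "t * norm w \<le> t * (norm w + 1)" using \<open>0 < t\<close> by simp
    also have "\<dots> = min r \<delta> / 2" using p unfolding t_def by (metis less_irrefl nonzero_mult_div_cancel_right times_divide_eq_left divide_divide_eq_left' mult.commute)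
    also have "\<dots> < min r \<delta>" using rp by linarith
    finally show "t * norm w < min r \<delta>" .
  qed
  let ?y = "x + t *\<^sub>R w"
  have dy: "dist x ?y < min r \<delta>" using tw by (simp add: dist_norm)
  have pr: "?y - (?y \<bullet> u) *\<^sub>R u = (x - (x \<bullet> u) *\<^sub>R u) + (t * \<mu>) *\<^sub>R m"
    using um by (simp add: w_def inner_simps nn inner_commute algebra_simps)
  have yu: "?y \<bullet> u = x \<bullet> u + t" using um by (simp add: w_def inner_simps nn inner_commute)
  have "g (?y - (?y \<bullet> u) *\<^sub>R u) \<le> g (x - (x \<bullet> u) *\<^sub>R u) + L * norm ((t * \<mu>) *\<^sub>R m)"
    using lipschitz_onD[OF g, of "?y - (?y \<bullet> u) *\<^sub>R u" "x - (x \<bullet> u) *\<^sub>R u"] unfolding pr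
    by (simp add: dist_norm)
  also have "\<dots> < x \<bullet> u + t"
  proof -
    have "L * norm ((t * \<mu>) *\<^sub>R m) = t * ((L * \<mu>) * norm m)" using tw \<mu> by simp
    also have "\<dots> \<le> t * ((L * \<mu>) * 1)" using m1 tw \<mu> L by (intro mult_left_mono) auto
    also have "\<dots> < t * 1"
    proof -
      have "L * \<mu> < 1" using L by (simp add: \<mu>_def)
      then show ?thesis using tw by (intro mult_strict_left_mono) auto
    qed
    finally show ?thesis using gx by simp
  qed
  finally have "?y \<in> U" using chart[of ?y] dy r yu by auto
  then have "n \<bullet> ?y \<le> b" using near2 dy closure_subset by auto
  then have "n \<bullet> w \<le> 0" using tw nx by (simp add: inner_simps mult_le_0_iff)
  then have "n \<bullet> u + \<mu> * (m \<bullet> m) \<le> 0" by (simp add: w_def inner_simps nm)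
  define c where "c = - (n \<bullet> u)"
  have c: "\<mu> * (1 - c\<^sup>2) \<le> c" using \<open>n \<bullet> u + \<mu> * (m \<bullet> m) \<le> 0\<close> unfolding mm c_def by simp
  have "0 \<le> 1 - c\<^sup>2" using mm inner_ge_zero[of m] by (simp add: c_def)
  then have c0: "0 \<le> c" using c \<mu> by (meson less_imp_le mult_nonneg_nonneg order_trans)
  have "c \<le> 1" using \<open>0 \<le> 1 - c\<^sup>2\<close> power2_le_imp_le[of c 1] by simp
  \<comment> \<open>Since c lies between 0 and 1, replacing \<open>c\<^sup>2\<close> by
    \<open>c\<close> makes the inequality linear.\<close>
  then have "c\<^sup>2 \<le> c" using c0 by (simp add: power2_eq_square mult_left_le)
  then have "\<mu> * (1 - c) \<le> c" using c \<mu> by (smt (verit) mult_left_mono)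
  then have "\<mu> \<le> c * (1 + \<mu>)" by (simp add: algebra_simps)
  then have "1 \<le> c * (L + 2)" using L by (simp add: \<mu>_def field_simps)
  then show ?thesis using L by (simp add: c_def field_simps)
qed


section \<open>Polynomials\<close>

text \<open>Polynomials without a degree bound, a class closed under products and partial
  derivatives. Smoothness is proved for it by induction; the degree matters for extrapolation, where
  \<open>polys r\<close> is used directly.\<close>

inductive cpoly :: "(real^'n \<Rightarrow> complex) \<Rightarrow> bool" where
  cpoly_const: "cpoly (\<lambda>x. c)"
| cpoly_coord: "cpoly (\<lambda>x. complex_of_real (x $ i))"
| cpoly_add: "cpoly p \<Longrightarrow> cpoly q \<Longrightarrow> cpoly (\<lambda>x. p x + q x)"
| cpoly_mult: "cpoly p \<Longrightarrow> cpoly q \<Longrightarrow> cpoly (\<lambda>x. p x * q x)"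

lemma cpoly_sum: "(\<And>a. a \<in> A \<Longrightarrow> cpoly (f a)) \<Longrightarrow> cpoly (\<lambda>x. \<Sum>a\<in>A. f a x)"
proof (induction A rule: infinite_finite_induct)
  case (insert a A)
  then show ?case using cpoly_add[of "f a" "\<lambda>x. \<Sum>a\<in>A. f a x"] by simp
qed (simp_all add: cpoly_const)

lemma cpoly_prod: "(\<And>a. a \<in> A \<Longrightarrow> cpoly (f a)) \<Longrightarrow> cpoly (\<lambda>x. \<Prod>a\<in>A. f a x)"
proof (induction A rule: infinite_finite_induct)
  case (insert a A)
  then show ?case using cpoly_mult[of "f a" "\<lambda>x. \<Prod>a\<in>A. f a x"] by simp
qed (simp_all add: cpoly_const)

lemma cpoly_power: "cpoly p \<Longrightarrow> cpoly (\<lambda>x. p x ^ k)"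
proof (induction k)
  case (Suc k)
  then show ?case using cpoly_mult[of p "\<lambda>x. p x ^ k"] by simp
qed (simp add: cpoly_const)

lemma polys_imp_cpoly:
  fixes p :: "real^'n \<Rightarrow> complex"
  shows "p \<in> polys r \<Longrightarrow> cpoly p"
proof -
  assume "p \<in> polys r"
  then obtain c where p: "p = (\<lambda>x. \<Sum>a | sum a UNIV \<le> r. c a * (\<Prod>i\<in>UNIV. complex_of_real (x $ i) ^ a i))"
    unfolding polys_def by blast
  have "cpoly (\<lambda>x::real^'n. \<Prod>i\<in>UNIV. complex_of_real (x $ i) ^ a i)" for a
    by (rule cpoly_prod, rule cpoly_power, rule cpoly_coord)
  then show ?thesis
    unfolding p by (intro cpoly_sum) (rule cpoly_mult[OF cpoly_const])
qed

text \<open>The partial derivatives are asserted to be polynomials again, so that the result can be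
  applied to the gradient in turn.\<close>

lemma cpoly_has_derivative:
  fixes p :: "real^'n \<Rightarrow> complex"
  assumes "cpoly p"
  shows "\<exists>D. (\<forall>i. cpoly (D i)) \<and> (\<forall>x. (p has_derivative (\<lambda>h. \<Sum>i\<in>UNIV. complex_of_real (h $ i) * D i x)) (at x))"
  using assms
proof induction
  case (cpoly_const c)
  show ?case by (intro exI[of _ "\<lambda>i x. 0"]) (simp add: cpoly.cpoly_const)
next
  case (cpoly_coord i)
  have "((\<lambda>x::real^'n. complex_of_real (x $ i)) has_derivative (\<lambda>h. complex_of_real (h $ i))) (at x)" for x
    by (intro bounded_linear_imp_has_derivative bounded_linear_compose[OF bounded_linear_of_real bounded_linear_vec_nth])
  then show ?case
    by (intro exI[of _ "\<lambda>j x. if j = i then 1 else 0"])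
      (simp add: cpoly_const if_distrib cong: if_cong)
next
  case (cpoly_add p q)
  obtain D where D: "\<forall>i. cpoly (D i)"
    "\<forall>x. (p has_derivative (\<lambda>h. \<Sum>i\<in>UNIV. complex_of_real (h $ i) * D i x)) (at x)"
    using cpoly_add.IH(1) by (elim exE conjE)
  obtain E where E: "\<forall>i. cpoly (E i)"
    "\<forall>x. (q has_derivative (\<lambda>h. \<Sum>i\<in>UNIV. complex_of_real (h $ i) * E i x)) (at x)"
    using cpoly_add.IH(2) by (elim exE conjE)
  have "((\<lambda>x. p x + q x) has_derivative
      (\<lambda>h. \<Sum>i\<in>UNIV. complex_of_real (h $ i) * (D i x + E i x))) (at x)" for x
    using has_derivative_add[OF D(2)[rule_format] E(2)[rule_format], of x]
    by (simp add: sum.distrib distrib_left)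
  then show ?case using D(1) E(1)
    by (intro exI[of _ "\<lambda>i x. D i x + E i x"] conjI allI) (rule cpoly.cpoly_add, simp_all)
next
  case (cpoly_mult p q)
  obtain D where D: "\<forall>i. cpoly (D i)"
    "\<forall>x. (p has_derivative (\<lambda>h. \<Sum>i\<in>UNIV. complex_of_real (h $ i) * D i x)) (at x)"
    using cpoly_mult.IH(1) by (elim exE conjE)
  obtain E where E: "\<forall>i. cpoly (E i)"
    "\<forall>x. (q has_derivative (\<lambda>h. \<Sum>i\<in>UNIV. complex_of_real (h $ i) * E i x)) (at x)"
    using cpoly_mult.IH(2) by (elim exE conjE)
  note * = D(1)[rule_format] E(1)[rule_format] D(2)[rule_format] E(2)[rule_format]
  have "((\<lambda>x. p x * q x) has_derivative
      (\<lambda>h. \<Sum>i\<in>UNIV. complex_of_real (h $ i) * (p x * E i x + D i x * q x))) (at x)" for x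
  proof -
    have "((\<lambda>x. p x * q x) has_derivative (\<lambda>h. p x * (\<Sum>i\<in>UNIV. complex_of_real (h $ i) * E i x) +
       (\<Sum>i\<in>UNIV. complex_of_real (h $ i) * D i x) * q x)) (at x)"
      by (rule has_derivative_mult[OF *(3,4)])
    moreover have "p x * (\<Sum>i\<in>UNIV. complex_of_real (h $ i) * E i x) +
       (\<Sum>i\<in>UNIV. complex_of_real (h $ i) * D i x) * q x =
       (\<Sum>i\<in>UNIV. complex_of_real (h $ i) * (p x * E i x + D i x * q x))" for h
      unfolding sum_distrib_left sum_distrib_right sum.distrib[symmetric]
      by (intro sum.cong) (auto simp: algebra_simps)
    ultimately show ?thesis by simp
  qed
  then show ?case using * cpoly_mult.hyps
    by (intro exI[of _ "\<lambda>i x. p x * E i x + D i x * q x"] conjI allI)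
      (rule cpoly.cpoly_add; rule cpoly.cpoly_mult; simp)
qed

lemma grad_cpoly:
  fixes p :: "real^'n \<Rightarrow> complex"
  assumes "cpoly p"
  shows "cpoly (\<lambda>x. grad p x $ i)"
    and "(p has_derivative (\<lambda>h. \<Sum>i\<in>UNIV. complex_of_real (h $ i) * grad p x $ i)) (at x)"
proof -
  obtain D where D: "\<And>i. cpoly (D i)"
    "\<And>x. (p has_derivative (\<lambda>h. \<Sum>i\<in>UNIV. complex_of_real (h $ i) * D i x)) (at x)"
    using cpoly_has_derivative[OF assms] by blast
  have "grad p x $ i = D i x" for x i
  proof -
    have "frechet_derivative p (at x) = (\<lambda>h. \<Sum>i\<in>UNIV. complex_of_real (h $ i) * D i x)"
      by (rule frechet_derivative_at[OF D(2), symmetric])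
    moreover have "complex_of_real (axis i 1 $ j) * D j x = (if j = i then D j x else 0)" for j
      by (simp add: axis_def)
    ultimately show ?thesis by (simp add: grad_def)
  qed
  then show "cpoly (\<lambda>x. grad p x $ i)"
    "(p has_derivative (\<lambda>h. \<Sum>i\<in>UNIV. complex_of_real (h $ i) * grad p x $ i)) (at x)"
    using D by auto
qed

lemma continuous_on_cpoly:
  assumes "cpoly p"
  shows "continuous_on A p"
proof (rule continuous_at_imp_continuous_on, rule ballI)
  fix x
  show "isCont p x" by (rule has_derivative_continuous[OF grad_cpoly(2)[OF assms, of x]])
qed

lemma continuous_on_vec:
  fixes f :: "'a::topological_space \<Rightarrow> 'b::topological_space ^ 'n"
  assumes "\<And>i. continuous_on A (\<lambda>x. f x $ i)"
  shows "continuous_on A f"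
proof -
  have "continuous_on A (\<lambda>x. \<chi> i. f x $ i)" by (rule continuous_on_vec_lambda) (rule assms)
  moreover have "(\<lambda>x. \<chi> i. f x $ i) = f" by (simp add: fun_eq_iff vec_eq_iff)
  ultimately show ?thesis by (simp only:)
qed

lemma continuous_on_grad: "cpoly p \<Longrightarrow> continuous_on A (grad p)"
  by (rule continuous_on_vec, rule continuous_on_cpoly, rule grad_cpoly)

lemma cpoly_hess: "cpoly p \<Longrightarrow> cpoly (\<lambda>x. hess p x $ i $ j)"
  unfolding hess_def vec_lambda_beta by (rule grad_cpoly, rule grad_cpoly)

lemma continuous_on_hess: "cpoly p \<Longrightarrow> continuous_on A (hess p)"
  by (rule continuous_on_vec, rule continuous_on_vec, rule continuous_on_cpoly, rule cpoly_hess)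

section \<open>Extrapolation along rays\<close>

lemma lagrange_at_zero:
  fixes t :: "nat \<Rightarrow> real"
  assumes "inj t"
  shows "\<exists>L. \<forall>q :: real poly. degree q \<le> r \<longrightarrow> poly q 0 = (\<Sum>j\<le>r. L j * poly q (t j))"
proof (induction r)
  case 0
  show ?case by (intro exI[of _ "\<lambda>_. 1"]) (auto elim: degree_eq_zeroE)
next
  case (Suc r)
  then obtain L where L: "\<And>q :: real poly. degree q \<le> r \<Longrightarrow> poly q 0 = (\<Sum>j\<le>r. L j * poly q (t j))" by blast
  let ?s = "t (Suc r)"
  \<comment> \<open>Splitting off the node \<open>?s\<close> as q(x) = q(?s) + (x - ?s) q1(x) lowers
    the degree. These weights result from extrapolating \<open>q1\<close> with the old ones.\<close>
  define L' where "L' j = (if j = Suc r then 1 + ?s * (\<Sum>j\<le>r. L j / (t j - ?s)) else - ?s * L j / (t j - ?s))" for j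
  have "poly q 0 = (\<Sum>j\<le>Suc r. L' j * poly q (t j))" if q: "degree q \<le> Suc r" for q :: "real poly"
  proof -
    have "poly (q - [:poly q ?s:]) ?s = 0" by simp
    then obtain q1 where q1: "q - [:poly q ?s:] = [:- ?s, 1:] * q1"
      unfolding poly_eq_0_iff_dvd by (auto elim: dvdE)
    have qe: "q = [:poly q ?s:] + [:- ?s, 1:] * q1" using q1 by (simp add: algebra_simps)
    have d: "degree q1 \<le> r"
    proof (cases "q1 = 0")
      case False
      have "degree ([:- ?s, 1:] * q1) = Suc (degree q1)" using False by (subst degree_mult_eq) auto
      moreover have "degree (q - [:poly q ?s:]) \<le> Suc r" using q by (intro degree_diff_le) auto
      ultimately show ?thesis using q1 by simp
    qed simp
    have pt: "poly q x = poly q ?s + (x - ?s) * poly q1 x" for x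
      by (subst qe) (simp add: algebra_simps)
    have p1: "poly q1 (t j) = (poly q (t j) - poly q ?s) / (t j - ?s)" if "j \<le> r" for j
    proof -
      have "t j \<noteq> ?s" using assms that by (auto simp: inj_eq)
      then show ?thesis using pt[of "t j"] by (simp add: field_simps)
    qed
    have "poly q 0 = poly q ?s - ?s * poly q1 0" using pt[of 0] by simp
    also have "poly q1 0 = (\<Sum>j\<le>r. L j * poly q1 (t j))" by (rule L[OF d])
    also have "\<dots> = (\<Sum>j\<le>r. L j / (t j - ?s) * poly q (t j)) - (\<Sum>j\<le>r. L j / (t j - ?s)) * poly q ?s"
      by (simp add: p1 sum_distrib_right sum_subtractf[symmetric] diff_divide_distrib right_diff_distrib)
    also have "poly q ?s - ?s * \<dots> = (\<Sum>j\<le>Suc r. L' j * poly q (t j))"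
      by (simp add: L'_def algebra_simps sum_distrib_left sum_distrib_right sum_negf)
    finally show ?thesis .
  qed
  then show ?case by blast
qed

text \<open>On a ray a monomial of degree at most \<open>r\<close> becomes a univariate polynomial
  of degree at most \<open>r\<close>, so univariate extrapolation to 0 applies. The nodes 1 / (j +
  1) lie in (0, 1], as the homotheties require.\<close>

lemma polys_reproducing:
  obtains L :: "nat \<Rightarrow> real" where
    "\<And>p :: real^'n \<Rightarrow> complex. p \<in> polys r \<Longrightarrow> reproducing {..r} (\<lambda>j. 1 / (real j + 1)) L p"
proof -
  let ?t = "\<lambda>j. 1 / (real j + 1)"
  have "inj ?t" by (auto simp: inj_def)
  then obtain L where L: "\<And>q :: real poly. degree q \<le> r \<Longrightarrow> poly q 0 = (\<Sum>j\<le>r. L j * poly q (?t j))"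
    using lagrange_at_zero by blast
  have mono: "(\<Prod>i\<in>UNIV. (x $ i) ^ a i) = (\<Sum>j\<le>r. L j * (\<Prod>i\<in>UNIV. ((x + ?t j *\<^sub>R v) $ i) ^ a i))"
    if "sum a UNIV \<le> r" for x v :: "real^'n" and a
  proof -
    define q where "q = (\<Prod>i\<in>UNIV. [:x $ i, v $ i:] ^ a i)"
    have "degree q \<le> (\<Sum>i\<in>UNIV. degree ([:x $ i, v $ i:] ^ a i))"
      unfolding q_def using degree_prod_sum_le[of UNIV "\<lambda>i. [:x $ i, v $ i:] ^ a i"] by (simp add: o_def)
    also have "\<dots> \<le> (\<Sum>i\<in>UNIV. a i)"
    proof (rule sum_mono)
      fix i
      have "degree ([:x $ i, v $ i:] ^ a i) \<le> degree [:x $ i, v $ i:] * a i" by (rule degree_power_le)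
      also have "\<dots> \<le> 1 * a i" by (intro mult_right_mono) auto
      finally show "degree ([:x $ i, v $ i:] ^ a i) \<le> a i" by simp
    qed
    finally have "degree q \<le> r" using that by simp
    moreover have "poly q s = (\<Prod>i\<in>UNIV. ((x + s *\<^sub>R v) $ i) ^ a i)" for s
      by (simp add: q_def poly_prod)
    ultimately show ?thesis using L[of q] by simp
  qed
  show thesis
  proof (rule that)
    fix p :: "real^'n \<Rightarrow> complex" assume "p \<in> polys r"
    then obtain c where p: "p = (\<lambda>x. \<Sum>a | sum a UNIV \<le> r. c a * (\<Prod>i\<in>UNIV. complex_of_real (x $ i) ^ a i))"
      unfolding polys_def by blast
    show "reproducing {..r} ?t L p"
      unfolding reproducing_def
    proof (intro allI)
      fix x v :: "real^'n"
      have "p x = (\<Sum>a | sum a UNIV \<le> r. c a * complex_of_real (\<Prod>i\<in>UNIV. (x $ i) ^ a i))"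
        by (simp add: p)
      also have "\<dots> = (\<Sum>a | sum a UNIV \<le> r. \<Sum>j\<le>r. L j *\<^sub>R (c a * complex_of_real (\<Prod>i\<in>UNIV. ((x + ?t j *\<^sub>R v) $ i) ^ a i)))"
      proof (rule sum.cong[OF refl])
        fix a :: "'n \<Rightarrow> nat" assume "a \<in> {a. sum a UNIV \<le> r}"
        then have a: "sum a UNIV \<le> r" by simp
        show "c a * complex_of_real (\<Prod>i\<in>UNIV. (x $ i) ^ a i) =
          (\<Sum>j\<le>r. L j *\<^sub>R (c a * complex_of_real (\<Prod>i\<in>UNIV. ((x + ?t j *\<^sub>R v) $ i) ^ a i)))"
          unfolding mono[OF a, of x v] of_real_sum sum_distrib_left
          by (intro sum.cong) (auto simp: scaleR_conv_of_real)
      qed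
      also have "\<dots> = (\<Sum>j\<le>r. L j *\<^sub>R p (x + ?t j *\<^sub>R v))"
        by (subst sum.swap) (simp add: p scaleR_sum_right)
      finally show "p x = (\<Sum>j\<le>r. L j *\<^sub>R p (x + ?t j *\<^sub>R v))" .
    qed
  qed
qed

lemma reproducing_vec:
  fixes f :: "'a::real_vector \<Rightarrow> 'b::real_normed_vector ^ 'n"
  assumes "\<And>i. reproducing J t L (\<lambda>x. f x $ i)"
  shows "reproducing J t L f"
  unfolding reproducing_def vec_eq_iff
proof (intro allI)
  fix x v i
  have "f x $ i = (\<Sum>j\<in>J. L j *\<^sub>R f (x + t j *\<^sub>R v) $ i)"
    by (rule assms[unfolded reproducing_def, rule_format])
  also have "\<dots> = (\<Sum>j\<in>J. L j *\<^sub>R f (x + t j *\<^sub>R v)) $ i" by simp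
  finally show "f x $ i = (\<Sum>j\<in>J. L j *\<^sub>R f (x + t j *\<^sub>R v)) $ i" .
qed

lemma reproducing_linear:
  assumes "linear T" "reproducing J t L f"
  shows "reproducing J t L (\<lambda>x. T (f x))"
  unfolding reproducing_def
proof (intro allI)
  fix x v
  have "T (f x) = T (\<Sum>j\<in>J. L j *\<^sub>R f (x + t j *\<^sub>R v))"
    by (rule arg_cong[OF assms(2)[unfolded reproducing_def, rule_format]])
  then show "T (f x) = (\<Sum>j\<in>J. L j *\<^sub>R T (f (x + t j *\<^sub>R v)))"
    by (simp add: linear_sum[OF assms(1)] linear_scale[OF assms(1)])
qed

text \<open>For fixed \<open>v\<close> the identity holds at all \<open>x\<close>, and each shift of
  \<open>x\<close> has the identity as its derivative; differentiating in \<open>x\<close> keeps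
  nodes and weights.\<close>

lemma reproducing_grad:
  fixes p :: "real^'n \<Rightarrow> complex"
  assumes "cpoly p" "reproducing J t L p"
  shows "reproducing J t L (grad p)"
proof (rule reproducing_vec, unfold reproducing_def, intro allI)
  fix i and x v :: "real^'n"
  have d: "(p has_derivative frechet_derivative p (at x)) (at x)" for x
    using grad_cpoly(2)[OF assms(1)] frechet_derivative_works differentiable_def by blast
  have "((\<lambda>x. \<Sum>j\<in>J. L j *\<^sub>R p (x + t j *\<^sub>R v)) has_derivative
     (\<lambda>h. \<Sum>j\<in>J. L j *\<^sub>R frechet_derivative p (at (x + t j *\<^sub>R v)) h)) (at x)"
  proof (intro has_derivative_sum has_derivative_scaleR_right)
    fix j
    show "((\<lambda>x. p (x + t j *\<^sub>R v)) has_derivative frechet_derivative p (at (x + t j *\<^sub>R v))) (at x)"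
      by (rule has_derivative_compose[of "\<lambda>x. x + t j *\<^sub>R v" "\<lambda>h. h" x UNIV p "frechet_derivative p (at (x + t j *\<^sub>R v))", OF _ d])
        (auto intro!: derivative_eq_intros)
  qed
  moreover have e: "(\<lambda>x. \<Sum>j\<in>J. L j *\<^sub>R p (x + t j *\<^sub>R v)) = p"
    by (rule ext) (rule assms(2)[unfolded reproducing_def, rule_format, symmetric])
  ultimately have "(p has_derivative
     (\<lambda>h. \<Sum>j\<in>J. L j *\<^sub>R frechet_derivative p (at (x + t j *\<^sub>R v)) h)) (at x)"
    by (simp only: e)
  then have "frechet_derivative p (at x) = (\<lambda>h. \<Sum>j\<in>J. L j *\<^sub>R frechet_derivative p (at (x + t j *\<^sub>R v)) h)"
    by (rule has_derivative_unique[OF d])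
  then show "grad p x $ i = (\<Sum>j\<in>J. L j *\<^sub>R grad p (x + t j *\<^sub>R v) $ i)"
    unfolding grad_def vec_lambda_beta by (rule fun_cong)
qed

lemma reproducing_hess:
  fixes p :: "real^'n \<Rightarrow> complex"
  assumes "cpoly p" "reproducing J t L p"
  shows "reproducing J t L (hess p)"
proof (rule reproducing_vec)
  fix i
  have "linear (\<lambda>z :: complex^'n. z $ i)" by (rule linearI) auto
  then have "reproducing J t L (\<lambda>x. grad p x $ i)"
    by (rule reproducing_linear[OF _ reproducing_grad[OF assms]])
  then show "reproducing J t L (\<lambda>x. hess p x $ i)"
    unfolding hess_def using reproducing_grad[OF grad_cpoly(1)[OF assms(1)]] by simp
qed

lemma linear_matrix_sandwich:
  fixes A B :: "complex^'n^'n"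
  shows "linear (\<lambda>H :: complex^'n^'n. A ** H ** B)"
proof (rule linearI)
  have r: "(X + Y) ** B = X ** B + Y ** B" for X Y :: "complex^'n^'n"
    by (vector matrix_matrix_mult_def sum.distrib[symmetric] field_simps)
  show "A ** (H + H') ** B = A ** H ** B + A ** H' ** B" for H H'
    by (simp add: matrix_add_ldistrib r)
  show "A ** (c *\<^sub>R H) ** B = c *\<^sub>R (A ** H ** B)" for c H
    by (simp add: matrix_scalar_ac scalar_matrix_assoc)
qed

lemma reproducing_thess:
  fixes p :: "real^'n \<Rightarrow> complex"
  assumes "cpoly p" "reproducing J t L p"
  shows "reproducing J t L (thess \<nu> p)"
  using reproducing_linear[OF linear_matrix_sandwich reproducing_hess[OF assms]]
  unfolding thess_def[abs_def] by blast

lemma continuous_on_thess: "cpoly p \<Longrightarrow> continuous_on A (thess \<nu> p)"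
  unfolding thess_def[abs_def]
  using linear_continuous_on_compose[OF continuous_on_hess linear_matrix_sandwich] by blast

lemma continuous_on_tgrad: "cpoly p \<Longrightarrow> continuous_on A (tgrad \<nu> p)"
  unfolding tgrad_def[abs_def]
  by (rule continuous_on_vec) (auto simp: matrix_vector_mult_def
      intro!: continuous_on_cpoly cpoly_sum cpoly_mult cpoly_const grad_cpoly)

section \<open>Pointwise bounds for the bilinear expressions\<close>

lemma norm_sum_mult_cnj_le:
  fixes u v :: "'n::finite \<Rightarrow> 'b::real_normed_vector"
  assumes "\<And>i. norm (f i) \<le> norm (u i) * norm (v i)"
  shows "norm (\<Sum>i\<in>UNIV. f i) \<le> L2_set (\<lambda>i. norm (u i)) UNIV * L2_set (\<lambda>i. norm (v i)) UNIV"
proof -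
  have "norm (\<Sum>i\<in>UNIV. f i) \<le> (\<Sum>i\<in>UNIV. norm (u i) * norm (v i))"
    by (rule order_trans[OF norm_sum]) (intro sum_mono assms)
  also have "\<dots> = (\<Sum>i\<in>UNIV. \<bar>norm (u i)\<bar> * \<bar>norm (v i)\<bar>)" by simp
  also have "\<dots> \<le> L2_set (\<lambda>i. norm (u i)) UNIV * L2_set (\<lambda>i. norm (v i)) UNIV"
    by (rule L2_set_mult_ineq)
  finally show ?thesis .
qed

lemma cmod_cdot_le: "cmod (cdot u v) \<le> norm u * norm v"
  unfolding cdot_def norm_vec_def by (rule norm_sum_mult_cnj_le) (simp add: norm_mult)

lemma cmod_cddot_le: "cmod (cddot A B) \<le> norm A * norm B"
proof -
  have "cddot A B = (\<Sum>i\<in>UNIV. cdot (A $ i) (B $ i))" by (simp add: cddot_def cdot_def)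
  then show ?thesis
    unfolding norm_vec_def[of A] norm_vec_def[of B] using norm_sum_mult_cnj_le[of "\<lambda>i. cdot (A $ i) (B $ i)" "($) A" "($) B"]
    by (simp add: cmod_cdot_le)
qed

lemma cmod_dnormal_le: "cmod (dnormal n p x) \<le> norm (grad p x) * norm n"
proof -
  have "norm (\<Sum>i\<in>UNIV. grad p x $ i * complex_of_real (n $ i))
    \<le> L2_set (\<lambda>i. norm (grad p x $ i)) UNIV * L2_set (\<lambda>i. norm (complex_of_real (n $ i))) UNIV"
    by (rule norm_sum_mult_cnj_le) (simp add: norm_mult)
  then show ?thesis by (simp add: dnormal_def norm_vec_def)
qed

lemma norm_vec_le_card:
  fixes x :: "'b::real_normed_vector ^ 'n"
  assumes "\<And>i. norm (x $ i) \<le> c"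
  shows "norm x \<le> real CARD('n) * c"
proof -
  have "norm x \<le> (\<Sum>i\<in>UNIV. norm (x $ i))" unfolding norm_vec_def by (rule L2_set_le_sum) auto
  also have "\<dots> \<le> (\<Sum>i\<in>(UNIV::'n set). c)" by (intro sum_mono assms)
  finally show ?thesis by simp
qed

lemma norm_contract_le:
  fixes D :: "real^'n^'n^'n^'n"
  shows "norm (contract D H) \<le> real CARD('n) ^ 4 * norm D * norm H"
proof -
  have "norm (contract D H $ i $ j) \<le> real CARD('n) * (real CARD('n) * (norm D * norm H))" for i j
  proof -
    have c: "norm (complex_of_real (D $ i $ j $ k $ l) * H $ k $ l) \<le> norm D * norm H" for k l
    proof -
      have "\<bar>D $ i $ j $ k $ l\<bar> \<le> norm D"
        using order_trans[OF Finite_Cartesian_Product.norm_nth_le[of "D $ i $ j $ k" l] order_trans[OF Finite_Cartesian_Product.norm_nth_le[of "D $ i $ j" k]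
          order_trans[OF Finite_Cartesian_Product.norm_nth_le[of "D $ i" j] Finite_Cartesian_Product.norm_nth_le[of D i]]]] by simp
      moreover have "cmod (H $ k $ l) \<le> norm H" by (rule order_trans[OF Finite_Cartesian_Product.norm_nth_le Finite_Cartesian_Product.norm_nth_le])
      ultimately show ?thesis by (simp add: norm_mult mult_mono)
    qed
    have "norm (contract D H $ i $ j) \<le> (\<Sum>k\<in>(UNIV::'n set). \<Sum>l\<in>(UNIV::'n set). norm D * norm H)"
      unfolding contract_def vec_lambda_beta
      by (intro sum_norm_le c)
    then show ?thesis by simp
  qed
  then have "norm (contract D H) \<le> real CARD('n) * (real CARD('n) * (real CARD('n) * (real CARD('n) * (norm D * norm H))))"
    by (intro norm_vec_le_card)
  then show ?thesis by (simp add: power4_eq_xxxx mult.assoc)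
qed


section \<open>Divergence theorem and facets of simplices\<close>

text \<open>\<open>\<Phi> u\<close> is the error of the formula for the constant field
  \<open>u\<close>. It is linear in \<open>u\<close> and vanishes on an edge vector a' - a'',
  because the cone identities at the two ends can be subtracted; the edge vectors span the
  space.\<close>

lemma simplex_divergence:
  fixes K :: "'a::euclidean_space set" and f :: "'a \<Rightarrow> real"
  assumes K: "int DIM('a) simplex K" and nr: "\<And>e. e facet_of K \<Longrightarrow> outward K e (nr e)"
    and f: "\<And>x. (f has_derivative Df x) (at x)" "\<And>u. continuous_on UNIV (\<lambda>x. Df x u)"
  shows "(LINT x:K|lborel. Df x u) =
    (\<Sum>e | e facet_of K. (nr e \<bullet> u) * (LINT y:e|flat_measure e. f y))"
proof -
  let ?N = "DIM('a)"
  obtain C where C: "finite C" "\<not> affine_dependent C" "int (card C) = int ?N + 1" "K = convex hull C"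
    using K unfolding simplex by blast
  have N1: "1 \<le> ?N" using DIM_positive[where 'a='a] by linarith
  then have c2: "2 \<le> card C" using C(3) by linarith
  define F where "F a = convex hull (C - {a})" for a
  have fac: "{e. e facet_of K} = F ` C"
    using facet_of_convex_hull_affine_independent_alt[OF C(2)] c2 unfolding C(4) F_def by auto
  have notin: "a \<notin> affine hull F a" if "a \<in> C" for a
    using that C(2) by (auto simp: F_def affine_hull_convex_hull affine_dependent_def)
  have inF: "a' \<in> F a" if "a' \<in> C" "a' \<noteq> a" for a a' using that by (auto simp: F_def hull_inc)
  have inj: "inj_on F C"
  proof (rule inj_onI, rule ccontr)
    fix a a' assume *: "a \<in> C" "a' \<in> C" "F a = F a'" "a \<noteq> a'"
    then have "a \<in> F a" using inF[of a a'] by simp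
    then show False using notin[OF *(1)] by (simp add: hull_inc)
  qed
  have facF: "F a facet_of K" if "a \<in> C" for a using fac that by auto
  define I where "I a = (LINT y:F a|flat_measure (F a). f y)" for a
  have cK: "compact K" using K compact_simplex by blast
  have neK: "K \<noteq> {}" using C c2 by auto
  have fK: "flat_measure K = lborel"
    by (rule flat_measure_full) (rule interior_simplex_nonempty(3)[OF K])
  have iK: "set_integrable lborel K h" if "continuous_on UNIV h" for h :: "'a \<Rightarrow> real"
    using set_integrable_flat_measure[OF neK cK, of h] continuous_on_subset[OF that] by (simp add: fK)
  have lin: "linear (Df x)" for x using has_derivative_linear[OF f(1)] .
  have fc: "continuous_on UNIV f"
    by (intro continuous_at_imp_continuous_on ballI has_derivative_continuous[OF f(1)])
  have cont: "continuous_on UNIV (\<lambda>x. Df x (x - a))" for a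
  proof -
    have "Df x (x - a) = (\<Sum>i\<in>Basis. ((x - a) \<bullet> i) * Df x i)" for x
    proof -
      have "Df x (\<Sum>i\<in>Basis. ((x - a) \<bullet> i) *\<^sub>R i) = (\<Sum>i\<in>Basis. ((x - a) \<bullet> i) * Df x i)"
        by (simp only: linear_sum[OF lin] linear_scale[OF lin] real_scaleR_def)
      then show ?thesis by (simp only: euclidean_representation)
    qed
    then show ?thesis by (auto intro!: continuous_intros f(2))
  qed
  \<comment> \<open>With the apex at the vertex \<open>a\<close> the facets through \<open>a\<close>
    drop out, and on the opposite facet the normal component of y - a is the constant height
    \<open>d\<close>.\<close>
  have cone: "\<exists>d. (LINT x:K|lborel. ?N * f x + Df x (x - a)) = d * I a \<and>
      (\<forall>y\<in>F a. nr (F a) \<bullet> y - nr (F a) \<bullet> a = d)" if aC: "a \<in> C" for a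
  proof -
    let ?n = "nr (F a)"
    obtain b where ab: "affine hull (F a) = {x. ?n \<bullet> x = b}" "F a \<subseteq> {x. ?n \<bullet> x = b}" "norm ?n = 1"
      "F a \<noteq> {}" "compact (F a)" "convex (F a)" "K \<subseteq> {x. ?n \<bullet> x \<le> b}"
      by (rule outwardE[OF K facF[OF aC] nr[OF facF[OF aC]]])
    have "a \<in> K" using C aC by (simp add: hull_inc)
    then have lt: "?n \<bullet> a < b" using ab notin[OF aC] by (force simp: less_le)
    have "K = convex hull (insert a (F a))"
      unfolding F_def C(4) using hull_insert[of convex a "C - {a}"] aC by (simp add: insert_absorb)
    then have Kc: "K = (\<lambda>(\<theta>, y). a + \<theta> *\<^sub>R (y - a)) ` ({0..1} \<times> F a)"
      using convex_hull_insert_cone[OF ab(6,4)] by simp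
    have fm: "flat_measure {x. ?n \<bullet> x = b} = flat_measure (F a)"
      by (rule flat_measure_cong) (simp add: ab(1)[symmetric])
    have "(LINT x:K|lborel. ?N * f x + Df x (x - a)) = (b - ?n \<bullet> a) * I a"
      unfolding I_def fm[symmetric]
      by (rule integral_cone_radial[OF ab(3) _ _ ab(5,2) Kc f(1) cont]) (use lt in auto)
    then show ?thesis using ab(2) by (intro exI[of _ "b - ?n \<bullet> a"]) auto
  qed
  then have "\<forall>a\<in>C. \<exists>d. (LINT x:K|lborel. ?N * f x + Df x (x - a)) = d * I a \<and>
      (\<forall>y\<in>F a. nr (F a) \<bullet> y - nr (F a) \<bullet> a = d)" by blast
  from bchoice[OF this] obtain d where d0: "\<forall>a\<in>C. (LINT x:K|lborel. ?N * f x + Df x (x - a)) = d a * I a \<and>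
      (\<forall>y\<in>F a. nr (F a) \<bullet> y - nr (F a) \<bullet> a = d a)" by (rule exE)
  have d: "(LINT x:K|lborel. ?N * f x + Df x (x - a)) = d a * I a"
    "y \<in> F a \<Longrightarrow> nr (F a) \<bullet> y - nr (F a) \<bullet> a = d a" if "a \<in> C" for a y
    using bspec[OF d0 that] by blast+
  define \<Phi> where "\<Phi> u = (LINT x:K|lborel. Df x u) - (\<Sum>a\<in>C. (nr (F a) \<bullet> u) * I a)" for u
  have "linear \<Phi>"
  proof (rule linearI)
    show "\<Phi> (u + v) = \<Phi> u + \<Phi> v" for u v
      by (simp add: \<Phi>_def linear_add[OF lin] set_integral_add(2)[OF iK iK] f(2) inner_simps algebra_simps sum.distrib)
    show "\<Phi> (c *\<^sub>R u) = c *\<^sub>R \<Phi> u" for c u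
      by (simp add: \<Phi>_def linear_scale[OF lin] algebra_simps sum_distrib_left)
  qed
  moreover have \<Phi>0: "\<Phi> (a' - a'') = 0" if a: "a' \<in> C" "a'' \<in> C" for a' a''
  proof -
    have "(LINT x:K|lborel. Df x (a' - a'')) =
      (LINT x:K|lborel. (?N * f x + Df x (x - a'')) - (?N * f x + Df x (x - a')))"
      by (simp add: linear_diff[OF lin])
    also have "\<dots> = d a'' * I a'' - d a' * I a'"
      unfolding d(1)[OF a(1), symmetric] d(1)[OF a(2), symmetric]
      by (intro set_integral_diff(2) iK continuous_intros fc cont)
    also have "d a'' * I a'' - d a' * I a' =
       (\<Sum>a\<in>C. (if a = a'' then d a'' * I a'' else 0)) - (\<Sum>a\<in>C. (if a = a' then d a' * I a' else 0))"
      using a C(1) by simp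
    also have "\<dots> = (\<Sum>a\<in>C. (nr (F a) \<bullet> (a' - a'')) * I a)"
      unfolding sum_subtractf[symmetric]
    proof (rule sum.cong[OF refl])
      fix a assume aC: "a \<in> C"
      obtain y where y: "y \<in> F a" using facF[OF aC] by (auto simp: facet_of_def)
      \<comment> \<open>The normal functional of a facet is constant on its vertices and smaller by
        \<open>d a\<close> at the opposite vertex, so only the facets opposite to \<open>a'\<close>
        and \<open>a''\<close> contribute to the sum.\<close>
      have v: "nr (F a) \<bullet> z = nr (F a) \<bullet> a + (if z = a then 0 else d a)" if "z \<in> C" for z
        using d(2)[OF aC inF[OF that]] by auto
      show "(if a = a'' then d a'' * I a'' else 0) - (if a = a' then d a' * I a' else 0) =
         nr (F a) \<bullet> (a' - a'') * I a"
        unfolding inner_diff_right v[OF a(1)] v[OF a(2)] by auto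
    qed
    finally show ?thesis by (simp add: \<Phi>_def)
  qed
  moreover obtain a0 where a0: "a0 \<in> C" using c2 by fastforce
  have "affine hull C = UNIV"
    using interior_simplex_nonempty(3)[OF K] C by (simp add: affine_hull_convex_hull)
  then have "(\<lambda>x. a0 + x) ` span ((\<lambda>x. - a0 + x) ` C) = UNIV"
    using affine_hull_span_gen[of a0 C] a0 by (simp add: hull_inc)
  then have "span ((\<lambda>x. - a0 + x) ` C) = UNIV"
    by (metis add_left_cancel UNIV_I UNIV_eq_I image_iff)
  ultimately have "\<Phi> u = 0"
    using linear_eq_0_on_span[of \<Phi> "(\<lambda>x. - a0 + x) ` C" u] a0 by auto
  then show ?thesis
    unfolding fac \<Phi>_def I_def by (simp add: sum.reindex[OF inj])
qed

section \<open>Null sets of the surface measure\<close>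

lemma flat_measure_rel_boundary_null:
  fixes e :: "'a::euclidean_space set"
  assumes e: "closed e" "convex e" "e \<noteq> {}"
  shows "AE x in flat_measure e. x \<in> e \<longrightarrow> x \<in> rel_interior e"
proof -
  let ?A = "affine hull e" and ?P = "closest_point (affine hull e)"
  have A: "affine ?A" "closed ?A" "?A \<noteq> {}" using e by (auto intro: affine_closed)
  have Pc: "continuous_on UNIV ?P"
    using A by (intro continuous_on_closest_point) (auto intro: affine_imp_convex)
  have lin: "?P (u *\<^sub>R x + v *\<^sub>R y) = u *\<^sub>R ?P x + v *\<^sub>R ?P y" if "u + v = 1" for u v x y
  proof (rule closest_point_affine_eqI[OF A(1)])
    have P: "?P x \<in> ?A" "?P y \<in> ?A" using A closest_point_in_set by blast+
    show *: "u *\<^sub>R ?P x + v *\<^sub>R ?P y \<in> ?A" using P that A(1) by (simp add: mem_affine)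
    fix z assume "z \<in> ?A"
    then have "(x - ?P x) \<bullet> (z - (u *\<^sub>R ?P x + v *\<^sub>R ?P y)) = 0" "(y - ?P y) \<bullet> (z - (u *\<^sub>R ?P x + v *\<^sub>R ?P y)) = 0"
      using closest_point_affine_orthogonal[OF A(1,3) _ *] by blast+
    moreover have "u *\<^sub>R x + v *\<^sub>R y - (u *\<^sub>R ?P x + v *\<^sub>R ?P y) = u *\<^sub>R (x - ?P x) + v *\<^sub>R (y - ?P y)"
      by (simp add: algebra_simps)
    ultimately show "(u *\<^sub>R x + v *\<^sub>R y - (u *\<^sub>R ?P x + v *\<^sub>R ?P y)) \<bullet> (z - (u *\<^sub>R ?P x + v *\<^sub>R ?P y)) = 0"
      by (simp only: inner_add_left inner_scaleR_left)
  qed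
  \<comment> \<open>The points that project into \<open>e\<close> form a convex set of the ambient
    space, whose frontier is a Lebesgue null set; the points projecting to the relative boundary of
    \<open>e\<close> lie in that frontier.\<close>
  define Z where "Z = ?P -` e"
  have "convex Z"
    unfolding Z_def convex_def using convexD[OF e(2)] by (auto simp: lin)
  then have neg: "negligible (frontier Z)" by (rule negligible_convex_frontier)
  have sub: "x \<in> frontier Z" if "?P x \<in> e - rel_interior e" for x
  proof -
    have "x \<in> Z" using that by (simp add: Z_def)
    moreover have "x \<notin> interior Z"
    proof
      assume "x \<in> interior Z"
      then obtain \<epsilon> where \<epsilon>: "0 < \<epsilon>" "ball x \<epsilon> \<subseteq> Z" using mem_interior by blast
      have "ball (?P x) \<epsilon> \<inter> ?A \<subseteq> e"
      proof
        fix y assume y: "y \<in> ball (?P x) \<epsilon> \<inter> ?A"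
        have "?P (x + (y - ?P x)) = y"
        proof (rule closest_point_affine_eqI[OF A(1)])
          show "y \<in> ?A" using y by simp
          fix z assume "z \<in> ?A"
          then show "(x + (y - ?P x) - y) \<bullet> (z - y) = 0"
            using closest_point_affine_orthogonal[OF A(1,3), of z y x] y by simp
        qed
        moreover have "x + (y - ?P x) \<in> ball x \<epsilon>" using y by (simp add: dist_norm norm_minus_commute)
        ultimately show "y \<in> e" using \<epsilon> by (auto simp: Z_def)
      qed
      then have "?P x \<in> rel_interior e" using that \<epsilon> by (auto simp: mem_rel_interior_ball)
      then show False using that by simp
    qed
    ultimately show ?thesis using closure_subset by (auto simp: frontier_def)
  qed
  have mb: "e - rel_interior e \<in> sets borel"
  proof -
    have "closed (rel_frontier e)" using closed_rel_boundary[of e] e by (simp add: rel_frontier_def)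
    moreover have "rel_frontier e = e - rel_interior e" using e by (simp add: rel_frontier_def)
    ultimately show ?thesis by (metis borel_closed)
  qed
  have "emeasure (flat_measure e) (e - rel_interior e) = (\<integral>\<^sup>+x. indicator (e - rel_interior e) x \<partial>flat_measure e)"
    using mb by simp
  also have "\<dots> = ennreal (tube_factor e) *
     (\<integral>\<^sup>+x. indicator (e - rel_interior e) (?P x) * indicator (tube ?A) x \<partial>lborel)"
    by (rule nn_integral_flat_measure[OF e(3)]) (use mb in auto)
  also have "(\<integral>\<^sup>+x. indicator (e - rel_interior e) (?P x) * indicator (tube ?A) x \<partial>lborel) = 0"
  proof -
    have "AE x in lborel. x \<notin> frontier Z"
      using neg by (intro AE_not_in) (simp add: negligible_iff_null_sets null_sets_completion_iff)
    then have "AE x in lborel. indicator (e - rel_interior e) (?P x) * indicator (tube ?A) x = (0::ennreal)"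
      by eventually_elim (use sub in \<open>auto simp: indicator_def\<close>)
    then show ?thesis
      using nn_integral_cong_AE[of "\<lambda>x. indicator (e - rel_interior e) (?P x) * indicator (tube ?A) x" "\<lambda>x. 0" lborel]
      by simp
  qed
  finally have "e - rel_interior e \<in> null_sets (flat_measure e)" using mb by (simp add: null_sets_def)
  then have "AE x in flat_measure e. x \<notin> e - rel_interior e" by (rule AE_not_in)
  then show ?thesis by eventually_elim auto
qed

text \<open>Distinct hyperplanes are either parallel, and then disjoint, or transversal; in the
  latter case the points projecting into the intersection satisfy an affine equation with normal
  \<open>k\<close>. It discards boundary facets that meet the inlet or the outlet from another
  plane.\<close>

lemma flat_measure_hyperplane_null:
  fixes e :: "'a::euclidean_space set"
  assumes n: "norm n = 1" "affine hull e = {x. n \<bullet> x = b}" and m: "norm m = 1"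
    and ne: "affine hull e \<noteq> {x. m \<bullet> x = c}"
  shows "AE x in flat_measure e. x \<in> e \<longrightarrow> m \<bullet> x \<noteq> c"
proof -
  have nn: "n \<bullet> n = 1" "m \<bullet> m = 1" using n m by (simp_all add: norm_eq_1)
  have e0: "e \<noteq> {}"
  proof
    assume "e = {}"
    then have "b *\<^sub>R n \<notin> {x. n \<bullet> x = b}" using n by simp
    then show False by (simp add: nn)
  qed
  show ?thesis
  proof (cases "m = (m \<bullet> n) *\<^sub>R n")
    case True
    then have "norm m = \<bar>m \<bullet> n\<bar> * norm n" by (metis norm_scaleR)
    then have s: "m \<bullet> n = 1 \<or> m \<bullet> n = - 1" using n m by auto
    define \<sigma> where "\<sigma> = m \<bullet> n"
    have mn: "m = \<sigma> *\<^sub>R n" using True by (simp add: \<sigma>_def)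
    have mx: "m \<bullet> x = \<sigma> * (n \<bullet> x)" for x by (simp add: mn)
    have s': "\<sigma> = 1 \<or> \<sigma> = - 1" using s by (simp add: \<sigma>_def)
    have "\<sigma> * b \<noteq> c"
    proof
      assume "\<sigma> * b = c"
      then have "{x. m \<bullet> x = c} = {x. n \<bullet> x = b}" using s' unfolding mx by auto
      then show False using ne n by simp
    qed
    moreover have "n \<bullet> x = b" if "x \<in> e" for x using hull_inc[OF that, of affine] n by simp
    ultimately show ?thesis by (intro AE_I2) (simp add: mx)
  next
    case False
    define k where "k = m - (m \<bullet> n) *\<^sub>R n"
    define H where "H = {x. m \<bullet> x = c}"
    have k0: "k \<noteq> 0" using False by (simp add: k_def)
    have [measurable]: "H \<in> sets borel" unfolding H_def by (intro borel_closed closed_hyperplane)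
    have "emeasure (flat_measure e) H = (\<integral>\<^sup>+x. indicator H x \<partial>flat_measure e)" by simp
    also have "\<dots> = ennreal (tube_factor e) *
       (\<integral>\<^sup>+x. indicator H (closest_point (affine hull e) x) * indicator (tube (affine hull e)) x \<partial>lborel)"
      by (rule nn_integral_flat_measure[OF e0]) measurable
    also have "(\<integral>\<^sup>+x. indicator H (closest_point (affine hull e) x) * indicator (tube (affine hull e)) x \<partial>lborel) = 0"
    proof -
      have "negligible {x. k \<bullet> x = c - (m \<bullet> n) * b}" using k0 by (intro negligible_hyperplane) auto
      then have "AE x in lborel. x \<notin> {x. k \<bullet> x = c - (m \<bullet> n) * b}"
        by (intro AE_not_in) (simp add: negligible_iff_null_sets null_sets_completion_iff closed_hyperplane borel_closed)
      then have "AE x in lborel. indicator H (closest_point (affine hull e) x) * indicator (tube (affine hull e)) x = (0::ennreal)"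
      proof eventually_elim
        case (elim x)
        have "m \<bullet> (x - (n \<bullet> x - b) *\<^sub>R n) = k \<bullet> x + (m \<bullet> n) * b"
          by (simp add: k_def inner_simps algebra_simps)
        then have "closest_point (affine hull e) x \<notin> H"
          unfolding n(2) closest_point_hyperplane[OF n(1)] H_def using elim by auto
        then show ?case by simp
      qed
      then show ?thesis
        using nn_integral_cong_AE[of "\<lambda>x. indicator H (closest_point (affine hull e) x) * indicator (tube (affine hull e)) x" "\<lambda>x. 0" lborel]
        by simp
    qed
    finally have "H \<in> null_sets (flat_measure e)" by (simp add: null_sets_def)
    then have "AE x in flat_measure e. x \<notin> H" by (rule AE_not_in)
    then show ?thesis by eventually_elim (simp add: H_def)
  qed
qed

section \<open>Inverse inequality on a facet\<close>

lemma facet_inverse_inequality: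
  fixes E p :: "'a::euclidean_space set" and f :: "'a \<Rightarrow> 'b::euclidean_space"
  assumes E: "compact E" "convex E" and p: "compact p" "p \<subseteq> E" "p \<noteq> {}"
    and n: "norm n = 1" and hull: "affine hull p = affine hull E \<inter> {x. n \<bullet> x = b}"
    and \<rho>: "0 < \<rho>" and seg: "\<And>\<tau>. \<bar>\<tau>\<bar> \<le> \<rho> \<Longrightarrow> a + \<tau> *\<^sub>R n \<in> E"
    and f: "continuous_on UNIV f"
    and J: "finite J" "\<And>j. j \<in> J \<Longrightarrow> 0 < t j \<and> t j \<le> 1" and rep: "reproducing J t L f"
    and tf: "tube_factor p \<le> tube_factor E"
  shows "(LINT x:p|flat_measure p. (norm (f x))\<^sup>2) \<le>
    2 ^ DIM('a) * ((\<Sum>j\<in>J. (L j)\<^sup>2) * (\<Sum>j\<in>J. (1 / t j) ^ DIM('a))) / \<rho> *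
    (LINT x:E|flat_measure E. (norm (f x))\<^sup>2)"
proof -
  define c where "c = (\<Sum>j\<in>J. (L j)\<^sup>2) * (\<Sum>j\<in>J. (1 / t j) ^ DIM('a))"
  define I where "I = (LINT x:E|flat_measure E. (norm (f x))\<^sup>2)"
  define mE where "mE = measure (flat_measure E) E"
  define mp where "mp = measure (flat_measure p) p"
  have ne: "E \<noteq> {}" using p by auto
  have I0: "0 \<le> I" unfolding I_def by (rule set_lebesgue_integral_nonneg) simp
  have c0: "0 \<le> c" unfolding c_def using J(2) by (intro mult_nonneg_nonneg sum_nonneg) (auto simp: less_imp_le)
  have fin: "emeasure (flat_measure E) E < \<infinity>" "emeasure (flat_measure p) p < \<infinity>"
    using emeasure_flat_measure_finite[OF ne compact_imp_bounded[OF E(1)] borel_compact[OF E(1)]]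
      emeasure_flat_measure_finite[OF p(3) compact_imp_bounded[OF p(1)] borel_compact[OF p(1)]] by simp_all
  \<comment> \<open>The ratio of the tube factors is at most 1 by assumption, so the constant keeps
    no trace of the two codimensions.\<close>
  have pE: "mp \<le> 2 ^ DIM('a) / \<rho> * mE"
  proof -
    have "ennreal mp \<le> ennreal (2 ^ DIM('a) * tube_factor p / tube_factor E / \<rho>) * ennreal mE"
      unfolding mp_def mE_def
      using emeasure_flat_measure_facet_le[OF compact_imp_closed[OF E(1)] E(2) compact_imp_closed[OF p(1)] p(2,3) n hull \<rho> seg] fin
      by (simp add: emeasure_eq_ennreal_measure)
    also have "\<dots> = ennreal (2 ^ DIM('a) * tube_factor p / tube_factor E / \<rho> * mE)"
      by (rule ennreal_mult''[symmetric]) (simp add: mE_def)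
    finally have "mp \<le> 2 ^ DIM('a) * tube_factor p / tube_factor E / \<rho> * mE"
      using tube_factor_pos[of p] tube_factor_pos[of E] \<rho> by (subst (asm) ennreal_le_iff) (auto simp: mE_def)
    also have "\<dots> = 2 ^ DIM('a) / \<rho> * mE * (tube_factor p / tube_factor E)" by (simp add: mult_ac)
    also have "\<dots> \<le> 2 ^ DIM('a) / \<rho> * mE * 1"
      using tf tube_factor_pos[of E] \<rho> by (intro mult_left_mono) (auto simp: mE_def)
    finally show ?thesis by simp
  qed
  have bound: "mE * (norm (f x))\<^sup>2 \<le> c * I" if "x \<in> p" for x
    unfolding mE_def c_def I_def
    by (rule inverse_inequality_flat_measure[OF E _ f J rep]) (use that p in auto)
  have ip: "set_integrable (flat_measure p) p h" if "continuous_on UNIV h" for h :: "'a \<Rightarrow> real"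
    by (rule set_integrable_flat_measure[OF p(3,1) continuous_on_subset[OF that]]) simp
  have cf: "continuous_on UNIV (\<lambda>x. (norm (f x))\<^sup>2)" by (intro continuous_intros f)
  have const: "(LINT x:p|flat_measure p. B) = B * mp" for B :: real
    unfolding set_lebesgue_integral_def mp_def using fin p(1) by (simp add: borel_compact)
  have "(LINT x:p|flat_measure p. (norm (f x))\<^sup>2) \<le> 2 ^ DIM('a) * c / \<rho> * I"
  \<comment> \<open>If \<open>mE\<close> is 0 the pointwise bound says nothing, but then
    \<open>mp\<close> is 0 as well and the left side vanishes.\<close>
  proof (cases "mE = 0")
    case True
    then have "mp = 0" using pE by (simp add: mp_def antisym)
    obtain B where B: "\<And>x. x \<in> p \<Longrightarrow> (norm (f x))\<^sup>2 \<le> B"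
      using compact_imp_bounded[OF compact_continuous_image[OF continuous_on_subset[OF cf] p(1)]]
      by (force simp: bounded_iff)
    have "(LINT x:p|flat_measure p. (norm (f x))\<^sup>2) \<le> (LINT x:p|flat_measure p. B)"
      by (intro set_integral_mono ip cf B continuous_intros) auto
    also have "\<dots> = 0" unfolding const using \<open>mp = 0\<close> by simp
    also have "\<dots> \<le> 2 ^ DIM('a) * c / \<rho> * I" using c0 I0 \<rho> by simp
    finally show ?thesis .
  next
    case False
    then have mE: "0 < mE" by (simp add: mE_def zero_less_measure_iff)
    have "(LINT x:p|flat_measure p. (norm (f x))\<^sup>2) \<le> (LINT x:p|flat_measure p. c * I / mE)"
      using bound mE by (intro set_integral_mono ip cf continuous_intros) (auto simp: field_simps)
    also have "\<dots> = c * I / mE * mp" by (rule const)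
    also have "\<dots> \<le> c * I / mE * (2 ^ DIM('a) / \<rho> * mE)"
      using pE mE c0 I0 by (intro mult_left_mono) auto
    also have "\<dots> = 2 ^ DIM('a) * c / \<rho> * I" using mE by (simp add: field_simps)
    finally show ?thesis .
  qed
  then show ?thesis unfolding c_def I_def .
qed

section \<open>Sums over almost disjoint pieces and Cauchy-Schwarz\<close>

lemma nn_integral_sum_disjoint_le:
  fixes g :: "'a \<Rightarrow> ennreal"
  assumes "finite I" "\<And>i. i \<in> I \<Longrightarrow> q i \<le> (\<integral>\<^sup>+x. g x * indicator (R i) x \<partial>N)"
    and "\<And>i. i \<in> I \<Longrightarrow> R i \<subseteq> B" "\<And>i. i \<in> I \<Longrightarrow> R i \<in> sets N" "disjoint_family_on R I"
    and "(\<lambda>x. g x * indicator B x) \<in> borel_measurable N"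
  shows "(\<Sum>i\<in>I. q i) \<le> (\<integral>\<^sup>+x. g x * indicator B x \<partial>N)"
proof -
  have "(\<Sum>i\<in>I. q i) \<le> (\<Sum>i\<in>I. \<integral>\<^sup>+x. (g x * indicator B x) * indicator (R i) x \<partial>N)"
  proof (rule sum_mono)
    fix i assume i: "i \<in> I"
    have "q i \<le> (\<integral>\<^sup>+x. g x * indicator (R i) x \<partial>N)" by (rule assms(2)[OF i])
    also have "\<dots> = (\<integral>\<^sup>+x. (g x * indicator B x) * indicator (R i) x \<partial>N)"
      using assms(3)[OF i] by (intro nn_integral_cong) (auto simp: indicator_def)
    finally show "q i \<le> (\<integral>\<^sup>+x. (g x * indicator B x) * indicator (R i) x \<partial>N)" .
  qed
  also have "\<dots> = (\<integral>\<^sup>+x. (\<Sum>i\<in>I. (g x * indicator B x) * indicator (R i) x) \<partial>N)"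
    by (rule nn_integral_sum[symmetric])
      (rule borel_measurable_times_ennreal[OF assms(6) borel_measurable_indicator[OF assms(4)]])
  also have "\<dots> \<le> (\<integral>\<^sup>+x. g x * indicator B x \<partial>N)"
  proof (rule nn_integral_mono)
    fix x
    have "(\<Sum>i\<in>I. indicator (R i) x) \<le> (1::ennreal)"
      unfolding indicator_UN_disjoint[OF assms(1,5), symmetric] by (simp add: indicator_def)
    then have "(g x * indicator B x) * (\<Sum>i\<in>I. indicator (R i) x) \<le> (g x * indicator B x) * 1"
      by (intro mult_left_mono) auto
    then show "(\<Sum>i\<in>I. (g x * indicator B x) * indicator (R i) x) \<le> g x * indicator B x"
      by (simp add: sum_distrib_left)
  qed
  finally show ?thesis .
qed

text \<open>Without integrability the left side is 0 by convention.\<close>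

lemma ennreal_set_integral_le:
  assumes "\<And>x. x \<in> A \<Longrightarrow> 0 \<le> f x"
  shows "ennreal (LINT x:A|M. f x) \<le> (\<integral>\<^sup>+x. ennreal (f x) * indicator A x \<partial>M)"
proof (cases "set_integrable M A f")
  case True
  then show ?thesis using nn_integral_eq_set_lebesgue_integral[OF True assms] by simp
next
  case False
  then show ?thesis by (simp add: set_lebesgue_integral_def set_integrable_def not_integrable_integral_eq)
qed

text \<open>Closed simplices overlap in their boundaries; almost everywhere the \<open>A i\<close>
  may be replaced by disjoint sets \<open>R i\<close>, such as their interiors. The measures
  \<open>M i\<close> are those of the single facets and have to agree with \<open>N\<close> only
  where \<open>R i\<close> is nonempty, so that facets in other planes can be given an empty
  \<open>R i\<close>.\<close>

lemma sum_set_integral_disjoint_le: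
  fixes f :: "'a \<Rightarrow> real" and fi :: "'i \<Rightarrow> 'a \<Rightarrow> real"
  assumes I: "finite I" "\<And>i. i \<in> I \<Longrightarrow> AE x in M i. x \<in> A i \<longrightarrow> x \<in> R i \<and> fi i x = f x"
    and M: "\<And>i. i \<in> I \<Longrightarrow> R i \<noteq> {} \<Longrightarrow> M i = N"
    and R: "\<And>i. i \<in> I \<Longrightarrow> R i \<subseteq> B" "\<And>i. i \<in> I \<Longrightarrow> R i \<in> sets N" "disjoint_family_on R I"
    and f: "set_integrable N B f" "\<And>x. 0 \<le> f x" "\<And>i x. 0 \<le> fi i x"
  shows "(\<Sum>i\<in>I. LINT x:A i|M i. fi i x) \<le> (LINT x:B|N. f x)"
proof -
  have meas: "(\<lambda>x. ennreal (f x) * indicator B x) \<in> borel_measurable N"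
  proof -
    have "(\<lambda>x. ennreal (indicat_real B x * f x)) \<in> borel_measurable N"
      using f(1) unfolding set_integrable_def by simp
    moreover have "(\<lambda>x. ennreal (indicat_real B x * f x)) = (\<lambda>x. ennreal (f x) * indicator B x)"
      by (auto simp: indicator_def)
    ultimately show ?thesis by simp
  qed
  have "ennreal (\<Sum>i\<in>I. LINT x:A i|M i. fi i x) = (\<Sum>i\<in>I. ennreal (LINT x:A i|M i. fi i x))"
    by (rule sum_ennreal[symmetric]) (intro set_lebesgue_integral_nonneg f(3))
  also have "\<dots> \<le> (\<integral>\<^sup>+x. ennreal (f x) * indicator B x \<partial>N)"
  proof (rule nn_integral_sum_disjoint_le[OF I(1) _ R meas])
    fix i assume i: "i \<in> I"
    have "ennreal (LINT x:A i|M i. fi i x) \<le> (\<integral>\<^sup>+x. ennreal (fi i x) * indicator (A i) x \<partial>M i)"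
      by (rule ennreal_set_integral_le) (rule f(3))
    also have "\<dots> \<le> (\<integral>\<^sup>+x. ennreal (f x) * indicator (R i) x \<partial>M i)"
    proof (rule nn_integral_mono_AE)
      show "AE x in M i. ennreal (fi i x) * indicator (A i) x \<le> ennreal (f x) * indicator (R i) x"
        using I(2)[OF i] by eventually_elim (auto simp: indicator_def)
    qed
    also have "\<dots> = (\<integral>\<^sup>+x. ennreal (f x) * indicator (R i) x \<partial>N)"
      using M[OF i] by (cases "R i = {}") auto
    finally show "ennreal (LINT x:A i|M i. fi i x) \<le> (\<integral>\<^sup>+x. ennreal (f x) * indicator (R i) x \<partial>N)" .
  qed
  also have "\<dots> = ennreal (LINT x:B|N. f x)"
    by (rule nn_integral_eq_set_lebesgue_integral[OF f(1,2)])
  finally show ?thesis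
    by (subst (asm) ennreal_le_iff) (auto intro!: set_lebesgue_integral_nonneg f(2))
qed

text \<open>An integrand that is not integrable has integral 0 by convention, so domination by
  \<open>g\<close> is enough.\<close>

lemma norm_set_integral_le:
  fixes f :: "'a \<Rightarrow> 'b::{banach, second_countable_topology}"
  assumes "set_integrable M A g" "\<And>x. x \<in> A \<Longrightarrow> norm (f x) \<le> g x"
  shows "norm (LINT x:A|M. f x) \<le> (LINT x:A|M. g x)"
proof (cases "set_integrable M A f")
  case True
  have "norm (LINT x:A|M. f x) \<le> (LINT x:A|M. norm (f x))" by (rule set_integral_norm_bound[OF True])
  also have "\<dots> \<le> (LINT x:A|M. g x)"
    by (intro set_integral_mono set_integrable_norm True assms)
  finally show ?thesis .
next
  case False
  then have "(LINT x:A|M. f x) = 0"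
    by (simp add: set_lebesgue_integral_def set_integrable_def not_integrable_integral_eq)
  moreover have "0 \<le> (LINT x:A|M. g x)"
    by (rule set_lebesgue_integral_nonneg) (use assms(2) norm_ge_zero order_trans in blast)
  ultimately show ?thesis by simp
qed

text \<open>Young's inequality optimised: t = sqrt b / sqrt a if both are positive, otherwise t
  tends to 0 or to infinity.\<close>

lemma le_sqrt_mult_sqrt:
  assumes "0 \<le> a" "0 \<le> b" "\<And>t. 0 < t \<Longrightarrow> x \<le> (t * a + b / t) / 2"
  shows "x \<le> sqrt a * sqrt (b::real)"
proof -
  have small: "y \<le> 0" if "\<And>t. 0 < t \<Longrightarrow> y \<le> t * c" "0 \<le> c" for y c :: real
  proof (rule ccontr)
    assume "\<not> y \<le> 0"
    then have "y \<le> y / (2 * (c + 1)) * c" using that by (intro that) auto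
    then have "y * (2 * (c + 1)) \<le> y * c" using that(2) by (simp add: field_simps)
    then show False using \<open>\<not> y \<le> 0\<close> that(2) by (simp add: not_le)
  qed
  consider "a = 0" | "b = 0" | "0 < a" "0 < b" using assms by fastforce
  then show ?thesis
  proof cases
    case 1
    have "x \<le> t * (b / 2)" if "0 < t" for t using assms(3)[of "1 / t"] that 1 by (simp add: mult.commute)
    then show ?thesis using small[of x "b/2"] assms 1 by simp
  next
    case 2
    have "x \<le> t * (a / 2)" if "0 < t" for t using assms(3)[of t] that 2 by simp
    then show ?thesis using small[of x "a/2"] assms 2 by simp
  next
    case 3
    have *: "0 < sqrt a" "0 < sqrt b" "sqrt a * sqrt a = a" "sqrt b * sqrt b = b" using 3 by auto
    have "x \<le> (sqrt b / sqrt a * a + b / (sqrt b / sqrt a)) / 2" using 3 by (intro assms(3)) auto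
    also have "sqrt b / sqrt a * a = sqrt b * (a / sqrt a)" by simp
    also have "\<dots> = sqrt a * sqrt b" using 3 by (simp add: real_div_sqrt)
    also have "b / (sqrt b / sqrt a) = (b / sqrt b) * sqrt a" by simp
    also have "\<dots> = sqrt a * sqrt b" using 3 by (simp add: real_div_sqrt)
    finally show ?thesis by simp
  qed
qed

text \<open>One parameter \<open>t\<close> for all pieces makes this a Cauchy-Schwarz inequality for
  sum and integral together. Young's form of it is pointwise and involves the squares of
  \<open>a\<close> and \<open>b\<close> alone.\<close>

lemma sum_integral_Cauchy_Schwarz:
  fixes f :: "'i \<Rightarrow> 'a \<Rightarrow> 'b::{banach, second_countable_topology}"
  assumes "\<And>i. i \<in> I \<Longrightarrow> set_integrable (M i) (A i) (\<lambda>x. (a i x)\<^sup>2)"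
    and "\<And>i. i \<in> I \<Longrightarrow> set_integrable (M i) (A i) (\<lambda>x. (b i x)\<^sup>2)"
    and "\<And>i x. i \<in> I \<Longrightarrow> x \<in> A i \<Longrightarrow> norm (f i x) \<le> a i x * b i x"
  shows "norm (\<Sum>i\<in>I. LINT x:A i|M i. f i x) \<le>
     sqrt (\<Sum>i\<in>I. LINT x:A i|M i. (a i x)\<^sup>2) * sqrt (\<Sum>i\<in>I. LINT x:A i|M i. (b i x)\<^sup>2)"
proof (rule le_sqrt_mult_sqrt)
  fix t :: real assume t: "0 < t"
  have "norm (\<Sum>i\<in>I. LINT x:A i|M i. f i x) \<le> (\<Sum>i\<in>I. norm (LINT x:A i|M i. f i x))" by (rule norm_sum)
  also have "\<dots> \<le> (\<Sum>i\<in>I. (t * (LINT x:A i|M i. (a i x)\<^sup>2) + (LINT x:A i|M i. (b i x)\<^sup>2) / t) / 2)"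
  proof (rule sum_mono)
    fix i assume i: "i \<in> I"
    let ?g = "\<lambda>x. (t / 2) * (a i x)\<^sup>2 + (1 / (2 * t)) * (b i x)\<^sup>2"
    have int: "set_integrable (M i) (A i) (\<lambda>x. (t / 2) * (a i x)\<^sup>2)" "set_integrable (M i) (A i) (\<lambda>x. (1 / (2 * t)) * (b i x)\<^sup>2)"
      using assms(1,2)[OF i] by (intro set_integrable_mult_right; simp)+
    have "norm (LINT x:A i|M i. f i x) \<le> (LINT x:A i|M i. ?g x)"
    proof (rule norm_set_integral_le)
      show "set_integrable (M i) (A i) ?g" by (intro set_integral_add(1) int)
      fix x assume x: "x \<in> A i"
      have "0 \<le> (t * a i x - b i x)\<^sup>2 / (2 * t)" using t by simp
      also have "\<dots> = ?g x - a i x * b i x" using t by (simp add: field_simps power2_eq_square)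
      finally show "norm (f i x) \<le> ?g x" using assms(3)[OF i x] by simp
    qed
    also have "\<dots> = (t * (LINT x:A i|M i. (a i x)\<^sup>2) + (LINT x:A i|M i. (b i x)\<^sup>2) / t) / 2"
      using set_integral_add(2)[OF int] t by (simp add: field_simps)
    finally show "norm (LINT x:A i|M i. f i x) \<le> (t * (LINT x:A i|M i. (a i x)\<^sup>2) + (LINT x:A i|M i. (b i x)\<^sup>2) / t) / 2" .
  qed
  also have "\<dots> = (t * (\<Sum>i\<in>I. LINT x:A i|M i. (a i x)\<^sup>2) + (\<Sum>i\<in>I. LINT x:A i|M i. (b i x)\<^sup>2) / t) / 2"
    by (simp add: sum_distrib_left sum.distrib sum_divide_distrib[symmetric])
  finally show "norm (\<Sum>i\<in>I. LINT x:A i|M i. f i x) \<le> (t * (\<Sum>i\<in>I. LINT x:A i|M i. (a i x)\<^sup>2) + (\<Sum>i\<in>I. LINT x:A i|M i. (b i x)\<^sup>2) / t) / 2" .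
qed (auto intro!: sum_nonneg set_lebesgue_integral_nonneg)


text \<open>The power of 2 comes from the measure of a facet, the squared weights from
  Cauchy-Schwarz, and the last sum from the homotheties with ratios 1 / (j + 1). With the ambient
  dimension for \<open>N\<close> it serves fluid and plate elements alike.\<close>

definition inverse_const :: "nat \<Rightarrow> nat \<Rightarrow> (nat \<Rightarrow> real) \<Rightarrow> real" where
  "inverse_const N r L = 2 ^ N * ((\<Sum>j\<le>r. (L j)\<^sup>2) * (\<Sum>j\<le>r. (1 / (1 / (real j + 1))) ^ N))"

lemma inverse_const_nonneg: "0 \<le> inverse_const N r L"
  unfolding inverse_const_def by (intro mult_nonneg_nonneg sum_nonneg) auto

lemma simplex_facet_inverse_inequality:
  fixes K e :: "'a::euclidean_space set" and f :: "'a \<Rightarrow> 'b::euclidean_space"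
  assumes K: "int DIM('a) simplex K" "e facet_of K" and ball: "cball c \<rho> \<subseteq> K" "0 < \<rho>"
    and f: "continuous_on UNIV f" and rep: "reproducing {..r} (\<lambda>j. 1 / (real j + 1)) L f"
  shows "(LINT x:e|flat_measure e. (norm (f x))\<^sup>2) \<le>
    inverse_const DIM('a) r L / \<rho> * (LINT x:K|lborel. (norm (f x))\<^sup>2)"
proof -
  obtain n where n: "outward K e n" using outward_exists[OF K] by blast
  obtain b where 1: "affine hull e = {x. n \<bullet> x = b}" "norm n = 1" "e \<noteq> {}" "compact e"
    by (rule outwardE[OF K n])
  have fK: "flat_measure K = lborel"
    by (rule flat_measure_full) (rule interior_simplex_nonempty(3)[OF K(1)])
  have "n \<noteq> 0" using 1 by auto
  then have "aff_dim e = int DIM('a) - 1"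
    using aff_dim_affine_hull[of e] by (simp add: 1 aff_dim_hyperplane)
  then have tfe: "tube_factor e = 1 / 2" by (simp add: tube_factor_def unit_ball_vol_1)
  have tfK: "tube_factor K = 1" using aff_dim_simplex[OF K(1)] by (simp add: tube_factor_def)
  have "(LINT x:e|flat_measure e. (norm (f x))\<^sup>2) \<le>
    2 ^ DIM('a) * ((\<Sum>j\<in>{..r}. (L j)\<^sup>2) * (\<Sum>j\<in>{..r}. (1 / (1 / (real j + 1))) ^ DIM('a))) / \<rho> *
    (LINT x:K|flat_measure K. (norm (f x))\<^sup>2)"
  proof (rule facet_inverse_inequality[OF _ _ 1(4) _ 1(3) 1(2) _ ball(2) _ f _ _ rep])
    show "compact K" "convex K" using K compact_simplex convex_simplex by blast+
    show "e \<subseteq> K" using K facet_of_imp_subset by blast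
    show "affine hull e = affine hull K \<inter> {x. n \<bullet> x = b}"
      by (simp add: 1(1) interior_simplex_nonempty(3)[OF K(1)])
    show "c + \<tau> *\<^sub>R n \<in> K" if "\<bar>\<tau>\<bar> \<le> \<rho>" for \<tau> using that 1 by (intro subsetD[OF ball(1)]) (simp add: dist_norm)
    show "tube_factor e \<le> tube_factor K" by (simp add: tfe tfK)
  qed auto
  then show ?thesis by (simp add: inverse_const_def fK)
qed

lemma finite_card_simplex_facets:
  fixes K :: "'a::euclidean_space set"
  assumes "m simplex K"
  shows "finite {e. e facet_of K}" "int (card {e. e facet_of K}) \<le> m + 1"
proof -
  obtain C where C: "finite C" "\<not> affine_dependent C" "int (card C) = m + 1" "K = convex hull C"
    using assms unfolding simplex by blast
  have sub: "{e. e facet_of K} \<subseteq> (\<lambda>a. convex hull (C - {a})) ` C"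
    using facet_of_convex_hull_affine_independent_alt[OF C(2)] unfolding C(4) by auto
  show "finite {e. e facet_of K}" using finite_subset[OF sub] C by simp
  have "card {e. e facet_of K} \<le> card C" using surj_card_le[OF C(1) sub] .
  then show "int (card {e. e facet_of K}) \<le> m + 1" using C by simp
qed


section \<open>Broken trace inequality\<close>

lemma DERIV_max_square: "((\<lambda>t::real. (max 0 t)\<^sup>2) has_real_derivative 2 * max 0 t) (at t)"
proof -
  consider "t < 0" | "t > 0" | "t = 0" by linarith
  then show ?thesis
  proof cases
    case 1
    have "((\<lambda>t::real. 0) has_real_derivative 0) (at t)" by simp
    then have "((\<lambda>t::real. (max 0 t)\<^sup>2) has_real_derivative 0) (at t)"
      by (rule has_field_derivative_transform_within_open[of _ _ _ "{..<0}"]) (use 1 in auto)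
    then show ?thesis using 1 by simp
  next
    case 2
    have "((\<lambda>t::real. t\<^sup>2) has_real_derivative 2 * t) (at t)" by (auto intro!: derivative_eq_intros)
    then have "((\<lambda>t::real. (max 0 t)\<^sup>2) has_real_derivative 2 * t) (at t)"
      by (rule has_field_derivative_transform_within_open[of _ _ _ "{0<..}"]) (use 2 in auto)
    then show ?thesis using 2 by simp
  next
    case 3
    have "(\<lambda>h. ((max 0 h)\<^sup>2 - 0) / h) \<midarrow>0\<rightarrow> (0::real)"
    proof (rule Lim_null_comparison)
      show "\<forall>\<^sub>F h in at 0. norm (((max 0 h)\<^sup>2 - 0) / h) \<le> \<bar>h::real\<bar>"
        by (intro always_eventually allI) (auto simp: max_def power2_eq_square)
      show "(\<lambda>h::real. \<bar>h\<bar>) \<midarrow>0\<rightarrow> 0" by (rule tendsto_rabs_zero) (rule tendsto_ident_at)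
    qed
    then show ?thesis using 3 by (simp add: DERIV_def)
  qed
qed

text \<open>The divergence theorem asks for a continuously differentiable function, and squaring the
  positive part of a quadratic achieves this with explicit bounds: at most \<rho> ^ 4, and at least
  9/16 of that on the ball of half the radius.\<close>

definition cutoff :: "'a::euclidean_space \<Rightarrow> real \<Rightarrow> 'a \<Rightarrow> real" where
  "cutoff x0 \<rho> x = (max 0 (\<rho>\<^sup>2 - (x - x0) \<bullet> (x - x0)))\<^sup>2"

definition cutoff_deriv :: "'a::euclidean_space \<Rightarrow> real \<Rightarrow> 'a \<Rightarrow> 'a \<Rightarrow> real" where
  "cutoff_deriv x0 \<rho> x v = 2 * max 0 (\<rho>\<^sup>2 - (x - x0) \<bullet> (x - x0)) * (- 2 * ((x - x0) \<bullet> v))"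

lemma cutoff_has_derivative: "(cutoff x0 \<rho> has_derivative cutoff_deriv x0 \<rho> x) (at x)"
proof -
  let ?g = "\<lambda>x. \<rho>\<^sup>2 - (x - x0) \<bullet> (x - x0)"
  have g: "(?g has_derivative (\<lambda>v. - 2 * ((x - x0) \<bullet> v))) (at x)"
    by (auto intro!: derivative_eq_intros simp: inner_commute)
  have m: "((\<lambda>t. (max 0 t)\<^sup>2) has_derivative (*) (2 * max 0 (?g x))) (at (?g x))"
    using DERIV_max_square[of "?g x"] by (simp add: has_field_derivative_def)
  show ?thesis
    unfolding cutoff_def[abs_def] cutoff_deriv_def[abs_def] using has_derivative_compose[OF g m] by simp
qed

lemma cutoff_bounds:
  assumes "0 < \<rho>"
  shows "0 \<le> cutoff x0 \<rho> x" "cutoff x0 \<rho> x \<le> \<rho> ^ 4"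
    "norm v = 1 \<Longrightarrow> \<bar>cutoff_deriv x0 \<rho> x v\<bar> \<le> 4 * \<rho> ^ 3"
    "x \<notin> ball x0 \<rho> \<Longrightarrow> cutoff x0 \<rho> x = 0"
    "x \<in> ball x0 (\<rho> / 2) \<Longrightarrow> 9 / 16 * \<rho> ^ 4 \<le> cutoff x0 \<rho> x"
proof -
  let ?m = "max 0 (\<rho>\<^sup>2 - (x - x0) \<bullet> (x - x0))"
  have m: "0 \<le> ?m" "?m \<le> \<rho>\<^sup>2" by auto
  have xx: "(x - x0) \<bullet> (x - x0) = (norm (x - x0))\<^sup>2" by (simp add: power2_norm_eq_inner)
  show "0 \<le> cutoff x0 \<rho> x" by (simp add: cutoff_def)
  have "?m\<^sup>2 \<le> (\<rho>\<^sup>2)\<^sup>2" by (rule power_mono[OF m(2,1)])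
  then show "cutoff x0 \<rho> x \<le> \<rho> ^ 4" by (simp add: cutoff_def flip: power_mult)
  show "x \<notin> ball x0 \<rho> \<Longrightarrow> cutoff x0 \<rho> x = 0"
    using assms power_mono[of \<rho> "norm (x - x0)" 2] by (simp add: cutoff_def xx dist_norm norm_minus_commute)
  show "9 / 16 * \<rho> ^ 4 \<le> cutoff x0 \<rho> x" if "x \<in> ball x0 (\<rho> / 2)"
  proof -
    have "(norm (x - x0))\<^sup>2 \<le> (\<rho> / 2)\<^sup>2" using that by (intro power_mono) (auto simp: dist_norm norm_minus_commute)
    then have "3 / 4 * \<rho>\<^sup>2 \<le> \<rho>\<^sup>2 - (x - x0) \<bullet> (x - x0)" by (simp add: xx power_divide)
    then have "3 / 4 * \<rho>\<^sup>2 \<le> ?m" by (rule max.coboundedI2)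
    have "9 / 16 * \<rho> ^ 4 = (3 / 4 * \<rho>\<^sup>2)\<^sup>2" by (simp add: power2_eq_square power4_eq_xxxx)
    also have "\<dots> \<le> ?m\<^sup>2" using \<open>3 / 4 * \<rho>\<^sup>2 \<le> ?m\<close> by (rule power_mono) simp
    finally show ?thesis unfolding cutoff_def .
  qed
  show "\<bar>cutoff_deriv x0 \<rho> x v\<bar> \<le> 4 * \<rho> ^ 3" if v: "norm v = 1"
  proof (cases "norm (x - x0) \<le> \<rho>")
    case True
    have "\<bar>(x - x0) \<bullet> v\<bar> \<le> \<rho>" using Cauchy_Schwarz_ineq2[of "x - x0" v] True v by simp
    then have "?m * \<bar>(x - x0) \<bullet> v\<bar> \<le> \<rho>\<^sup>2 * \<rho>" using m by (intro mult_mono) auto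
    then show ?thesis using m by (simp add: cutoff_deriv_def abs_mult power3_eq_cube power2_eq_square)
  next
    case False
    then have "?m = 0" using assms power_mono[of \<rho> "norm (x - x0)" 2] by (simp add: xx)
    then show ?thesis using assms by (simp only: cutoff_deriv_def) simp
  qed
qed

definition dirderiv :: "(real^'n \<Rightarrow> complex) \<Rightarrow> real^'n \<Rightarrow> real^'n \<Rightarrow> complex" where
  "dirderiv p x v = (\<Sum>i\<in>UNIV. complex_of_real (v $ i) * grad p x $ i)"

lemma cmod_dirderiv_le: "cmod (dirderiv p x v) \<le> norm (grad p x) * norm v"
  using cmod_dnormal_le[of v p x] by (simp add: dirderiv_def dnormal_def mult.commute)

definition cut_square :: "real^'n \<Rightarrow> real \<Rightarrow> (real^'n \<Rightarrow> complex) \<Rightarrow> real^'n \<Rightarrow> real" where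
  "cut_square x0 \<rho> p x = cutoff x0 \<rho> x * (cmod (p x))\<^sup>2"

definition cut_square_deriv :: "real^'n \<Rightarrow> real \<Rightarrow> (real^'n \<Rightarrow> complex) \<Rightarrow> real^'n \<Rightarrow> real^'n \<Rightarrow> real" where
  "cut_square_deriv x0 \<rho> p x v =
     cutoff x0 \<rho> x * (2 * (p x \<bullet> dirderiv p x v)) + cutoff_deriv x0 \<rho> x v * (cmod (p x))\<^sup>2"

lemma cut_square_has_derivative:
  assumes "cpoly p"
  shows "(cut_square x0 \<rho> p has_derivative cut_square_deriv x0 \<rho> p x) (at x)"
proof -
  have p: "(p has_derivative dirderiv p x) (at x)"
    using grad_cpoly(2)[OF assms, of x] by (simp add: dirderiv_def[abs_def])
  have "((\<lambda>x. (cmod (p x))\<^sup>2) has_derivative (\<lambda>v. 2 * (p x \<bullet> dirderiv p x v))) (at x)"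
    unfolding power2_norm_eq_inner
    using has_derivative_inner[OF p p] by (simp add: inner_commute)
  from has_derivative_mult[OF cutoff_has_derivative this]
  show ?thesis unfolding cut_square_def[abs_def] cut_square_deriv_def[abs_def] .
qed

lemma continuous_on_cutoff: "continuous_on A (cutoff x0 \<rho>)"
  unfolding cutoff_def[abs_def] by (intro continuous_intros)

lemma continuous_on_dirderiv: "cpoly p \<Longrightarrow> continuous_on A (\<lambda>x. dirderiv p x v)"
  unfolding dirderiv_def by (intro continuous_intros continuous_on_cpoly grad_cpoly)

lemma continuous_on_cut_square: "cpoly p \<Longrightarrow> continuous_on A (cut_square x0 \<rho> p)"
  unfolding cut_square_def[abs_def] by (intro continuous_intros continuous_on_cpoly continuous_on_cutoff)

lemma continuous_on_cut_square_deriv: "cpoly p \<Longrightarrow> continuous_on A (\<lambda>x. cut_square_deriv x0 \<rho> p x v)"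
  unfolding cut_square_deriv_def cutoff_deriv_def
  by (intro continuous_intros continuous_on_cpoly continuous_on_cutoff continuous_on_dirderiv)

lemma cut_square_deriv_bound:
  assumes "0 < \<rho>" "norm v = 1"
  shows "\<bar>cut_square_deriv x0 \<rho> p x v\<bar> \<le> (4 * \<rho> ^ 3 + \<rho> ^ 4) * ((cmod (p x))\<^sup>2 + (norm (grad p x))\<^sup>2)"
proof -
  let ?a = "cmod (p x)" and ?g = "norm (grad p x)"
  have "\<bar>p x \<bullet> dirderiv p x v\<bar> \<le> ?a * ?g"
    using Cauchy_Schwarz_ineq2[of "p x" "dirderiv p x v"] cmod_dirderiv_le[of p x v] assms(2)
      mult_left_mono[of "cmod (dirderiv p x v)" ?g ?a] by simp
  then have "\<bar>2 * (p x \<bullet> dirderiv p x v)\<bar> \<le> ?a\<^sup>2 + ?g\<^sup>2"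
    using sum_squares_bound[of ?a ?g] by simp
  then have "\<bar>cutoff x0 \<rho> x * (2 * (p x \<bullet> dirderiv p x v))\<bar> \<le> \<rho> ^ 4 * (?a\<^sup>2 + ?g\<^sup>2)"
    unfolding abs_mult[of "cutoff x0 \<rho> x"] using cutoff_bounds(1,2)[OF assms(1), of x0 x] by (intro mult_mono) auto
  moreover have "\<bar>cutoff_deriv x0 \<rho> x v * ?a\<^sup>2\<bar> \<le> 4 * \<rho> ^ 3 * (?a\<^sup>2 + ?g\<^sup>2)"
    unfolding abs_mult[of "cutoff_deriv x0 \<rho> x v"] using cutoff_bounds(3)[OF assms, of x0 x] assms(1)
    by (intro mult_mono) auto
  ultimately show ?thesis unfolding cut_square_deriv_def by (simp add: algebra_simps)
qed

section \<open>Pairs of a simplex and one of its facets\<close>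

definition facet_pairs :: "'a::euclidean_space set set \<Rightarrow> ('a set \<times> 'a set) set" where
  "facet_pairs S = {(K, e). K \<in> S \<and> e facet_of K}"

text \<open>Pairs rather than facets, because the trace is taken from the simplex; a facet occurs in
  one such pair at most.\<close>

definition boundary_pairs :: "'a::euclidean_space set set \<Rightarrow> ('a set \<times> 'a set) set" where
  "boundary_pairs S = {(K, e). K \<in> S \<and> e facet_of K \<and> e \<notin> interior_facets S}"

text \<open>A facet has at most two simplices, so the interior pairs are exactly those given by
  \<open>s1\<close> and \<open>s2\<close>. The rearrangement brings together the two contributions
  of an interior facet.\<close>

lemma facet_pairs_split:
  fixes S :: "'a::euclidean_space set set" and \<Psi> :: "'a set \<Rightarrow> 'a set \<Rightarrow> 'b::comm_monoid_add"
  assumes S: "triangulation S" "\<And>K. K \<in> S \<Longrightarrow> int DIM('a) simplex K"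
    and s: "\<And>e. e \<in> interior_facets S \<Longrightarrow>
       s1 e \<in> S \<and> s2 e \<in> S \<and> s1 e \<noteq> s2 e \<and> e facet_of s1 e \<and> e facet_of s2 e"
  shows "finite (facet_pairs S)" "finite (boundary_pairs S)" "finite (interior_facets S)"
    and "(\<Sum>K\<in>S. \<Sum>e | e facet_of K. \<Psi> K e) =
      (\<Sum>(K, e)\<in>boundary_pairs S. \<Psi> K e) + (\<Sum>e\<in>interior_facets S. \<Psi> (s1 e) e + \<Psi> (s2 e) e)"
proof -
  have finS: "finite S" using S(1) by (simp add: triangulation_def)
  have ff: "finite {e. e facet_of K}" if "K \<in> S" for K using finite_card_simplex_facets(1)[OF S(2)[OF that]] .
  have P: "facet_pairs S = (SIGMA K:S. {e. e facet_of K})" by (auto simp: facet_pairs_def)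
  show f1: "finite (facet_pairs S)" unfolding P using finS ff by auto
  show f2: "finite (boundary_pairs S)"
    by (rule finite_subset[OF _ f1]) (auto simp: boundary_pairs_def facet_pairs_def)
  have "interior_facets S \<subseteq> snd ` facet_pairs S"
    by (force simp: interior_facets_def facet_pairs_def)
  then show f3: "finite (interior_facets S)" using f1 finite_surj by blast
  let ?I1 = "(\<lambda>e. (s1 e, e)) ` interior_facets S" and ?I2 = "(\<lambda>e. (s2 e, e)) ` interior_facets S"
  have u: "facet_pairs S = boundary_pairs S \<union> (?I1 \<union> ?I2)"
  proof (intro equalityI subsetI)
    fix z assume z: "z \<in> facet_pairs S"
    obtain K e where Ke: "z = (K, e)" "K \<in> S" "e facet_of K" using z by (auto simp: facet_pairs_def)
    show "z \<in> boundary_pairs S \<union> (?I1 \<union> ?I2)"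
    proof (cases "e \<in> interior_facets S")
      case True
      have "K = s1 e \<or> K = s2 e"
        by (rule facet_at_most_two[OF S]) (use s[OF True] Ke in auto)
      then show ?thesis using True Ke by auto
    qed (use Ke in \<open>auto simp: boundary_pairs_def\<close>)
  next
    fix z assume "z \<in> boundary_pairs S \<union> (?I1 \<union> ?I2)"
    then show "z \<in> facet_pairs S" using s by (auto simp: boundary_pairs_def facet_pairs_def)
  qed
  have d1: "boundary_pairs S \<inter> (?I1 \<union> ?I2) = {}" by (auto simp: boundary_pairs_def)
  have d2: "?I1 \<inter> ?I2 = {}" using s by auto
  have "(\<Sum>K\<in>S. \<Sum>e | e facet_of K. \<Psi> K e) = (\<Sum>(K, e)\<in>facet_pairs S. \<Psi> K e)"
    unfolding P using finS ff by (subst sum.Sigma) auto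
  also have "\<dots> = (\<Sum>(K, e)\<in>boundary_pairs S. \<Psi> K e) + ((\<Sum>(K, e)\<in>?I1. \<Psi> K e) + (\<Sum>(K, e)\<in>?I2. \<Psi> K e))"
    unfolding u using f2 f3 d1 d2 by (subst sum.union_disjoint; simp add: sum.union_disjoint)
  also have "(\<Sum>(K, e)\<in>?I1. \<Psi> K e) = (\<Sum>e\<in>interior_facets S. \<Psi> (s1 e) e)"
    by (subst sum.reindex) (auto simp: inj_on_def)
  also have "(\<Sum>(K, e)\<in>?I2. \<Psi> K e) = (\<Sum>e\<in>interior_facets S. \<Psi> (s2 e) e)"
    by (subst sum.reindex) (auto simp: inj_on_def)
  finally show "(\<Sum>K\<in>S. \<Sum>e | e facet_of K. \<Psi> K e) =
      (\<Sum>(K, e)\<in>boundary_pairs S. \<Psi> K e) + (\<Sum>e\<in>interior_facets S. \<Psi> (s1 e) e + \<Psi> (s2 e) e)"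
    by (simp add: sum.distrib)
qed


lemma boundary_pairsD:
  assumes "(K, e) \<in> boundary_pairs S"
  shows "K \<in> S" "e facet_of K" "\<And>K'. K' \<in> S \<Longrightarrow> e facet_of K' \<Longrightarrow> K' = K"
  using assms unfolding boundary_pairs_def interior_facets_def by auto

lemma set_lebesgue_integral_eq_0:
  "(\<And>x. x \<in> A \<Longrightarrow> f x = 0) \<Longrightarrow> (LINT x:A|M. f x) = 0"
  unfolding set_lebesgue_integral_def
  by (subst Bochner_Integration.integral_cong[of M M _ "\<lambda>x. 0"]) (auto simp: indicator_def)

lemma simplex_set_integrable:
  fixes K :: "'a::euclidean_space set" and f :: "'a \<Rightarrow> 'b::euclidean_space"
  assumes "int DIM('a) simplex K" "continuous_on UNIV f"
  shows "set_integrable lborel K f"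
    and "e facet_of K \<Longrightarrow> set_integrable (flat_measure e) e f"
proof -
  have ne: "K \<noteq> {}" using interior_simplex_nonempty(1)[OF assms(1)] by auto
  have fK: "flat_measure K = lborel"
    by (rule flat_measure_full) (rule interior_simplex_nonempty(3)[OF assms(1)])
  show "set_integrable lborel K f"
    using set_integrable_flat_measure[OF ne compact_simplex[OF assms(1)] continuous_on_subset[OF assms(2)]]
    by (simp add: fK)
  assume e: "e facet_of K"
  show "set_integrable (flat_measure e) e f"
    using simplex_facetE[OF assms(1) e]
    by (metis set_integrable_flat_measure continuous_on_subset[OF assms(2)] subset_UNIV)
qed

lemma set_lebesgue_integral_sum:
  fixes f :: "'i \<Rightarrow> 'a \<Rightarrow> real"
  assumes "\<And>i. i \<in> I \<Longrightarrow> set_integrable M A (f i)"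
  shows "(LINT x:A|M. \<Sum>i\<in>I. f i x) = (\<Sum>i\<in>I. LINT x:A|M. f i x)"
  using assms unfolding set_lebesgue_integral_def set_integrable_def
  by (simp add: scaleR_sum_right sum_distrib_left)

lemma chart_trace_estimate:
  fixes U :: "(real^'n) set"
  assumes U: "open U" and S: "triangulation S" "\<And>K. K \<in> S \<Longrightarrow> int CARD('n) simplex K" "\<Union>S = closure U"
    and u: "norm u = 1" and g: "L-lipschitz_on UNIV g" and \<rho>: "0 < \<rho>"
    and chart: "\<And>y. y \<in> ball x0 \<rho> \<Longrightarrow> y \<in> U \<longleftrightarrow> g (y - (y \<bullet> u) *\<^sub>R u) < y \<bullet> u"
    and s: "\<And>e. e \<in> interior_facets S \<Longrightarrow>
       s1 e \<in> S \<and> s2 e \<in> S \<and> s1 e \<noteq> s2 e \<and> e facet_of s1 e \<and> e facet_of s2 e"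
    and p: "\<And>K. K \<in> S \<Longrightarrow> cpoly (p K)"
  shows "1 / (L + 2) * (\<Sum>(K, e)\<in>boundary_pairs S. LINT x:e|flat_measure e. cut_square x0 \<rho> (p K) x) \<le>
     (4 * \<rho> ^ 3 + \<rho> ^ 4) * (\<Sum>K\<in>S. LINT x:K|lborel. (cmod (p K x))\<^sup>2 + (norm (grad (p K) x))\<^sup>2) +
     \<rho> ^ 4 * (\<Sum>e\<in>interior_facets S. LINT x:e|flat_measure e.
        cmod (p (s1 e) x - p (s2 e) x) * (cmod (p (s1 e) x) + cmod (p (s2 e) x)))"
proof -
  have S2: "int DIM(real^'n) simplex K" if "K \<in> S" for K using S(2)[OF that] by simp
  have L: "0 \<le> L" using g by (rule lipschitz_on_nonneg)
  define nr where "nr K e = (SOME n. outward K e n)" for K e :: "(real^'n) set"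
  have nr: "outward K e (nr K e)" if "K \<in> S" "e facet_of K" for K e
    unfolding nr_def using outward_exists[OF S2[OF that(1)] that(2)] by (metis someI_ex)
  define I where "I K e = (LINT x:e|flat_measure e. cut_square x0 \<rho> (p K) x)" for K e
  define \<Psi> where "\<Psi> K e = (nr K e \<bullet> u) * I K e" for K e
  define A where "A K = (LINT x:K|lborel. cut_square_deriv x0 \<rho> (p K) x u)" for K
  define Q where "Q K = (LINT x:K|lborel. (cmod (p K x))\<^sup>2 + (norm (grad (p K) x))\<^sup>2)" for K
  define J where "J e = (LINT x:e|flat_measure e.
        cmod (p (s1 e) x - p (s2 e) x) * (cmod (p (s1 e) x) + cmod (p (s2 e) x)))" for e
  have I0: "0 \<le> I K e" for K e
    unfolding I_def cut_square_def by (intro set_lebesgue_integral_nonneg mult_nonneg_nonneg cutoff_bounds(1)[OF \<rho>]) simp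
  have "A K = (\<Sum>e | e facet_of K. \<Psi> K e)" if "K \<in> S" for K
    unfolding A_def \<Psi>_def I_def
    by (rule simplex_divergence[OF S2[OF that] _ cut_square_has_derivative[OF p[OF that]]
          continuous_on_cut_square_deriv[OF p[OF that]]]) (rule nr[OF that])
  then have "(\<Sum>K\<in>S. A K) = (\<Sum>K\<in>S. \<Sum>e | e facet_of K. \<Psi> K e)" by simp
  also have "\<dots> = (\<Sum>(K, e)\<in>boundary_pairs S. \<Psi> K e) + (\<Sum>e\<in>interior_facets S. \<Psi> (s1 e) e + \<Psi> (s2 e) e)"
    by (rule facet_pairs_split(4)[OF S(1) S2 s])
  finally have eq: "(\<Sum>(K, e)\<in>boundary_pairs S. - \<Psi> K e) =
     (\<Sum>K\<in>S. - A K) + (\<Sum>e\<in>interior_facets S. \<Psi> (s1 e) e + \<Psi> (s2 e) e)"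
    by (simp add: sum_negf case_prod_beta)
  have b: "1 / (L + 2) * I K e \<le> - \<Psi> K e" if "(K, e) \<in> boundary_pairs S" for K e
  proof -
    note Ke = boundary_pairsD[OF that]
    show ?thesis
    \<comment> \<open>The bound on the normal needs a relative interior point of \<open>e\<close> in
      the ball. If there is none, the closure of the relative interior, which is \<open>e\<close>,
      misses the open ball as well, and the cutoff vanishes on \<open>e\<close>.\<close>
    proof (cases "rel_interior e \<inter> ball x0 \<rho> = {}")
      case True
      have "convex e" "closed e"
        using simplex_facetE[OF S2[OF Ke(1)] Ke(2)] compact_imp_closed by metis+
      then have "e = closure (rel_interior e)" by (simp add: convex_closure_rel_interior closure_closed)
      then have "e \<inter> ball x0 \<rho> = {}"
        using True open_Int_closure_eq_empty[of "ball x0 \<rho>" "rel_interior e"] by (simp add: Int_commute)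
      then have "I K e = 0"
        unfolding I_def cut_square_def
        by (intro set_lebesgue_integral_eq_0) (metis cutoff_bounds(4)[OF \<rho>] disjoint_iff mult_zero_left)
      then show ?thesis by (simp add: \<Psi>_def)
    next
      case False
      then obtain x where x: "x \<in> rel_interior e" "x \<in> ball x0 \<rho>" by auto
      have "1 / (L + 2) \<le> - (nr K e \<bullet> u)"
        by (rule boundary_facet_normal[OF U S Ke nr[OF Ke(1,2)] u g chart x])
      then have "1 / (L + 2) * I K e \<le> - (nr K e \<bullet> u) * I K e" using I0 by (rule mult_right_mono)
      then show ?thesis by (simp add: \<Psi>_def)
    qed
  qed
  \<comment> \<open>Opposite normals leave the difference of the squared moduli, which is at most
    the modulus of the jump times the sum of the moduli.\<close>
  have i: "\<Psi> (s1 e) e + \<Psi> (s2 e) e \<le> \<rho> ^ 4 * J e" if "e \<in> interior_facets S" for e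
  proof -
    note se = s[OF that]
    have n1: "outward (s1 e) e (nr (s1 e) e)" and n2: "outward (s2 e) e (nr (s2 e) e)" using nr se by blast+
    have "outward (s2 e) e (- nr (s1 e) e)"
      by (rule outward_opposite[OF S(1) S2 _ _ _ _ _ n1, of "s2 e"]) (use se in auto)
    then have n: "nr (s2 e) e = - nr (s1 e) e"
      using outward_unique[OF S2 _ n2] se by blast
    have int: "set_integrable (flat_measure e) e h" if "continuous_on UNIV h" for h :: "real^'n \<Rightarrow> real"
      using simplex_set_integrable(2)[OF S2 that] se by blast
    have cp: "cpoly (p (s1 e))" "cpoly (p (s2 e))" using p se by auto
    have "I (s1 e) e - I (s2 e) e =
      (LINT x:e|flat_measure e. cut_square x0 \<rho> (p (s1 e)) x - cut_square x0 \<rho> (p (s2 e)) x)"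
      unfolding I_def by (rule set_integral_diff(2)[symmetric]) (intro int continuous_on_cut_square cp)+
    then have "\<bar>I (s1 e) e - I (s2 e) e\<bar> \<le> (LINT x:e|flat_measure e.
        \<rho> ^ 4 * (cmod (p (s1 e) x - p (s2 e) x) * (cmod (p (s1 e) x) + cmod (p (s2 e) x))))"
      unfolding real_norm_def[symmetric]
    proof (elim ssubst, intro norm_set_integral_le)
      show "set_integrable (flat_measure e) e (\<lambda>x. \<rho> ^ 4 * (cmod (p (s1 e) x - p (s2 e) x) * (cmod (p (s1 e) x) + cmod (p (s2 e) x))))"
        by (intro int continuous_intros continuous_on_cpoly cp)
      fix x
      let ?a = "cmod (p (s1 e) x)" and ?b = "cmod (p (s2 e) x)"
      have "?a\<^sup>2 - ?b\<^sup>2 = (?a - ?b) * (?a + ?b)" by (simp add: power2_eq_square algebra_simps)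
      then have "\<bar>?a\<^sup>2 - ?b\<^sup>2\<bar> = \<bar>?a - ?b\<bar> * (?a + ?b)" by (simp add: abs_mult)
      also have "\<dots> \<le> cmod (p (s1 e) x - p (s2 e) x) * (?a + ?b)"
        by (intro mult_right_mono norm_triangle_ineq3) auto
      finally have "cutoff x0 \<rho> x * \<bar>?a\<^sup>2 - ?b\<^sup>2\<bar> \<le> \<rho> ^ 4 * (cmod (p (s1 e) x - p (s2 e) x) * (?a + ?b))"
        using cutoff_bounds(1,2)[OF \<rho>, of x0 x] by (intro mult_mono) auto
      then show "norm (cut_square x0 \<rho> (p (s1 e)) x - cut_square x0 \<rho> (p (s2 e)) x)
        \<le> \<rho> ^ 4 * (cmod (p (s1 e) x - p (s2 e) x) * (?a + ?b))"
        using cutoff_bounds(1)[OF \<rho>, of x0 x]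
        by (simp add: cut_square_def right_diff_distrib[symmetric] abs_mult)
    qed
    also have "\<dots> = \<rho> ^ 4 * J e" by (simp add: J_def)
    finally have le: "\<bar>I (s1 e) e - I (s2 e) e\<bar> \<le> \<rho> ^ 4 * J e" .
    have "\<bar>nr (s1 e) e \<bullet> u\<bar> \<le> 1"
      using Cauchy_Schwarz_ineq2[of "nr (s1 e) e" u] u n1 by (simp add: outward_def)
    then have "\<bar>(nr (s1 e) e \<bullet> u) * (I (s1 e) e - I (s2 e) e)\<bar> \<le> 1 * (\<rho> ^ 4 * J e)"
      unfolding abs_mult using le by (intro mult_mono) auto
    then show ?thesis by (simp add: \<Psi>_def n algebra_simps)
  qed
  have a: "- A K \<le> (4 * \<rho> ^ 3 + \<rho> ^ 4) * Q K" if "K \<in> S" for K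
  proof -
    have "norm (A K) \<le> (LINT x:K|lborel. (4 * \<rho> ^ 3 + \<rho> ^ 4) * ((cmod (p K x))\<^sup>2 + (norm (grad (p K) x))\<^sup>2))"
      unfolding A_def
    proof (rule norm_set_integral_le)
      show "set_integrable lborel K (\<lambda>x. (4 * \<rho> ^ 3 + \<rho> ^ 4) * ((cmod (p K x))\<^sup>2 + (norm (grad (p K) x))\<^sup>2))"
        by (intro simplex_set_integrable(1)[OF S2[OF that]] continuous_intros continuous_on_cpoly continuous_on_grad p that)
    qed (use cut_square_deriv_bound[OF \<rho> u] in auto)
    then show ?thesis by (simp add: Q_def)
  qed
  have "1 / (L + 2) * (\<Sum>(K, e)\<in>boundary_pairs S. I K e) = (\<Sum>(K, e)\<in>boundary_pairs S. 1 / (L + 2) * I K e)"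
    by (simp add: sum_distrib_left case_prod_beta)
  also have "\<dots> \<le> (\<Sum>(K, e)\<in>boundary_pairs S. - \<Psi> K e)"
    by (intro sum_mono) (use b in auto)
  also have "\<dots> \<le> (\<Sum>K\<in>S. (4 * \<rho> ^ 3 + \<rho> ^ 4) * Q K) + (\<Sum>e\<in>interior_facets S. \<rho> ^ 4 * J e)"
    unfolding eq by (intro add_mono sum_mono a i)
  also have "\<dots> = (4 * \<rho> ^ 3 + \<rho> ^ 4) * (\<Sum>K\<in>S. Q K) + \<rho> ^ 4 * (\<Sum>e\<in>interior_facets S. J e)"
    by (simp add: sum_distrib_left)
  finally show ?thesis unfolding I_def Q_def J_def .
qed

text \<open>Young's inequality with weight 1 / d e on the squared jump leaves d e times the squared
  traces. As d e \<le> h, and h is at most \<sigma> times the radius of a ball in the simplex, the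
  inverse inequality bounds these by the mass on the simplex, which is counted once for each of its
  at most CARD('n) + 1 facets.\<close>

lemma jump_product_estimate:
  fixes S :: "(real^'n) set set"
  assumes S: "triangulation S" "\<And>K. K \<in> S \<Longrightarrow> int CARD('n) simplex K"
    and s: "\<And>e. e \<in> interior_facets S \<Longrightarrow>
       s1 e \<in> S \<and> s2 e \<in> S \<and> s1 e \<noteq> s2 e \<and> e facet_of s1 e \<and> e facet_of s2 e"
    and d: "\<And>e. e \<in> interior_facets S \<Longrightarrow> 0 < d e \<and> d e \<le> h" and \<sigma>: "0 \<le> \<sigma>"
    and ball: "\<And>K. K \<in> S \<Longrightarrow> \<exists>c \<rho>. 0 < \<rho> \<and> h \<le> \<sigma> * \<rho> \<and> cball c \<rho> \<subseteq> K"
    and p: "\<And>K. K \<in> S \<Longrightarrow> cpoly (p K)"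
    and rep: "\<And>K. K \<in> S \<Longrightarrow> reproducing {..r} (\<lambda>j. 1 / (real j + 1)) L (p K)"
  shows "(\<Sum>e\<in>interior_facets S. LINT x:e|flat_measure e.
        cmod (p (s1 e) x - p (s2 e) x) * (cmod (p (s1 e) x) + cmod (p (s2 e) x))) \<le>
     (\<Sum>e\<in>interior_facets S. 1 / d e * (LINT x:e|flat_measure e. (cmod (p (s1 e) x - p (s2 e) x))\<^sup>2)) +
     \<sigma> * inverse_const CARD('n) r L * (real CARD('n) + 1) * (\<Sum>K\<in>S. LINT x:K|lborel. (cmod (p K x))\<^sup>2)"
proof -
  have S2: "int DIM(real^'n) simplex K" if "K \<in> S" for K using S(2)[OF that] by simp
  define C where "C = \<sigma> * inverse_const CARD('n) r L"
  define Q where "Q K = (LINT x:K|lborel. (cmod (p K x))\<^sup>2)" for K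
  define J where "J e = (LINT x:e|flat_measure e. (cmod (p (s1 e) x - p (s2 e) x))\<^sup>2)" for e
  define T where "T K e = (LINT x:e|flat_measure e. (cmod (p K x))\<^sup>2)" for K e
  have C0: "0 \<le> C" using \<sigma> inverse_const_nonneg by (simp add: C_def)
  have Q0: "0 \<le> Q K" for K unfolding Q_def by (intro set_lebesgue_integral_nonneg) simp
  have J0: "0 \<le> J e" for e unfolding J_def by (intro set_lebesgue_integral_nonneg) simp
  have T0: "0 \<le> T K e" for K e unfolding T_def by (intro set_lebesgue_integral_nonneg) simp
  have T: "d e * T K e \<le> C * Q K" if e: "e \<in> interior_facets S" and K: "K \<in> S" "e facet_of K" for K e
  proof -
    obtain c \<rho> where cr: "0 < \<rho>" "h \<le> \<sigma> * \<rho>" "cball c \<rho> \<subseteq> K" using ball[OF K(1)] by blast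
    have "T K e \<le> inverse_const CARD('n) r L / \<rho> * Q K"
      unfolding T_def Q_def
      using simplex_facet_inverse_inequality[OF S2[OF K(1)] K(2) cr(3,1) continuous_on_cpoly[OF p[OF K(1)]] rep[OF K(1)]]
      by simp
    then have "d e * T K e \<le> (\<sigma> * \<rho>) * (inverse_const CARD('n) r L / \<rho> * Q K)"
      using d[OF e] cr T0 by (intro mult_mono) auto
    then show ?thesis using cr by (simp add: C_def)
  qed
  have one: "(LINT x:e|flat_measure e.
        cmod (p (s1 e) x - p (s2 e) x) * (cmod (p (s1 e) x) + cmod (p (s2 e) x)))
     \<le> 1 / d e * J e + C * (Q (s1 e) + Q (s2 e))" if e: "e \<in> interior_facets S" for e
  proof -
    note se = s[OF e] and de = d[OF e]
    have int: "set_integrable (flat_measure e) e h" if "continuous_on UNIV h" for h :: "real^'n \<Rightarrow> real"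
      using simplex_set_integrable(2)[OF S2 that] se by blast
    have cp: "continuous_on UNIV (p (s1 e))" "continuous_on UNIV (p (s2 e))"
      using p se by (auto intro: continuous_on_cpoly)
    let ?a = "\<lambda>x. cmod (p (s1 e) x)" and ?b = "\<lambda>x. cmod (p (s2 e) x)" and ?j = "\<lambda>x. cmod (p (s1 e) x - p (s2 e) x)"
    have "(LINT x:e|flat_measure e. ?j x * (?a x + ?b x)) \<le>
      (LINT x:e|flat_measure e. (1 / d e * (?j x)\<^sup>2 + d e * (?a x)\<^sup>2) + d e * (?b x)\<^sup>2)"
    proof (intro set_integral_mono int continuous_intros cp)
      fix x
      have "0 \<le> (?j x - d e * (?a x + ?b x))\<^sup>2 / (2 * d e)" using de by simp
      also have "\<dots> = (1 / d e * (?j x)\<^sup>2) / 2 + d e * (?a x + ?b x)\<^sup>2 / 2 - ?j x * (?a x + ?b x)"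
        using de by (simp add: field_simps power2_eq_square)
      finally have 1: "?j x * (?a x + ?b x) \<le> (1 / d e * (?j x)\<^sup>2) / 2 + d e * (?a x + ?b x)\<^sup>2 / 2" by simp
      have "(?a x + ?b x)\<^sup>2 \<le> 2 * (?a x)\<^sup>2 + 2 * (?b x)\<^sup>2"
        using sum_squares_bound[of "?a x" "?b x"] by (simp add: power2_sum)
      then have 2: "d e * (?a x + ?b x)\<^sup>2 \<le> d e * (2 * (?a x)\<^sup>2 + 2 * (?b x)\<^sup>2)" using de by (intro mult_left_mono) auto
      have "0 \<le> 1 / d e * (?j x)\<^sup>2" using de by simp
      with 1 2 show "?j x * (?a x + ?b x) \<le> (1 / d e * (?j x)\<^sup>2 + d e * (?a x)\<^sup>2) + d e * (?b x)\<^sup>2"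
        by (simp add: distrib_left)
    qed
    also have "\<dots> = (1 / d e * J e + d e * T (s1 e) e) + d e * T (s2 e) e"
    proof -
      have i1: "set_integrable (flat_measure e) e (\<lambda>x. 1 / d e * (?j x)\<^sup>2)"
        and i2: "set_integrable (flat_measure e) e (\<lambda>x. d e * (?a x)\<^sup>2)"
        and i3: "set_integrable (flat_measure e) e (\<lambda>x. d e * (?b x)\<^sup>2)"
        by (intro int continuous_intros cp)+
      show ?thesis
        unfolding set_integral_add(2)[OF set_integral_add(1)[OF i1 i2] i3] set_integral_add(2)[OF i1 i2] J_def T_def
        by (simp only: set_integral_mult_right)
    qed
    also have "\<dots> \<le> (1 / d e * J e + C * Q (s1 e)) + C * Q (s2 e)"
      by (intro add_mono order_refl T e) (use se in auto)
    finally show ?thesis by (simp add: distrib_left)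
  qed
  have cnt: "(\<Sum>e\<in>interior_facets S. Q (s1 e) + Q (s2 e)) \<le> (real CARD('n) + 1) * (\<Sum>K\<in>S. Q K)"
  proof -
    have "(\<Sum>e\<in>interior_facets S. Q (s1 e) + Q (s2 e)) \<le> (\<Sum>K\<in>S. \<Sum>e | e facet_of K. Q K)"
    proof -
      have "0 \<le> (\<Sum>(K, e)\<in>boundary_pairs S. Q K)" using Q0 by (intro sum_nonneg) auto
      then show ?thesis using facet_pairs_split(4)[OF S(1) S2 s, of "\<lambda>K e. Q K"] by linarith
    qed
    also have "\<dots> \<le> (\<Sum>K\<in>S. (real CARD('n) + 1) * Q K)"
    proof (rule sum_mono)
      fix K assume "K \<in> S"
      have "real (card {e. e facet_of K}) \<le> real CARD('n) + 1"
        using finite_card_simplex_facets(2)[OF S(2)[OF \<open>K \<in> S\<close>]] by linarith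
      then show "(\<Sum>e | e facet_of K. Q K) \<le> (real CARD('n) + 1) * Q K"
        using Q0 by (simp add: mult_right_mono)
    qed
    finally show ?thesis by (simp add: sum_distrib_left)
  qed
  have "(\<Sum>e\<in>interior_facets S. LINT x:e|flat_measure e.
        cmod (p (s1 e) x - p (s2 e) x) * (cmod (p (s1 e) x) + cmod (p (s2 e) x))) \<le>
     (\<Sum>e\<in>interior_facets S. 1 / d e * J e + C * (Q (s1 e) + Q (s2 e)))"
    by (intro sum_mono one)
  also have "\<dots> = (\<Sum>e\<in>interior_facets S. 1 / d e * J e) + C * (\<Sum>e\<in>interior_facets S. Q (s1 e) + Q (s2 e))"
    by (simp only: sum.distrib[of "\<lambda>e. 1 / d e * J e"] sum_distrib_left)
  also have "\<dots> \<le> (\<Sum>e\<in>interior_facets S. 1 / d e * J e) + C * ((real CARD('n) + 1) * (\<Sum>K\<in>S. Q K))"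
    using C0 cnt by (intro add_left_mono mult_left_mono)
  finally show ?thesis unfolding C_def Q_def J_def by (simp only: mult.assoc)
qed

lemma lipschitz_chartE:
  fixes U :: "(real^'n) set"
  assumes "lipschitz_domain U" "x \<in> frontier U"
  obtains u \<rho> L g where "norm u = 1" "0 < \<rho>" "L-lipschitz_on UNIV g"
    "\<And>y. y \<in> ball x \<rho> \<Longrightarrow> y \<in> U \<longleftrightarrow> g (y - (y \<bullet> u) *\<^sub>R u) < y \<bullet> u"
proof -
  have "\<exists>u \<rho> L g. norm u = 1 \<and> 0 < \<rho> \<and> L-lipschitz_on UNIV g \<and>
        (\<forall>y\<in>ball x \<rho>. y \<in> U \<longleftrightarrow> g (y - (y \<bullet> u) *\<^sub>R u) < y \<bullet> u)"
    using assms unfolding lipschitz_domain_def by blast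
  then show thesis using that by (elim exE conjE) blast
qed

text \<open>
  \<open>S\<close> triangulates \<open>U\<close>, \<open>\<sigma>\<close> bounds the ratio of the mesh size \<open>h\<close> to the inradii, \<open>d\<close> gives the facet
  sizes, and \<open>s1 e\<close>, \<open>s2 e\<close> are the simplices sharing \<open>e\<close>. The point is that \<open>C\<close> is fixed
  before all of these.
\<close>
definition broken_trace_bound :: "(real^'n) set \<Rightarrow> real \<Rightarrow> nat \<Rightarrow> real \<Rightarrow> bool" where
  "broken_trace_bound U \<sigma> r C \<longleftrightarrow> (\<forall>S h s1 s2 d p.
     triangulation S \<longrightarrow> (\<forall>K\<in>S. int CARD('n) simplex K) \<longrightarrow> \<Union>S = closure U \<longrightarrow>
     (\<forall>K\<in>S. \<exists>c \<rho>. 0 < \<rho> \<and> h \<le> \<sigma> * \<rho> \<and> cball c \<rho> \<subseteq> K) \<longrightarrow>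
     (\<forall>e\<in>interior_facets S. s1 e \<in> S \<and> s2 e \<in> S \<and> s1 e \<noteq> s2 e \<and> e facet_of s1 e \<and> e facet_of s2 e) \<longrightarrow>
     (\<forall>e\<in>interior_facets S. 0 < d e \<and> d e \<le> h) \<longrightarrow>
     (\<forall>K\<in>S. p K \<in> polys r) \<longrightarrow>
     (\<Sum>(K, e)\<in>boundary_pairs S. LINT x:e|flat_measure e. (cmod (p K x))\<^sup>2) \<le>
       C * ((\<Sum>K\<in>S. LINT x:K|lborel. (cmod (p K x))\<^sup>2) +
        (\<Sum>K\<in>S. LINT x:K|lborel. (norm (grad (p K) x))\<^sup>2) +
        (\<Sum>e\<in>interior_facets S. 1 / d e * (LINT x:e|flat_measure e. (cmod (p (s1 e) x - p (s2 e) x))\<^sup>2))))"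

lemma broken_trace_inequality:
  fixes U :: "(real^'n) set"
  assumes U: "lipschitz_domain U" "bounded U" and \<sigma>: "0 \<le> \<sigma>"
  shows "\<exists>C>0. broken_trace_bound U \<sigma> r C"
proof -
  obtain Lr :: "nat \<Rightarrow> real" where Lr: "\<And>p :: real^'n \<Rightarrow> complex. p \<in> polys r \<Longrightarrow>
     reproducing {..r} (\<lambda>j. 1 / (real j + 1)) Lr p" by (rule polys_reproducing) blast
  have opU: "open U" using U by (simp add: lipschitz_domain_def)
  \<comment> \<open>The chart data are packed into one tuple, so that a single choice yields them as
    functions of the boundary point.\<close>
  have "\<forall>x\<in>frontier U. \<exists>z. norm (fst z) = 1 \<and> 0 < fst (snd z) \<and> (fst (snd (snd z)))-lipschitz_on UNIV (snd (snd (snd z))) \<and>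
     (\<forall>y\<in>ball x (fst (snd z)). y \<in> U \<longleftrightarrow> snd (snd (snd z)) (y - (y \<bullet> fst z) *\<^sub>R fst z) < y \<bullet> fst z)"
  proof
    fix x assume "x \<in> frontier U"
    then obtain u \<rho> L g where "norm u = 1" "0 < \<rho>" "L-lipschitz_on UNIV g"
      "\<And>y. y \<in> ball x \<rho> \<Longrightarrow> y \<in> U \<longleftrightarrow> g (y - (y \<bullet> u) *\<^sub>R u) < y \<bullet> u"
      by (rule lipschitz_chartE[OF U(1)]) blast
    then show "\<exists>z. norm (fst z) = 1 \<and> 0 < fst (snd z) \<and> (fst (snd (snd z)))-lipschitz_on UNIV (snd (snd (snd z))) \<and>
     (\<forall>y\<in>ball x (fst (snd z)). y \<in> U \<longleftrightarrow> snd (snd (snd z)) (y - (y \<bullet> fst z) *\<^sub>R fst z) < y \<bullet> fst z)"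
      by (intro exI[of _ "(u, \<rho>, L, g)"]) simp
  qed
  from bchoice[OF this] obtain z where z: "\<forall>x\<in>frontier U. norm (fst (z x)) = 1 \<and> 0 < fst (snd (z x)) \<and>
     (fst (snd (snd (z x))))-lipschitz_on UNIV (snd (snd (snd (z x)))) \<and>
     (\<forall>y\<in>ball x (fst (snd (z x))). y \<in> U \<longleftrightarrow> snd (snd (snd (z x))) (y - (y \<bullet> fst (z x)) *\<^sub>R fst (z x)) < y \<bullet> fst (z x))" ..
  define u where "u x = fst (z x)" for x
  define \<rho> where "\<rho> x = fst (snd (z x))" for x
  define L where "L x = fst (snd (snd (z x)))" for x
  define g where "g x = snd (snd (snd (z x)))" for x
  have ch: "norm (u x) = 1" "0 < \<rho> x" "(L x)-lipschitz_on UNIV (g x)"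
     "\<And>y. y \<in> ball x (\<rho> x) \<Longrightarrow> y \<in> U \<longleftrightarrow> g x (y - (y \<bullet> u x) *\<^sub>R u x) < y \<bullet> u x" if "x \<in> frontier U" for x
    using bspec[OF z that] unfolding u_def \<rho>_def L_def g_def by auto
  have cf: "compact (frontier U)" using U(2) by (rule compact_frontier_bounded)
  \<comment> \<open>Balls of half the chart radius, because the cutoff is bounded below
    there.\<close>
  have cov: "frontier U \<subseteq> (\<Union>x\<in>frontier U. ball x (\<rho> x / 2))"
  proof
    fix x assume x: "x \<in> frontier U"
    then have "x \<in> ball x (\<rho> x / 2)" using ch(2) by simp
    then show "x \<in> (\<Union>x\<in>frontier U. ball x (\<rho> x / 2))" using x by blast
  qed
  obtain X where X: "X \<subseteq> frontier U" "finite X" "frontier U \<subseteq> (\<Union>x\<in>X. ball x (\<rho> x / 2))"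
    by (rule compactE_image[OF cf _ cov]) auto
  \<comment> \<open>The constant of one chart: \<open>L x + 2\<close> inverts the transversality
    bound, the first two powers come from the derivative of the cut-off square, and the last term
    from the interior facets after absorption.\<close>
  define A where "A x = (L x + 2) * (4 * \<rho> x ^ 3 + \<rho> x ^ 4 + \<rho> x ^ 4 * (1 + \<sigma> * inverse_const CARD('n) r Lr * (real CARD('n) + 1)))" for x
  \<comment> \<open>The factor \<open>16 / (9 * \<rho> x ^ 4)\<close> compensates for the cutoff on
    the half ball, and adding 1 makes \<open>C\<close> positive even for an empty
    \<open>X\<close>.\<close>
  define C where "C = (\<Sum>x\<in>X. 16 / (9 * \<rho> x ^ 4) * A x) + 1"
  have L0: "0 \<le> L x" if "x \<in> X" for x using ch(3) X(1) that lipschitz_on_nonneg by blast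
  have \<rho>0: "0 < \<rho> x" if "x \<in> X" for x using ch(2) X(1) that by blast
  have A0: "0 \<le> A x" if "x \<in> X" for x
    unfolding A_def using L0[OF that] \<rho>0[OF that] \<sigma> inverse_const_nonneg by (auto intro!: mult_nonneg_nonneg add_nonneg_nonneg)
  have C0: "0 < C" unfolding C_def using A0 \<rho>0
    by (intro add_nonneg_pos sum_nonneg mult_nonneg_nonneg) (auto simp: less_imp_le)
  show ?thesis
    unfolding broken_trace_bound_def
  proof (intro exI[of _ C] conjI allI impI C0)
    fix S h s1 s2 d and p :: "(real^'n) set \<Rightarrow> real^'n \<Rightarrow> complex"
    assume S: "triangulation S" "\<forall>K\<in>S. int CARD('n) simplex K" "\<Union>S = closure U"
      and ball: "\<forall>K\<in>S. \<exists>c \<rho>. 0 < \<rho> \<and> h \<le> \<sigma> * \<rho> \<and> cball c \<rho> \<subseteq> K"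
      and s: "\<forall>e\<in>interior_facets S. s1 e \<in> S \<and> s2 e \<in> S \<and> s1 e \<noteq> s2 e \<and> e facet_of s1 e \<and> e facet_of s2 e"
      and d: "\<forall>e\<in>interior_facets S. 0 < d e \<and> d e \<le> (h::real)" and p: "\<forall>K\<in>S. p K \<in> polys r"
    define Q0 where "Q0 = (\<Sum>K\<in>S. LINT x:K|lborel. (cmod (p K x))\<^sup>2)"
    define Q1 where "Q1 = (\<Sum>K\<in>S. LINT x:K|lborel. (norm (grad (p K) x))\<^sup>2)"
    define J where "J = (\<Sum>e\<in>interior_facets S. 1 / d e * (LINT x:e|flat_measure e. (cmod (p (s1 e) x - p (s2 e) x))\<^sup>2))"
    define JJ where "JJ = (\<Sum>e\<in>interior_facets S. LINT x:e|flat_measure e.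
        cmod (p (s1 e) x - p (s2 e) x) * (cmod (p (s1 e) x) + cmod (p (s2 e) x)))"
    define cI where "cI = \<sigma> * inverse_const CARD('n) r Lr * (real CARD('n) + 1)"
    have S2: "int DIM(real^'n) simplex K" if "K \<in> S" for K using S(2) that by simp
    have cp: "cpoly (p K)" if "K \<in> S" for K using p that polys_imp_cpoly by blast
    have nn: "0 \<le> Q0" "0 \<le> Q1" "0 \<le> J"
      unfolding Q0_def Q1_def J_def using d
      by (auto intro!: sum_nonneg set_lebesgue_integral_nonneg divide_nonneg_nonneg simp: less_imp_le)
    have cI0: "0 \<le> cI" unfolding cI_def using \<sigma> inverse_const_nonneg by (intro mult_nonneg_nonneg) auto
    have JJ: "JJ \<le> J + cI * Q0"
      unfolding JJ_def J_def cI_def Q0_def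
      by (rule jump_product_estimate[OF S(1) _ _ _ \<sigma>, where h = h]) (use S s d ball cp p Lr in auto)
    have QQ: "(\<Sum>K\<in>S. LINT x:K|lborel. (cmod (p K x))\<^sup>2 + (norm (grad (p K) x))\<^sup>2) = Q0 + Q1"
      unfolding Q0_def Q1_def sum.distrib[symmetric]
    proof (intro sum.cong refl set_integral_add(2))
      fix K assume K: "K \<in> S"
      show "set_integrable lborel K (\<lambda>x. (cmod (p K x))\<^sup>2)" "set_integrable lborel K (\<lambda>x. (norm (grad (p K) x))\<^sup>2)"
        by (intro simplex_set_integrable(1)[OF S2[OF K]] continuous_intros continuous_on_cpoly continuous_on_grad cp K)+
    qed
    have est: "(\<Sum>(K, e)\<in>boundary_pairs S. LINT y:e|flat_measure e. cut_square x (\<rho> x) (p K) y) \<le> A x * (Q0 + Q1 + J)"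
      if "x \<in> X" for x
    proof -
      have xf: "x \<in> frontier U" using X that by blast
      let ?B = "\<Sum>(K, e)\<in>boundary_pairs S. LINT y:e|flat_measure e. cut_square x (\<rho> x) (p K) y"
      have "1 / (L x + 2) * ?B \<le> (4 * \<rho> x ^ 3 + \<rho> x ^ 4) * (Q0 + Q1) + \<rho> x ^ 4 * JJ"
        unfolding QQ[symmetric] JJ_def
        by (rule chart_trace_estimate[OF opU S(1) _ S(3) ch(1)[OF xf] ch(3)[OF xf] ch(2)[OF xf] ch(4)[OF xf]])
          (use S s cp in auto)
      also have "\<dots> \<le> (4 * \<rho> x ^ 3 + \<rho> x ^ 4) * (Q0 + Q1 + J) + \<rho> x ^ 4 * ((1 + cI) * (Q0 + Q1 + J))"
      proof (rule add_mono; rule mult_left_mono)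
        have "J + cI * Q0 \<le> 1 * (Q0 + Q1 + J) + cI * (Q0 + Q1 + J)"
          using nn cI0 by (intro add_mono mult_left_mono) auto
        then show "JJ \<le> (1 + cI) * (Q0 + Q1 + J)" using JJ by (simp add: distrib_right)
      qed (use nn \<rho>0[OF that] in auto)
      finally have "(L x + 2) * (1 / (L x + 2) * ?B) \<le> (L x + 2) * ((4 * \<rho> x ^ 3 + \<rho> x ^ 4) * (Q0 + Q1 + J) + \<rho> x ^ 4 * ((1 + cI) * (Q0 + Q1 + J)))"
        using L0[OF that] by (intro mult_left_mono) auto
      moreover have "(L x + 2) * (1 / (L x + 2) * ?B) = ?B" using L0[OF that] by simp
      moreover have "(L x + 2) * ((4 * \<rho> x ^ 3 + \<rho> x ^ 4) * (Q0 + Q1 + J) + \<rho> x ^ 4 * ((1 + cI) * (Q0 + Q1 + J)))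
         = A x * (Q0 + Q1 + J)"
        unfolding A_def cI_def[symmetric] by (simp only: distrib_right mult.assoc)
      ultimately show ?thesis by (simp only:)
    qed
    have int: "set_integrable (flat_measure e) e f"
      if "(K, e) \<in> boundary_pairs S" "continuous_on UNIV f" for K e and f :: "real^'n \<Rightarrow> real"
      using simplex_set_integrable(2)[OF S2 that(2)] boundary_pairsD[OF that(1)] by blast
    have "(\<Sum>(K, e)\<in>boundary_pairs S. LINT x:e|flat_measure e. (cmod (p K x))\<^sup>2) \<le>
      (\<Sum>(K, e)\<in>boundary_pairs S. \<Sum>x\<in>X. 16 / (9 * \<rho> x ^ 4) * (LINT y:e|flat_measure e. cut_square x (\<rho> x) (p K) y))"
    proof (intro sum_mono, clarify)
      fix K e assume Ke: "(K, e) \<in> boundary_pairs S"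
      note b = boundary_pairsD[OF Ke]
      have "e \<subseteq> frontier U"
      proof -
        have "rel_interior e \<subseteq> frontier U"
          using boundary_facet_frontier[OF opU S(1) S2 S(3) b] by blast
        then have "closure (rel_interior e) \<subseteq> frontier U" by (simp add: closure_minimal)
        moreover have "convex e" using simplex_facetE[OF S2[OF b(1)] b(2)] by metis
        ultimately show ?thesis using convex_closure_rel_interior closure_subset by blast
      qed
      have "(LINT x:e|flat_measure e. (cmod (p K x))\<^sup>2) \<le>
        (LINT y:e|flat_measure e. (\<Sum>x\<in>X. 16 / (9 * \<rho> x ^ 4) * cut_square x (\<rho> x) (p K) y))"
      proof (intro set_integral_mono int[OF Ke] continuous_intros continuous_on_cpoly continuous_on_cut_square cp b(1))
        fix y assume "y \<in> e"
        then obtain x where x: "x \<in> X" "y \<in> ball x (\<rho> x / 2)" using X(3) \<open>e \<subseteq> frontier U\<close> by blast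
        have "1 * (cmod (p K y))\<^sup>2 \<le> (16 / (9 * \<rho> x ^ 4) * cutoff x (\<rho> x) y) * (cmod (p K y))\<^sup>2"
          using cutoff_bounds(5)[OF \<rho>0[OF x(1)] x(2)] \<rho>0[OF x(1)] by (intro mult_right_mono) (auto simp: field_simps)
        then have "(cmod (p K y))\<^sup>2 \<le> 16 / (9 * \<rho> x ^ 4) * cut_square x (\<rho> x) (p K) y"
          by (simp add: cut_square_def)
        also have "\<dots> \<le> (\<Sum>x\<in>X. 16 / (9 * \<rho> x ^ 4) * cut_square x (\<rho> x) (p K) y)"
        proof (rule member_le_sum[OF x(1) _ X(2)])
          fix x' assume "x' \<in> X - {x}"
          then show "0 \<le> 16 / (9 * \<rho> x' ^ 4) * cut_square x' (\<rho> x') (p K) y"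
            unfolding cut_square_def using cutoff_bounds(1)[OF \<rho>0, of x'] by (intro mult_nonneg_nonneg) auto
        qed
        finally show "(cmod (p K y))\<^sup>2 \<le> (\<Sum>x\<in>X. 16 / (9 * \<rho> x ^ 4) * cut_square x (\<rho> x) (p K) y)" .
      qed
      also have "\<dots> = (\<Sum>x\<in>X. LINT y:e|flat_measure e. 16 / (9 * \<rho> x ^ 4) * cut_square x (\<rho> x) (p K) y)"
        by (rule set_lebesgue_integral_sum) (intro int[OF Ke] continuous_intros continuous_on_cut_square cp b(1))
      also have "\<dots> = (\<Sum>x\<in>X. 16 / (9 * \<rho> x ^ 4) * (LINT y:e|flat_measure e. cut_square x (\<rho> x) (p K) y))"
        by (simp only: set_integral_mult_right)
      finally show "(LINT x:e|flat_measure e. (cmod (p K x))\<^sup>2) \<le>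
         (\<Sum>x\<in>X. 16 / (9 * \<rho> x ^ 4) * (LINT y:e|flat_measure e. cut_square x (\<rho> x) (p K) y))" .
    qed
    also have "\<dots> = (\<Sum>x\<in>X. 16 / (9 * \<rho> x ^ 4) * (\<Sum>(K, e)\<in>boundary_pairs S. LINT y:e|flat_measure e. cut_square x (\<rho> x) (p K) y))"
      unfolding case_prod_beta sum_distrib_left by (rule sum.swap)
    also have "\<dots> \<le> (\<Sum>x\<in>X. 16 / (9 * \<rho> x ^ 4) * (A x * (Q0 + Q1 + J)))"
      by (intro sum_mono mult_left_mono est) (use \<rho>0 in \<open>auto simp: less_imp_le\<close>)
    also have "\<dots> = (\<Sum>x\<in>X. 16 / (9 * \<rho> x ^ 4) * A x) * (Q0 + Q1 + J)"
      by (simp add: sum_distrib_right mult.assoc)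
    also have "\<dots> \<le> C * (Q0 + Q1 + J)" using nn by (intro mult_right_mono) (auto simp: C_def)
    finally show "(\<Sum>(K, e)\<in>boundary_pairs S. LINT x:e|flat_measure e. (cmod (p K x))\<^sup>2) \<le>
       C * ((\<Sum>K\<in>S. LINT x:K|lborel. (cmod (p K x))\<^sup>2) +
        (\<Sum>K\<in>S. LINT x:K|lborel. (norm (grad (p K) x))\<^sup>2) +
        (\<Sum>e\<in>interior_facets S. 1 / d e * (LINT x:e|flat_measure e. (cmod (p (s1 e) x - p (s2 e) x))\<^sup>2)))"
      unfolding Q0_def Q1_def J_def .
  qed
qed


text \<open>Distinct facets give distinct pairs (s e, e), and a simplex of dimension
  \<open>m\<close> has at most m + 1 facets, so each \<open>Q K\<close> is counted at most m + 1
  times.\<close>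

lemma sum_facet_sides_le:
  fixes S :: "'a::euclidean_space set set" and Q :: "'a set \<Rightarrow> real"
  assumes "finite S" "\<And>K. K \<in> S \<Longrightarrow> int m simplex K" "\<And>e. e \<in> F \<Longrightarrow> s e \<in> S \<and> e facet_of s e"
    and "\<And>K. 0 \<le> Q K"
  shows "(\<Sum>e\<in>F. Q (s e)) \<le> (real m + 1) * (\<Sum>K\<in>S. Q K)"
proof -
  have ff: "finite {e. e facet_of K}" if "K \<in> S" for K using finite_card_simplex_facets(1)[OF assms(2)[OF that]] .
  have P: "facet_pairs S = (SIGMA K:S. {e. e facet_of K})" by (auto simp: facet_pairs_def)
  have fin: "finite (facet_pairs S)" unfolding P using assms(1) ff by auto
  have "(\<Sum>e\<in>F. Q (s e)) = (\<Sum>(K, e)\<in>(\<lambda>e. (s e, e)) ` F. Q K)"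
    by (subst sum.reindex) (auto simp: inj_on_def)
  also have "\<dots> \<le> (\<Sum>(K, e)\<in>facet_pairs S. Q K)"
    using assms(3,4) by (intro sum_mono2 fin) (auto simp: facet_pairs_def)
  also have "\<dots> = (\<Sum>K\<in>S. \<Sum>e | e facet_of K. Q K)"
    unfolding P using assms(1) ff by (subst sum.Sigma) auto
  also have "\<dots> \<le> (\<Sum>K\<in>S. (real m + 1) * Q K)"
  proof (rule sum_mono)
    fix K assume "K \<in> S"
    have "real (card {e. e facet_of K}) \<le> real m + 1"
      using finite_card_simplex_facets(2)[OF assms(2)[OF \<open>K \<in> S\<close>]] by linarith
    then show "(\<Sum>e | e facet_of K. Q K) \<le> (real m + 1) * Q K"
      using assms(4) by (simp add: mult_right_mono)
  qed
  finally show ?thesis by (simp add: sum_distrib_left)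
qed

text \<open>Both facets are faces of the common face of \<open>K\<close> and \<open>K'\<close>, and
  faces of a convex set whose relative interiors meet coincide.\<close>

lemma facets_rel_interior_disjoint:
  assumes "triangulation S" "K \<in> S" "K' \<in> S" "e facet_of K" "e' facet_of K'"
    and x: "x \<in> rel_interior e" "x \<in> rel_interior e'"
  shows "e = e'"
proof -
  have f: "(K \<inter> K') face_of K" "(K' \<inter> K) face_of K'"
    using assms unfolding triangulation_def by blast+
  have xx: "x \<in> e" "x \<in> e'" "x \<in> K" "x \<in> K'"
    using x rel_interior_subset facet_of_imp_subset[OF assms(4)] facet_of_imp_subset[OF assms(5)] by blast+
  have s1: "e \<subseteq> K \<inter> K'"
    by (rule subset_of_face_of[OF f(1) facet_of_imp_subset[OF assms(4)]]) (use x xx in auto)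
  have s2: "e' \<subseteq> K' \<inter> K"
    by (rule subset_of_face_of[OF f(2) facet_of_imp_subset[OF assms(5)]]) (use x xx in auto)
  have 1: "e face_of (K \<inter> K')" by (rule face_of_subset[OF facet_of_imp_face_of[OF assms(4)] s1]) auto
  have 2: "e' face_of (K \<inter> K')" by (rule face_of_subset[OF facet_of_imp_face_of[OF assms(5)]]) (use s2 in auto)
  show ?thesis by (rule face_of_eq[OF 1 2]) (use x in auto)
qed

lemma borel_rel_interior:
  fixes e :: "'a::euclidean_space set"
  assumes "closed e"
  shows "rel_interior e \<in> sets borel"
proof -
  have "rel_interior e = e - (e - rel_interior e)" using rel_interior_subset by blast
  moreover have "closed (e - rel_interior e)" using closed_rel_boundary[OF assms] .
  ultimately show ?thesis using assms by (metis borel_closed sets.Diff)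
qed

lemma set_integral_lebesgue_eq_lborel:
  fixes f :: "'a::euclidean_space \<Rightarrow> 'b::{banach, second_countable_topology}"
  assumes "A \<in> sets borel" "f \<in> borel_measurable borel"
  shows "(LINT x:A|lebesgue. f x) = (LINT x:A|lborel. f x)"
  unfolding set_lebesgue_integral_def using assms
  by (intro integral_completion borel_measurable_scaleR borel_measurable_indicator) auto

lemma triangulation_mono: "triangulation S \<Longrightarrow> S' \<subseteq> S \<Longrightarrow> triangulation S'"
  unfolding triangulation_def by (meson finite_subset subset_iff)


section \<open>Admissible meshes\<close>

locale fluid_mesh =
  fixes G :: "'n::finite geometry" and \<kappa> q c0 :: real and T :: "'n mesh"
  assumes dim: "CARD('n) = 2 \<or> CARD('n) = 3" and geo: "fluid_geometry G"
    and kq: "0 < \<kappa>" "0 < q" "0 < c0" and mesh: "admissible_mesh G \<kappa> q c0 T"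
begin

lemma conforming:
  "triangulation (els T)" "K \<in> els T \<Longrightarrow> int CARD('n) simplex K"
  "\<Union>(elsP T) = closure (OmP G)" "\<Union>(elsM T) = closure (OmM G)" "\<Union>(plate_els G T) = closure (Gam G)"
  using mesh unfolding admissible_mesh_def conforming_mesh_def by auto

lemma els_simplex: "K \<in> els T \<Longrightarrow> int DIM(real^'n) simplex K" using conforming(2) by simp

lemma finite_els: "finite (els T)" using conforming(1) by (simp add: triangulation_def)

lemma domains:
  "bounded (Om G)" "lipschitz_domain (Om G)" "lipschitz_domain (OmP G)" "lipschitz_domain (OmM G)"
  "OmP G \<inter> OmM G = {}" "Om G - Gam G = OmP G \<union> OmM G"
  "closure (OmP G) \<inter> closure (OmM G) = closure (Gam G)" "Gam G \<noteq> {}" "Gam G \<subseteq> Om G" "norm (nu G) = 1"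
  using geo unfolding fluid_geometry_def by auto

lemma domains_open: "open (Om G)" "open (OmP G)" "open (OmM G)"
  using domains by (auto simp: lipschitz_domain_def)

lemma closure_subsets: "closure (OmP G) \<subseteq> closure (Om G)" "closure (OmM G) \<subseteq> closure (Om G)"
  using domains(6) by (intro closure_mono; blast)+

lemma els_interior_subset:
  assumes "K \<in> els T"
  shows "interior K \<subseteq> Om G"
proof -
  have "K \<subseteq> closure (Om G)"
    using assms conforming(3,4) closure_subsets unfolding els_def by blast
  then have "interior K \<subseteq> interior (closure (Om G))" by (rule interior_mono)
  then show ?thesis using lipschitz_domain_interior_closure[OF domains(2)] by simp
qed

lemma elsP_elsM_disjoint: "elsP T \<inter> elsM T = {}"
proof (rule ccontr)
  assume "elsP T \<inter> elsM T \<noteq> {}"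
  then obtain K where K: "K \<in> elsP T" "K \<in> elsM T" by auto
  then have "interior K \<subseteq> interior (closure (OmP G))" "interior K \<subseteq> interior (closure (OmM G))"
    using conforming(3,4) by (intro interior_mono; blast)+
  then have "interior K \<subseteq> OmP G \<inter> OmM G"
    using lipschitz_domain_interior_closure[OF domains(3)] lipschitz_domain_interior_closure[OF domains(4)] by auto
  moreover have "interior K \<noteq> {}" using interior_simplex_nonempty(1)[OF els_simplex, of K] K by (auto simp: els_def)
  ultimately show False using domains(5) by auto
qed

lemma sides:
  assumes "e \<in> interior_facets (els T)"
  shows "side1 T e \<in> els T" "side2 T e \<in> els T" "side1 T e \<noteq> side2 T e"
    "e facet_of side1 T e" "e facet_of side2 T e" "norm (fnormal T e) = 1"
  using assms mesh unfolding admissible_mesh_def oriented_mesh_def by auto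

lemma sides_unique:
  assumes "e \<in> interior_facets (els T)" "K \<in> els T" "e facet_of K"
  shows "K = side1 T e \<or> K = side2 T e"
  using facet_at_most_two[OF conforming(1) els_simplex sides(1-5)[OF assms(1)] assms(2,3)[unfolded] ] by simp

lemma interior_facets_mono: "S \<subseteq> S' \<Longrightarrow> interior_facets S \<subseteq> interior_facets S'"
  unfolding interior_facets_def by blast

lemma plate_els_sides:
  assumes "E \<in> plate_els G T"
  shows "E \<in> interior_facets (els T)" "side1 T E \<in> elsM T" "side2 T E \<in> elsP T" "E \<subseteq> closure (Gam G)"
  using assms mesh unfolding admissible_mesh_def oriented_mesh_def plate_els_def by auto

text \<open>A plate element has its sides in different halves, which share no simplex, so it is an
  interior facet of neither. On the other facets the sides chosen for the whole mesh also serve the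
  half.\<close>

lemma interior_facets_half:
  assumes S: "S = elsP T \<or> S = elsM T" and e: "e \<in> interior_facets S"
  shows "e \<in> fluid_facets G T" "side1 T e \<in> S" "side2 T e \<in> S"
proof -
  have sub: "S \<subseteq> els T" using S by (auto simp: els_def)
  then have eI: "e \<in> interior_facets (els T)" using e interior_facets_mono by blast
  obtain K1 K2 where K: "K1 \<in> S" "K2 \<in> S" "K1 \<noteq> K2" "e facet_of K1" "e facet_of K2"
    using e unfolding interior_facets_def by blast
  have "K1 = side1 T e \<or> K1 = side2 T e" "K2 = side1 T e \<or> K2 = side2 T e"
    using sides_unique[OF eI] K sub by blast+
  then show s: "side1 T e \<in> S" "side2 T e \<in> S" using K by auto
  show "e \<in> fluid_facets G T"
    unfolding fluid_facets_def
  proof (intro DiffI eI notI)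
    assume "e \<in> plate_els G T"
    from plate_els_sides(2,3)[OF this] show False using s S elsP_elsM_disjoint by auto
  qed
qed

lemma finite_facets: "finite (interior_facets (els T))" "finite (fluid_facets G T)" "finite (plate_els G T)"
  "finite (boundary_facets (els T))" "finite (plate_facets G T)"
proof -
  have ff: "finite {e. e facet_of K}" if "K \<in> els T" for K
    using finite_card_simplex_facets(1)[OF conforming(2)[OF that]] .
  have "facets (els T) = (\<Union>K\<in>els T. {e. e facet_of K})" by (auto simp: facets_def)
  then have f: "finite (facets (els T))" using finite_els ff by simp
  show 1: "finite (interior_facets (els T))"
    by (rule finite_subset[OF _ f]) (auto simp: facets_def interior_facets_def)
  show "finite (fluid_facets G T)" unfolding fluid_facets_def using 1 by simp
  show 2: "finite (plate_els G T)" unfolding plate_els_def using 1 by simp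
  show "finite (boundary_facets (els T))" unfolding boundary_facets_def using f by simp
  have "finite {p. p facet_of E}" if "E \<in> plate_els G T" for E
  proof -
    have E: "E \<in> interior_facets (els T)" using plate_els_sides(1)[OF that] .
    obtain a where "(int CARD('n) - 1) simplex E"
      by (rule simplex_facetE[OF conforming(2)[OF sides(1)[OF E]] sides(4)[OF E]])
    then show ?thesis by (rule finite_card_simplex_facets(1))
  qed
  then have "finite (\<Union>E\<in>plate_els G T. {p. p facet_of E})" using 2 by simp
  then show "finite (plate_facets G T)"
    by (rule finite_subset[rotated]) (auto simp: plate_facets_def interior_facets_def)
qed

lemma els_nonempty: "els T \<noteq> {}" "K \<in> els T \<Longrightarrow> 0 < diameter K" "K \<in> els T \<Longrightarrow> bounded K"
proof -
  have "OmP G \<noteq> {}" using domains(3) by (simp add: lipschitz_domain_def)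
  then have "elsP T \<noteq> {}" using conforming(3) by (metis Union_empty closure_eq_empty)
  then show "els T \<noteq> {}" by (simp add: els_def)
  assume K: "K \<in> els T"
  show b: "bounded K" using compact_simplex[OF conforming(2)[OF K]] compact_imp_bounded by blast
  obtain x where "x \<in> interior K" using interior_simplex_nonempty(1)[OF els_simplex[OF K]] by auto
  then obtain \<epsilon> where \<epsilon>: "0 < \<epsilon>" "cball x \<epsilon> \<subseteq> K" using mem_interior_cball by blast
  obtain v :: "real^'n" where v: "norm v = 1" using vector_choose_size[of 1] by auto
  have "x \<in> K" "x + \<epsilon> *\<^sub>R v \<in> K" using \<epsilon> v by (auto intro!: subsetD[OF \<epsilon>(2)] simp: dist_norm)
  then have "dist x (x + \<epsilon> *\<^sub>R v) \<le> diameter K" by (rule diameter_bounded_bound[OF b])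
  then show "0 < diameter K" using \<epsilon> v by (simp add: dist_norm)
qed

section \<open>Mesh size and shape regularity\<close>

lemma diameter_le_mesh_size: "K \<in> els T \<Longrightarrow> diameter K \<le> mesh_size T"
  unfolding mesh_size_def using finite_els by (intro Max_ge) auto

lemma mesh_size_pos: "0 < mesh_size T"
  using els_nonempty diameter_le_mesh_size by (metis all_not_in_conv less_le_trans)

text \<open>Bounds the mesh size by the radius of a ball inside each element. The 2 arises because a
  ball of half the inradius is taken, the inradius being a supremum.\<close>

definition shape :: real where "shape = 2 * q * \<kappa>"

lemma shape_nonneg: "0 \<le> shape" using kq by (simp add: shape_def)

lemma els_ball:
  assumes "K \<in> els T"
  shows "\<exists>c \<rho>. 0 < \<rho> \<and> mesh_size T \<le> shape * \<rho> \<and> cball c \<rho> \<subseteq> K"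
proof -
  have m: "mesh_size T \<le> q * diameter K" "diameter K \<le> \<kappa> * inradius K"
    using mesh assms unfolding admissible_mesh_def by auto
  have "0 < \<kappa> * inradius K" using m(2) els_nonempty(2)[OF assms] by linarith
  then have i: "0 < inradius K" using kq by (simp add: zero_less_mult_iff)
  have "K \<noteq> {}" using els_nonempty(2)[OF assms] by (auto simp: diameter_def)
  then obtain c where c: "cball c (inradius K / 2) \<subseteq> K"
    using inradius_ball[OF els_nonempty(3)[OF assms], of "inradius K / 2"] i by auto
  have "mesh_size T \<le> q * (\<kappa> * inradius K)" using m kq by (meson less_imp_le mult_left_mono order_trans)
  also have "\<dots> = shape * (inradius K / 2)" by (simp add: shape_def)
  finally show ?thesis using c i by (intro exI[of _ c] exI[of _ "inradius K / 2"]) auto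
qed

lemma facet_diameter:
  assumes "K \<in> els T" "e facet_of K"
  shows "0 < diameter e" "diameter e \<le> mesh_size T"
proof -
  have "c0 * mesh_size T \<le> diameter e"
    using mesh assms unfolding admissible_mesh_def facets_def by blast
  then show "0 < diameter e" using kq mesh_size_pos by (metis less_le_trans mult_pos_pos)
  have "diameter e \<le> diameter K"
    using diameter_subset[OF facet_of_imp_subset[OF assms(2)] els_nonempty(3)[OF assms(1)]] .
  then show "diameter e \<le> mesh_size T" using diameter_le_mesh_size[OF assms(1)] by linarith
qed

section \<open>The plate and its mesh\<close>

lemma plate_hyperplane:
  obtains b where "affine hull (Gam G) = {x. nu G \<bullet> x = b}" "closure (Gam G) \<subseteq> {x. nu G \<bullet> x = b}"
    "Gam G \<in> sets borel"
proof -
  obtain b where b: "openin (top_of_set {x. nu G \<bullet> x = b}) (Gam G)"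
    using geo unfolding fluid_geometry_def by auto
  have h: "affine hull {x. nu G \<bullet> x = b} = {x. nu G \<bullet> x = b}" by (simp add: affine_hyperplane hull_same)
  have "openin (top_of_set (affine hull {x. nu G \<bullet> x = b})) (Gam G)" using b by (simp only: h)
  then have "affine hull (Gam G) = affine hull {x. nu G \<bullet> x = b}"
    using domains(8) by (rule affine_hull_openin)
  moreover obtain O' where O': "open O'" "Gam G = {x. nu G \<bullet> x = b} \<inter> O'" using b by (auto simp: openin_open)
  moreover have "closure (Gam G) \<subseteq> {x. nu G \<bullet> x = b}" using O' by (intro closure_minimal closed_hyperplane) auto
  moreover have "Gam G \<in> sets borel" unfolding O'(2) using O'(1) by (intro sets.Int borel_closed closed_hyperplane borel_open)
  ultimately show thesis using that h by simp
qed

lemma plate_el: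
  assumes "E \<in> plate_els G T"
  shows "affine hull E = affine hull (Gam G)" "flat_measure E = flat_measure (Gam G)"
    "int (CARD('n) - 1) simplex E" "compact E" "convex E" "E \<noteq> {}" "rel_interior E \<subseteq> Gam G"
proof -
  have E: "E \<in> interior_facets (els T)" using plate_els_sides(1)[OF assms] .
  obtain b where b: "affine hull (Gam G) = {x. nu G \<bullet> x = b}" "closure (Gam G) \<subseteq> {x. nu G \<bullet> x = b}"
    by (rule plate_hyperplane)
  have "E \<subseteq> {x. nu G \<bullet> x = b}" using b plate_els_sides(4)[OF assms] by auto
  then show h: "affine hull E = affine hull (Gam G)"
    unfolding b(1) by (rule outward_hyperplane[OF els_simplex[OF sides(1)[OF E]] sides(4)[OF E] domains(10)])
  then show "flat_measure E = flat_measure (Gam G)" by (rule flat_measure_cong)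
  obtain a where a: "compact E" "convex E" "E \<noteq> {}" "(int CARD('n) - 1) simplex E"
    by (rule simplex_facetE[OF conforming(2)[OF sides(1)[OF E]] sides(4)[OF E]])
  then show "compact E" "convex E" "E \<noteq> {}" by auto
  show "int (CARD('n) - 1) simplex E" using a(4) dim by (simp add: of_nat_diff)
  show "rel_interior E \<subseteq> Gam G"
  proof
    \<comment> \<open>The half balls in the two adjacent elements make up a neighbourhood of y in
      the closure of \<Omega>, so y lies in \<Omega>. Since y is in the closures of both halves,
      which are open and disjoint, it belongs to neither of them, and only the plate
      remains.\<close>
    fix y assume y: "y \<in> rel_interior E"
    obtain n where n: "outward (side1 T E) E n"
      using outward_exists[OF els_simplex[OF sides(1)[OF E]] sides(4)[OF E]] by blast
    have n2: "outward (side2 T E) E (- n)"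
      by (rule outward_opposite[OF conforming(1) els_simplex sides(1-5)[OF E] n])
    obtain c where c: "E \<subseteq> {x. n \<bullet> x = c}" using n by (auto simp: outward_def)
    then have c2: "E \<subseteq> {x. (- n) \<bullet> x = - c}" by auto
    obtain d1 where d1: "0 < d1" "ball y d1 \<inter> {x. n \<bullet> x \<le> c} \<subseteq> side1 T E"
      by (rule half_ball_subset_simplex[OF els_simplex[OF sides(1)[OF E]] sides(4)[OF E] n c y])
    obtain d2 where d2: "0 < d2" "ball y d2 \<inter> {x. (- n) \<bullet> x \<le> - c} \<subseteq> side2 T E"
      by (rule half_ball_subset_simplex[OF els_simplex[OF sides(2)[OF E]] sides(5)[OF E] n2 c2 y])
    have "ball y (min d1 d2) \<subseteq> side1 T E \<union> side2 T E"
    proof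
      fix x assume x: "x \<in> ball y (min d1 d2)"
      have "n \<bullet> x \<le> c \<or> (- n) \<bullet> x \<le> - c" by auto
      then show "x \<in> side1 T E \<union> side2 T E" using x d1(2) d2(2) by auto
    qed
    also have "\<dots> \<subseteq> closure (Om G)"
      using plate_els_sides(2,3)[OF assms] conforming(3,4) closure_subsets by blast
    finally have "y \<in> interior (closure (Om G))"
      using d1 d2 by (auto simp: mem_interior intro!: exI[of _ "min d1 d2"])
    then have yO: "y \<in> Om G" using lipschitz_domain_interior_closure[OF domains(2)] by simp
    have yc: "y \<in> closure (OmP G)" "y \<in> closure (OmM G)"
      using y rel_interior_subset plate_els_sides(4)[OF assms] domains(7) by blast+
    have "y \<notin> OmP G"
      using yc(2) domains(5) open_Int_closure_eq_empty[OF domains_open(2), of "OmM G"] by blast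
    moreover have "y \<notin> OmM G"
      using yc(1) domains(5) open_Int_closure_eq_empty[OF domains_open(3), of "OmP G"] by blast
    ultimately show "y \<in> Gam G" using yO domains(6) by blast
  qed
qed

lemma plate_disjoint: "disjoint_family_on rel_interior (plate_els G T)"
  unfolding disjoint_family_on_def
proof (intro ballI impI, rule ccontr)
  fix E E' assume *: "E \<in> plate_els G T" "E' \<in> plate_els G T" "E \<noteq> E'" "rel_interior E \<inter> rel_interior E' \<noteq> {}"
  note I = plate_els_sides(1)[OF *(1)] and I' = plate_els_sides(1)[OF *(2)]
  have "E = E'"
    using facets_rel_interior_disjoint[OF conforming(1) sides(1)[OF I] sides(1)[OF I'] sides(4)[OF I] sides(4)[OF I']] *(4) by blast
  then show False using *(3) by simp
qed

lemma compact_plate: "compact (closure (Gam G))"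
  using domains(1,9) bounded_subset by (metis bounded_closure compact_eq_bounded_closed closed_closure)

lemma plate_facet:
  assumes "p \<in> plate_facets G T"
  shows "pside1 T p \<in> plate_els G T" "pside2 T p \<in> plate_els G T"
    "p facet_of pside1 T p" "p facet_of pside2 T p"
    "norm (conormal T p) = 1" "conormal T p \<bullet> nu G = 0" "\<And>x y. x \<in> p \<Longrightarrow> y \<in> p \<Longrightarrow> (x - y) \<bullet> conormal T p = 0"
  using assms mesh unfolding admissible_mesh_def oriented_mesh_def by auto

lemma plate_facet_aff_dim:
  assumes "p facet_of E" "E \<in> plate_els G T"
  shows "aff_dim p = int CARD('n) - 2" "compact p" "p \<noteq> {}" "convex p"
proof -
  note s = plate_el(3)[OF assms(2)]
  have "aff_dim E = int CARD('n) - 1" using aff_dim_simplex[OF s] dim by (simp add: of_nat_diff)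
  then show "aff_dim p = int CARD('n) - 2" using assms(1) by (simp add: facet_of_def)
  obtain a where "compact p" "convex p" "p \<noteq> {}" by (rule simplex_facetE[OF s assms(1)])
  then show "compact p" "p \<noteq> {}" "convex p" by auto
qed

lemma plate_el_diameter:
  assumes "E \<in> plate_els G T"
  shows "0 < diameter E" "diameter E \<le> mesh_size T" "bounded E"
  using facet_diameter[OF sides(1)[OF plate_els_sides(1)[OF assms]] sides(4)[OF plate_els_sides(1)[OF assms]]]
    plate_el(4)[OF assms] compact_imp_bounded by auto

lemma plate_facet_size:
  assumes p: "p \<in> plate_facets G T"
  shows "0 < plate_facet_size T p" "plate_facet_size T p \<le> mesh_size T"
proof -
  note f = plate_facet[OF p]
  note d1 = plate_el_diameter[OF f(1)] and d2 = plate_el_diameter[OF f(2)]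
  have "0 < plate_facet_size T p \<and> plate_facet_size T p \<le> mesh_size T"
  proof (cases "CARD('n) = 2")
    case True
    then show ?thesis using d1 d2 by (simp add: plate_facet_size_def)
  next
    case False
    \<comment> \<open>For d = 3 an interface is one-dimensional, so it contains two points and has
      positive diameter.\<close>
    then have "aff_dim p = 1" using plate_facet_aff_dim(1)[OF f(3,1)] dim by auto
    moreover have "p \<noteq> {}" using plate_facet_aff_dim(3)[OF f(3,1)] .
    ultimately obtain x y where xy: "x \<in> p" "y \<in> p" "x \<noteq> y"
      by (metis aff_dim_sing all_not_in_conv insertI1 is_singletonI' is_singleton_def zero_neq_one)
    have b: "bounded p" using plate_facet_aff_dim(2)[OF f(3,1)] compact_imp_bounded by blast
    have "dist x y \<le> diameter p" by (rule diameter_bounded_bound[OF b xy(1,2)])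
    moreover have "0 < dist x y" using xy by simp
    moreover have "diameter p \<le> diameter (pside1 T p)"
      by (rule diameter_subset[OF facet_of_imp_subset[OF f(3)] d1(3)])
    ultimately have "0 < diameter p" "diameter p \<le> mesh_size T" using d1(2) by linarith+
    then show ?thesis using False by (simp add: plate_facet_size_def)
  qed
  then show "0 < plate_facet_size T p" "plate_facet_size T p \<le> mesh_size T" by auto
qed

text \<open>The plate element is a facet of the fluid element \<open>side1 T E\<close> and contains
  a disc as large as a ball inscribed there. The conormal is tangential to the plate, so the segment
  normal to \<open>p\<close> can be taken in that disc.\<close>

lemma plate_facet_inverse_inequality:
  fixes f :: "real^'n \<Rightarrow> 'b::euclidean_space"
  assumes p: "p \<in> plate_facets G T" and E: "E \<in> plate_els G T" "p facet_of E"
    and f: "continuous_on UNIV f" and rep: "reproducing {..r} (\<lambda>j. 1 / (real j + 1)) L f"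
  shows "mesh_size T * (LINT x:p|flat_measure p. (norm (f x))\<^sup>2) \<le>
    shape * inverse_const CARD('n) r L * (LINT x:E|flat_measure E. (norm (f x))\<^sup>2)"
proof -
  let ?m = "conormal T p"
  note pf = plate_facet[OF p] and pd = plate_facet_aff_dim[OF E(2,1)]
  note EI = plate_els_sides(1)[OF E(1)]
  obtain b where b: "affine hull (Gam G) = {x. nu G \<bullet> x = b}" "closure (Gam G) \<subseteq> {x. nu G \<bullet> x = b}"
    by (rule plate_hyperplane)
  have hE: "affine hull E = {x. nu G \<bullet> x = b}" using plate_el(1)[OF E(1)] b by simp
  have EH: "E \<subseteq> {x. nu G \<bullet> x = b}" using b plate_els_sides(4)[OF E(1)] by auto
  obtain x0 where x0: "x0 \<in> p" using pd(3) by auto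
  have pE: "p \<subseteq> E" using facet_of_imp_subset[OF E(2)] .
  have mm: "?m \<bullet> ?m = 1" "nu G \<bullet> ?m = 0" using pf by (auto simp: norm_eq_1 inner_commute)
  have hp: "affine hull p = affine hull E \<inter> {x. ?m \<bullet> x = ?m \<bullet> x0}"
  proof (rule affine_dim_equal)
    let ?I = "affine hull E \<inter> {x. ?m \<bullet> x = ?m \<bullet> x0}"
    show aI: "affine ?I" by (intro affine_Int affine_affine_hull affine_hyperplane)
    show "affine hull p \<noteq> {}" using pd(3) by simp
    have "p \<subseteq> {x. ?m \<bullet> x = ?m \<bullet> x0}"
      using pf(7)[OF _ x0] by (auto simp: inner_diff_left inner_commute[of ?m])
    moreover have "p \<subseteq> affine hull E" using pE hull_subset[of E affine] by blast
    ultimately show sub: "affine hull p \<subseteq> ?I" by (intro hull_minimal aI) auto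
    \<comment> \<open>Moving \<open>x0\<close> by the conormal stays in the plane of the plate but
      leaves \<open>?I\<close>, so the dimension drops.\<close>
    have "aff_dim ?I \<noteq> aff_dim (affine hull E)"
    proof
      assume "aff_dim ?I = aff_dim (affine hull E)"
      moreover have "?I \<noteq> {}" using sub x0 hull_inc[of x0 p affine] by blast
      ultimately have "?I = affine hull E" by (intro affine_dim_equal aI) auto
      moreover have "x0 + ?m \<in> affine hull E" using x0 pE EH mm unfolding hE by (auto simp: inner_add_right)
      ultimately have "x0 + ?m \<in> ?I" by simp
      then show False using mm by (simp add: inner_add_right)
    qed
    moreover have "aff_dim ?I \<le> aff_dim (affine hull E)" by (rule aff_dim_subset) auto
    moreover have "aff_dim (affine hull p) \<le> aff_dim ?I" by (rule aff_dim_subset[OF sub])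
    moreover have "aff_dim p = aff_dim E - 1" using E(2) by (simp add: facet_of_def)
    ultimately show "aff_dim (affine hull p) = aff_dim ?I" by simp
  qed simp
  obtain c \<rho> where cr: "0 < \<rho>" "mesh_size T \<le> shape * \<rho>" "cball c \<rho> \<subseteq> side1 T E"
    using els_ball[OF sides(1)[OF EI]] by blast
  have d2: "2 \<le> DIM(real^'n)" using dim by auto
  obtain a where a: "\<And>w. nu G \<bullet> w = 0 \<Longrightarrow> norm w \<le> \<rho> \<Longrightarrow> a + w \<in> E"
    by (rule facet_contains_ball[OF els_simplex[OF sides(1)[OF EI]] sides(4)[OF EI] d2 domains(10) EH cr(3,1)]) blast
  \<comment> \<open>The codimensions are 1 and 2, and the unit balls an interval of length 2 and a
    disc of area \<pi>.\<close>
  have tf: "tube_factor p \<le> tube_factor E"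
  proof -
    have "aff_dim E = int CARD('n) - 1" using pd(1) E(2) by (simp add: facet_of_def)
    then have t: "tube_factor E = 1 / 2" "tube_factor p = 1 / pi"
      using pd(1) by (simp_all add: tube_factor_def unit_ball_vol_1 unit_ball_vol_2)
    show ?thesis unfolding t using pi_ge_two by (simp add: frac_le)
  qed
  let ?I = "LINT x:E|flat_measure E. (norm (f x))\<^sup>2"
  have le: "(LINT x:p|flat_measure p. (norm (f x))\<^sup>2) \<le> inverse_const CARD('n) r L / \<rho> * ?I"
  proof -
    have "(LINT x:p|flat_measure p. (norm (f x))\<^sup>2) \<le>
      2 ^ DIM(real^'n) * ((\<Sum>j\<in>{..r}. (L j)\<^sup>2) * (\<Sum>j\<in>{..r}. (1 / (1 / (real j + 1))) ^ DIM(real^'n))) / \<rho> * ?I"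
    proof (rule facet_inverse_inequality[OF plate_el(4)[OF E(1)] plate_el(5)[OF E(1)] pd(2) pE pd(3) pf(5) hp cr(1) _ f _ _ rep tf])
      show "a + \<tau> *\<^sub>R ?m \<in> E" if "\<bar>\<tau>\<bar> \<le> \<rho>" for \<tau> using that mm pf(5) by (intro a) auto
    qed auto
    then show ?thesis by (simp add: inverse_const_def)
  qed
  have "mesh_size T * (LINT x:p|flat_measure p. (norm (f x))\<^sup>2) \<le> (shape * \<rho>) * (inverse_const CARD('n) r L / \<rho> * ?I)"
    using cr(2) le mesh_size_pos by (intro mult_mono) (auto intro!: set_lebesgue_integral_nonneg)
  then show ?thesis using cr(1) by simp
qed

lemma fluid_facet_inverse_inequality:
  fixes f :: "real^'n \<Rightarrow> 'b::euclidean_space"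
  assumes K: "K \<in> els T" "e facet_of K"
    and f: "continuous_on UNIV f" and rep: "reproducing {..r} (\<lambda>j. 1 / (real j + 1)) L f"
  shows "mesh_size T * (LINT x:e|flat_measure e. (norm (f x))\<^sup>2) \<le>
    shape * inverse_const CARD('n) r L * (LINT x:K|lborel. (norm (f x))\<^sup>2)"
proof -
  obtain c \<rho> where cr: "0 < \<rho>" "mesh_size T \<le> shape * \<rho>" "cball c \<rho> \<subseteq> K"
    using els_ball[OF K(1)] by blast
  have "(LINT x:e|flat_measure e. (norm (f x))\<^sup>2) \<le> inverse_const CARD('n) r L / \<rho> * (LINT x:K|lborel. (norm (f x))\<^sup>2)"
    using simplex_facet_inverse_inequality[OF els_simplex[OF K(1)] K(2) cr(3,1) f rep] by simp
  then have "mesh_size T * (LINT x:e|flat_measure e. (norm (f x))\<^sup>2) \<le>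
      (shape * \<rho>) * (inverse_const CARD('n) r L / \<rho> * (LINT x:K|lborel. (norm (f x))\<^sup>2))"
    using cr(2) mesh_size_pos by (intro mult_mono) (auto intro!: set_lebesgue_integral_nonneg)
  then show ?thesis using cr(1) by simp
qed

end


section \<open>Trace bounds for discrete functions\<close>

lemma set_integral_mono_set_nonneg:
  fixes f :: "'a \<Rightarrow> real"
  assumes "set_integrable M A f" "B \<in> sets M" "B \<subseteq> A" "\<And>x. 0 \<le> f x"
  shows "(LINT x:B|M. f x) \<le> (LINT x:A|M. f x)"
proof -
  have "set_integrable M B f" by (rule set_integrable_subset[OF assms(1-3)])
  then show ?thesis
    using assms unfolding set_lebesgue_integral_def set_integrable_def
    by (intro integral_mono) (auto simp: indicator_def)
qed

lemma nn_integral_hyperplane_translate: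
  fixes n :: "'a::euclidean_space"
  assumes n: "norm n = 1" and [measurable]: "g \<in> borel_measurable borel"
  shows "(\<integral>\<^sup>+y. g y \<partial>flat_measure {x. n \<bullet> x = b + s}) = (\<integral>\<^sup>+y. g (y + s *\<^sub>R n) \<partial>flat_measure {x. n \<bullet> x = b})"
proof -
  have n0: "n \<noteq> 0" using n by auto
  have nn: "n \<bullet> n = 1" using n by (simp add: norm_eq_1)
  have ne: "{x. n \<bullet> x = b} \<noteq> {}" for b using n0 hyperplane_eq_empty by blast
  have hull: "affine hull {x. n \<bullet> x = b} = {x. n \<bullet> x = b}" for b by (simp add: affine_hyperplane hull_same)
  have tf: "tube_factor {x. n \<bullet> x = b} = 1 / 2" for b
    using n0 by (simp add: tube_factor_def aff_dim_hyperplane unit_ball_vol_1)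
  have tb: "tube {x. n \<bullet> x = b} = {x. \<bar>n \<bullet> x - b\<bar> \<le> 1}" for b
    using mem_tube_iff[of "{x. n \<bullet> x = b}"] ne n by (auto simp: closest_point_hyperplane closed_hyperplane)
  have fl: "(\<integral>\<^sup>+y. g y \<partial>flat_measure {x. n \<bullet> x = b}) =
     ennreal (1/2) * (\<integral>\<^sup>+x. g (x - (n \<bullet> x - b) *\<^sub>R n) * indicator {x. \<bar>n \<bullet> x - b\<bar> \<le> 1} x \<partial>lborel)"
    if [measurable]: "g \<in> borel_measurable borel" for b and g :: "'a \<Rightarrow> ennreal"
    by (subst nn_integral_flat_measure[OF ne]) (auto simp: hull tf tb closest_point_hyperplane[OF n])
  let ?h = "\<lambda>x. g (x - (n \<bullet> x - (b + s)) *\<^sub>R n) * indicator {x. \<bar>n \<bullet> x - (b + s)\<bar> \<le> 1} x"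
  have "(\<integral>\<^sup>+x. ?h x \<partial>lborel) = (\<integral>\<^sup>+x. ?h (x + s *\<^sub>R n) \<partial>lborel)"
    by (rule nn_integral_lborel_translate[symmetric]) measurable
  also have "\<dots> = (\<integral>\<^sup>+x. g (x - (n \<bullet> x - b) *\<^sub>R n + s *\<^sub>R n) * indicator {x. \<bar>n \<bullet> x - b\<bar> \<le> 1} x \<partial>lborel)"
    by (intro nn_integral_cong) (simp add: inner_simps nn algebra_simps indicator_def)
  finally show ?thesis
    by (subst (1 2) fl) (simp_all add: measurable)
qed

text \<open>Inlet and outlet are translates of the cross section; this carries integrals of the
  modes over them back to \<open>cross_measure\<close>.\<close>

lemma flat_measure_hyperplane_translate:
  fixes n :: "'a::euclidean_space"
  assumes n: "norm n = 1"
  shows "flat_measure {x. n \<bullet> x = b + s} = distr (flat_measure {x. n \<bullet> x = b}) borel (\<lambda>y. y + s *\<^sub>R n)"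
proof (rule measure_eqI)
  fix X assume "X \<in> sets (flat_measure {x. n \<bullet> x = b + s})"
  then have X: "X \<in> sets borel" by simp
  have "emeasure (flat_measure {x. n \<bullet> x = b + s}) X = (\<integral>\<^sup>+y. indicator X y \<partial>flat_measure {x. n \<bullet> x = b + s})"
    using X by simp
  also have "\<dots> = (\<integral>\<^sup>+y. indicator X (y + s *\<^sub>R n) \<partial>flat_measure {x. n \<bullet> x = b})"
    using X by (intro nn_integral_hyperplane_translate[OF n]) auto
  also have "\<dots> = (\<integral>\<^sup>+y. indicator X y \<partial>distr (flat_measure {x. n \<bullet> x = b}) borel (\<lambda>y. y + s *\<^sub>R n))"
    using X by (subst nn_integral_distr) auto
  also have "\<dots> = emeasure (distr (flat_measure {x. n \<bullet> x = b}) borel (\<lambda>y. y + s *\<^sub>R n)) X"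
    using X by simp
  finally show "emeasure (flat_measure {x. n \<bullet> x = b + s}) X =
    emeasure (distr (flat_measure {x. n \<bullet> x = b}) borel (\<lambda>y. y + s *\<^sub>R n)) X" .
qed simp

lemma loc_polys:
  assumes "v \<in> fluid_space G r T" "K \<in> els T"
  shows "loc r v K \<in> polys r" "AE x in lebesgue. x \<in> K \<longrightarrow> v x = loc r v K x"
proof -
  have "\<exists>p. p \<in> polys r \<and> (AE x in lebesgue. x \<in> K \<longrightarrow> v x = p x)"
    using assms unfolding fluid_space_def by blast
  from someI_ex[OF this] show "loc r v K \<in> polys r" "AE x in lebesgue. x \<in> K \<longrightarrow> v x = loc r v K x"
    unfolding loc_def by auto
qed

lemma ploc_polys:
  assumes "w \<in> plate_space G r T" "E \<in> plate_els G T"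
  shows "ploc r w E \<in> polys r" "\<And>x. x \<in> E \<Longrightarrow> w x = ploc r w E x"
proof -
  have "\<exists>p. p \<in> polys r \<and> (\<forall>x\<in>E. w x = p x)"
    using assms unfolding plate_space_def by blast
  from someI_ex[OF this] show "ploc r w E \<in> polys r" "\<And>x. x \<in> E \<Longrightarrow> w x = ploc r w E x"
    unfolding ploc_def by auto
qed

definition fluid_norm2 :: "'n::finite geometry \<Rightarrow> nat \<Rightarrow> 'n mesh \<Rightarrow> (real^'n \<Rightarrow> complex) \<Rightarrow> real" where
  "fluid_norm2 G r T \<phi> = (\<Sum>K\<in>els T. LINT x:K|lebesgue. (norm (grad (loc r \<phi> K) x))\<^sup>2)
     + (LINT x:Om G|lebesgue. (cmod (\<phi> x))\<^sup>2) + Jf2 G r T \<phi>"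

definition plate_norm2 :: "'n::finite geometry \<Rightarrow> nat \<Rightarrow> 'n mesh \<Rightarrow> (real^'n \<Rightarrow> complex) \<Rightarrow> real" where
  "plate_norm2 G r T w =
     (\<Sum>E\<in>plate_els G T. LINT x:E|flat_measure E. (norm (thess (nu G) (ploc r w E) x))\<^sup>2)
     + (LINT x:Gam G|flat_measure (Gam G). (cmod (w x))\<^sup>2) + Jp2 G r T w"

text \<open>
  \<open>Lr\<close>, \<open>CP\<close> and \<open>CM\<close> depend on \<open>r\<close> and on the geometry only, and are fixed here so that the bounds below
  hold with the same constants on all meshes.
\<close>
locale fluid_mesh_degree = fluid_mesh G \<kappa> q c0 T
  for G :: "'n::finite geometry" and \<kappa> q c0 :: real and T :: "'n mesh" +
  fixes r :: nat and Lr :: "nat \<Rightarrow> real" and CP CM :: real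
  assumes rep: "\<And>p :: real^'n \<Rightarrow> complex. p \<in> polys r \<Longrightarrow> reproducing {..r} (\<lambda>j. 1 / (real j + 1)) Lr p"
    and trace_bounds: "broken_trace_bound (OmP G) (2 * q * \<kappa>) r CP" "broken_trace_bound (OmM G) (2 * q * \<kappa>) r CM"
      "0 < CP" "0 < CM"
begin

definition CF :: real where "CF = inverse_const CARD('n) r Lr"
definition Ct :: real where "Ct = CP + CM"

lemma flat_integral_nonneg: "0 \<le> (LINT x:A|M. (norm (f x))\<^sup>2)"
  by (rule set_lebesgue_integral_nonneg) simp

lemma Jf2_nonneg: "0 \<le> Jf2 G r T \<phi>"
  unfolding Jf2_def
proof (rule sum_nonneg)
  fix e assume "e \<in> fluid_facets G T"
  then have "e \<in> interior_facets (els T)" by (simp add: fluid_facets_def)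
  then have "0 < diameter e" using facet_diameter(1) sides by blast
  then show "0 \<le> 1 / diameter e * (LINT x:e|flat_measure e. (cmod (jump r T \<phi> e x))\<^sup>2)"
    using flat_integral_nonneg by (intro mult_nonneg_nonneg) auto
qed

lemma Jp2_nonneg: "0 \<le> Jp2 G r T w"
  unfolding Jp2_def
proof (rule sum_nonneg)
  fix p assume "p \<in> plate_facets G T"
  then show "0 \<le> 1 / plate_facet_size T p * (LINT x:p|flat_measure p. (norm (pjump G r T w p x))\<^sup>2)"
    using flat_integral_nonneg plate_facet_size(1) by (intro mult_nonneg_nonneg) (auto simp: less_imp_le)
qed

lemma fluid_norm2_parts:
  "0 \<le> fluid_norm2 G r T \<phi>"
  "(\<Sum>K\<in>els T. LINT x:K|lebesgue. (norm (grad (loc r \<phi> K) x))\<^sup>2) \<le> fluid_norm2 G r T \<phi>"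
  "Jf2 G r T \<phi> \<le> fluid_norm2 G r T \<phi>"
  "(LINT x:Om G|lebesgue. (cmod (\<phi> x))\<^sup>2) + (\<Sum>K\<in>els T. LINT x:K|lebesgue. (norm (grad (loc r \<phi> K) x))\<^sup>2)
     + Jf2 G r T \<phi> = fluid_norm2 G r T \<phi>"
proof -
  have "0 \<le> (\<Sum>K\<in>els T. LINT x:K|lebesgue. (norm (grad (loc r \<phi> K) x))\<^sup>2)"
    by (intro sum_nonneg flat_integral_nonneg)
  moreover have "0 \<le> (LINT x:Om G|lebesgue. (cmod (\<phi> x))\<^sup>2)" by (rule flat_integral_nonneg)
  ultimately show "0 \<le> fluid_norm2 G r T \<phi>"
    "(\<Sum>K\<in>els T. LINT x:K|lebesgue. (norm (grad (loc r \<phi> K) x))\<^sup>2) \<le> fluid_norm2 G r T \<phi>"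
    "Jf2 G r T \<phi> \<le> fluid_norm2 G r T \<phi>"
    "(LINT x:Om G|lebesgue. (cmod (\<phi> x))\<^sup>2) + (\<Sum>K\<in>els T. LINT x:K|lebesgue. (norm (grad (loc r \<phi> K) x))\<^sup>2)
     + Jf2 G r T \<phi> = fluid_norm2 G r T \<phi>"
    using Jf2_nonneg[of \<phi>] unfolding fluid_norm2_def by linarith+
qed

lemma plate_norm2_parts:
  "0 \<le> plate_norm2 G r T w"
  "(\<Sum>E\<in>plate_els G T. LINT x:E|flat_measure E. (norm (thess (nu G) (ploc r w E) x))\<^sup>2) \<le> plate_norm2 G r T w"
  "(LINT x:Gam G|flat_measure (Gam G). (cmod (w x))\<^sup>2) \<le> plate_norm2 G r T w"
  "Jp2 G r T w \<le> plate_norm2 G r T w"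
proof -
  have "0 \<le> (\<Sum>E\<in>plate_els G T. LINT x:E|flat_measure E. (norm (thess (nu G) (ploc r w E) x))\<^sup>2)"
    by (intro sum_nonneg flat_integral_nonneg)
  moreover have "0 \<le> (LINT x:Gam G|flat_measure (Gam G). (cmod (w x))\<^sup>2)" by (rule flat_integral_nonneg)
  ultimately show "0 \<le> plate_norm2 G r T w"
    "(\<Sum>E\<in>plate_els G T. LINT x:E|flat_measure E. (norm (thess (nu G) (ploc r w E) x))\<^sup>2) \<le> plate_norm2 G r T w"
    "(LINT x:Gam G|flat_measure (Gam G). (cmod (w x))\<^sup>2) \<le> plate_norm2 G r T w"
    "Jp2 G r T w \<le> plate_norm2 G r T w"
    using Jp2_nonneg[of w] unfolding plate_norm2_def by linarith+
qed

lemma facet_integrable: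
  fixes f :: "real^'n \<Rightarrow> 'b::euclidean_space"
  assumes "K \<in> els T" "e facet_of K" "continuous_on UNIV f"
  shows "set_integrable (flat_measure e) e f"
  by (rule simplex_set_integrable(2)[OF els_simplex[OF assms(1)] assms(3,2)])

lemma plate_integrable:
  fixes f :: "real^'n \<Rightarrow> 'b::euclidean_space"
  assumes "continuous_on UNIV f"
  shows "E \<in> plate_els G T \<Longrightarrow> set_integrable (flat_measure E) E f"
    "p \<in> plate_facets G T \<Longrightarrow> set_integrable (flat_measure p) p f"
proof -
  show "set_integrable (flat_measure E) E f" if "E \<in> plate_els G T"
    using set_integrable_flat_measure[OF plate_el(6,4)[OF that] continuous_on_subset[OF assms]] by simp
  show "set_integrable (flat_measure p) p f" if "p \<in> plate_facets G T"
    using set_integrable_flat_measure[OF plate_facet_aff_dim(3,2)[OF plate_facet(3,1)[OF that]] continuous_on_subset[OF assms]]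
    by simp
qed

section \<open>Mass and traces of a function in the fluid space\<close>

context
  fixes \<phi> assumes \<phi>: "\<phi> \<in> fluid_space G r T"
begin

lemma loc_cpoly: "K \<in> els T \<Longrightarrow> cpoly (loc r \<phi> K)"
  using loc_polys(1)[OF \<phi>] polys_imp_cpoly by blast

lemma loc_continuous:
  assumes "K \<in> els T"
  shows "continuous_on A (loc r \<phi> K)" "continuous_on A (grad (loc r \<phi> K))"
  using loc_cpoly[OF assms] continuous_on_cpoly continuous_on_grad by blast+

lemma els_lebesgue_eq:
  fixes f :: "real^'n \<Rightarrow> 'b::euclidean_space"
  assumes "K \<in> els T" "continuous_on UNIV f"
  shows "(LINT x:K|lebesgue. f x) = (LINT x:K|lborel. f x)" "set_integrable lebesgue K f"
proof -
  have K: "K \<in> sets borel" using compact_simplex[OF els_simplex[OF assms(1)]] by (rule borel_compact)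
  show "(LINT x:K|lebesgue. f x) = (LINT x:K|lborel. f x)"
    by (rule set_integral_lebesgue_eq_lborel[OF K borel_measurable_continuous_onI[OF assms(2)]])
  have "set_integrable lborel K f" by (rule simplex_set_integrable(1)[OF els_simplex[OF assms(1)] assms(2)])
  then show "set_integrable lebesgue K f"
    unfolding set_integrable_def by (subst integrable_completion) auto
qed

text \<open>The local polynomials agree with \<phi> almost everywhere on their elements, and the
  elements overlap only in frontiers, which are null by convexity. The trace inequality produces the
  left side; the norm contains the right side.\<close>

lemma mass_le: "(\<Sum>K\<in>els T. LINT x:K|lborel. (cmod (loc r \<phi> K x))\<^sup>2) \<le> (LINT x:Om G|lebesgue. (cmod (\<phi> x))\<^sup>2)"
proof -
  have "(\<Sum>K\<in>els T. LINT x:K|lborel. (cmod (loc r \<phi> K x))\<^sup>2) = (\<Sum>K\<in>els T. LINT x:K|lebesgue. (cmod (loc r \<phi> K x))\<^sup>2)"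
    by (intro sum.cong refl els_lebesgue_eq(1)[symmetric] continuous_intros loc_continuous)
  also have "\<dots> \<le> (LINT x:Om G|lebesgue. (cmod (\<phi> x))\<^sup>2)"
  proof (rule sum_set_integral_disjoint_le[where R = interior])
    fix K assume K: "K \<in> els T"
    have "negligible (frontier K)" using convex_simplex[OF els_simplex[OF K]] by (rule negligible_convex_frontier)
    then have "AE x in lebesgue. x \<notin> frontier K" by (intro AE_not_in) (simp add: negligible_iff_null_sets)
    then show "AE x in lebesgue. x \<in> K \<longrightarrow> x \<in> interior K \<and> (cmod (loc r \<phi> K x))\<^sup>2 = (cmod (\<phi> x))\<^sup>2"
      using loc_polys(2)[OF \<phi> K] by eventually_elim (use closure_subset in \<open>auto simp: frontier_def\<close>)
    show "interior K \<subseteq> Om G" by (rule els_interior_subset[OF K])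
  next
    show "disjoint_family_on interior (els T)"
      unfolding disjoint_family_on_def
    proof (intro ballI impI, rule ccontr)
      fix K K' assume "K \<in> els T" "K' \<in> els T" "K \<noteq> K'" "interior K \<inter> interior K' \<noteq> {}"
      then show False
        using triangulation_interiors_disjoint2[OF conforming(1), of K K'] els_simplex by simp
    qed
    have "integrable (lebesgue_on (Om G)) (\<lambda>x. (cmod (\<phi> x))\<^sup>2)" using \<phi> by (simp add: fluid_space_def)
    then show "set_integrable lebesgue (Om G) (\<lambda>x. (cmod (\<phi> x))\<^sup>2)"
      unfolding set_integrable_def using domains_open(1) by (subst (asm) integrable_restrict_space) auto
  qed (use finite_els in auto)
  finally show ?thesis .
qed

definition "facet_mass K e = (LINT x:e|flat_measure e. (cmod (loc r \<phi> K x))\<^sup>2)"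

lemma facet_mass_nonneg: "0 \<le> facet_mass K e"
  unfolding facet_mass_def by (rule flat_integral_nonneg)

lemma finite_boundary_pairs: "S = elsP T \<or> S = elsM T \<Longrightarrow> finite (boundary_pairs S)"
proof -
  assume S: "S = elsP T \<or> S = elsM T"
  have sub: "S \<subseteq> els T" using S by (auto simp: els_def)
  show ?thesis
  proof (rule facet_pairs_split(2))
    show "triangulation S" by (rule triangulation_mono[OF conforming(1) sub])
    show "int DIM(real^'n) simplex K" if "K \<in> S" for K using els_simplex that sub by blast
    fix e assume e: "e \<in> interior_facets S"
    then have "e \<in> interior_facets (els T)" using interior_facets_mono[OF sub] by blast
    then show "side1 T e \<in> S \<and> side2 T e \<in> S \<and> side1 T e \<noteq> side2 T e \<and> e facet_of side1 T e \<and> e facet_of side2 T e"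
      using interior_facets_half(2,3)[OF S e] sides by simp
  qed
qed

text \<open>With the facet diameters as weights, the jump sum over the interior facets of one half
  is a part of \<open>Jf2\<close>.\<close>

lemma trace_half:
  assumes S: "S = elsP T \<or> S = elsM T" and U: "\<Union>S = closure U" and C: "broken_trace_bound U (2 * q * \<kappa>) r C" "0 < C"
  shows "(\<Sum>(K, e)\<in>boundary_pairs S. facet_mass K e) \<le> C * fluid_norm2 G r T \<phi>"
proof -
  have sub: "S \<subseteq> els T" using S by (auto simp: els_def)
  note half = interior_facets_half[OF S]
  have IF: "e \<in> interior_facets (els T)" if "e \<in> interior_facets S" for e
    using interior_facets_mono[OF sub] that by blast
  have "(\<Sum>(K, e)\<in>boundary_pairs S. LINT x:e|flat_measure e. (cmod (loc r \<phi> K x))\<^sup>2) \<le>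
       C * ((\<Sum>K\<in>S. LINT x:K|lborel. (cmod (loc r \<phi> K x))\<^sup>2) +
        (\<Sum>K\<in>S. LINT x:K|lborel. (norm (grad (loc r \<phi> K) x))\<^sup>2) +
        (\<Sum>e\<in>interior_facets S. 1 / diameter e *
           (LINT x:e|flat_measure e. (cmod (loc r \<phi> (side1 T e) x - loc r \<phi> (side2 T e) x))\<^sup>2)))"
  proof (rule C(1)[unfolded broken_trace_bound_def, rule_format, where h = "mesh_size T"])
    show "triangulation S" by (rule triangulation_mono[OF conforming(1) sub])
    show "int CARD('n) simplex K" if "K \<in> S" for K using conforming(2) that sub by blast
    show "\<Union>S = closure U" by (rule U)
    show "\<exists>c \<rho>. 0 < \<rho> \<and> mesh_size T \<le> 2 * q * \<kappa> * \<rho> \<and> cball c \<rho> \<subseteq> K" if "K \<in> S" for K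
      using els_ball[of K] that sub by (auto simp: shape_def)
    fix e assume e: "e \<in> interior_facets S"
    show "side1 T e \<in> S \<and> side2 T e \<in> S \<and> side1 T e \<noteq> side2 T e \<and> e facet_of side1 T e \<and> e facet_of side2 T e"
      using half(2,3)[OF e] sides[OF IF[OF e]] by simp
    show "0 < diameter e \<and> diameter e \<le> mesh_size T"
      using facet_diameter[OF sides(1)[OF IF[OF e]] sides(4)[OF IF[OF e]]] by simp
  next
    show "loc r \<phi> K \<in> polys r" if "K \<in> S" for K using loc_polys(1)[OF \<phi>] that sub by blast
  qed
  also have "\<dots> \<le> C * fluid_norm2 G r T \<phi>"
  proof (intro mult_left_mono)
    have 1: "(\<Sum>K\<in>S. LINT x:K|lborel. (cmod (loc r \<phi> K x))\<^sup>2) \<le> (\<Sum>K\<in>els T. LINT x:K|lborel. (cmod (loc r \<phi> K x))\<^sup>2)"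
      by (intro sum_mono2 finite_els sub flat_integral_nonneg)
    have 2: "(\<Sum>K\<in>S. LINT x:K|lborel. (norm (grad (loc r \<phi> K) x))\<^sup>2) \<le> (\<Sum>K\<in>els T. LINT x:K|lborel. (norm (grad (loc r \<phi> K) x))\<^sup>2)"
      by (intro sum_mono2 finite_els sub flat_integral_nonneg)
    also have "\<dots> = (\<Sum>K\<in>els T. LINT x:K|lebesgue. (norm (grad (loc r \<phi> K) x))\<^sup>2)"
      by (intro sum.cong refl els_lebesgue_eq(1)[symmetric] continuous_intros loc_continuous)
    finally have 2: "(\<Sum>K\<in>S. LINT x:K|lborel. (norm (grad (loc r \<phi> K) x))\<^sup>2)
       \<le> (\<Sum>K\<in>els T. LINT x:K|lebesgue. (norm (grad (loc r \<phi> K) x))\<^sup>2)" .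
    have 3: "(\<Sum>e\<in>interior_facets S. 1 / diameter e *
           (LINT x:e|flat_measure e. (cmod (loc r \<phi> (side1 T e) x - loc r \<phi> (side2 T e) x))\<^sup>2)) \<le> Jf2 G r T \<phi>"
      unfolding Jf2_def jump_def
    proof (rule sum_mono2[OF finite_facets(2)])
      show "interior_facets S \<subseteq> fluid_facets G T" using half(1) by blast
      fix e assume "e \<in> fluid_facets G T - interior_facets S"
      then have "e \<in> interior_facets (els T)" by (simp add: fluid_facets_def)
      then have "0 < diameter e" using facet_diameter(1) sides by blast
      then show "0 \<le> 1 / diameter e * (LINT x:e|flat_measure e. (cmod (loc r \<phi> (side1 T e) x - loc r \<phi> (side2 T e) x))\<^sup>2)"
        using flat_integral_nonneg by (intro mult_nonneg_nonneg) auto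
    qed
    show "(\<Sum>K\<in>S. LINT x:K|lborel. (cmod (loc r \<phi> K x))\<^sup>2) +
        (\<Sum>K\<in>S. LINT x:K|lborel. (norm (grad (loc r \<phi> K) x))\<^sup>2) +
        (\<Sum>e\<in>interior_facets S. 1 / diameter e *
           (LINT x:e|flat_measure e. (cmod (loc r \<phi> (side1 T e) x - loc r \<phi> (side2 T e) x))\<^sup>2))
      \<le> fluid_norm2 G r T \<phi>"
      using 1 2 3 mass_le fluid_norm2_parts(4)[of \<phi>] by linarith
  qed (use C(2) in simp)
  finally show ?thesis by (simp add: facet_mass_def)
qed

text \<open>Stated for arbitrary sets of boundary pairs of the halves, because the outer boundary
  facets and either side of the plate are such sets.\<close>

lemma trace_pairs_le:
  assumes "F \<subseteq> boundary_pairs (elsP T) \<union> boundary_pairs (elsM T)"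
  shows "(\<Sum>(K, e)\<in>F. facet_mass K e) \<le> Ct * fluid_norm2 G r T \<phi>"
proof -
  have fin: "finite (boundary_pairs (elsP T))" "finite (boundary_pairs (elsM T))"
    using finite_boundary_pairs by blast+
  have d: "boundary_pairs (elsP T) \<inter> boundary_pairs (elsM T) = {}"
    using elsP_elsM_disjoint by (auto simp: boundary_pairs_def)
  have "(\<Sum>(K, e)\<in>F. facet_mass K e) \<le> (\<Sum>(K, e)\<in>boundary_pairs (elsP T) \<union> boundary_pairs (elsM T). facet_mass K e)"
    using assms fin facet_mass_nonneg by (intro sum_mono2) auto
  also have "\<dots> = (\<Sum>(K, e)\<in>boundary_pairs (elsP T). facet_mass K e) + (\<Sum>(K, e)\<in>boundary_pairs (elsM T). facet_mass K e)"
    using fin d by (rule sum.union_disjoint)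
  also have "\<dots> \<le> CP * fluid_norm2 G r T \<phi> + CM * fluid_norm2 G r T \<phi>"
    by (intro add_mono trace_half[OF _ conforming(3) trace_bounds(1,3)] trace_half[OF _ conforming(4) trace_bounds(2,4)]) auto
  finally show ?thesis by (simp add: Ct_def distrib_right)
qed

lemma boundary_facet_el:
  assumes "e \<in> boundary_facets (els T)"
  shows "(THE K. K \<in> els T \<and> e facet_of K) \<in> els T" "e facet_of (THE K. K \<in> els T \<and> e facet_of K)"
proof -
  obtain K where K: "K \<in> els T" "e facet_of K" using assms by (auto simp: boundary_facets_def facets_def)
  have "e \<notin> interior_facets (els T)" using assms by (simp add: boundary_facets_def)
  then have "K' = K" if "K' \<in> els T" "e facet_of K'" for K'
    using K that unfolding interior_facets_def by blast
  then have "\<exists>!K. K \<in> els T \<and> e facet_of K" using K by (intro ex1I[of _ K]) blast+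
  from theI'[OF this] show "(THE K. K \<in> els T \<and> e facet_of K) \<in> els T" "e facet_of (THE K. K \<in> els T \<and> e facet_of K)"
    by (rule conjunct1, rule conjunct2)
qed

lemma bd_trace_integrable:
  assumes "e \<in> boundary_facets (els T)" "closed S"
  shows "set_integrable (flat_measure e) (e \<inter> S) (\<lambda>x. (cmod (bd_trace r T \<phi> e x))\<^sup>2)"
    "set_integrable (flat_measure e) e (\<lambda>x. (cmod (bd_trace r T \<phi> e x))\<^sup>2)" "e \<inter> S \<in> sets borel"
proof -
  note K = boundary_facet_el[OF assms(1)]
  show 1: "set_integrable (flat_measure e) e (\<lambda>x. (cmod (bd_trace r T \<phi> e x))\<^sup>2)"
    unfolding bd_trace_def by (intro facet_integrable[OF K] continuous_intros loc_continuous K)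
  obtain a where "compact e" by (rule simplex_facetE[OF els_simplex[OF K(1)] K(2)])
  then show 2: "e \<inter> S \<in> sets borel" using assms(2) compact_imp_closed by (intro borel_closed closed_Int) auto
  show "set_integrable (flat_measure e) (e \<inter> S) (\<lambda>x. (cmod (bd_trace r T \<phi> e x))\<^sup>2)"
    by (rule set_integrable_subset[OF 1]) (use 2 in auto)
qed

lemma bd_trace_le:
  assumes "closed S"
  shows "(\<Sum>e\<in>boundary_facets (els T). LINT x:(e \<inter> S)|flat_measure e. (cmod (bd_trace r T \<phi> e x))\<^sup>2)
     \<le> Ct * fluid_norm2 G r T \<phi>"
proof -
  let ?K = "\<lambda>e. THE K. K \<in> els T \<and> e facet_of K"
  have "(\<Sum>e\<in>boundary_facets (els T). LINT x:(e \<inter> S)|flat_measure e. (cmod (bd_trace r T \<phi> e x))\<^sup>2) \<le>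
     (\<Sum>e\<in>boundary_facets (els T). facet_mass (?K e) e)"
  proof (rule sum_mono)
    fix e assume e: "e \<in> boundary_facets (els T)"
    have "(LINT x:(e \<inter> S)|flat_measure e. (cmod (bd_trace r T \<phi> e x))\<^sup>2) \<le>
       (LINT x:e|flat_measure e. (cmod (bd_trace r T \<phi> e x))\<^sup>2)"
      by (rule set_integral_mono_set_nonneg[OF bd_trace_integrable(2)[OF e assms]]) (use bd_trace_integrable(3)[OF e assms] in auto)
    then show "(LINT x:(e \<inter> S)|flat_measure e. (cmod (bd_trace r T \<phi> e x))\<^sup>2) \<le> facet_mass (?K e) e"
      by (simp add: facet_mass_def bd_trace_def)
  qed
  also have "\<dots> = (\<Sum>(K, e)\<in>(\<lambda>e. (?K e, e)) ` boundary_facets (els T). facet_mass K e)"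
    by (subst sum.reindex) (auto simp: inj_on_def)
  also have "\<dots> \<le> Ct * fluid_norm2 G r T \<phi>"
  proof (rule trace_pairs_le, clarify)
    fix e assume e: "e \<in> boundary_facets (els T)" "(?K e, e) \<notin> boundary_pairs (elsM T)"
    have "e \<notin> interior_facets (els T)" using e by (simp add: boundary_facets_def)
    then have "e \<notin> interior_facets (elsP T)" "e \<notin> interior_facets (elsM T)"
      using interior_facets_mono[of "elsP T" "els T"] interior_facets_mono[of "elsM T" "els T"] by (auto simp: els_def)
    then show "(?K e, e) \<in> boundary_pairs (elsP T)"
      using e boundary_facet_el[OF e(1)] by (auto simp: boundary_pairs_def els_def)
  qed
  finally show ?thesis .
qed

lemma jump_integrable:
  assumes "e \<in> interior_facets (els T)"
  shows "set_integrable (flat_measure e) e (\<lambda>x. (c * cmod (jump r T \<phi> e x))\<^sup>2)"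
  unfolding jump_def
  by (rule facet_integrable[OF sides(1)[OF assms] sides(4)[OF assms]])
    (intro continuous_intros loc_continuous sides(1,2)[OF assms])

text \<open>The norm does not penalise the jump across the plate, so the two one-sided traces are
  bounded separately, each as a boundary trace of its half. The 4 consists of 2 from squaring a sum
  and 2 for the two sides.\<close>

lemma plate_jump_le:
  "(\<Sum>E\<in>plate_els G T. LINT x:E|flat_measure E. (cmod (jump r T \<phi> E x))\<^sup>2) \<le> 4 * Ct * fluid_norm2 G r T \<phi>"
proof -
  have one: "(LINT x:E|flat_measure E. (cmod (jump r T \<phi> E x))\<^sup>2) \<le> 2 * facet_mass (side1 T E) E + 2 * facet_mass (side2 T E) E"
    if "E \<in> plate_els G T" for E
  proof -
    note I = plate_els_sides(1)[OF that]
    have int: "set_integrable (flat_measure E) E f" if "continuous_on UNIV f" for f :: "real^'n \<Rightarrow> real"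
      by (rule facet_integrable[OF sides(1)[OF I] sides(4)[OF I] that])
    have i1: "set_integrable (flat_measure E) E (\<lambda>x. 2 * (cmod (loc r \<phi> (side1 T E) x))\<^sup>2)"
      and i2: "set_integrable (flat_measure E) E (\<lambda>x. 2 * (cmod (loc r \<phi> (side2 T E) x))\<^sup>2)"
      by (intro int continuous_intros loc_continuous sides(1,2)[OF I])+
    have "(LINT x:E|flat_measure E. (cmod (jump r T \<phi> E x))\<^sup>2) \<le>
      (LINT x:E|flat_measure E. 2 * (cmod (loc r \<phi> (side1 T E) x))\<^sup>2 + 2 * (cmod (loc r \<phi> (side2 T E) x))\<^sup>2)"
    proof (rule set_integral_mono)
      show "set_integrable (flat_measure E) E (\<lambda>x. (cmod (jump r T \<phi> E x))\<^sup>2)"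
        using jump_integrable[OF I, of 1] by simp
      show "set_integrable (flat_measure E) E
         (\<lambda>x. 2 * (cmod (loc r \<phi> (side1 T E) x))\<^sup>2 + 2 * (cmod (loc r \<phi> (side2 T E) x))\<^sup>2)"
        by (rule set_integral_add(1)[OF i1 i2])
      fix x
      let ?a = "cmod (loc r \<phi> (side1 T E) x)" and ?b = "cmod (loc r \<phi> (side2 T E) x)"
      have "(cmod (jump r T \<phi> E x))\<^sup>2 \<le> (?a + ?b)\<^sup>2"
        unfolding jump_def by (intro power_mono norm_triangle_ineq4) auto
      also have "\<dots> \<le> 2 * ?a\<^sup>2 + 2 * ?b\<^sup>2" using sum_squares_bound[of ?a ?b] by (simp add: power2_sum)
      finally show "(cmod (jump r T \<phi> E x))\<^sup>2 \<le> 2 * ?a\<^sup>2 + 2 * ?b\<^sup>2" .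
    qed
    then show ?thesis unfolding set_integral_add(2)[OF i1 i2] facet_mass_def by simp
  qed
  have notin: "E \<notin> interior_facets (elsP T)" "E \<notin> interior_facets (elsM T)" if "E \<in> plate_els G T" for E
    using interior_facets_half(1)[of _ E] that by (auto simp: fluid_facets_def)
  have s1: "(\<Sum>E\<in>plate_els G T. facet_mass (side1 T E) E) \<le> Ct * fluid_norm2 G r T \<phi>"
  proof -
    have "(\<Sum>E\<in>plate_els G T. facet_mass (side1 T E) E) = (\<Sum>(K, e)\<in>(\<lambda>E. (side1 T E, E)) ` plate_els G T. facet_mass K e)"
      by (subst sum.reindex) (auto simp: inj_on_def)
    also have "\<dots> \<le> Ct * fluid_norm2 G r T \<phi>"
      using notin plate_els_sides sides by (intro trace_pairs_le) (auto simp: boundary_pairs_def)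
    finally show ?thesis .
  qed
  have s2: "(\<Sum>E\<in>plate_els G T. facet_mass (side2 T E) E) \<le> Ct * fluid_norm2 G r T \<phi>"
  proof -
    have "(\<Sum>E\<in>plate_els G T. facet_mass (side2 T E) E) = (\<Sum>(K, e)\<in>(\<lambda>E. (side2 T E, E)) ` plate_els G T. facet_mass K e)"
      by (subst sum.reindex) (auto simp: inj_on_def)
    also have "\<dots> \<le> Ct * fluid_norm2 G r T \<phi>"
      using notin plate_els_sides sides by (intro trace_pairs_le) (auto simp: boundary_pairs_def)
    finally show ?thesis .
  qed
  have "(\<Sum>E\<in>plate_els G T. LINT x:E|flat_measure E. (cmod (jump r T \<phi> E x))\<^sup>2) \<le>
     (\<Sum>E\<in>plate_els G T. 2 * facet_mass (side1 T E) E + 2 * facet_mass (side2 T E) E)"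
    by (intro sum_mono one)
  also have "\<dots> = 2 * (\<Sum>E\<in>plate_els G T. facet_mass (side1 T E) E) + 2 * (\<Sum>E\<in>plate_els G T. facet_mass (side2 T E) E)"
    by (simp add: sum.distrib sum_distrib_left)
  finally show ?thesis using s1 s2 by linarith
qed

end

end


section \<open>Terms of the sesquilinear form\<close>

lemma sum_integral_le_sqrt:
  fixes f :: "'i \<Rightarrow> 'a \<Rightarrow> 'b::{banach, second_countable_topology}"
  assumes "\<And>i. i \<in> I \<Longrightarrow> set_integrable (M i) (A i) (\<lambda>x. (a i x)\<^sup>2)"
    and "\<And>i. i \<in> I \<Longrightarrow> set_integrable (M i) (A i) (\<lambda>x. (b i x)\<^sup>2)"
    and "\<And>i x. i \<in> I \<Longrightarrow> x \<in> A i \<Longrightarrow> norm (f i x) \<le> a i x * b i x"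
    and "(\<Sum>i\<in>I. LINT x:A i|M i. (a i x)\<^sup>2) \<le> \<alpha>" "(\<Sum>i\<in>I. LINT x:A i|M i. (b i x)\<^sup>2) \<le> \<beta>"
  shows "norm (\<Sum>i\<in>I. LINT x:A i|M i. f i x) \<le> sqrt \<alpha> * sqrt \<beta>"
proof -
  have "norm (\<Sum>i\<in>I. LINT x:A i|M i. f i x) \<le>
     sqrt (\<Sum>i\<in>I. LINT x:A i|M i. (a i x)\<^sup>2) * sqrt (\<Sum>i\<in>I. LINT x:A i|M i. (b i x)\<^sup>2)"
    by (rule sum_integral_Cauchy_Schwarz[OF assms(1-3)])
  also have "\<dots> \<le> sqrt \<alpha> * sqrt \<beta>"
  proof -
    have "0 \<le> (\<Sum>i\<in>I. LINT x:A i|M i. (a i x)\<^sup>2)" "0 \<le> (\<Sum>i\<in>I. LINT x:A i|M i. (b i x)\<^sup>2)"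
      by (intro sum_nonneg set_lebesgue_integral_nonneg zero_le_power2)+
    then show ?thesis using assms(4,5) by (intro mult_mono real_sqrt_le_mono) auto
  qed
  finally show ?thesis .
qed

lemma sum_integral_le_const_sqrt:
  fixes f :: "'i \<Rightarrow> 'a \<Rightarrow> 'b::{banach, second_countable_topology}"
  assumes "\<And>i. i \<in> I \<Longrightarrow> set_integrable (M i) (A i) (\<lambda>x. (a i x)\<^sup>2)"
    and "\<And>i. i \<in> I \<Longrightarrow> set_integrable (M i) (A i) (\<lambda>x. (b i x)\<^sup>2)"
    and "\<And>i x. i \<in> I \<Longrightarrow> x \<in> A i \<Longrightarrow> norm (f i x) \<le> k * (a i x * b i x)"
    and "(\<Sum>i\<in>I. LINT x:A i|M i. (a i x)\<^sup>2) \<le> \<alpha>" "(\<Sum>i\<in>I. LINT x:A i|M i. (b i x)\<^sup>2) \<le> \<beta>" and k: "0 \<le> k"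
  shows "norm (\<Sum>i\<in>I. LINT x:A i|M i. f i x) \<le> k * (sqrt \<alpha> * sqrt \<beta>)"
proof -
  have "norm (\<Sum>i\<in>I. LINT x:A i|M i. f i x) \<le> sqrt (k\<^sup>2 * \<alpha>) * sqrt \<beta>"
  proof (rule sum_integral_le_sqrt[where a = "\<lambda>i x. k * a i x" and b = b])
    show "set_integrable (M i) (A i) (\<lambda>x. (k * a i x)\<^sup>2)" if "i \<in> I" for i
      unfolding power_mult_distrib using assms(1)[OF that] by (rule set_integrable_mult_right)
    show "(\<Sum>i\<in>I. LINT x:A i|M i. (k * a i x)\<^sup>2) \<le> k\<^sup>2 * \<alpha>"
      unfolding power_mult_distrib set_integral_mult_right sum_distrib_left[symmetric]
      using assms(4) by (rule mult_left_mono) simp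
    show "norm (f i x) \<le> k * a i x * b i x" if "i \<in> I" "x \<in> A i" for i x
      using assms(3)[OF that] by (simp only: mult.assoc)
  qed (use assms in auto)
  then show ?thesis using k by (simp add: real_sqrt_mult)
qed

lemma set_integral_le_const_sqrt:
  fixes f :: "'a \<Rightarrow> 'b::{banach, second_countable_topology}"
  assumes "set_integrable M A (\<lambda>x. (a x)\<^sup>2)" "set_integrable M A (\<lambda>x. (b x)\<^sup>2)"
    and "\<And>x. x \<in> A \<Longrightarrow> norm (f x) \<le> k * (a x * b x)"
    and "(LINT x:A|M. (a x)\<^sup>2) \<le> \<alpha>" "(LINT x:A|M. (b x)\<^sup>2) \<le> \<beta>" and "0 \<le> k"
  shows "norm (LINT x:A|M. f x) \<le> k * (sqrt \<alpha> * sqrt \<beta>)"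
  using sum_integral_le_const_sqrt[of "{()}" "\<lambda>_. M" "\<lambda>_. A" "\<lambda>_. a" "\<lambda>_. b" "\<lambda>_. f" k \<alpha> \<beta>] assms by simp

lemma square_average_le: "((a + b) / 2)\<^sup>2 \<le> (a\<^sup>2 + b\<^sup>2) / (2::real)"
proof -
  have "0 \<le> (a - b)\<^sup>2" by simp
  then show ?thesis by (simp add: power2_eq_square field_simps)
qed

text \<open>Meant for averaged derivatives: \<open>g1\<close> and \<open>g2\<close> come from the
  two sides of a facet of size \<open>d\<close>, and the last two assumptions have the form that the
  inverse inequality provides.\<close>

lemma weighted_average_integral_le:
  fixes g1 g2 :: "'a \<Rightarrow> real"
  assumes "set_integrable M A (\<lambda>x. (g1 x)\<^sup>2)" "set_integrable M A (\<lambda>x. (g2 x)\<^sup>2)"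
    and "set_integrable M A (\<lambda>x. (sqrt d * (c * ((g1 x + g2 x) / 2)))\<^sup>2)"
    and d: "0 \<le> d" "d \<le> h"
    and "h * (LINT x:A|M. (g1 x)\<^sup>2) \<le> C * Q1" "h * (LINT x:A|M. (g2 x)\<^sup>2) \<le> C * Q2"
  shows "(LINT x:A|M. (sqrt d * (c * ((g1 x + g2 x) / 2)))\<^sup>2) \<le> c\<^sup>2 * C / 2 * (Q1 + Q2)"
proof -
  have i: "set_integrable M A (\<lambda>x. h * c\<^sup>2 / 2 * (g1 x)\<^sup>2)" "set_integrable M A (\<lambda>x. h * c\<^sup>2 / 2 * (g2 x)\<^sup>2)"
    using assms(1,2) by (intro set_integrable_mult_right; simp)+
  have "(LINT x:A|M. (sqrt d * (c * ((g1 x + g2 x) / 2)))\<^sup>2) \<le>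
     (LINT x:A|M. h * c\<^sup>2 / 2 * (g1 x)\<^sup>2 + h * c\<^sup>2 / 2 * (g2 x)\<^sup>2)"
  proof (rule set_integral_mono[OF assms(3) set_integral_add(1)[OF i]])
    fix x
    have "(sqrt d * (c * ((g1 x + g2 x) / 2)))\<^sup>2 = d * (c\<^sup>2 * ((g1 x + g2 x) / 2)\<^sup>2)"
      using d by (simp only: power_mult_distrib real_sqrt_pow2)
    also have "\<dots> \<le> h * (c\<^sup>2 * (((g1 x)\<^sup>2 + (g2 x)\<^sup>2) / 2))"
      using d by (intro mult_mono mult_left_mono square_average_le) auto
    finally show "(sqrt d * (c * ((g1 x + g2 x) / 2)))\<^sup>2 \<le> h * c\<^sup>2 / 2 * (g1 x)\<^sup>2 + h * c\<^sup>2 / 2 * (g2 x)\<^sup>2"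
      by (simp add: algebra_simps add_divide_distrib)
  qed
  also have "\<dots> = c\<^sup>2 / 2 * (h * (LINT x:A|M. (g1 x)\<^sup>2)) + c\<^sup>2 / 2 * (h * (LINT x:A|M. (g2 x)\<^sup>2))"
    unfolding set_integral_add(2)[OF i] set_integral_mult_right by (simp add: algebra_simps)
  also have "\<dots> \<le> c\<^sup>2 / 2 * (C * Q1) + c\<^sup>2 / 2 * (C * Q2)"
    using assms(6,7) by (intro add_mono mult_left_mono) auto
  finally show ?thesis by (simp add: algebra_simps add_divide_distrib)
qed

lemma continuous_on_outer: "continuous_on A u \<Longrightarrow> continuous_on A (\<lambda>x. outer (u x) n)"
  unfolding outer_def by (intro continuous_on_vec_lambda continuous_intros)

lemma fluid_geometry_closed:
  assumes "fluid_geometry G"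
  shows "closed (Gfs G)" "closed (Gin G)" "closed (Gout G)"
  using assms unfolding fluid_geometry_def by auto

lemma cross_section_facts:
  assumes "fluid_geometry G"
  shows "Sec G \<subseteq> {y. y $ ix G = 0}"
    "Gin G = (\<lambda>y. y + (- Lf G) *\<^sub>R axis (ix G) 1) ` Sec G"
    "Gout G = (\<lambda>y. y + Lf G *\<^sub>R axis (ix G) 1) ` Sec G"
  using assms unfolding fluid_geometry_def by auto

context fluid_mesh_degree
begin

lemma fluid_facetD:
  assumes "e \<in> fluid_facets G T"
  shows "e \<in> interior_facets (els T)" "0 < diameter e" "diameter e \<le> mesh_size T"
proof -
  show I: "e \<in> interior_facets (els T)" using assms by (simp add: fluid_facets_def)
  show "0 < diameter e" "diameter e \<le> mesh_size T" by (rule facet_diameter[OF sides(1)[OF I] sides(4)[OF I]])+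
qed

section \<open>Averages, jumps and modal coefficients in the fluid\<close>

context
  fixes \<phi> assumes \<phi>: "\<phi> \<in> fluid_space G r T"
begin

definition "grad_average e x =
  (norm (grad (loc r \<phi> (side1 T e)) x) + norm (grad (loc r \<phi> (side2 T e)) x)) / 2"

lemma cmod_avg_dn_le:
  assumes "e \<in> interior_facets (els T)"
  shows "cmod (avg_dn r T \<phi> e x) \<le> grad_average e x"
proof -
  let ?d1 = "dnormal (fnormal T e) (loc r \<phi> (side1 T e)) x" and ?d2 = "dnormal (fnormal T e) (loc r \<phi> (side2 T e)) x"
  have "cmod ?d1 \<le> norm (grad (loc r \<phi> (side1 T e)) x)" "cmod ?d2 \<le> norm (grad (loc r \<phi> (side2 T e)) x)"
    using cmod_dnormal_le[of "fnormal T e"] sides(6)[OF assms] by (metis mult.right_neutral)+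
  then have "cmod (?d1 + ?d2) \<le> norm (grad (loc r \<phi> (side1 T e)) x) + norm (grad (loc r \<phi> (side2 T e)) x)"
    by (rule norm_triangle_mono)
  then show ?thesis unfolding avg_dn_def grad_average_def by (simp add: norm_divide)
qed

lemma grad_average_integrable:
  assumes "e \<in> interior_facets (els T)"
  shows "set_integrable (flat_measure e) e (\<lambda>x. (c * (d * grad_average e x))\<^sup>2)"
  unfolding grad_average_def
  by (rule facet_integrable[OF sides(1)[OF assms] sides(4)[OF assms]])
    (intro continuous_intros loc_continuous[OF \<phi>] sides(1,2)[OF assms], simp)

text \<open>Passing from a facet to an element costs one power of the mesh size, which the squared
  weight supplies. Each element is counted through its facets on either side.\<close>

lemma grad_average_le:
  "(\<Sum>e\<in>fluid_facets G T. LINT x:e|flat_measure e. (sqrt (diameter e) * grad_average e x)\<^sup>2) \<le>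
     shape * CF * (real CARD('n) + 1) * fluid_norm2 G r T \<phi>"
proof -
  define Q where "Q K = (LINT x:K|lborel. (norm (grad (loc r \<phi> K) x))\<^sup>2)" for K
  have Q0: "0 \<le> Q K" for K unfolding Q_def by (rule flat_integral_nonneg)
  have one: "(LINT x:e|flat_measure e. (sqrt (diameter e) * grad_average e x)\<^sup>2) \<le>
     (shape * CF) / 2 * (Q (side1 T e) + Q (side2 T e))" if e: "e \<in> fluid_facets G T" for e
  proof -
    note f = fluid_facetD[OF e] and s = sides[OF fluid_facetD(1)[OF e]]
    have i: "set_integrable (flat_measure e) e (\<lambda>x. (norm (grad (loc r \<phi> K) x))\<^sup>2)" if "K \<in> els T" for K
      by (rule facet_integrable[OF s(1,4)]) (intro continuous_intros loc_continuous[OF \<phi>] that)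
    have h: "mesh_size T * (LINT x:e|flat_measure e. (norm (grad (loc r \<phi> K) x))\<^sup>2) \<le> (shape * CF) * Q K"
      if "K \<in> els T" "e facet_of K" for K
      unfolding Q_def CF_def
      by (rule fluid_facet_inverse_inequality[OF that loc_continuous(2)[OF \<phi> that(1)]
          reproducing_grad[OF loc_cpoly[OF \<phi> that(1)] rep[OF loc_polys(1)[OF \<phi> that(1)]]]])
    have "(LINT x:e|flat_measure e. (sqrt (diameter e) * (1 * ((norm (grad (loc r \<phi> (side1 T e)) x) + norm (grad (loc r \<phi> (side2 T e)) x)) / 2)))\<^sup>2)
      \<le> 1\<^sup>2 * (shape * CF) / 2 * (Q (side1 T e) + Q (side2 T e))"
    proof (rule weighted_average_integral_le[OF i i _ _ f(3) h h])
      show "set_integrable (flat_measure e) e (\<lambda>x. (sqrt (diameter e) * (1 * ((norm (grad (loc r \<phi> (side1 T e)) x) + norm (grad (loc r \<phi> (side2 T e)) x)) / 2)))\<^sup>2)"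
        using grad_average_integrable[OF f(1), of "sqrt (diameter e)" 1] unfolding grad_average_def .
    qed (use s f in auto)
    then show ?thesis by (simp add: grad_average_def)
  qed
  have c: "(\<Sum>e\<in>fluid_facets G T. Q (side1 T e)) \<le> (real CARD('n) + 1) * (\<Sum>K\<in>els T. Q K)"
    "(\<Sum>e\<in>fluid_facets G T. Q (side2 T e)) \<le> (real CARD('n) + 1) * (\<Sum>K\<in>els T. Q K)"
    by (rule sum_facet_sides_le[OF finite_els conforming(2)]; use fluid_facetD(1) sides Q0 in simp)+
  have QF: "(\<Sum>K\<in>els T. Q K) \<le> fluid_norm2 G r T \<phi>"
  proof -
    have "(\<Sum>K\<in>els T. Q K) = (\<Sum>K\<in>els T. LINT x:K|lebesgue. (norm (grad (loc r \<phi> K) x))\<^sup>2)"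
      unfolding Q_def by (intro sum.cong refl els_lebesgue_eq(1)[OF \<phi>, symmetric] continuous_intros loc_continuous[OF \<phi>])
    then show ?thesis using fluid_norm2_parts(2)[of \<phi>] by simp
  qed
  have CF0: "0 \<le> shape * CF" using shape_nonneg inverse_const_nonneg by (simp add: CF_def)
  have "(\<Sum>e\<in>fluid_facets G T. LINT x:e|flat_measure e. (sqrt (diameter e) * grad_average e x)\<^sup>2) \<le>
     (\<Sum>e\<in>fluid_facets G T. (shape * CF) / 2 * (Q (side1 T e) + Q (side2 T e)))"
    by (intro sum_mono one)
  also have "\<dots> = (shape * CF) / 2 * ((\<Sum>e\<in>fluid_facets G T. Q (side1 T e)) + (\<Sum>e\<in>fluid_facets G T. Q (side2 T e)))"
    unfolding sum.distrib[symmetric] sum_distrib_left ..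
  also have "\<dots> \<le> (shape * CF) / 2 * (2 * ((real CARD('n) + 1) * fluid_norm2 G r T \<phi>))"
  proof (rule mult_left_mono)
    have "(real CARD('n) + 1) * (\<Sum>K\<in>els T. Q K) \<le> (real CARD('n) + 1) * fluid_norm2 G r T \<phi>"
      using QF by (intro mult_left_mono) auto
    then show "(\<Sum>e\<in>fluid_facets G T. Q (side1 T e)) + (\<Sum>e\<in>fluid_facets G T. Q (side2 T e))
      \<le> 2 * ((real CARD('n) + 1) * fluid_norm2 G r T \<phi>)" using c by linarith
  qed (use CF0 in simp)
  finally show ?thesis by simp
qed

lemma fluid_jump_le:
  "(\<Sum>e\<in>fluid_facets G T. LINT x:e|flat_measure e. (1 / sqrt (diameter e) * cmod (jump r T \<phi> e x))\<^sup>2) \<le> fluid_norm2 G r T \<phi>"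
proof -
  have "(\<Sum>e\<in>fluid_facets G T. LINT x:e|flat_measure e. (1 / sqrt (diameter e) * cmod (jump r T \<phi> e x))\<^sup>2) = Jf2 G r T \<phi>"
    unfolding Jf2_def
  proof (rule sum.cong[OF refl])
    fix e assume "e \<in> fluid_facets G T"
    then have "(1 / sqrt (diameter e))\<^sup>2 = 1 / diameter e" using fluid_facetD(2) by (simp add: power_divide less_imp_le)
    then show "(LINT x:e|flat_measure e. (1 / sqrt (diameter e) * cmod (jump r T \<phi> e x))\<^sup>2) =
       1 / diameter e * (LINT x:e|flat_measure e. (cmod (jump r T \<phi> e x))\<^sup>2)"
      by (simp only: power_mult_distrib set_integral_mult_right)
  qed
  then show ?thesis using fluid_norm2_parts(3)[of \<phi>] by simp
qed

text \<open>Cauchy-Schwarz separates the trace from the mode. The mode is only square integrable on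
  the cross section, so its integrals over the boundary facets have to be reassembled into one
  integral over \<open>S\<close>: facets in the plane of \<open>S\<close> overlap in null sets, and
  facets in other planes meet \<open>S\<close> in null sets.\<close>

lemma modal_coeff_le:
  assumes md: "modal_data G P" and m: "m \<le> nmode P" and S: "S = Gin G \<or> S = Gout G"
  shows "cmod (modal_coeff G P r T S \<phi> m) \<le> sqrt (Ct * fluid_norm2 G r T \<phi>) * sqrt (modal_norm2 G P m)"
proof -
  let ?a = "axis (ix G) 1 :: real^'n"
  \<comment> \<open>\<open>s\<close> is - Lf for the inlet and Lf for the outlet.\<close>
  obtain s where s: "S = (\<lambda>y. y + s *\<^sub>R ?a) ` Sec G" using S cross_section_facts[OF geo] by metis
  have clS: "closed S" using S fluid_geometry_closed[OF geo] by auto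
  have sec: "Sec G \<subseteq> {y. y $ ix G = 0}" by (rule cross_section_facts(1)[OF geo])
  have na: "norm ?a = 1" by simp
  have ax: "?a \<bullet> x = x $ ix G" for x by (simp add: inner_axis')
  let ?H = "{x. ?a \<bullet> x = s}" and ?Z = "{x. ?a \<bullet> x = 0}"
  have hH: "affine hull ?H = ?H" by (simp add: affine_hyperplane hull_same)
  have cross: "cross_measure G = flat_measure ?Z" by (simp add: cross_measure_def ax)
  have fH: "flat_measure ?H = distr (flat_measure ?Z) borel (\<lambda>y. y + s *\<^sub>R ?a)"
    using flat_measure_hyperplane_translate[OF na, where b = 0 and s = s] unfolding add_0 .
  define \<psi> where "\<psi> x = psi P m (to_cross G x)" for x
  \<comment> \<open>The squared mode, extended by 0 off \<open>S\<close>. Translated back by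
    \<open>s\<close> it is the squared mode on the cross section, from which measurability and
    integral are inherited.\<close>
  define f where "f x = indicat_real S x *\<^sub>R (\<psi> x)\<^sup>2" for x
  have tc: "to_cross G (y + s *\<^sub>R ?a) = y" if "y $ ix G = 0" for y
    using that by (simp add: to_cross_def)
  have memS: "x \<in> S \<longleftrightarrow> x \<in> ?H \<and> to_cross G x \<in> Sec G" for x
  proof
    assume "x \<in> S"
    then obtain y where "y \<in> Sec G" "x = y + s *\<^sub>R ?a" using s by auto
    then show "x \<in> ?H \<and> to_cross G x \<in> Sec G" using sec tc[of y] by (auto simp: ax)
  next
    assume "x \<in> ?H \<and> to_cross G x \<in> Sec G"
    moreover have "x = to_cross G x + (x $ ix G) *\<^sub>R ?a" by (simp add: to_cross_def)
    ultimately show "x \<in> S" unfolding s by (auto simp: ax)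
  qed
  have int0: "integrable (flat_measure ?Z) (\<lambda>y. indicat_real (Sec G) y *\<^sub>R (psi P m y)\<^sup>2)"
    using md m unfolding modal_data_def set_integrable_def cross by auto
  then have b0: "(\<lambda>y. indicat_real (Sec G) y *\<^sub>R (psi P m y)\<^sup>2) \<in> borel_measurable borel"
    using borel_measurable_integrable measurable_cong_sets[OF sets_flat_measure refl] by blast
  have tcm: "to_cross G \<in> borel_measurable borel"
    unfolding to_cross_def[abs_def] by (intro borel_measurable_continuous_onI continuous_intros)
  have fe: "f = (\<lambda>x. indicat_real ?H x * (indicat_real (Sec G) (to_cross G x) *\<^sub>R (psi P m (to_cross G x))\<^sup>2))"
    unfolding f_def \<psi>_def by (auto simp: memS indicator_def)
  have bf: "f \<in> borel_measurable borel"
    unfolding fe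
    by (intro borel_measurable_times measurable_compose[OF tcm b0] borel_measurable_indicator borel_closed closed_hyperplane)
  have fs: "f (y + s *\<^sub>R ?a) = indicat_real (Sec G) y *\<^sub>R (psi P m y)\<^sup>2" for y
  proof (cases "y $ ix G = 0")
    case True
    then show ?thesis unfolding fe using tc[OF True] by (simp add: ax)
  next
    case False
    then have "y \<notin> Sec G" using sec by auto
    then show ?thesis unfolding fe using False by (simp add: ax)
  qed
  have T: "(\<lambda>y. y + s *\<^sub>R ?a) \<in> measurable (flat_measure ?Z) borel"
    unfolding measurable_cong_sets[OF sets_flat_measure refl] by measurable
  have intf: "integrable (flat_measure ?H) f"
    unfolding fH integrable_distr_eq[OF T bf] fs by (rule int0)
  have If: "(LINT x:S|flat_measure ?H. (\<psi> x)\<^sup>2) = modal_norm2 G P m"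
  proof -
    have "(LINT x:S|flat_measure ?H. (\<psi> x)\<^sup>2) = integral\<^sup>L (flat_measure ?H) f"
      unfolding set_lebesgue_integral_def f_def ..
    also have "\<dots> = modal_norm2 G P m"
      unfolding fH integral_distr[OF T bf] fs modal_norm2_def set_lebesgue_integral_def cross ..
    finally show ?thesis .
  qed
  have intS: "set_integrable (flat_measure ?H) S (\<lambda>x. (\<psi> x)\<^sup>2)"
    using intf unfolding f_def set_integrable_def .
  have ehull: "\<exists>n b. norm n = 1 \<and> affine hull e = {x. n \<bullet> x = b} \<and> e \<noteq> {} \<and> compact e \<and> convex e"
    if e: "e \<in> boundary_facets (els T)" for e
  proof -
    note K = boundary_facet_el[OF \<phi> e]
    obtain n where n: "outward (THE K. K \<in> els T \<and> e facet_of K) e n" using outward_exists[OF els_simplex[OF K(1)] K(2)] by blast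
    obtain b where "affine hull e = {x. n \<bullet> x = b}" "norm n = 1" "e \<noteq> {}" "compact e" "convex e"
      by (rule outwardE[OF els_simplex[OF K(1)] K(2) n])
    then show ?thesis by blast
  qed
  have null: "AE x in flat_measure e. x \<notin> e \<inter> S" if e: "e \<in> boundary_facets (els T)" "affine hull e \<noteq> ?H" for e
  proof -
    obtain n b where n: "norm n = 1" "affine hull e = {x. n \<bullet> x = b}" using ehull[OF e(1)] by blast
    have "AE x in flat_measure e. x \<in> e \<longrightarrow> ?a \<bullet> x \<noteq> s"
      by (rule flat_measure_hyperplane_null[OF n na e(2)])
    then show ?thesis by eventually_elim (use memS in blast)
  qed
  have flat_eq: "flat_measure e = flat_measure ?H" if "affine hull e = ?H" for e
    by (rule flat_measure_cong) (simp only: that hH)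
  have inte: "set_integrable (flat_measure e) (e \<inter> S) (\<lambda>x. (\<psi> x)\<^sup>2)" if e: "e \<in> boundary_facets (els T)" for e
  proof -
    note eS = bd_trace_integrable(3)[OF \<phi> e clS]
    show ?thesis
    proof (cases "affine hull e = ?H")
      case True
      show ?thesis unfolding flat_eq[OF True] by (rule set_integrable_subset[OF intS]) (use eS in auto)
    next
      case False
      have ce: "compact e" using ehull[OF e] by blast
      have "(\<lambda>x. indicat_real (e \<inter> S) x *\<^sub>R (\<psi> x)\<^sup>2) = (\<lambda>x. indicat_real e x * f x)"
        by (auto simp: f_def indicator_def)
      then have m: "(\<lambda>x. indicat_real (e \<inter> S) x *\<^sub>R (\<psi> x)\<^sup>2) \<in> borel_measurable (flat_measure e)"
        unfolding measurable_cong_sets[OF sets_flat_measure refl]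
        using bf ce by (simp only:) (intro borel_measurable_times borel_measurable_indicator borel_compact)
      have "AE x in flat_measure e. indicat_real (e \<inter> S) x *\<^sub>R (\<psi> x)\<^sup>2 = 0"
        using null[OF e False] by eventually_elim simp
      then show ?thesis
        unfolding set_integrable_def using integrable_cong_AE[OF m, of "\<lambda>x. 0"] by simp
    qed
  qed
  \<comment> \<open>Relative interiors are disjoint and lose only a null set of a facet. A facet
    outside the plane of \<open>S\<close> gets the empty set.\<close>
  define R where "R e = (if affine hull e = ?H then rel_interior e \<inter> S else {})" for e
  have sum: "(\<Sum>e\<in>boundary_facets (els T). LINT x:(e \<inter> S)|flat_measure e. (\<psi> x)\<^sup>2) \<le> modal_norm2 G P m"
    unfolding If[symmetric]
  proof (rule sum_set_integral_disjoint_le[where R = R])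
    fix e assume e: "e \<in> boundary_facets (els T)"
    show "AE x in flat_measure e. x \<in> e \<inter> S \<longrightarrow> x \<in> R e \<and> (\<psi> x)\<^sup>2 = (\<psi> x)\<^sup>2"
    proof (cases "affine hull e = ?H")
      case True
      have "AE x in flat_measure e. x \<in> e \<longrightarrow> x \<in> rel_interior e"
        using ehull[OF e] by (intro flat_measure_rel_boundary_null) (auto intro: compact_imp_closed)
      then show ?thesis by eventually_elim (auto simp: R_def True)
    next
      case False
      show ?thesis using null[OF e False] by eventually_elim auto
    qed
    show "R e \<noteq> {} \<Longrightarrow> flat_measure e = flat_measure ?H"
      using flat_eq by (auto simp: R_def split: if_splits)
    show "R e \<subseteq> S" by (auto simp: R_def)
    have "compact e" using ehull[OF e] by blast
    then have "rel_interior e \<in> sets borel" by (intro borel_rel_interior compact_imp_closed)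
    then show "R e \<in> sets (flat_measure ?H)"
      using borel_closed[OF clS] by (simp add: R_def sets.Int)
  next
    show "disjoint_family_on R (boundary_facets (els T))"
      unfolding disjoint_family_on_def
    proof (intro ballI impI, rule ccontr)
      fix e e' assume *: "e \<in> boundary_facets (els T)" "e' \<in> boundary_facets (els T)" "e \<noteq> e'" "R e \<inter> R e' \<noteq> {}"
      obtain x where x: "x \<in> rel_interior e" "x \<in> rel_interior e'" using *(4) by (auto simp: R_def split: if_splits)
      have "e = e'"
        by (rule facets_rel_interior_disjoint[OF conforming(1) boundary_facet_el(1)[OF \<phi> *(1)] boundary_facet_el(1)[OF \<phi> *(2)]
            boundary_facet_el(2)[OF \<phi> *(1)] boundary_facet_el(2)[OF \<phi> *(2)] x])
      then show False using *(3) by simp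
    qed
  qed (use finite_facets intS in auto)
  show ?thesis
    unfolding modal_coeff_def bd_integral_def \<psi>_def[symmetric]
  proof (rule sum_integral_le_sqrt[where a = "\<lambda>e x. cmod (bd_trace r T \<phi> e x)" and b = "\<lambda>e x. \<bar>\<psi> x\<bar>"])
    show "(\<Sum>e\<in>boundary_facets (els T). LINT x:(e \<inter> S)|flat_measure e. (cmod (bd_trace r T \<phi> e x))\<^sup>2) \<le> Ct * fluid_norm2 G r T \<phi>"
      by (rule bd_trace_le[OF \<phi> clS])
    show "(\<Sum>e\<in>boundary_facets (els T). LINT x:(e \<inter> S)|flat_measure e. \<bar>\<psi> x\<bar>\<^sup>2) \<le> modal_norm2 G P m"
      using sum by simp
  qed (use bd_trace_integrable(1)[OF \<phi> _ clS] inte in \<open>auto simp: norm_mult\<close>)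
qed

end

section \<open>Averages and jumps on the plate\<close>

context
  fixes w assumes w: "w \<in> plate_space G r T"
begin

lemma ploc_cpoly: "E \<in> plate_els G T \<Longrightarrow> cpoly (ploc r w E)"
  using ploc_polys(1)[OF w] polys_imp_cpoly by blast

definition "hess_average p x =
  (norm (thess (nu G) (ploc r w (pside1 T p)) x) + norm (thess (nu G) (ploc r w (pside2 T p)) x)) / 2"

lemma norm_pavg_le:
  assumes p: "p \<in> plate_facets G T" "x \<in> p"
    and D: "\<And>x H. x \<in> closure (Gam G) \<Longrightarrow> norm (contract (rigid P x) H) \<le> d * norm H"
  shows "norm (pavg G P r T w p x) \<le> d * hess_average p x"
proof -
  have x: "x \<in> closure (Gam G)"
    using p(2) facet_of_imp_subset[OF plate_facet(3)[OF p(1)]] plate_els_sides(4)[OF plate_facet(1)[OF p(1)]] by blast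
  let ?c1 = "contract (rigid P x) (thess (nu G) (ploc r w (pside1 T p)) x)"
  let ?c2 = "contract (rigid P x) (thess (nu G) (ploc r w (pside2 T p)) x)"
  have "norm (?c1 + ?c2) \<le> d * norm (thess (nu G) (ploc r w (pside1 T p)) x) + d * norm (thess (nu G) (ploc r w (pside2 T p)) x)"
    by (rule norm_triangle_mono[OF D[OF x] D[OF x]])
  then show ?thesis unfolding pavg_def hess_average_def by (simp add: distrib_left)
qed

lemma hess_average_integrable:
  assumes "p \<in> plate_facets G T"
  shows "set_integrable (flat_measure p) p (\<lambda>x. (c * (d * hess_average p x))\<^sup>2)"
  unfolding hess_average_def
  by (rule plate_integrable(2)[OF _ assms])
    (intro continuous_intros continuous_on_thess ploc_cpoly plate_facet(1,2)[OF assms], simp)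

lemma hess_average_le:
  "(\<Sum>p\<in>plate_facets G T. LINT x:p|flat_measure p. (sqrt (plate_facet_size T p) * (d * hess_average p x))\<^sup>2) \<le>
     d\<^sup>2 * shape * CF * real CARD('n) * plate_norm2 G r T w"
proof -
  define Q where "Q E = (LINT x:E|flat_measure E. (norm (thess (nu G) (ploc r w E) x))\<^sup>2)" for E
  have Q0: "0 \<le> Q K" for K unfolding Q_def by (rule flat_integral_nonneg)
  have one: "(LINT x:p|flat_measure p. (sqrt (plate_facet_size T p) * (d * hess_average p x))\<^sup>2) \<le>
     d\<^sup>2 * (shape * CF) / 2 * (Q (pside1 T p) + Q (pside2 T p))" if p: "p \<in> plate_facets G T" for p
  proof -
    note f = plate_facet[OF p] and sz = plate_facet_size[OF p]
    have i: "set_integrable (flat_measure p) p (\<lambda>x. (norm (thess (nu G) (ploc r w E) x))\<^sup>2)" if "E \<in> plate_els G T" for E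
      by (rule plate_integrable(2)[OF _ p]) (intro continuous_intros continuous_on_thess ploc_cpoly that)
    have h: "mesh_size T * (LINT x:p|flat_measure p. (norm (thess (nu G) (ploc r w E) x))\<^sup>2) \<le> (shape * CF) * Q E"
      if "E \<in> plate_els G T" "p facet_of E" for E
      unfolding Q_def CF_def
      by (rule plate_facet_inverse_inequality[OF p that continuous_on_thess[OF ploc_cpoly[OF that(1)]]
          reproducing_thess[OF ploc_cpoly[OF that(1)] rep[OF ploc_polys(1)[OF w that(1)]]]])
    show ?thesis
      unfolding hess_average_def
    proof (rule weighted_average_integral_le[OF i i _ _ sz(2) h h])
      show "set_integrable (flat_measure p) p (\<lambda>x. (sqrt (plate_facet_size T p) * (d * ((norm (thess (nu G) (ploc r w (pside1 T p)) x)
          + norm (thess (nu G) (ploc r w (pside2 T p)) x)) / 2)))\<^sup>2)"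
        using hess_average_integrable[OF p] unfolding hess_average_def .
    qed (use f sz in auto)
  qed
  \<comment> \<open>A plate element is a simplex of dimension CARD('n) - 1, with at most CARD('n)
    facets.\<close>
  have N: "real (CARD('n) - 1) + 1 = real CARD('n)" using dim by auto
  have c: "(\<Sum>p\<in>plate_facets G T. Q (pside1 T p)) \<le> real CARD('n) * (\<Sum>E\<in>plate_els G T. Q E)"
    "(\<Sum>p\<in>plate_facets G T. Q (pside2 T p)) \<le> real CARD('n) * (\<Sum>E\<in>plate_els G T. Q E)"
    unfolding N[symmetric]
    by (rule sum_facet_sides_le[OF finite_facets(3) plate_el(3)]; use plate_facet Q0 in simp)+
  have QF: "(\<Sum>E\<in>plate_els G T. Q E) \<le> plate_norm2 G r T w"
    using plate_norm2_parts(2)[of w] unfolding Q_def .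
  have CF0: "0 \<le> d\<^sup>2 * (shape * CF)" using shape_nonneg inverse_const_nonneg by (simp add: CF_def)
  have "(\<Sum>p\<in>plate_facets G T. LINT x:p|flat_measure p. (sqrt (plate_facet_size T p) * (d * hess_average p x))\<^sup>2) \<le>
     (\<Sum>p\<in>plate_facets G T. d\<^sup>2 * (shape * CF) / 2 * (Q (pside1 T p) + Q (pside2 T p)))"
    by (intro sum_mono one)
  also have "\<dots> = d\<^sup>2 * (shape * CF) / 2 * ((\<Sum>p\<in>plate_facets G T. Q (pside1 T p)) + (\<Sum>p\<in>plate_facets G T. Q (pside2 T p)))"
    unfolding sum.distrib[symmetric] sum_distrib_left ..
  also have "\<dots> \<le> d\<^sup>2 * (shape * CF) / 2 * (2 * (real CARD('n) * plate_norm2 G r T w))"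
  proof (rule mult_left_mono)
    have "real CARD('n) * (\<Sum>E\<in>plate_els G T. Q E) \<le> real CARD('n) * plate_norm2 G r T w"
      using QF by (intro mult_left_mono) auto
    then show "(\<Sum>p\<in>plate_facets G T. Q (pside1 T p)) + (\<Sum>p\<in>plate_facets G T. Q (pside2 T p))
      \<le> 2 * (real CARD('n) * plate_norm2 G r T w)" using c by linarith
  qed (use CF0 in simp)
  finally show ?thesis by simp
qed

lemma plate_jump_integrable:
  assumes "p \<in> plate_facets G T"
  shows "set_integrable (flat_measure p) p (\<lambda>x. (c * norm (pjump G r T w p x))\<^sup>2)"
  unfolding pjump_def
  by (rule plate_integrable(2)[OF _ assms])
    (intro continuous_intros continuous_on_outer continuous_on_tgrad ploc_cpoly plate_facet(1,2)[OF assms])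

lemma plate_gradient_jump_le:
  "(\<Sum>p\<in>plate_facets G T. LINT x:p|flat_measure p. (1 / sqrt (plate_facet_size T p) * norm (pjump G r T w p x))\<^sup>2) \<le> plate_norm2 G r T w"
proof -
  have "(\<Sum>p\<in>plate_facets G T. LINT x:p|flat_measure p. (1 / sqrt (plate_facet_size T p) * norm (pjump G r T w p x))\<^sup>2) = Jp2 G r T w"
    unfolding Jp2_def
  proof (rule sum.cong[OF refl])
    fix p assume "p \<in> plate_facets G T"
    then have "(1 / sqrt (plate_facet_size T p))\<^sup>2 = 1 / plate_facet_size T p"
      using plate_facet_size(1) by (simp add: power_divide less_imp_le)
    then show "(LINT x:p|flat_measure p. (1 / sqrt (plate_facet_size T p) * norm (pjump G r T w p x))\<^sup>2) =
       1 / plate_facet_size T p * (LINT x:p|flat_measure p. (norm (pjump G r T w p x))\<^sup>2)"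
      by (simp only: power_mult_distrib set_integral_mult_right)
  qed
  then show ?thesis using plate_norm2_parts(4)[of w] by simp
qed

lemma plate_continuous: "continuous_on (closure (Gam G)) w"
  using w by (simp add: plate_space_def)

lemma plate_value_integrable:
  "E \<in> plate_els G T \<Longrightarrow> set_integrable (flat_measure E) E (\<lambda>x. (c * cmod (w x))\<^sup>2)"
  "set_integrable (flat_measure (Gam G)) (Gam G) (\<lambda>x. (c * cmod (w x))\<^sup>2)"
proof -
  show "set_integrable (flat_measure E) E (\<lambda>x. (c * cmod (w x))\<^sup>2)" if "E \<in> plate_els G T"
    by (intro set_integrable_flat_measure plate_el[OF that] continuous_intros
        continuous_on_subset[OF plate_continuous] plate_els_sides(4)[OF that])
  have "set_integrable (flat_measure (Gam G)) (closure (Gam G)) (\<lambda>x. (c * cmod (w x))\<^sup>2)"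
    by (intro set_integrable_flat_measure domains(8) compact_plate continuous_intros plate_continuous)
  moreover obtain b where "Gam G \<in> sets borel" by (rule plate_hyperplane)
  then have "Gam G \<in> sets (flat_measure (Gam G))" by simp
  ultimately show "set_integrable (flat_measure (Gam G)) (Gam G) (\<lambda>x. (c * cmod (w x))\<^sup>2)"
    by (rule set_integrable_subset) (auto simp: closure_subset)
qed

text \<open>The coupling terms integrate over closed plate elements, the norm over
  \<open>Gam G\<close>. The relative interiors of the elements are disjoint parts of
  \<open>Gam G\<close> and carry the full integrals.\<close>

lemma plate_value_le:
  "(\<Sum>E\<in>plate_els G T. LINT x:E|flat_measure E. (cmod (w x))\<^sup>2) \<le> plate_norm2 G r T w"
proof -
  have "(\<Sum>E\<in>plate_els G T. LINT x:E|flat_measure E. (cmod (w x))\<^sup>2) \<le> (LINT x:Gam G|flat_measure (Gam G). (cmod (w x))\<^sup>2)"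
  proof (rule sum_set_integral_disjoint_le[where R = rel_interior])
    fix E assume E: "E \<in> plate_els G T"
    have "AE x in flat_measure E. x \<in> E \<longrightarrow> x \<in> rel_interior E"
      by (intro flat_measure_rel_boundary_null plate_el[OF E] compact_imp_closed)
    then show "AE x in flat_measure E. x \<in> E \<longrightarrow> x \<in> rel_interior E \<and> (cmod (w x))\<^sup>2 = (cmod (w x))\<^sup>2"
      by eventually_elim simp
    show "flat_measure E = flat_measure (Gam G)" "rel_interior E \<subseteq> Gam G" by (rule plate_el[OF E])+
    show "rel_interior E \<in> sets (flat_measure (Gam G))"
      using plate_el(4)[OF E] by (simp add: borel_rel_interior compact_imp_closed)
  qed (use finite_facets plate_disjoint plate_value_integrable(2)[of 1] in auto)
  then show ?thesis using plate_norm2_parts(3)[of w] by linarith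
qed

end

end


section \<open>Continuity\<close>

lemma norm_six_le:
  fixes a :: "'a::real_normed_vector"
  assumes "norm a \<le> a'" "norm b \<le> b'" "norm c \<le> c'" "norm d \<le> d'" "norm e \<le> e'" "norm f \<le> f'"
  shows "norm (a - b - c - d - e + f) \<le> a' + b' + c' + d' + e' + f'"
proof -
  have "norm (a - b) \<le> a' + b'" using norm_triangle_ineq4[of a b] assms by linarith
  then have "norm (a - b - c) \<le> a' + b' + c'" using norm_triangle_ineq4[of "a - b" c] assms by linarith
  then have "norm (a - b - c - d) \<le> a' + b' + c' + d'" using norm_triangle_ineq4[of "a - b - c" d] assms by linarith
  then have "norm (a - b - c - d - e) \<le> a' + b' + c' + d' + e'"
    using norm_triangle_ineq4[of "a - b - c - d" e] assms by linarith
  then show ?thesis using norm_triangle_ineq[of "a - b - c - d - e" f] assms by linarith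
qed

text \<open>\<open>ct\<close> is the trace constant and \<open>ca\<close> the constant for averaged
  gradients. The summands belong, in order, to the gradient term, the free surface, the modal
  operator, the two consistency terms and the penalty.\<close>

definition fluid_const :: "'n::finite geometry \<Rightarrow> 'n params \<Rightarrow> real \<Rightarrow> real \<Rightarrow> real" where
  "fluid_const G P ct ca = 1 + (omega P)\<^sup>2 / grav P * ct
     + (\<Sum>m\<le>nmode P. cmod (\<i> * km P m / complex_of_real (modal_norm2 G P m)) * (2 * (ct * modal_norm2 G P m)))
     + 2 * sqrt ca + sig1 P"

text \<open>\<open>cd\<close> bounds the contraction with the rigidity tensor and \<open>cp\<close>
  the averaged moments. The summands belong to the bending energy, the inertia, the two consistency
  terms and the penalty.\<close>

definition plate_const :: "'n::finite params \<Rightarrow> real \<Rightarrow> real \<Rightarrow> real" where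
  "plate_const P cd cp = cd + inert P * (omega P)\<^sup>2 + 2 * sqrt cp + sig2 P"

text \<open>\<open>4 * ct\<close> is the constant for the jump across the plate, and the division by
  \<open>sqrt (mup P)\<close> passes from the plate norm to the full norm. The summands 1 and
  \<open>mup P * rhow P\<close> stand for the two coupling terms of the form.\<close>

definition coupling_const :: "'n::finite params \<Rightarrow> real \<Rightarrow> real" where
  "coupling_const P ct = (1 + mup P * rhow P) * (omega P * sqrt (4 * ct) / sqrt (mup P))"

context fluid_mesh_degree
begin

lemma Ct_pos: "0 < Ct" using trace_bounds by (simp add: Ct_def)

lemma modal_product_le:
  assumes "\<phi> \<in> fluid_space G r T" "v \<in> fluid_space G r T"
    and "modal_data G P" "m \<le> nmode P" "S = Gin G \<or> S = Gout G"
  shows "cmod (modal_coeff G P r T S \<phi> m * cnj (modal_coeff G P r T S v m)) \<le>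
     Ct * modal_norm2 G P m * (sqrt (fluid_norm2 G r T \<phi>) * sqrt (fluid_norm2 G r T v))"
proof -
  have m0: "0 \<le> modal_norm2 G P m" using assms(3,4) by (auto simp: modal_data_def less_imp_le)
  have "cmod (modal_coeff G P r T S \<phi> m * cnj (modal_coeff G P r T S v m)) \<le>
     (sqrt (Ct * fluid_norm2 G r T \<phi>) * sqrt (modal_norm2 G P m)) * (sqrt (Ct * fluid_norm2 G r T v) * sqrt (modal_norm2 G P m))"
    unfolding norm_mult complex_mod_cnj
    by (intro mult_mono modal_coeff_le assms) (auto intro!: mult_nonneg_nonneg simp: Ct_pos less_imp_le fluid_norm2_parts m0)
  also have "\<dots> = (sqrt Ct * sqrt Ct) * (sqrt (modal_norm2 G P m) * sqrt (modal_norm2 G P m)) * (sqrt (fluid_norm2 G r T \<phi>) * sqrt (fluid_norm2 G r T v))"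
    by (simp only: real_sqrt_mult mult_ac)
  also have "\<dots> = Ct * modal_norm2 G P m * (sqrt (fluid_norm2 G r T \<phi>) * sqrt (fluid_norm2 G r T v))"
    using Ct_pos m0 by simp
  finally show ?thesis .
qed

lemma Kform_le:
  assumes v: "\<phi> \<in> fluid_space G r T" "v \<in> fluid_space G r T" and md: "modal_data G P"
  shows "cmod (Kform G P r T \<phi> v) \<le>
    (\<Sum>m\<le>nmode P. cmod (\<i> * km P m / complex_of_real (modal_norm2 G P m)) * (2 * (Ct * modal_norm2 G P m))) *
    (sqrt (fluid_norm2 G r T \<phi>) * sqrt (fluid_norm2 G r T v))"
  unfolding Kform_def sum_distrib_right
proof (rule sum_norm_le)
  fix m assume "m \<in> {..nmode P}"
  then have m: "m \<le> nmode P" by simp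
  let ?F = "sqrt (fluid_norm2 G r T \<phi>) * sqrt (fluid_norm2 G r T v)"
  let ?c = "\<i> * km P m / complex_of_real (modal_norm2 G P m)"
  have "cmod (modal_coeff G P r T (Gin G) \<phi> m * cnj (modal_coeff G P r T (Gin G) v m)
      + modal_coeff G P r T (Gout G) \<phi> m * cnj (modal_coeff G P r T (Gout G) v m))
     \<le> Ct * modal_norm2 G P m * ?F + Ct * modal_norm2 G P m * ?F"
    by (intro norm_triangle_mono modal_product_le[OF v md m]) auto
  then have "cmod ?c * cmod (modal_coeff G P r T (Gin G) \<phi> m * cnj (modal_coeff G P r T (Gin G) v m)
      + modal_coeff G P r T (Gout G) \<phi> m * cnj (modal_coeff G P r T (Gout G) v m))
    \<le> cmod ?c * (Ct * modal_norm2 G P m * ?F + Ct * modal_norm2 G P m * ?F)"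
    by (rule mult_left_mono) simp
  also have "\<dots> = cmod ?c * (2 * (Ct * modal_norm2 G P m)) * ?F" by (simp add: algebra_simps)
  finally show "cmod (?c * (modal_coeff G P r T (Gin G) \<phi> m * cnj (modal_coeff G P r T (Gin G) v m)
      + modal_coeff G P r T (Gout G) \<phi> m * cnj (modal_coeff G P r T (Gout G) v m)))
    \<le> cmod ?c * (2 * (Ct * modal_norm2 G P m)) * ?F"
    by (simp only: norm_mult)
qed

lemma fluid_form_le:
  assumes v: "\<phi> \<in> fluid_space G r T" "v \<in> fluid_space G r T" and P: "admissible_params G P"
  shows "cmod (fluid_form G P r T \<phi> v) \<le>
    fluid_const G P Ct (shape * CF * (real CARD('n) + 1)) * (sqrt (fluid_norm2 G r T \<phi>) * sqrt (fluid_norm2 G r T v))"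
proof -
  let ?F = "sqrt (fluid_norm2 G r T \<phi>) * sqrt (fluid_norm2 G r T v)"
  let ?ca = "shape * CF * (real CARD('n) + 1)"
  have md: "modal_data G P" and pos: "0 < omega P" "0 < grav P" "0 < sig1 P"
    using P by (auto simp: admissible_params_def)
  have t1: "cmod (\<Sum>K\<in>els T. LINT x:K|lebesgue. cdot (grad (loc r \<phi> K) x) (grad (loc r v K) x)) \<le> 1 * ?F"
  proof (rule sum_integral_le_const_sqrt)
    fix K assume K: "K \<in> els T"
    show "set_integrable lebesgue K (\<lambda>x. (norm (grad (loc r \<phi> K) x))\<^sup>2)"
      "set_integrable lebesgue K (\<lambda>x. (norm (grad (loc r v K) x))\<^sup>2)"
      by (intro els_lebesgue_eq(2)[OF v(1) K] continuous_intros loc_continuous[OF v(1) K] loc_continuous[OF v(2) K])+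
  qed (use cmod_cdot_le fluid_norm2_parts(2) in auto)
  have t2: "cmod (bd_integral T (Gfs G) (\<lambda>e x. complex_of_real ((omega P)\<^sup>2 / grav P) *
         bd_trace r T \<phi> e x * cnj (bd_trace r T v e x))) \<le> (omega P)\<^sup>2 / grav P * Ct * ?F"
  proof -
    note cl = fluid_geometry_closed(1)[OF geo]
    have "cmod (bd_integral T (Gfs G) (\<lambda>e x. complex_of_real ((omega P)\<^sup>2 / grav P) *
         bd_trace r T \<phi> e x * cnj (bd_trace r T v e x))) \<le>
       (omega P)\<^sup>2 / grav P * (sqrt (Ct * fluid_norm2 G r T \<phi>) * sqrt (Ct * fluid_norm2 G r T v))"
      unfolding bd_integral_def
      by (rule sum_integral_le_const_sqrt[OF bd_trace_integrable(1)[OF v(1) _ cl] bd_trace_integrable(1)[OF v(2) _ cl] _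
            bd_trace_le[OF v(1) cl] bd_trace_le[OF v(2) cl]])
        (use pos in \<open>auto simp: norm_mult norm_divide norm_power\<close>)
    also have "sqrt (Ct * fluid_norm2 G r T \<phi>) * sqrt (Ct * fluid_norm2 G r T v) = (sqrt Ct * sqrt Ct) * ?F"
      by (simp only: real_sqrt_mult mult_ac)
    finally show ?thesis using Ct_pos by simp
  qed
  have jump_i: "set_integrable (flat_measure e) e (\<lambda>x. (1 / sqrt (diameter e) * cmod (jump r T \<psi> e x))\<^sup>2)"
    if "e \<in> fluid_facets G T" "\<psi> \<in> fluid_space G r T" for e \<psi>
    using jump_integrable[OF that(2) fluid_facetD(1)[OF that(1)]] .
  have avg_i: "set_integrable (flat_measure e) e (\<lambda>x. (sqrt (diameter e) * grad_average \<psi> e x)\<^sup>2)"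
    if "e \<in> fluid_facets G T" "\<psi> \<in> fluid_space G r T" for e \<psi>
    using grad_average_integrable[OF that(2) fluid_facetD(1)[OF that(1)], of "sqrt (diameter e)" 1] by simp
  \<comment> \<open>In the consistency terms a factor 1 is inserted: the root of the facet size goes
    to the averaged gradient, its inverse to the jump.\<close>
  have t4: "cmod (\<Sum>e\<in>fluid_facets G T. LINT x:e|flat_measure e. avg_dn r T \<phi> e x * cnj (jump r T v e x)) \<le> sqrt ?ca * ?F"
  proof -
    have "cmod (\<Sum>e\<in>fluid_facets G T. LINT x:e|flat_measure e. avg_dn r T \<phi> e x * cnj (jump r T v e x)) \<le>
       sqrt (?ca * fluid_norm2 G r T \<phi>) * sqrt (fluid_norm2 G r T v)"
    proof (rule sum_integral_le_sqrt[OF avg_i[OF _ v(1)] jump_i[OF _ v(2)] _ grad_average_le[OF v(1)] fluid_jump_le[OF v(2)]])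
      fix e x assume e: "e \<in> fluid_facets G T"
      have "cmod (avg_dn r T \<phi> e x * cnj (jump r T v e x)) \<le> grad_average \<phi> e x * cmod (jump r T v e x)"
        unfolding norm_mult complex_mod_cnj by (intro mult_right_mono cmod_avg_dn_le v fluid_facetD(1)[OF e]) simp
      then show "cmod (avg_dn r T \<phi> e x * cnj (jump r T v e x)) \<le>
        sqrt (diameter e) * grad_average \<phi> e x * (1 / sqrt (diameter e) * cmod (jump r T v e x))"
        using fluid_facetD(2)[OF e] by simp
    qed
    then show ?thesis by (simp only: real_sqrt_mult mult.assoc)
  qed
  have t5: "cmod (\<Sum>e\<in>fluid_facets G T. LINT x:e|flat_measure e. jump r T \<phi> e x * cnj (avg_dn r T v e x)) \<le> sqrt ?ca * ?F"
  proof -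
    have "cmod (\<Sum>e\<in>fluid_facets G T. LINT x:e|flat_measure e. jump r T \<phi> e x * cnj (avg_dn r T v e x)) \<le>
       sqrt (fluid_norm2 G r T \<phi>) * sqrt (?ca * fluid_norm2 G r T v)"
    proof (rule sum_integral_le_sqrt[OF jump_i[OF _ v(1)] avg_i[OF _ v(2)] _ fluid_jump_le[OF v(1)] grad_average_le[OF v(2)]])
      fix e x assume e: "e \<in> fluid_facets G T"
      have "cmod (jump r T \<phi> e x * cnj (avg_dn r T v e x)) \<le> cmod (jump r T \<phi> e x) * grad_average v e x"
        unfolding norm_mult complex_mod_cnj by (intro mult_left_mono cmod_avg_dn_le v fluid_facetD(1)[OF e]) simp
      then show "cmod (jump r T \<phi> e x * cnj (avg_dn r T v e x)) \<le>
        1 / sqrt (diameter e) * cmod (jump r T \<phi> e x) * (sqrt (diameter e) * grad_average v e x)"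
        using fluid_facetD(2)[OF e] by simp
    qed
    then show ?thesis by (simp only: real_sqrt_mult mult_ac)
  qed
  have t6: "cmod (\<Sum>e\<in>fluid_facets G T. LINT x:e|flat_measure e.
          complex_of_real (sig1 P / diameter e) * jump r T \<phi> e x * cnj (jump r T v e x)) \<le> sig1 P * ?F"
  proof (rule sum_integral_le_const_sqrt[OF jump_i[OF _ v(1)] jump_i[OF _ v(2)] _ fluid_jump_le[OF v(1)] fluid_jump_le[OF v(2)]])
    fix e x assume e: "e \<in> fluid_facets G T"
    have "1 / diameter e = 1 / sqrt (diameter e) * (1 / sqrt (diameter e))" using fluid_facetD(2)[OF e] by simp
    then show "cmod (complex_of_real (sig1 P / diameter e) * jump r T \<phi> e x * cnj (jump r T v e x)) \<le>
      sig1 P * (1 / sqrt (diameter e) * cmod (jump r T \<phi> e x) * (1 / sqrt (diameter e) * cmod (jump r T v e x)))"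
      using pos fluid_facetD(2)[OF e] by (simp add: norm_mult norm_divide)
  qed (use pos in auto)
  have "cmod (fluid_form G P r T \<phi> v) \<le> 1 * ?F + (omega P)\<^sup>2 / grav P * Ct * ?F +
     (\<Sum>m\<le>nmode P. cmod (\<i> * km P m / complex_of_real (modal_norm2 G P m)) * (2 * (Ct * modal_norm2 G P m))) * ?F +
     sqrt ?ca * ?F + sqrt ?ca * ?F + sig1 P * ?F"
    unfolding fluid_form_def by (rule norm_six_le[OF t1 t2 Kform_le[OF v md] t4 t5 t6])
  also have "\<dots> = fluid_const G P Ct ?ca * ?F"
    unfolding fluid_const_def by (simp only: distrib_right mult_2 add.assoc)
  finally show ?thesis .
qed

lemma plate_form_le:
  assumes \<phi>: "\<phi> \<in> fluid_space G r T" and w: "w \<in> plate_space G r T" "s \<in> plate_space G r T"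
    and P: "admissible_params G P"
    and D: "\<And>x H. x \<in> closure (Gam G) \<Longrightarrow> norm (contract (rigid P x) H) \<le> cd * norm H" "0 \<le> cd"
  shows "cmod (plate_form G P r T \<phi> w s) \<le>
    plate_const P cd (cd\<^sup>2 * shape * CF * real CARD('n)) * (sqrt (plate_norm2 G r T w) * sqrt (plate_norm2 G r T s)) +
    omega P * rhow P * sqrt (4 * Ct) * (sqrt (fluid_norm2 G r T \<phi>) * sqrt (plate_norm2 G r T s))"
proof -
  let ?F = "sqrt (plate_norm2 G r T w) * sqrt (plate_norm2 G r T s)"
  let ?cp = "cd\<^sup>2 * shape * CF * real CARD('n)"
  have pos: "0 < omega P" "0 < rhow P" "0 \<le> inert P" "0 < sig2 P"
    using P by (auto simp: admissible_params_def)
  have jump_i: "set_integrable (flat_measure p) p (\<lambda>x. (1 / sqrt (plate_facet_size T p) * norm (pjump G r T z p x))\<^sup>2)"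
    if "p \<in> plate_facets G T" "z \<in> plate_space G r T" for p z
    using plate_jump_integrable[OF that(2,1)] .
  have avg_i: "set_integrable (flat_measure p) p (\<lambda>x. (sqrt (plate_facet_size T p) * (cd * hess_average z p x))\<^sup>2)"
    if "p \<in> plate_facets G T" "z \<in> plate_space G r T" for p z
    using hess_average_integrable[OF that(2,1)] .
  have t1: "cmod (\<Sum>E\<in>plate_els G T. LINT x:E|flat_measure E.
        cddot (contract (rigid P x) (thess (nu G) (ploc r w E) x)) (thess (nu G) (ploc r s E) x)) \<le> cd * ?F"
  proof (rule sum_integral_le_const_sqrt[OF _ _ _ plate_norm2_parts(2) plate_norm2_parts(2) D(2)])
    fix E assume E: "E \<in> plate_els G T"
    show "set_integrable (flat_measure E) E (\<lambda>x. (norm (thess (nu G) (ploc r w E) x))\<^sup>2)"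
      "set_integrable (flat_measure E) E (\<lambda>x. (norm (thess (nu G) (ploc r s E) x))\<^sup>2)"
      by (intro plate_integrable(1)[OF _ E] continuous_intros continuous_on_thess ploc_cpoly[OF w(1) E] ploc_cpoly[OF w(2) E])+
    fix x assume "x \<in> E"
    then have x: "x \<in> closure (Gam G)" using plate_els_sides(4)[OF E] by blast
    have "cmod (cddot (contract (rigid P x) (thess (nu G) (ploc r w E) x)) (thess (nu G) (ploc r s E) x)) \<le>
       norm (contract (rigid P x) (thess (nu G) (ploc r w E) x)) * norm (thess (nu G) (ploc r s E) x)" by (rule cmod_cddot_le)
    also have "\<dots> \<le> cd * norm (thess (nu G) (ploc r w E) x) * norm (thess (nu G) (ploc r s E) x)"
      by (intro mult_right_mono D(1)[OF x]) simp
    finally show "cmod (cddot (contract (rigid P x) (thess (nu G) (ploc r w E) x)) (thess (nu G) (ploc r s E) x)) \<le>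
       cd * (norm (thess (nu G) (ploc r w E) x) * norm (thess (nu G) (ploc r s E) x))" by (simp only: mult.assoc)
  qed
  have t2: "cmod (LINT x:Gam G|flat_measure (Gam G).
          complex_of_real (inert P * (omega P)\<^sup>2) * w x * cnj (s x)) \<le> inert P * (omega P)\<^sup>2 * ?F"
    by (rule set_integral_le_const_sqrt[where a = "\<lambda>x. cmod (w x)" and b = "\<lambda>x. cmod (s x)"])
      (use plate_value_integrable(2)[OF w(1), of 1] plate_value_integrable(2)[OF w(2), of 1] plate_norm2_parts(3) pos
        in \<open>auto simp: norm_mult norm_power\<close>)
  have t3: "cmod (\<Sum>E\<in>plate_els G T. LINT x:E|flat_measure E.
          \<i> * complex_of_real (omega P * rhow P) * jump r T \<phi> E x * cnj (s x)) \<le>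
     omega P * rhow P * sqrt (4 * Ct) * (sqrt (fluid_norm2 G r T \<phi>) * sqrt (plate_norm2 G r T s))"
  proof -
    have "cmod (\<Sum>E\<in>plate_els G T. LINT x:E|flat_measure E.
          \<i> * complex_of_real (omega P * rhow P) * jump r T \<phi> E x * cnj (s x)) \<le>
       omega P * rhow P * (sqrt (4 * Ct * fluid_norm2 G r T \<phi>) * sqrt (plate_norm2 G r T s))"
    proof (rule sum_integral_le_const_sqrt[OF _ _ _ plate_jump_le[OF \<phi>] plate_value_le[OF w(2)]])
      fix E assume E: "E \<in> plate_els G T"
      show "set_integrable (flat_measure E) E (\<lambda>x. (cmod (jump r T \<phi> E x))\<^sup>2)"
        using jump_integrable[OF \<phi> plate_els_sides(1)[OF E], of 1] by simp
      show "set_integrable (flat_measure E) E (\<lambda>x. (cmod (s x))\<^sup>2)"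
        using plate_value_integrable(1)[OF w(2) E, of 1] by simp
    qed (use pos in \<open>auto simp: norm_mult\<close>)
    then show ?thesis by (simp only: real_sqrt_mult mult.assoc)
  qed
  have t4: "cmod (\<Sum>p\<in>plate_facets G T. LINT x:p|flat_measure p. cddot (pavg G P r T w p x) (pjump G r T s p x)) \<le> sqrt ?cp * ?F"
  proof -
    have "cmod (\<Sum>p\<in>plate_facets G T. LINT x:p|flat_measure p. cddot (pavg G P r T w p x) (pjump G r T s p x)) \<le>
       sqrt (?cp * plate_norm2 G r T w) * sqrt (plate_norm2 G r T s)"
    proof (rule sum_integral_le_sqrt[OF avg_i[OF _ w(1)] jump_i[OF _ w(2)] _ hess_average_le[OF w(1)] plate_gradient_jump_le[OF w(2)]])
      fix p x assume p: "p \<in> plate_facets G T" "x \<in> p"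
      have "cmod (cddot (pavg G P r T w p x) (pjump G r T s p x)) \<le> (cd * hess_average w p x) * norm (pjump G r T s p x)"
        by (intro order_trans[OF cmod_cddot_le] mult_right_mono norm_pavg_le[OF w(1) p D(1)]) auto
      then show "cmod (cddot (pavg G P r T w p x) (pjump G r T s p x)) \<le>
        sqrt (plate_facet_size T p) * (cd * hess_average w p x) * (1 / sqrt (plate_facet_size T p) * norm (pjump G r T s p x))"
        using plate_facet_size(1)[OF p(1)] by simp
    qed
    then show ?thesis by (simp only: real_sqrt_mult mult.assoc)
  qed
  have t5: "cmod (\<Sum>p\<in>plate_facets G T. LINT x:p|flat_measure p. cddot (pjump G r T w p x) (pavg G P r T s p x)) \<le> sqrt ?cp * ?F"
  proof -
    have "cmod (\<Sum>p\<in>plate_facets G T. LINT x:p|flat_measure p. cddot (pjump G r T w p x) (pavg G P r T s p x)) \<le>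
       sqrt (plate_norm2 G r T w) * sqrt (?cp * plate_norm2 G r T s)"
    proof (rule sum_integral_le_sqrt[OF jump_i[OF _ w(1)] avg_i[OF _ w(2)] _ plate_gradient_jump_le[OF w(1)] hess_average_le[OF w(2)]])
      fix p x assume p: "p \<in> plate_facets G T" "x \<in> p"
      have "cmod (cddot (pjump G r T w p x) (pavg G P r T s p x)) \<le> norm (pjump G r T w p x) * (cd * hess_average s p x)"
        by (intro order_trans[OF cmod_cddot_le] mult_left_mono norm_pavg_le[OF w(2) p D(1)]) auto
      then show "cmod (cddot (pjump G r T w p x) (pavg G P r T s p x)) \<le>
        1 / sqrt (plate_facet_size T p) * norm (pjump G r T w p x) * (sqrt (plate_facet_size T p) * (cd * hess_average s p x))"
        using plate_facet_size(1)[OF p(1)] by simp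
    qed
    also have "\<dots> = sqrt ?cp * ?F" by (simp only: real_sqrt_mult mult.assoc mult.left_commute)
    finally show ?thesis .
  qed
  have t6: "cmod (\<Sum>p\<in>plate_facets G T. LINT x:p|flat_measure p.
          complex_of_real (sig2 P / plate_facet_size T p) *
          cddot (pjump G r T w p x) (pjump G r T s p x)) \<le> sig2 P * ?F"
  proof (rule sum_integral_le_const_sqrt[OF jump_i[OF _ w(1)] jump_i[OF _ w(2)] _ plate_gradient_jump_le[OF w(1)] plate_gradient_jump_le[OF w(2)]])
    fix p x assume p: "p \<in> plate_facets G T" "x \<in> p"
    let ?d = "plate_facet_size T p"
    have d: "0 < ?d" using plate_facet_size(1)[OF p(1)] .
    then have dd: "1 / sqrt ?d * (1 / sqrt ?d) = 1 / ?d" by simp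
    have "cmod (complex_of_real (sig2 P / ?d) * cddot (pjump G r T w p x) (pjump G r T s p x)) \<le>
      sig2 P / ?d * (norm (pjump G r T w p x) * norm (pjump G r T s p x))"
      unfolding norm_mult norm_of_real using pos d by (intro mult_mono cmod_cddot_le) auto
    also have "\<dots> = sig2 P * ((1 / sqrt ?d * (1 / sqrt ?d)) * (norm (pjump G r T w p x) * norm (pjump G r T s p x)))"
      unfolding dd by simp
    finally show "cmod (complex_of_real (sig2 P / ?d) * cddot (pjump G r T w p x) (pjump G r T s p x)) \<le>
      sig2 P * (1 / sqrt ?d * norm (pjump G r T w p x) * (1 / sqrt ?d * norm (pjump G r T s p x)))"
      by (simp only: mult_ac)
  qed (use pos in auto)
  have "cmod (plate_form G P r T \<phi> w s) \<le> cd * ?F + inert P * (omega P)\<^sup>2 * ?F +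
     omega P * rhow P * sqrt (4 * Ct) * (sqrt (fluid_norm2 G r T \<phi>) * sqrt (plate_norm2 G r T s)) +
     sqrt ?cp * ?F + sqrt ?cp * ?F + sig2 P * ?F"
    unfolding plate_form_def by (rule norm_six_le[OF t1 t2 t3 t4 t5 t6])
  also have "\<dots> = plate_const P cd ?cp * ?F +
     omega P * rhow P * sqrt (4 * Ct) * (sqrt (fluid_norm2 G r T \<phi>) * sqrt (plate_norm2 G r T s))"
    unfolding plate_const_def by (simp only: distrib_right mult_2 add_ac)
  finally show ?thesis .
qed

lemma Xnorm_eq:
  "Xnorm G P r T (\<phi>, w) = sqrt (fluid_norm2 G r T \<phi> + mup P * plate_norm2 G r T w)"
  unfolding Xnorm_def fluid_norm2_def plate_norm2_def by simp

lemma Bform_le: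
  assumes v: "\<phi> \<in> fluid_space G r T" "v \<in> fluid_space G r T" and w: "w \<in> plate_space G r T" "s \<in> plate_space G r T"
    and P: "admissible_params G P"
    and D: "\<And>x H. x \<in> closure (Gam G) \<Longrightarrow> norm (contract (rigid P x) H) \<le> cd * norm H" "0 \<le> cd"
  shows "cmod (Bform G P r T (\<phi>, w) (v, s)) \<le>
    (fluid_const G P Ct (shape * CF * (real CARD('n) + 1)) + plate_const P cd (cd\<^sup>2 * shape * CF * real CARD('n))
      + coupling_const P Ct) * Xnorm G P r T (\<phi>, w) * Xnorm G P r T (v, s)"
proof -
  define X Y where "X = Xnorm G P r T (\<phi>, w)" and "Y = Xnorm G P r T (v, s)"
  let ?fc = "fluid_const G P Ct (shape * CF * (real CARD('n) + 1))"
  let ?pc = "plate_const P cd (cd\<^sup>2 * shape * CF * real CARD('n))"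
  let ?\<mu> = "mup P"
  define fx fy px py where "fx = sqrt (fluid_norm2 G r T \<phi>)" and "fy = sqrt (fluid_norm2 G r T v)"
    and "px = sqrt (plate_norm2 G r T w)" and "py = sqrt (plate_norm2 G r T s)"
  have pos: "0 < omega P" "0 < rhow P" "0 < ?\<mu>" "0 < grav P" "0 < sig1 P" "0 < sig2 P" "0 \<le> inert P"
    using P by (auto simp: admissible_params_def)
  have nn: "0 \<le> fx" "0 \<le> fy" "0 \<le> px" "0 \<le> py"
    unfolding fx_def fy_def px_def py_def by (simp_all add: fluid_norm2_parts plate_norm2_parts)
  have X: "fx \<le> X" "sqrt ?\<mu> * px \<le> X" and Y: "fy \<le> Y" "sqrt ?\<mu> * py \<le> Y"
    unfolding fx_def fy_def px_def py_def X_def Y_def Xnorm_eq real_sqrt_mult[symmetric]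
    using pos fluid_norm2_parts(1) plate_norm2_parts(1) by (auto intro!: real_sqrt_le_mono)
  have XY: "0 \<le> X" "0 \<le> Y" using X(1) Y(1) nn by linarith+
  have CF0: "0 \<le> shape * CF" using shape_nonneg inverse_const_nonneg by (simp add: CF_def)
  have fc0: "0 \<le> ?fc"
  proof -
    have "0 \<le> (\<Sum>m\<le>nmode P. cmod (\<i> * km P m / complex_of_real (modal_norm2 G P m)) * (2 * (Ct * modal_norm2 G P m)))"
      using P Ct_pos
      by (intro sum_nonneg mult_nonneg_nonneg) (auto simp: admissible_params_def modal_data_def less_imp_le)
    moreover have "0 \<le> sqrt (shape * CF * (real CARD('n) + 1))" using CF0 by simp
    moreover have "0 \<le> (omega P)\<^sup>2 / grav P * Ct" using pos Ct_pos by simp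
    ultimately show ?thesis unfolding fluid_const_def using pos(5) by linarith
  qed
  have pc0: "0 \<le> ?pc"
  proof -
    have "0 \<le> sqrt (cd\<^sup>2 * shape * CF * real CARD('n))" using mult_nonneg_nonneg[OF mult_nonneg_nonneg[OF zero_le_power2 CF0], of "real CARD('n)" cd] by (simp add: mult.assoc)
    moreover have "0 \<le> inert P * (omega P)\<^sup>2" using pos by simp
    ultimately show ?thesis unfolding plate_const_def using pos(6) D(2) by linarith
  qed
  have B1: "cmod (fluid_form G P r T \<phi> v) \<le> ?fc * (X * Y)"
  proof -
    have "cmod (fluid_form G P r T \<phi> v) \<le> ?fc * (fx * fy)"
      unfolding fx_def fy_def by (rule fluid_form_le[OF v P])
    also have "\<dots> \<le> ?fc * (X * Y)" using X Y nn XY fc0 by (intro mult_left_mono mult_mono) auto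
    finally show ?thesis .
  qed
  \<comment> \<open>The plate part of the norm carries the factor \<open>mup P\<close>, so the bare
    plate norm costs 1 / sqrt (mup P). Two such factors cancel the prefactor of the pure plate
    terms; each coupling term has one of them.\<close>
  have px': "px \<le> X / sqrt ?\<mu>" and py': "py \<le> Y / sqrt ?\<mu>"
    using X(2) Y(2) pos by (simp_all add: field_simps)
  have B2: "cmod (\<Sum>E\<in>plate_els G T. LINT x:E|flat_measure E.
          \<i> * complex_of_real (omega P) * w x * cnj (jump r T v E x)) \<le> omega P * sqrt (4 * Ct) / sqrt ?\<mu> * (X * Y)"
  proof -
    have "cmod (\<Sum>E\<in>plate_els G T. LINT x:E|flat_measure E.
          \<i> * complex_of_real (omega P) * w x * cnj (jump r T v E x)) \<le>
       omega P * (sqrt (plate_norm2 G r T w) * sqrt (4 * Ct * fluid_norm2 G r T v))"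
    proof (rule sum_integral_le_const_sqrt[OF _ _ _ plate_value_le[OF w(1)] plate_jump_le[OF v(2)]])
      fix E assume E: "E \<in> plate_els G T"
      show "set_integrable (flat_measure E) E (\<lambda>x. (cmod (jump r T v E x))\<^sup>2)"
        using jump_integrable[OF v(2) plate_els_sides(1)[OF E], of 1] by simp
      show "set_integrable (flat_measure E) E (\<lambda>x. (cmod (w x))\<^sup>2)"
        using plate_value_integrable(1)[OF w(1) E, of 1] by simp
    qed (use pos in \<open>auto simp: norm_mult\<close>)
    also have "\<dots> = omega P * sqrt (4 * Ct) * (px * fy)" unfolding px_def fy_def by (simp only: real_sqrt_mult mult_ac)
    also have "\<dots> \<le> omega P * sqrt (4 * Ct) * (X / sqrt ?\<mu> * Y)"
      using px' Y nn XY pos Ct_pos by (intro mult_left_mono mult_mono) auto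
    finally show ?thesis by simp
  qed
  have B3: "cmod (complex_of_real ?\<mu> * plate_form G P r T \<phi> w s) \<le>
     ?pc * (X * Y) + ?\<mu> * rhow P * (omega P * sqrt (4 * Ct) / sqrt ?\<mu>) * (X * Y)"
  proof -
    have "cmod (plate_form G P r T \<phi> w s) \<le> ?pc * (px * py) + omega P * rhow P * sqrt (4 * Ct) * (fx * py)"
      unfolding px_def py_def fx_def by (rule plate_form_le[OF v(1) w P D])
    also have "\<dots> \<le> ?pc * (X / sqrt ?\<mu> * (Y / sqrt ?\<mu>)) + omega P * rhow P * sqrt (4 * Ct) * (X * (Y / sqrt ?\<mu>))"
      using px' py' X(1) nn XY pos Ct_pos pc0 by (intro add_mono mult_left_mono mult_mono) auto
    finally have "?\<mu> * cmod (plate_form G P r T \<phi> w s) \<le>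
      ?\<mu> * (?pc * (X / sqrt ?\<mu> * (Y / sqrt ?\<mu>)) + omega P * rhow P * sqrt (4 * Ct) * (X * (Y / sqrt ?\<mu>)))"
      using pos by (intro mult_left_mono) auto
    also have "\<dots> = ?\<mu> * (1 / (sqrt ?\<mu> * sqrt ?\<mu>)) * ?pc * (X * Y) + ?\<mu> * rhow P * (omega P * sqrt (4 * Ct) / sqrt ?\<mu>) * (X * Y)"
      by (simp add: algebra_simps)
    finally show ?thesis using pos by (simp add: norm_mult)
  qed
  have "cmod (Bform G P r T (\<phi>, w) (v, s)) \<le> ?fc * (X * Y) + omega P * sqrt (4 * Ct) / sqrt ?\<mu> * (X * Y) +
     (?pc * (X * Y) + ?\<mu> * rhow P * (omega P * sqrt (4 * Ct) / sqrt ?\<mu>) * (X * Y))"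
    unfolding Bform_def prod.case by (intro norm_triangle_mono B1 B2 B3)
  also have "\<dots> = (?fc + ?pc + coupling_const P Ct) * X * Y"
    unfolding coupling_const_def by (simp only: distrib_right mult_1 mult.assoc add_ac)
  finally show ?thesis unfolding X_def Y_def .
qed

end

theorem theorem3:
  fixes G :: "'n::finite geometry" and P :: "'n params"
    and r :: nat and \<kappa> q c0 :: real
  assumes "CARD('n) = 2 \<or> CARD('n) = 3"
    and "fluid_geometry G"
    and "admissible_params G P"
    and "2 \<le> r"
    and "0 < \<kappa>" and "0 < q" and "0 < c0" and "c0 \<le> 1"
  shows "\<exists>M>0. \<forall>T. admissible_mesh G \<kappa> q c0 T \<longrightarrow>
           (\<forall>\<xi>\<in>discrete_space G r T. \<forall>\<eta>\<in>discrete_space G r T.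
              cmod (Bform G P r T \<xi> \<eta>) \<le> M * Xnorm G P r T \<xi> * Xnorm G P r T \<eta>)"
proof -
  obtain Lr :: "nat \<Rightarrow> real" where Lr: "\<And>p :: real^'n \<Rightarrow> complex. p \<in> polys r \<Longrightarrow>
     reproducing {..r} (\<lambda>j. 1 / (real j + 1)) Lr p" by (rule polys_reproducing) blast
  have geo: "lipschitz_domain (OmP G)" "lipschitz_domain (OmM G)" "bounded (OmP G)" "bounded (OmM G)"
  proof -
    have "bounded (Om G)" "Om G - Gam G = OmP G \<union> OmM G" and *: "lipschitz_domain (OmP G)" "lipschitz_domain (OmM G)"
      using assms(2) unfolding fluid_geometry_def by auto
    then show "bounded (OmP G)" "bounded (OmM G)" by (blast intro: bounded_subset)+
    show "lipschitz_domain (OmP G)" "lipschitz_domain (OmM G)" by (rule *)+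
  qed
  have qk: "0 \<le> 2 * q * \<kappa>" using assms by simp
  obtain CP where CP: "0 < CP" "broken_trace_bound (OmP G) (2 * q * \<kappa>) r CP"
    using broken_trace_inequality[OF geo(1,3) qk] by blast
  obtain CM where CM: "0 < CM" "broken_trace_bound (OmM G) (2 * q * \<kappa>) r CM"
    using broken_trace_inequality[OF geo(2,4) qk] by blast
  have "bounded (rigid P ` closure (Gam G))"
    using assms(3) unfolding admissible_params_def rigidity_tensor_def by blast
  then obtain b where b: "0 < b" "\<And>x. x \<in> closure (Gam G) \<Longrightarrow> norm (rigid P x) \<le> b"
    by (auto simp: bounded_pos)
  define cd where "cd = real CARD('n) ^ 4 * b"
  have D: "norm (contract (rigid P x) H) \<le> cd * norm H" if "x \<in> closure (Gam G)" for x H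
  proof -
    have "norm (contract (rigid P x) H) \<le> real CARD('n) ^ 4 * norm (rigid P x) * norm H" by (rule norm_contract_le)
    also have "\<dots> \<le> real CARD('n) ^ 4 * b * norm H" using b(2)[OF that] by (intro mult_right_mono mult_left_mono) auto
    finally show ?thesis by (simp add: cd_def)
  qed
  have cd0: "0 \<le> cd" using b by (simp add: cd_def)
  \<comment> \<open>\<open>shape * CF\<close> written out: \<open>M\<close> has to be chosen first,
    and the locale is available only once a mesh is given.\<close>
  define I where "I = 2 * q * \<kappa> * inverse_const CARD('n) r Lr"
  define M where "M = fluid_const G P (CP + CM) (I * (real CARD('n) + 1)) +
     plate_const P cd (cd\<^sup>2 * I * real CARD('n)) + coupling_const P (CP + CM)"
  \<comment> \<open>\<open>\<bar>M\<bar> + 1\<close> replaces \<open>M\<close> to make the constant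
    evidently positive.\<close>
  have main: "cmod (Bform G P r T \<xi> \<eta>) \<le> (\<bar>M\<bar> + 1) * Xnorm G P r T \<xi> * Xnorm G P r T \<eta>"
    if T: "admissible_mesh G \<kappa> q c0 T" and x: "\<xi> \<in> discrete_space G r T" "\<eta> \<in> discrete_space G r T" for T \<xi> \<eta>
  proof -
    interpret fluid_mesh_degree G \<kappa> q c0 T r Lr CP CM
      using assms T Lr CP CM by unfold_locales auto
    obtain \<phi> w v s where e: "\<xi> = (\<phi>, w)" "\<eta> = (v, s)" "\<phi> \<in> fluid_space G r T" "v \<in> fluid_space G r T"
      "w \<in> plate_space G r T" "s \<in> plate_space G r T"
      using x by (auto simp: discrete_space_def)
    have "cmod (Bform G P r T \<xi> \<eta>) \<le> M * Xnorm G P r T \<xi> * Xnorm G P r T \<eta>"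
      using Bform_le[OF e(3-6) assms(3) D cd0]
      unfolding e M_def I_def shape_def CF_def Ct_def by (simp only: mult.assoc)
    also have "\<dots> \<le> (\<bar>M\<bar> + 1) * Xnorm G P r T \<xi> * Xnorm G P r T \<eta>"
      unfolding e Xnorm_eq using assms(3) fluid_norm2_parts(1) plate_norm2_parts(1)
      by (intro mult_right_mono) (auto simp: admissible_params_def)
    finally show ?thesis .
  qed
  show ?thesis by (intro exI[of _ "\<bar>M\<bar> + 1"] conjI) (use main in auto)
qed

end
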